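(* Let $0\le\delta<\frac12$ and let $A$ be a semiclassical pseudodifferential operator whose symbol is in $S_\delta$, i.e. $A=Op_{t,h}(a)$ with $a\in S_\delta$, $t\in[0,1]$. Then \[ \mathrm{WF}_h(A)=\bigcup_u \mathrm{WF}_h(Au), \] where $u$ ranges over all families $u=\{u(h)\}_{0<h<h_0}\subseteq L^2(\mathbb{R}^n)$ which are bounded in $L^2(\mathbb{R}^n)$ uniformly with respect to $h$.
   Context: Here $h\in(0,h_0)$ is a small semiclassical parameter, with $h_0>0$ fixed, and $T^*\mathbb{R}^n=\mathbb{R}^n_x\times\mathbb{R}^n_\xi$. $\mathcal{O}(h^\infty)$ means $\mathcal{O}(h^N)$ as $h\to0$ for every $N$. Symbol classes: for $\delta\ge0$, $S_\delta$ is the set of families $a(x,\xi;h)$, $0<h<h_0$, of complex-valued functions with $a(\cdot,\cdot;h)\in C^\infty(T^*\mathbb{R}^n)$ such that for all multi-indices $\alpha,\beta$ there is $C_{\alpha,\beta}$ (independent of $h$) with $|\partial_x^\alpha\partial_\xi^\beta a(x,\xi;h)|\le C_{\alpha,\beta}h^{-\delta(|\alpha|+|\beta|)}$ everywhere. Put $S=S_0$. Quantization: for $t\in[0,1]$, \[Op_{t,h}(a)u(x)=(2\pi h)^{-n}\iint a(tx+(1-t)y,\xi;h)e^{i\langle x-y,\xi\rangle/h}u(y)\,dy\,d\xi\] (an oscillatory integral for $u\in\mathscr{S}(\mathbb{R}^n)$; for $a\in S_\delta$, $0\le\delta<\frac12$, it extends to bounded operators on $L^2(\mathbb{R}^n)$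 with norm bounded uniformly in $h$). For a family $u=\{u(h)\}$, $Au$ is the family $\{Au(h)\}$. Wavefront set of an operator: for $a\in S_\delta$, $0\le\delta<\frac12$, $(x_0,\xi_0)\notin\mathrm{ess}\text{-}\mathrm{supp}(a)\subseteq T^*\mathbb{R}^n$ if and only if there is an open neighborhood $U$ of $(x_0,\xi_0)$ with $a=\mathcal{O}_{C^\infty(U)}(h^\infty)$, i.e. every derivative of $a$ in $(x,\xi)$ is $\mathcal{O}(h^\infty)$ uniformly on $U$. For $A=Op_{t,h}(a)$, $\mathrm{WF}_h(A)=\mathrm{ess}\text{-}\mathrm{supp}(a)$ (independent of the choice of $t\in[0,1]$ used to represent $A$). Wavefront set of a family: for $u=\{u(h)\}_{0<h<h_0}\subseteq L^2(\mathbb{R}^n)$ with $\|u(h)\|_{L^2}\le C$, $(x_0,\xi_0)\notin\mathrm{WF}_h(u)\subseteq T^*\mathbb{R}^n$ if and only if there is $c\in S$ with $\inf_h|c(x_0,\xi_0;h)|>0$ and $\|Op_{t,h}(c)u(h)\|_{L^2}=\mathcal{O}(h^\infty)$ (this does not depend on $t\in[0,1]$). *)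

theory Defs
  imports "HOL-Analysis.Analysis" "HOL-Library.Landau_Symbols"
begin

type_synonym 'n phase = "(real ^ 'n) \<times> (real ^ 'n)"
type_synonym 'n wave = "real ^ 'n \<Rightarrow> complex"

section \<open>Smooth functions and symbol classes\<close>

text \<open>
  \<open>iter_deriv [b\<^sub>1, \<dots>, b\<^sub>k] f\<close> is the iterated directional derivative of \<open>f\<close> along
  \<open>b\<^sub>1, \<dots>, b\<^sub>k\<close>. Mixed partial derivatives of order \<open>k\<close> are the case where all \<open>b\<^sub>i\<close> are standard
  basis vectors. For smooth functions the order of the directions is irrelevant, so the lists over
  \<open>Basis\<close> enumerate exactly the multi-indices; on \<open>T\<^sup>*\<real>\<^sup>n\<close>, where \<open>Basis\<close> consists of the vectors
  \<open>(e\<^sub>i, 0)\<close> and \<open>(0, e\<^sub>i)\<close>, they enumerate the pairs \<open>(\<alpha>, \<beta>)\<close>, with \<open>length bs = |\<alpha>| + |\<beta>|\<close>.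
\<close>

primrec iter_deriv ::
  "'a::euclidean_space list \<Rightarrow> ('a \<Rightarrow> complex) \<Rightarrow> 'a \<Rightarrow> complex" where
  "iter_deriv [] f = f"
| "iter_deriv (b # bs) f = (\<lambda>x. frechet_derivative (iter_deriv bs f) (at x) b)"

definition smooth :: "('a::euclidean_space \<Rightarrow> complex) \<Rightarrow> bool" where
  "smooth f \<longleftrightarrow> (\<forall>bs\<in>lists Basis. \<forall>x. iter_deriv bs f differentiable (at x))"

definition symbol_class :: "real \<Rightarrow> real \<Rightarrow> (real \<Rightarrow> 'n::finite phase \<Rightarrow> complex) set" where
  "symbol_class h0 \<delta> =
    {a. (\<forall>h\<in>{0<..<h0}. smooth (a h)) \<and>
        (\<forall>bs\<in>lists Basis. \<exists>C. \<forall>h\<in>{0<..<h0}. \<forall>\<rho>.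
           norm (iter_deriv bs (a h) \<rho>) \<le> C * h powr (- \<delta> * real (length bs)))}"

definition schwartz :: "('a::euclidean_space \<Rightarrow> complex) set" where
  "schwartz = {f. smooth f \<and>
     (\<forall>bs\<in>lists Basis. \<forall>k. \<exists>C. \<forall>x. norm x ^ k * norm (iter_deriv bs f x) \<le> C)}"

section \<open>The space of square integrable functions\<close>

text \<open>
  Elements of \<open>L\<^sup>2\<close> are given by Borel representatives; everything below depends only on
  the classes modulo null sets.
\<close>

definition L2 :: "('a::euclidean_space \<Rightarrow> complex) set" where
  "L2 = {u \<in> borel_measurable lborel. integrable lborel (\<lambda>x. (norm (u x))\<^sup>2)}"

definition L2_norm :: "('a::euclidean_space \<Rightarrow> complex) \<Rightarrow> real" where
  "L2_norm u = sqrt (LINT x|lborel. (norm (u x))\<^sup>2)"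

definition L2_tendsto ::
  "(nat \<Rightarrow> 'a::euclidean_space \<Rightarrow> complex) \<Rightarrow> ('a \<Rightarrow> complex) \<Rightarrow> bool" where
  "L2_tendsto f u \<longleftrightarrow>
     (\<forall>k. f k \<in> L2) \<and> u \<in> L2 \<and> (\<lambda>k. L2_norm (\<lambda>x. f k x - u x)) \<longlonglongrightarrow> 0"

definition L2_bounded_family ::
  "real \<Rightarrow> (real \<Rightarrow> 'a::euclidean_space \<Rightarrow> complex) \<Rightarrow> bool" where
  "L2_bounded_family h0 u \<longleftrightarrow>
     (\<forall>h\<in>{0<..<h0}. u h \<in> L2) \<and> (\<exists>C. \<forall>h\<in>{0<..<h0}. L2_norm (u h) \<le> C)"

section \<open>Semiclassical quantization\<close>

text \<open>
  For a fixed \<open>h\<close>, a symbol \<open>a\<close> with bounded derivatives and a Schwartz function \<open>u\<close>, the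
  oscillatory integral is the iterated integral, first over \<open>y\<close> and then over \<open>\<xi>\<close>: the inner
  integral is absolutely convergent and, by integration by parts in \<open>y\<close>, rapidly decreasing in
  \<open>\<xi>\<close>. (The double integral over \<open>(y, \<xi>)\<close> is in general not absolutely convergent.)
\<close>

definition Op_schwartz ::
  "real \<Rightarrow> real \<Rightarrow> ('n::finite phase \<Rightarrow> complex) \<Rightarrow> 'n wave \<Rightarrow> 'n wave" where
  "Op_schwartz t h a u x =
     complex_of_real (1 / (2 * pi * h) ^ CARD('n)) *
     (LINT \<xi>|lborel. LINT y|lborel.
        a (t *\<^sub>R x + (1 - t) *\<^sub>R y, \<xi>) *
        exp (\<i> * complex_of_real (((x - y) \<bullet> \<xi>) / h)) * u y)"

text \<open>
  The extension by continuity to \<open>L\<^sup>2\<close>: \<open>Op t h a u\<close> is (a representative of) the common \<open>L\<^sup>2\<close>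
  limit of \<open>Op_schwartz t h a (\<phi> k)\<close> for all sequences \<open>\<phi>\<close> of Schwartz functions converging
  to \<open>u\<close> in \<open>L\<^sup>2\<close>. It is unique up to null sets since Schwartz functions are dense.
\<close>

definition Op ::
  "real \<Rightarrow> real \<Rightarrow> ('n::finite phase \<Rightarrow> complex) \<Rightarrow> 'n wave \<Rightarrow> 'n wave" where
  "Op t h a u =
     (if u \<in> L2
      then SOME v. v \<in> L2 \<and>
             (\<forall>\<phi>. (\<forall>k. \<phi> k \<in> schwartz) \<and> L2_tendsto \<phi> u \<longrightarrow>
                  L2_tendsto (\<lambda>k. Op_schwartz t h a (\<phi> k)) v)
      else (\<lambda>_. 0))"

definition quantizes ::
  "real \<Rightarrow> real \<Rightarrow> (real \<Rightarrow> 'n::finite phase \<Rightarrow> complex) \<Rightarrow>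
   (real \<Rightarrow> 'n wave \<Rightarrow> 'n wave) \<Rightarrow> bool" where
  "quantizes h0 t a A \<longleftrightarrow> (\<forall>h\<in>{0<..<h0}. A h = Op t h (a h))"

section \<open>Wavefront sets\<close>

definition ess_supp :: "(real \<Rightarrow> 'n::finite phase \<Rightarrow> complex) \<Rightarrow> 'n phase set" where
  "ess_supp a =
    {\<rho>. \<not> (\<exists>U. open U \<and> \<rho> \<in> U \<and>
          (\<forall>bs\<in>lists Basis. \<forall>N::nat. \<exists>C. \<forall>\<^sub>F h in at_right 0. \<forall>\<sigma>\<in>U.
             norm (iter_deriv bs (a h) \<sigma>) \<le> C * h ^ N))}"

text \<open>
  The wavefront set of an operator family \<open>A\<close> is the essential support of a symbol of \<open>A\<close>,
  which does not depend on the \<open>t\<close>, \<open>\<delta>\<close> and \<open>a\<close> used to represent \<open>A\<close>.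
\<close>

definition WF_op ::
  "real \<Rightarrow> (real \<Rightarrow> 'n::finite wave \<Rightarrow> 'n wave) \<Rightarrow> 'n phase set" where
  "WF_op h0 A =
     (THE K. \<exists>t\<in>{0..1}. \<exists>\<delta>. 0 \<le> \<delta> \<and> \<delta> < 1/2 \<and>
        (\<exists>a\<in>symbol_class h0 \<delta>. quantizes h0 t a A \<and> K = ess_supp a))"

text \<open>
  The parameter \<open>s\<close> is the one used to quantize the test symbols \<open>c\<close>; for families bounded in
  \<open>L\<^sup>2\<close> the result is the same for all \<open>s \<in> [0, 1]\<close>.
\<close>

definition WF ::
  "real \<Rightarrow> real \<Rightarrow> (real \<Rightarrow> 'n::finite wave) \<Rightarrow> 'n phase set" where
  "WF h0 s u =
    {\<rho>. \<not> (\<exists>c\<in>symbol_class h0 0.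
          0 < (INF h\<in>{0<..<h0}. norm (c h \<rho>)) \<and>
          (\<forall>N::nat. (\<lambda>h. L2_norm (Op s h (c h) (u h))) \<in> O[at_right 0](\<lambda>h. h ^ N)))}"

end

theory Submission
  imports Defs "HOL-Probability.Characteristic_Functions" "HOL-Probability.Sinc_Integral"
begin

text \<open>
  The dilation \<open>x = sqrt h * X\<close> turns \<open>Op t h a\<close> into the quantization at \<open>h = 1\<close> of the symbol
  \<open>b z = a (sqrt h * z)\<close>, whose derivatives are bounded uniformly in \<open>h\<close> because \<open>\<delta> < 1/2\<close>. In the
  Gaussian wave packet transform, which is an isometry up to a constant, the kernel of such an
  operator is a windowed Fourier transform of \<open>b\<close>: it decays rapidly off the diagonal and its size
  near the diagonal is that of \<open>b\<close>. Schur's test turns this into the following estimates: operators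
  whose symbols live at distance \<open>1 / sqrt h\<close> from each other compose to \<open>O(h\<^sup>\<infinity>)\<close>; elliptic operators
  are bounded below on microlocalized functions; and the symbol is recovered from the images of
  wave packets.

  If \<open>a\<close> is negligible near \<open>\<rho>\<close>, composition with a cut-off at \<open>\<rho>\<close> shows \<open>\<rho> \<notin> WF (A u)\<close> for all
  bounded \<open>u\<close>. If \<open>\<rho>\<close> lies in the essential support, then on every neighbourhood of \<open>\<rho>\<close> the images of
  wave packets fail to be \<open>O(h\<^sup>\<infinity>)\<close>; gluing packets centred closer and closer to \<open>\<rho>\<close> along a sequence
  \<open>h \<rightarrow> 0\<close> gives one bounded family \<open>u\<close> such that no symbol elliptic at \<open>\<rho>\<close> makes \<open>A u\<close> negligible.
\<close>

text \<open>That a symbol is small near a point p is expressed by a bound \<epsilon> (1 + |z - p|)^P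
  on it and its derivatives. The region where the symbol is merely bounded is paid for by the growth
  in z: it begins at distance of order 1 / sqrt h, so P = 2N turns the price into h^N, and the
  kernel, which decays to every order, absorbs the growth.

  The order of quantifiers shapes the second inclusion: one u must defeat all test symbols, although
  a test symbol is known only after u. So for each ball of radius 1 / (j + 1) an exponent M j to
  which the packet images fail to be small is fixed beforehand. A test symbol brings its own radius
  of ellipticity and its own constants; a ball inside that radius is visited at arbitrarily small h,
  and one spare power of h beats the constants.

  Packets give back only the values of the symbol. Its derivatives, which enter the essential
  support as well, follow by interpolation between these values and the bounds of the symbol
  class.\<close>

section \<open>Directional derivatives and smoothness of finite order\<close>

definition dird :: "'a::euclidean_space \<Rightarrow> ('a \<Rightarrow> complex) \<Rightarrow> 'a \<Rightarrow> complex" where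
  "dird b f = (\<lambda>x. frechet_derivative f (at x) b)"

lemma iter_deriv_Cons_dird: "iter_deriv (b # bs) f = dird b (iter_deriv bs f)"
  by (simp add: dird_def)

text \<open>The recursion of \<open>iter_deriv\<close> applies the head of the list last. Splitting
  off the last entry peels the innermost derivative instead, and what remains is an iterated
  derivative of the new function \<open>dird b f\<close>. Inductions over the order can therefore
  run with the function arbitrary.\<close>

lemma iter_deriv_snoc: "iter_deriv (bs @ [b]) f = iter_deriv bs (dird b f)"
  by (induction bs) (auto simp: dird_def)

lemma dird_eqI: "(f has_derivative f') (at x) \<Longrightarrow> dird b f x = f' b"
  unfolding dird_def by (drule frechet_derivative_at) simp

lemma differentiable_has_derivative_dird:
  "f differentiable (at x) \<Longrightarrow> (f has_derivative (\<lambda>b. dird b f x)) (at x)"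
  unfolding dird_def by (drule frechet_derivative_works[THEN iffD1])

lemma dird_const [simp]: "dird b (\<lambda>x. c) = (\<lambda>x. 0)"
  by (rule ext, rule dird_eqI[OF has_derivative_const])

lemma dird_add:
  assumes "\<And>x. f differentiable (at x)" "\<And>x. g differentiable (at x)"
  shows "dird b (\<lambda>x. f x + g x) = (\<lambda>x. dird b f x + dird b g x)"
  by (rule ext, rule dird_eqI)
     (auto intro!: derivative_eq_intros differentiable_has_derivative_dird assms)

lemma dird_mult:
  assumes "\<And>x. f differentiable (at x)" "\<And>x. g differentiable (at x)"
  shows "dird b (\<lambda>x. f x * g x) = (\<lambda>x. dird b f x * g x + f x * dird b g x)"
  by (rule ext, rule dird_eqI[THEN trans])
     (auto intro!: derivative_eq_intros differentiable_has_derivative_dird assms simp: algebra_simps)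

lemma dird_affine:
  assumes f: "\<And>x. f differentiable (at x)" and L: "\<And>x. L x = c + T x" "bounded_linear T"
    and T: "T b = r *\<^sub>R b'"
  shows "dird b (\<lambda>x. f (L x)) = (\<lambda>x. complex_of_real r * dird b' f (L x))"
proof
  fix x
  have L': "(L has_derivative T) (at x)"
    unfolding L(1)[abs_def] by (auto intro!: derivative_eq_intros bounded_linear_imp_has_derivative L(2))
  have F: "(f has_derivative (\<lambda>b. dird b f (L x))) (at (L x))"
    by (rule differentiable_has_derivative_dird[OF f])
  have "((\<lambda>x. f (L x)) has_derivative (\<lambda>v. dird (T v) f (L x))) (at x)"
    using has_derivative_compose[OF L' F] by simp
  then have "dird b (\<lambda>x. f (L x)) x = dird (r *\<^sub>R b') f (L x)"
    by (simp add: dird_eqI T)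
  also have "\<dots> = complex_of_real r * dird b' f (L x)"
    using linear_cmul[OF has_derivative_linear[OF F]] by (simp add: scaleR_conv_of_real)
  finally show "dird b (\<lambda>x. f (L x)) x = complex_of_real r * dird b' f (L x)" .
qed

text \<open>The recursion follows the innermost derivative. The first-order rules for products,
  exponentials and substitutions then drive an induction on the order, in place of Leibniz or Faa di
  Bruno formulas.\<close>

primrec smooth_upto :: "nat \<Rightarrow> ('a::euclidean_space \<Rightarrow> complex) \<Rightarrow> bool" where
  "smooth_upto 0 f \<longleftrightarrow> (\<forall>x. f differentiable (at x))"
| "smooth_upto (Suc k) f \<longleftrightarrow> (\<forall>x. f differentiable (at x)) \<and> (\<forall>b\<in>Basis. smooth_upto k (dird b f))"

lemma lists_snoc_cases:
  assumes "bs \<in> lists B"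
  obtains "bs = []" | cs b where "bs = cs @ [b]" "cs \<in> lists B" "b \<in> B"
  using assms by (cases bs rule: rev_cases) auto

lemma smooth_upto_iff:
  "smooth_upto k f \<longleftrightarrow>
    (\<forall>bs\<in>lists Basis. length bs \<le> k \<longrightarrow> (\<forall>x. iter_deriv bs f differentiable (at x)))"
proof (induction k arbitrary: f)
  case 0
  then show ?case by auto
next
  case (Suc k)
  show ?case (is "?L \<longleftrightarrow> ?R")
  proof
    assume L: ?L
    show ?R
    proof (intro ballI impI)
      fix bs :: "'a list" assume "bs \<in> lists Basis" "length bs \<le> Suc k"
      then show "\<forall>x. iter_deriv bs f differentiable (at x)"
        using L Suc by (cases rule: lists_snoc_cases) (auto simp: iter_deriv_snoc)
    qed
  next
    assume R: ?R
    have "smooth_upto k (dird b f)" if "b \<in> Basis" for b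
      unfolding Suc
    proof (intro ballI impI)
      fix bs :: "'a list" assume "bs \<in> lists Basis" "length bs \<le> k"
      then show "\<forall>x. iter_deriv bs (dird b f) differentiable (at x)"
        using R[rule_format, of "bs @ [b]"] that by (simp add: iter_deriv_snoc)
    qed
    moreover have "\<forall>x. f differentiable (at x)" using R[rule_format, of "[]"] by simp
    ultimately show ?L by simp
  qed
qed

lemma smooth_iff_smooth_upto: "smooth f \<longleftrightarrow> (\<forall>k. smooth_upto k f)"
  unfolding smooth_def smooth_upto_iff by blast

lemma smooth_upto_antimono: "smooth_upto k f \<Longrightarrow> j \<le> k \<Longrightarrow> smooth_upto j f"
  unfolding smooth_upto_iff by auto

lemma smooth_upto_differentiable: "smooth_upto k f \<Longrightarrow> f differentiable (at x)"
  by (cases k) auto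

lemma smooth_differentiable: "smooth f \<Longrightarrow> f differentiable (at x)"
  unfolding smooth_iff_smooth_upto using smooth_upto_differentiable[of 0] by blast

lemma smooth_dird: "smooth f \<Longrightarrow> b \<in> Basis \<Longrightarrow> smooth (dird b f)"
  by (meson smooth_iff_smooth_upto smooth_upto.simps(2))

lemma smooth_iter_deriv: "smooth f \<Longrightarrow> bs \<in> lists Basis \<Longrightarrow> smooth (iter_deriv bs f)"
  by (induction bs) (auto simp: iter_deriv_Cons_dird smooth_dird simp del: iter_deriv.simps(2))

lemma smooth_continuous: "smooth f \<Longrightarrow> continuous_on S f"
  by (meson continuous_at_imp_continuous_on differentiable_imp_continuous_within smooth_differentiable)

lemma smooth_measurable [measurable_dest]: "smooth f \<Longrightarrow> f \<in> borel_measurable borel"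
  by (intro borel_measurable_continuous_onI smooth_continuous)

lemma smooth_upto_const: "smooth_upto k (\<lambda>x. c)"
  by (induction k arbitrary: c) auto

lemma smooth_const [simp]: "smooth (\<lambda>x. c)"
  by (simp add: smooth_iff_smooth_upto smooth_upto_const)

lemma smooth_upto_add: "smooth_upto k f \<Longrightarrow> smooth_upto k g \<Longrightarrow> smooth_upto k (\<lambda>x. f x + g x)"
  by (induction k arbitrary: f g) (auto simp: dird_add)

lemma smooth_upto_mult: "smooth_upto k f \<Longrightarrow> smooth_upto k g \<Longrightarrow> smooth_upto k (\<lambda>x. f x * g x)"
proof (induction k arbitrary: f g)
  case (Suc k)
  then have "smooth_upto k f" "smooth_upto k g"
    using smooth_upto_antimono le_SucI by blast+
  then show ?case using Suc by (auto simp: dird_mult intro!: smooth_upto_add)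
qed auto

lemma smooth_add: "smooth f \<Longrightarrow> smooth g \<Longrightarrow> smooth (\<lambda>x. f x + g x)"
  by (simp add: smooth_iff_smooth_upto smooth_upto_add)

lemma smooth_mult: "smooth f \<Longrightarrow> smooth g \<Longrightarrow> smooth (\<lambda>x. f x * g x)"
  by (simp add: smooth_iff_smooth_upto smooth_upto_mult)

lemma smooth_diff: "smooth f \<Longrightarrow> smooth g \<Longrightarrow> smooth (\<lambda>x. f x - g x)"
  using smooth_add[of f "\<lambda>x. (-1) * g x"] smooth_mult[of "\<lambda>x. -1" g] by simp

lemma has_derivative_exp_dird:
  assumes "q differentiable (at x)"
  shows "((\<lambda>x. exp (q x)) has_derivative (\<lambda>b. exp (q x) * dird b q x)) (at x)"
  using has_derivative_compose[OF differentiable_has_derivative_dird[OF assms]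
      DERIV_exp[unfolded has_field_derivative_def]] .

lemma dird_exp:
  assumes "\<And>x. q differentiable (at x)"
  shows "dird b (\<lambda>x. exp (q x)) = (\<lambda>x. exp (q x) * dird b q x)"
  by (intro ext dird_eqI has_derivative_exp_dird assms)

lemma smooth_upto_exp: "smooth_upto k q \<Longrightarrow> smooth_upto k (\<lambda>x. exp (q x))"
proof (induction k arbitrary: q)
  case 0
  then show ?case using differentiableI[OF has_derivative_exp_dird] by auto
next
  case (Suc k)
  have q: "smooth_upto k q"
    using Suc.prems smooth_upto_antimono le_SucI by blast
  have "smooth_upto k (dird b (\<lambda>x. exp (q x)))" if "b \<in> Basis" for b
    using Suc.prems that by (subst dird_exp) (auto intro: smooth_upto_mult Suc.IH[OF q])
  then show ?case
    using Suc.prems differentiableI[OF has_derivative_exp_dird] by auto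
qed

lemma smooth_exp: "smooth q \<Longrightarrow> smooth (\<lambda>x. exp (q x))"
  by (simp add: smooth_iff_smooth_upto smooth_upto_exp)

lemma smooth_bounded_linear:
  assumes "bounded_linear (T :: 'a::euclidean_space \<Rightarrow> complex)"
  shows "smooth T"
proof -
  have D: "(T has_derivative T) (at x)" for x
    by (rule bounded_linear_imp_has_derivative[OF assms])
  have "dird b T = (\<lambda>x. T b)" for b using D by (intro ext dird_eqI)
  then have "smooth_upto k T" for k
    using D by (cases k) (auto intro: differentiableI smooth_upto_const)
  then show ?thesis by (simp add: smooth_iff_smooth_upto)
qed

section \<open>Substitutions that respect the coordinate directions\<close>

text \<open>The condition on the linear part makes every partial derivative of
  \<open>f (L x)\<close> a multiple of a single partial derivative of \<open>f\<close> instead of a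
  sum, so estimates pick up only a power of \<open>R\<close>. Translations, dilations and the slices
  of phase space along which the oscillatory integral runs are of this kind.\<close>

definition basis_affine :: "real \<Rightarrow> ('a::euclidean_space \<Rightarrow> 'b::euclidean_space) \<Rightarrow> bool" where
  "basis_affine R L \<longleftrightarrow> (\<exists>c T. (\<forall>x. L x = c + T x) \<and> bounded_linear T \<and>
      (\<forall>b\<in>Basis. \<exists>r b'. \<bar>r\<bar> \<le> R \<and> b' \<in> Basis \<and> T b = r *\<^sub>R b'))"

lemma smooth_upto_affine:
  assumes "basis_affine R L"
  shows "smooth_upto k f \<Longrightarrow> smooth_upto k (\<lambda>x. f (L x))"
proof (induction k arbitrary: f)
  obtain c T where L: "\<And>x. L x = c + T x" "bounded_linear T"
    and T: "\<And>b. b \<in> Basis \<Longrightarrow> \<exists>r b'. \<bar>r\<bar> \<le> R \<and> b' \<in> Basis \<and> T b = r *\<^sub>R b'"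
    using assms unfolding basis_affine_def by blast
  have dL: "L differentiable (at x)" for x
    unfolding L(1)[abs_def] by (intro derivative_intros bounded_linear_imp_differentiable L(2))
  {
    case 0
    then show ?case using dL by (auto intro: differentiable_compose)
  next
    case (Suc k)
    have "smooth_upto k (dird b (\<lambda>x. f (L x)))" if b: "b \<in> Basis" for b
    proof -
      obtain r b' where "b' \<in> Basis" "T b = r *\<^sub>R b'" using T[OF b] by blast
      then show ?thesis
        using Suc by (subst dird_affine[OF _ L]) (auto intro!: smooth_upto_mult smooth_upto_const)
    qed
    then show ?case using Suc.prems dL by (auto intro: differentiable_compose)
  }
qed

lemma smooth_affine: "basis_affine R L \<Longrightarrow> smooth f \<Longrightarrow> smooth (\<lambda>x. f (L x))"
  by (simp add: smooth_iff_smooth_upto smooth_upto_affine)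

lemma basis_affine_translation: "basis_affine 1 (\<lambda>x. a + x)" "basis_affine 1 (\<lambda>x. x + a)"
  unfolding basis_affine_def
  by (rule exI[of _ a], rule exI[of _ "\<lambda>x. x"]; force intro: exI[of _ 1] simp: add.commute)+

lemma basis_affine_scale: "basis_affine \<bar>r\<bar> (\<lambda>x. r *\<^sub>R x)"
  unfolding basis_affine_def
  by (rule exI[of _ 0], rule exI[of _ "\<lambda>x. r *\<^sub>R x"]) (auto intro: bounded_linear_scaleR_right)

lemma basis_affine_slice:
  fixes x :: "'a::euclidean_space"
  assumes "\<bar>r\<bar> \<le> 1"
  shows "basis_affine 1 (\<lambda>y. (c + r *\<^sub>R y, x))"
  unfolding basis_affine_def
  by (rule exI[of _ "(c, x)"], rule exI[of _ "\<lambda>y. (r *\<^sub>R y, 0)"])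
     (use assms in \<open>auto intro!: bounded_linear_Pair bounded_linear_scaleR_right bounded_linear_zero
        exI[of _ r] simp: Basis_prod_def\<close>)

section \<open>Pointwise bounds on all derivatives up to a given order\<close>

definition derivs_le :: "nat \<Rightarrow> ('a::euclidean_space \<Rightarrow> real) \<Rightarrow> ('a \<Rightarrow> complex) \<Rightarrow> bool" where
  "derivs_le k p f \<longleftrightarrow>
    (\<forall>bs\<in>lists Basis. length bs \<le> k \<longrightarrow> (\<forall>x. norm (iter_deriv bs f x) \<le> p x))"

lemma derivs_le_0: "derivs_le 0 p f \<longleftrightarrow> (\<forall>x. norm (f x) \<le> p x)"
  unfolding derivs_le_def by auto

lemma derivs_le_Suc:
  "derivs_le (Suc k) p f \<longleftrightarrow> (\<forall>x. norm (f x) \<le> p x) \<and> (\<forall>b\<in>Basis. derivs_le k p (dird b f))"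
  (is "?L \<longleftrightarrow> ?R")
proof
  assume L: ?L
  have "norm (iter_deriv bs (dird b f) x) \<le> p x"
    if "b \<in> Basis" "bs \<in> lists Basis" "length bs \<le> k" for b bs x
    using L[unfolded derivs_le_def, rule_format, of "bs @ [b]" x] that by (simp add: iter_deriv_snoc)
  then show ?R using L[unfolded derivs_le_def, rule_format, of "[]"] unfolding derivs_le_def by auto
next
  assume R: ?R
  show ?L unfolding derivs_le_def
  proof (intro ballI impI allI)
    fix bs :: "'a list" and x assume "bs \<in> lists Basis" "length bs \<le> Suc k"
    then show "norm (iter_deriv bs f x) \<le> p x"
      using R by (cases rule: lists_snoc_cases) (auto simp: iter_deriv_snoc derivs_le_def)
  qed
qed

lemma derivs_leD: "derivs_le k p f \<Longrightarrow> norm (f x) \<le> p x"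
  by (cases k) (auto simp: derivs_le_0 derivs_le_Suc)

lemma derivs_le_mono: "derivs_le k p f \<Longrightarrow> j \<le> k \<Longrightarrow> (\<And>x. p x \<le> q x) \<Longrightarrow> derivs_le j q f"
  unfolding derivs_le_def by (meson order_trans)

lemma derivs_le_const: "norm c \<le> B \<Longrightarrow> derivs_le k (\<lambda>_. B) (\<lambda>x. c)"
proof (induction k arbitrary: c)
  case (Suc k)
  have "norm (0::complex) \<le> B" using order_trans[OF norm_ge_zero Suc.prems] by simp
  with Suc show ?case by (simp add: derivs_le_Suc)
qed (simp add: derivs_le_0)

lemma derivs_le_add:
  assumes "smooth f" "smooth g" "derivs_le k p f" "derivs_le k q g"
  shows "derivs_le k (\<lambda>x. p x + q x) (\<lambda>x. f x + g x)"
  using assms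
proof (induction k arbitrary: f g)
  case 0
  then show ?case by (auto simp: derivs_le_0 intro: norm_triangle_mono)
next
  case (Suc k)
  then show ?case
    by (auto simp: derivs_le_Suc dird_add smooth_differentiable smooth_dird intro: norm_triangle_mono)
qed

text \<open>Each differentiation splits a product in two, so a derivative of order at most
  \<open>k\<close> is a sum of at most 2^k products, each bounded by
  \<open>p x * q x\<close>.\<close>

lemma derivs_le_mult:
  assumes "smooth f" "smooth g" "derivs_le k p f" "derivs_le k q g"
  shows "derivs_le k (\<lambda>x. 2 ^ k * (p x * q x)) (\<lambda>x. f x * g x)"
  using assms
proof (induction k arbitrary: f g)
  case 0
  then show ?case
    by (auto simp: derivs_le_0 norm_mult intro!: mult_mono norm_ge_zero order_trans[OF norm_ge_zero])
next
  case (Suc k)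
  have pq: "norm (f x * g x) \<le> p x * q x" for x
    using derivs_leD[OF Suc.prems(3), of x] derivs_leD[OF Suc.prems(4), of x]
    by (auto simp: norm_mult intro!: mult_mono norm_ge_zero order_trans[OF norm_ge_zero])
  then have pq0: "0 \<le> p x * q x" for x by (meson norm_ge_zero order_trans)
  have le: "norm (f x * g x) \<le> 2 ^ Suc k * (p x * q x)" for x
  proof -
    have "1 * (p x * q x) \<le> 2 ^ Suc k * (p x * q x)"
      by (rule mult_right_mono[OF one_le_power pq0]) auto
    then show ?thesis using pq[of x] by simp
  qed
  have kk: "derivs_le k p f" "derivs_le k q g"
    using Suc.prems(3,4) derivs_le_mono[OF _ le_SucI[OF order_refl]] by blast+
  have "derivs_le k (\<lambda>x. 2 ^ Suc k * (p x * q x)) (dird b (\<lambda>x. f x * g x))" if b: "b \<in> Basis" for b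
  proof -
    have "derivs_le k (\<lambda>x. 2 ^ k * (p x * q x) + 2 ^ k * (p x * q x))
       (\<lambda>x. dird b f x * g x + f x * dird b g x)"
      using Suc kk b by (intro derivs_le_add smooth_mult smooth_dird) (auto simp: derivs_le_Suc smooth_dird)
    then show ?thesis
      using Suc.prems by (simp add: dird_mult smooth_differentiable algebra_simps)
  qed
  then show ?case using le by (auto simp: derivs_le_Suc)
qed

lemma derivs_le_cmult:
  assumes "smooth f" "derivs_le k p f"
  shows "derivs_le k (\<lambda>x. norm c * p x) (\<lambda>x. c * f x)"
  using assms
proof (induction k arbitrary: f)
  case 0
  then show ?case by (auto simp: derivs_le_0 norm_mult intro: mult_left_mono)
next
  case (Suc k)
  then show ?case
    by (auto simp: derivs_le_Suc norm_mult dird_mult smooth_differentiable smooth_dird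
        intro: mult_left_mono)
qed

lemma derivs_le_affine:
  assumes L: "basis_affine R L" and R: "1 \<le> R"
  shows "smooth f \<Longrightarrow> derivs_le k p f \<Longrightarrow> derivs_le k (\<lambda>x. R ^ k * p (L x)) (\<lambda>x. f (L x))"
proof (induction k arbitrary: f)
  obtain c T where L': "\<And>x. L x = c + T x" "bounded_linear T"
    and T: "\<And>b. b \<in> Basis \<Longrightarrow> \<exists>r b'. \<bar>r\<bar> \<le> R \<and> b' \<in> Basis \<and> T b = r *\<^sub>R b'"
    using L unfolding basis_affine_def by blast
  {
    case 0
    then show ?case by (auto simp: derivs_le_0)
  next
    case (Suc k)
    have "derivs_le k (\<lambda>x. R ^ Suc k * p (L x)) (dird b (\<lambda>x. f (L x)))" if b: "b \<in> Basis" for b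
    proof -
      obtain r b' where rb: "\<bar>r\<bar> \<le> R" "b' \<in> Basis" "T b = r *\<^sub>R b'" using T[OF b] by blast
      have "derivs_le k (\<lambda>x. R ^ k * p (L x)) (\<lambda>x. dird b' f (L x))"
        using Suc rb by (intro Suc.IH) (auto simp: derivs_le_Suc smooth_dird)
      then have D: "derivs_le k (\<lambda>x. norm (complex_of_real r) * (R ^ k * p (L x)))
          (\<lambda>x. complex_of_real r * dird b' f (L x))"
        using Suc.prems rb by (intro derivs_le_cmult smooth_affine[OF L] smooth_dird)
      have p: "0 \<le> p x" for x using derivs_leD[OF Suc.prems(2), of x] by (meson norm_ge_zero order_trans)
      have "derivs_le k (\<lambda>x. R ^ Suc k * p (L x)) (\<lambda>x. complex_of_real r * dird b' f (L x))"
        by (rule derivs_le_mono[OF D]) (use rb R p in \<open>auto intro!: mult_right_mono simp: mult.assoc\<close>)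
      then show ?thesis
        using Suc.prems rb by (subst dird_affine[OF _ L' rb(3)]) (auto simp: smooth_differentiable)
    qed
    moreover have "norm (f (L x)) \<le> R ^ Suc k * p (L x)" for x
    proof -
      have "0 \<le> p (L x)" "norm (f (L x)) \<le> p (L x)"
        using derivs_leD[OF Suc.prems(2), of "L x"] by (auto intro: order_trans[OF norm_ge_zero])
      moreover have "1 * p (L x) \<le> R ^ Suc k * p (L x)"
        by (rule mult_right_mono[OF one_le_power[OF R]]) fact
      ultimately show ?thesis by simp
    qed
    ultimately show ?case by (auto simp: derivs_le_Suc)
  }
qed

text \<open>Only finitely many lists over \<open>Basis\<close> have length at most \<open>k\<close>,
  so the sum of the absolute values of their constants serves all of them at once.\<close>

lemma derivs_le_finite:
  assumes "\<And>bs. bs \<in> lists Basis \<Longrightarrow> length bs \<le> k \<Longrightarrow> \<exists>C. \<forall>x. norm (iter_deriv bs f x) \<le> C * p x"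
    and "\<And>x. 0 \<le> p x"
  shows "\<exists>C\<ge>0. derivs_le k (\<lambda>x. C * p x) (f :: 'a::euclidean_space \<Rightarrow> complex)"
proof -
  let ?L = "{bs :: 'a list. set bs \<subseteq> Basis \<and> length bs \<le> k}"
  have fin: "finite ?L" by (rule finite_lists_length_le) simp
  obtain C where C: "\<And>bs x. bs \<in> ?L \<Longrightarrow> norm (iter_deriv bs f x) \<le> C bs * p x"
    using assms(1) by (metis (mono_tags, lifting) mem_Collect_eq lists_eq_set)
  have "norm (iter_deriv bs f x) \<le> (\<Sum>bs\<in>?L. \<bar>C bs\<bar>) * p x" if "bs \<in> ?L" for bs x
  proof -
    have "C bs * p x \<le> (\<Sum>bs\<in>?L. \<bar>C bs\<bar>) * p x"
      using member_le_sum[OF that _ fin, of "\<lambda>b. \<bar>C b\<bar>"] assms(2) by (intro mult_right_mono) auto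
    then show ?thesis using C[OF that, of x] by simp
  qed
  then show ?thesis
    by (intro exI[of _ "\<Sum>bs\<in>?L. \<bar>C bs\<bar>"]) (auto simp: derivs_le_def lists_eq_set sum_nonneg)
qed


section \<open>A bump function\<close>

text \<open>The polynomial factor is a parameter so that the family is closed under differentiation;
  \<open>flat 1\<close> is the classical function exp (- 1 / x), extended by 0 to the left, which is
  smooth but not analytic at the origin.\<close>

definition flat :: "real poly \<Rightarrow> real \<Rightarrow> real" where
  "flat p x = (if x > 0 then poly p (1 / x) * exp (- (1 / x)) else 0)"

lemma poly_times_exp_tendsto_0: "((\<lambda>y::real. poly p y * exp (- y)) \<longlongrightarrow> 0) at_top"
proof (induction p)
  case (pCons a p)
  have "((\<lambda>y::real. a * exp (-y) + y * (poly p y * exp (-y))) \<longlongrightarrow> 0) at_top"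
  proof -
    have "((\<lambda>y::real. y ^ k / exp y) \<longlongrightarrow> 0) at_top" for k by (rule tendsto_power_div_exp_0)
    then have mon: "((\<lambda>y::real. y ^ k * exp (- y)) \<longlongrightarrow> 0) at_top" for k
      by (simp add: exp_minus divide_inverse)
    have "((\<lambda>y. \<Sum>i\<le>degree (pCons a p). coeff (pCons a p) i * (y ^ i * exp (- y))) \<longlongrightarrow>
        (\<Sum>i\<le>degree (pCons a p). coeff (pCons a p) i * 0)) at_top"
      by (intro tendsto_sum tendsto_mult tendsto_const mon)
    moreover have "(\<lambda>y. \<Sum>i\<le>degree (pCons a p). coeff (pCons a p) i * (y ^ i * exp (- y))) =
        (\<lambda>y. poly (pCons a p) y * exp (- y))"
      by (simp only: poly_altdef sum_distrib_right mult.assoc)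
    ultimately show ?thesis by (simp add: algebra_simps)
  qed
  then show ?case by (simp add: algebra_simps)
qed auto

text \<open>In the variable y = 1 / x, division by x multiplies the polynomial by y, that is, passes
  from \<open>p\<close> to \<open>pCons 0 p\<close>. Exponential decay still wins. The limit is the
  derivative of \<open>flat p\<close> at 0.\<close>

lemma flat_div_tendsto_0: "((\<lambda>x. flat p x / x) \<longlongrightarrow> 0) (at 0)"
proof -
  have "((\<lambda>y::real. poly (pCons 0 p) y * exp (- y)) \<longlongrightarrow> 0) at_top"
    by (rule poly_times_exp_tendsto_0)
  then have "((\<lambda>x::real. poly (pCons 0 p) (inverse x) * exp (- inverse x)) \<longlongrightarrow> 0) (at_right 0)"
    by (rule filterlim_compose[OF _ filterlim_inverse_at_top_right])
  then have "((\<lambda>x. flat p x / x) \<longlongrightarrow> 0) (at_right 0)"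
    by (rule Lim_transform_eventually)
       (auto simp: flat_def eventually_at_right_field divide_simps intro: exI[of _ 1])
  moreover have "((\<lambda>x. flat p x / x) \<longlongrightarrow> 0) (at_left 0)"
    by (rule Lim_transform_eventually[OF tendsto_const])
       (auto simp: flat_def eventually_at_left_field intro: exI[of _ "-1"])
  ultimately show ?thesis by (simp add: filterlim_split_at)
qed

text \<open>The derivative of \<open>p (1 / x) * exp (- 1 / x)\<close> is \<open>(1 / x)\<^sup>2 * (p - p') (1 / x) * exp (- 1 / x)\<close>.\<close>

definition flat_deriv_poly :: "real poly \<Rightarrow> real poly" where
  "flat_deriv_poly p = [:0, 0, 1:] * (p - pderiv p)"

lemma flat_has_derivative: "(flat p has_real_derivative flat (flat_deriv_poly p) x) (at x)"
proof -
  consider "x > 0" | "x = 0" | "x < 0" by linarith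
  then show ?thesis
  proof cases
    case 1
    have "((\<lambda>x. poly p (1 / x) * exp (- (1 / x))) has_real_derivative flat (flat_deriv_poly p) x) (at x)"
      using 1 by (auto intro!: derivative_eq_intros poly_DERIV[THEN DERIV_chain2]
          simp: flat_def flat_deriv_poly_def field_simps power2_eq_square)
    then show ?thesis
      by (rule has_field_derivative_transform_within_open[of _ _ _ "{0<..}"]) (use 1 in \<open>auto simp: flat_def\<close>)
  next
    case 2
    have "((\<lambda>h. (flat p (0 + h) - flat p 0) / h) \<longlongrightarrow> 0) (at 0)"
      using flat_div_tendsto_0[of p] by (simp add: flat_def)
    then show ?thesis using 2 by (simp add: DERIV_def flat_def)
  next
    case 3
    have "((\<lambda>x. 0) has_real_derivative flat (flat_deriv_poly p) x) (at x)"
      using 3 by (simp add: flat_def)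
    then show ?thesis
      by (rule has_field_derivative_transform_within_open[of _ _ _ "{..<0}"]) (use 3 in \<open>auto simp: flat_def\<close>)
  qed
qed

text \<open>Differentiation replaces \<open>p\<close> by \<open>flat_deriv_poly p\<close> and
  produces a factor \<open>dird b\<close> of the inner function, smooth to one order less, so the
  induction keeps \<open>p\<close> arbitrary. The real function \<open>q\<close> is viewed as
  complex because \<open>dird\<close> acts on complex functions; \<open>qb\<close> records that its
  derivatives stay real.\<close>

lemma smooth_upto_flat_comp:
  fixes q :: "'a::euclidean_space \<Rightarrow> real"
  shows "smooth_upto k (\<lambda>x. complex_of_real (q x)) \<Longrightarrow> smooth_upto k (\<lambda>x. complex_of_real (flat p (q x)))"
proof (induction k arbitrary: p)
  have D: "((\<lambda>x. complex_of_real (flat p (q x))) has_derivative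
      (\<lambda>b. complex_of_real (flat (flat_deriv_poly p) (q x)) * dird b (\<lambda>x. complex_of_real (q x)) x)) (at x)"
    if q: "(\<lambda>x. complex_of_real (q x)) differentiable (at x)" for x p
  proof -
    let ?q = "\<lambda>b. dird b (\<lambda>x. complex_of_real (q x)) x"
    have "((\<lambda>x. complex_of_real (q x)) has_derivative ?q) (at x)"
      by (rule differentiable_has_derivative_dird[OF q])
    then have qd: "(q has_derivative (\<lambda>b. Re (?q b))) (at x)"
      using bounded_linear.has_derivative[OF bounded_linear_Re] by force
    then have "((\<lambda>x. complex_of_real (q x)) has_derivative (\<lambda>b. complex_of_real (Re (?q b)))) (at x)"
      by (rule has_derivative_of_real)
    then have qb: "?q b = complex_of_real (Re (?q b))" for b
      by (rule dird_eqI)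
    have "((\<lambda>x. flat p (q x)) has_derivative (\<lambda>b. flat (flat_deriv_poly p) (q x) * Re (?q b))) (at x)"
      using has_derivative_compose[OF qd flat_has_derivative[unfolded has_field_derivative_def]] .
    then have "((\<lambda>x. complex_of_real (flat p (q x))) has_derivative
        (\<lambda>b. complex_of_real (flat (flat_deriv_poly p) (q x) * Re (?q b)))) (at x)"
      by (rule has_derivative_of_real)
    then show ?thesis using qb by simp
  qed
  {
    case 0
    then show ?case using differentiableI[OF D] by auto
  next
    case (Suc k)
    have "dird b (\<lambda>x. complex_of_real (flat p (q x))) =
      (\<lambda>x. complex_of_real (flat (flat_deriv_poly p) (q x)) * dird b (\<lambda>x. complex_of_real (q x)) x)" for b
      using Suc.prems by (intro ext dird_eqI D) auto
    moreover have "smooth_upto k (\<lambda>x. complex_of_real (q x))"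
      using Suc.prems smooth_upto_antimono le_SucI by blast
    ultimately show ?case
      using Suc differentiableI[OF D] by (auto intro: smooth_upto_mult)
  }
qed

lemma has_derivative_norm_sq:
  "((\<lambda>x::'a::euclidean_space. complex_of_real ((norm x)\<^sup>2)) has_derivative (\<lambda>v. complex_of_real (2 * (x \<bullet> v)))) (at x)"
proof -
  have "((\<lambda>x::'a. x \<bullet> x) has_derivative (\<lambda>v. 2 * (x \<bullet> v))) (at x)"
    by (auto intro!: derivative_eq_intros simp: inner_commute)
  then show ?thesis unfolding power2_norm_eq_inner by (rule has_derivative_of_real)
qed

lemma smooth_inner_left: "smooth (\<lambda>x. complex_of_real (c \<bullet> x))" 
  by (rule smooth_bounded_linear[OF bounded_linear_compose[OF bounded_linear_of_real bounded_linear_inner_right]])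

lemma smooth_norm_sq: "smooth (\<lambda>x::'a::euclidean_space. complex_of_real ((norm x)\<^sup>2))"
proof -
  have "dird b (\<lambda>x::'a. complex_of_real ((norm x)\<^sup>2)) = (\<lambda>x. complex_of_real ((2 *\<^sub>R b) \<bullet> x))" for b
    by (rule ext, rule trans[OF dird_eqI[OF has_derivative_norm_sq]]) (simp add: inner_commute)
  moreover have "smooth_upto k (\<lambda>x::'a. complex_of_real ((2 *\<^sub>R b) \<bullet> x))" for b k
    using smooth_inner_left[of "2 *\<^sub>R b"] smooth_iff_smooth_upto by blast
  ultimately have "smooth_upto k (\<lambda>x::'a. complex_of_real ((norm x)\<^sup>2))" for k
    using differentiableI[OF has_derivative_norm_sq[where ?'a='a]] by (cases k) simp_all
  then show ?thesis by (simp add: smooth_iff_smooth_upto)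
qed

definition bump :: "real \<Rightarrow> 'a::euclidean_space \<Rightarrow> real" where
  "bump r x = flat 1 (r\<^sup>2 - (norm x)\<^sup>2)"

lemma smooth_bump: "smooth (\<lambda>x. complex_of_real (bump r x))"
proof -
  have "smooth (\<lambda>x::'a. complex_of_real (r\<^sup>2 - (norm x)\<^sup>2))"
    using smooth_diff[OF smooth_const[of "complex_of_real (r\<^sup>2)"] smooth_norm_sq] by simp
  then show ?thesis unfolding bump_def smooth_iff_smooth_upto by (auto intro: smooth_upto_flat_comp)
qed

lemma bump_pos: "norm x < r \<Longrightarrow> 0 < bump r x"
  by (auto simp: bump_def flat_def power_strict_mono)

lemma bump_eq_0: "r \<le> norm x \<Longrightarrow> 0 \<le> r \<Longrightarrow> bump r x = 0"
  using power_mono[of r "norm x" 2] by (auto simp: bump_def flat_def simp del: power_mono_iff)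

lemma iter_deriv_eq_0_open:
  assumes "open U" "\<And>x. x \<in> U \<Longrightarrow> f x = 0" "x \<in> U"
  shows "iter_deriv bs f x = 0"
  using assms(3)
proof (induction bs arbitrary: x)
  case (Cons b bs)
  have "(iter_deriv bs f has_derivative (\<lambda>_. 0)) (at x)"
    by (rule has_derivative_transform_within_open[OF has_derivative_const[of 0] assms(1) Cons.prems])
       (simp add: Cons.IH)
  then show ?case by (simp add: frechet_derivative_at[symmetric])
qed (simp add: assms(2))

text \<open>Beyond radius \<open>r\<close> the function vanishes on an open set, and its derivatives
  vanish with it; on the closed ball they are continuous, hence bounded by compactness.\<close>

lemma bounded_support_derivs:
  assumes f: "smooth f" and supp: "\<And>x. r < norm x \<Longrightarrow> f x = 0" and bs: "bs \<in> lists Basis"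
  shows "\<exists>C. \<forall>x. norm (iter_deriv bs f x) \<le> C \<and> (r < norm x \<longrightarrow> iter_deriv bs f x = 0)"
proof -
  have z: "iter_deriv bs f x = 0" if "r < norm x" for x
    by (rule iter_deriv_eq_0_open[of "{x. r < norm x}"])
       (use that supp in \<open>auto intro!: open_Collect_less continuous_on_const continuous_on_norm_id\<close>)
  have "compact (iter_deriv bs f ` cball 0 r)"
    by (intro compact_continuous_image smooth_continuous smooth_iter_deriv f bs) simp
  then obtain C where C: "\<And>x. x \<in> cball 0 r \<Longrightarrow> norm (iter_deriv bs f x) \<le> C"
    using bounded_iff compact_imp_bounded by (metis imageI)
  have "norm (iter_deriv bs f x) \<le> max C 0" for x
    using C[of x] z[of x] by (cases "r < norm x") (auto simp: max.coboundedI1)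
  then show ?thesis using z by blast
qed

section \<open>Integration over Euclidean spaces\<close>

text \<open>An affine dilation maps Lebesgue measure to a constant multiple of itself. If
  \<open>f\<close> is not integrable, both integrals take the default value 0, so the identity
  persists.\<close>

lemma lborel_has_integral_affine:
  fixes f :: "'a::euclidean_space \<Rightarrow> 'b::{banach, second_countable_topology}"
  assumes f: "f \<in> borel_measurable borel" and c: "c \<noteq> 0"
  shows lborel_integral_affine:
      "(\<integral>x. f (t + c *\<^sub>R x) \<partial>lborel) = (1 / \<bar>c\<bar> ^ DIM('a)) *\<^sub>R (\<integral>x. f x \<partial>lborel)"
    and lborel_integrable_affine_iff:
      "integrable lborel (\<lambda>x. f (t + c *\<^sub>R x)) \<longleftrightarrow> integrable lborel f"
proof -
  have m: "(\<lambda>x::'a. t + c *\<^sub>R x) \<in> lborel \<rightarrow>\<^sub>M borel" by simp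
  have nz: "\<bar>c\<bar> ^ DIM('a) \<noteq> 0" using c by simp
  have "(\<integral>x. f x \<partial>lborel) = \<bar>c\<bar> ^ DIM('a) *\<^sub>R (\<integral>x. f (t + c *\<^sub>R x) \<partial>lborel)"
    by (subst lborel_affine[OF c, of t], subst integral_density)
       (auto simp: integral_distr[OF m] f)
  then show "(\<integral>x. f (t + c *\<^sub>R x) \<partial>lborel) = (1 / \<bar>c\<bar> ^ DIM('a)) *\<^sub>R (\<integral>x. f x \<partial>lborel)"
    using nz by simp
  show "integrable lborel (\<lambda>x. f (t + c *\<^sub>R x)) \<longleftrightarrow> integrable lborel f"
  proof -
    have "integrable lborel f \<longleftrightarrow> integrable (distr lborel borel (\<lambda>x. t + c *\<^sub>R x)) (\<lambda>x. \<bar>c\<bar> ^ DIM('a) *\<^sub>R f x)"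
      by (subst lborel_affine[OF c, of t], subst integrable_density) (auto simp: f)
    also have "\<dots> \<longleftrightarrow> integrable lborel (\<lambda>x. \<bar>c\<bar> ^ DIM('a) *\<^sub>R f (t + c *\<^sub>R x))"
      by (rule integrable_distr_eq[OF m]) (use f in measurable)
    also have "\<dots> \<longleftrightarrow> integrable lborel (\<lambda>x. f (t + c *\<^sub>R x))"
    proof
      assume "integrable lborel (\<lambda>x. \<bar>c\<bar> ^ DIM('a) *\<^sub>R f (t + c *\<^sub>R x))"
      from integrable_scaleR_right[OF this, of "inverse (\<bar>c\<bar> ^ DIM('a))"]
      show "integrable lborel (\<lambda>x. f (t + c *\<^sub>R x))" using c by simp
    qed (rule integrable_scaleR_right)
    finally show ?thesis by simp
  qed
qed

lemma lborel_integral_shift: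
  fixes f :: "'a::euclidean_space \<Rightarrow> 'b::{banach, second_countable_topology}"
  assumes "f \<in> borel_measurable borel"
  shows "(\<integral>x. f (t + x) \<partial>lborel) = (\<integral>x. f x \<partial>lborel)"
  using lborel_integral_affine[OF assms, of 1 t] by simp

lemma lborel_integral_reflect:
  fixes f :: "'a::euclidean_space \<Rightarrow> 'b::{banach, second_countable_topology}"
  assumes "f \<in> borel_measurable borel"
  shows "(\<integral>x. f (t - x) \<partial>lborel) = (\<integral>x. f x \<partial>lborel)"
  using lborel_integral_affine[OF assms, of "-1" t] by simp

lemma lborel_integrable_shift:
  fixes f :: "'a::euclidean_space \<Rightarrow> 'b::{banach, second_countable_topology}"
  assumes "integrable lborel f"
  shows "integrable lborel (\<lambda>x. f (t + x))" "integrable lborel (\<lambda>x. f (x - t))"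
    "integrable lborel (\<lambda>x. f (t - x))"
  using lborel_integrable_affine_iff[of f 1 t] lborel_integrable_affine_iff[of f 1 "-t"]
    lborel_integrable_affine_iff[of f "-1" t] assms borel_measurable_integrable[OF assms] by simp_all

lemma lborel_prod_integral:
  fixes f :: "'a::euclidean_space \<Rightarrow> real \<Rightarrow> 'b::{real_normed_field,banach,second_countable_topology}"
  assumes f: "\<And>b. b \<in> Basis \<Longrightarrow> integrable lborel (f b)"
  shows lborel_integrable_prod: "integrable lborel (\<lambda>x::'a. \<Prod>b\<in>Basis. f b (x \<bullet> b))"
    and lborel_integral_prod:
      "(\<integral>x. (\<Prod>b\<in>Basis. f b (x \<bullet> b)) \<partial>lborel) = (\<Prod>b\<in>Basis. (\<integral>x. f b x \<partial>lborel))"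
proof -
  interpret product_sigma_finite "\<lambda>_::'a. lborel :: real measure" ..
  have m: "(\<lambda>g. \<Sum>b\<in>Basis. g b *\<^sub>R b) \<in> (\<Pi>\<^sub>M b\<in>(Basis::'a set). (lborel :: real measure)) \<rightarrow>\<^sub>M borel"
    by measurable
  have fm: "(\<lambda>x::'a. \<Prod>b\<in>Basis. f b (x \<bullet> b)) \<in> borel_measurable borel"
    using borel_measurable_integrable[OF f]
    by (intro borel_measurable_prod measurable_compose[OF borel_measurable_inner[OF measurable_ident_sets[OF refl] measurable_const]])
       (auto)
  have e: "(\<Prod>b\<in>Basis. f b ((\<Sum>b\<in>Basis. g b *\<^sub>R b) \<bullet> b)) = (\<Prod>b\<in>Basis. f b (g b))" for g :: "'a \<Rightarrow> real"
    by (intro prod.cong) auto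
  show "integrable lborel (\<lambda>x::'a. \<Prod>b\<in>Basis. f b (x \<bullet> b))"
    by (subst lborel_eq, subst integrable_distr_eq[OF m fm])
       (use f in \<open>auto simp: e intro!: product_integrable_prod\<close>)
  show "(\<integral>x. (\<Prod>b\<in>Basis. f b (x \<bullet> b)) \<partial>lborel) = (\<Prod>b\<in>Basis. (\<integral>x. f b x \<partial>lborel))"
    by (subst lborel_eq, subst integral_distr[OF m fm], simp only: e)
       (use f in \<open>auto intro!: product_integral_prod\<close>)
qed

text \<open>Most interchanges of Bochner integrals below are justified by a majorant in product form
  with integrable factors. This is the form that Peetre's inequality delivers for bounds depending
  on a difference of the two variables.\<close>

lemma lborel_Fubini_dominated:
  fixes f :: "'a::euclidean_space \<Rightarrow> 'b::euclidean_space \<Rightarrow> 'c::{banach, second_countable_topology}"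
  assumes f: "case_prod f \<in> borel_measurable borel"
    and le: "\<And>x y. norm (f x y) \<le> p x * q y"
    and p: "integrable lborel p" and q: "integrable lborel q"
  shows lborel_integrable_dominated: "integrable lborel (case_prod f)"
    and lborel_swap_dominated: "(\<integral>x. (\<integral>y. f x y \<partial>lborel) \<partial>lborel) = (\<integral>y. (\<integral>x. f x y \<partial>lborel) \<partial>lborel)"
    and lborel_iterated_dominated: "(\<integral>x. (\<integral>y. f x y \<partial>lborel) \<partial>lborel) = (\<integral>z. case_prod f z \<partial>lborel)"
proof -
  have f': "case_prod f \<in> borel_measurable (lborel \<Otimes>\<^sub>M lborel)" using f by (simp add: lborel_prod)
  have fx: "(\<lambda>y. f x y) \<in> borel_measurable lborel" for x
    using measurable_compose[OF measurable_Pair1' f', of x] by simp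
  have ix: "integrable lborel (\<lambda>y. f x y)" for x
    by (rule Bochner_Integration.integrable_bound[OF integrable_mult_right[OF q, of "p x"]])
       (use fx in \<open>auto intro!: order_trans[OF le abs_ge_self]\<close>)
  have i: "integrable (lborel \<Otimes>\<^sub>M lborel) (case_prod f)"
  proof (rule lborel_pair.Fubini_integrable[OF f'])
    have nf: "(\<lambda>x. \<integral>y. norm (f x y) \<partial>lborel) \<in> borel_measurable lborel"
      by (rule lborel.borel_measurable_lebesgue_integral) (use f' in measurable)
    have "(\<integral>y. norm (f x y) \<partial>lborel) \<le> p x * integral\<^sup>L lborel q" for x
    proof -
      have "(\<integral>y. norm (f x y) \<partial>lborel) \<le> (\<integral>y. p x * q y \<partial>lborel)"
        by (rule integral_mono) (use ix q le in auto)
      then show ?thesis by simp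
    qed
    then show "integrable lborel (\<lambda>x. \<integral>y. norm (case_prod f (x, y)) \<partial>lborel)"
      by (intro Bochner_Integration.integrable_bound[OF integrable_mult_left[OF p, of "integral\<^sup>L lborel q"]])
         (use nf in \<open>auto intro: abs_ge_self[THEN order_trans[rotated]]\<close>)
  qed (use ix in auto)
  then show "integrable lborel (case_prod f)" by (simp add: lborel_prod)
  show "(\<integral>x. (\<integral>y. f x y \<partial>lborel) \<partial>lborel) = (\<integral>y. (\<integral>x. f x y \<partial>lborel) \<partial>lborel)"
    by (rule lborel_pair.Fubini_integral[OF i, symmetric])
  show "(\<integral>x. (\<integral>y. f x y \<partial>lborel) \<partial>lborel) = (\<integral>z. case_prod f z \<partial>lborel)"
    using lborel_pair.integral_fst'[OF i] by (simp add: lborel_prod)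
qed

section \<open>Polynomial weights and Peetre's inequality\<close>

definition wt :: "nat \<Rightarrow> 'a::real_normed_vector \<Rightarrow> real" where
  "wt k x = inverse ((1 + norm x) ^ k)"

lemma wt_pos: "0 < wt k x"
  by (auto simp: wt_def intro!: zero_less_power add_pos_nonneg)

lemma wt_nonneg [simp]: "0 \<le> wt k x"
  using wt_pos[of k x] by simp

lemma wt_le_1: "wt k x \<le> 1"
  unfolding wt_def by (intro inverse_le_1_iff[THEN iffD2] disjI2 one_le_power) simp

lemma wt_0 [simp]: "wt 0 x = 1" "wt k 0 = 1"
  by (simp_all add: wt_def)

lemma wt_minus: "wt k (- x) = wt k x" "wt k (x - y) = wt k (y - x)"
  by (simp_all add: wt_def norm_minus_commute)

lemma wt_antimono: "j \<le> k \<Longrightarrow> wt k x \<le> wt j x"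
  unfolding wt_def by (intro le_imp_inverse_le power_increasing zero_less_power) (auto intro: add_pos_nonneg)

lemma wt_add: "wt (j + k) x = wt j x * wt k x"
  by (simp add: wt_def power_add)

lemma one_plus_norm_pos: "0 < 1 + norm x"
  by (rule add_pos_nonneg) auto

lemma peetre: "1 + norm (x + y) \<le> (1 + norm x) * (1 + norm y)"
proof -
  have "norm (x + y) \<le> norm x + norm y" by (rule norm_triangle_ineq)
  also have "\<dots> \<le> norm x + norm y + norm x * norm y" by simp
  finally show ?thesis by (simp add: algebra_simps)
qed

text \<open>Moves the centre of a weight at the price of a polynomial factor; a bound centred at a
  varying point thereby becomes a product majorant.\<close>

lemma wt_peetre: "wt k (x + y) \<le> (1 + norm y) ^ k * wt k x"
proof -
  have "1 + norm x \<le> (1 + norm (x + y)) * (1 + norm y)"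
    using peetre[of "x + y" "- y"] by simp
  then have "(1 + norm x) ^ k \<le> (1 + norm (x + y)) ^ k * (1 + norm y) ^ k"
    by (metis power_mono power_mult_distrib order_less_imp_le one_plus_norm_pos)
  then show ?thesis
    unfolding wt_def using one_plus_norm_pos[of x] one_plus_norm_pos[of "x + y"]
    by (simp add: field_simps)
qed

text \<open>Peetre's inequality inverted: decay in two vectors gives decay in their sum. Applied to
  w and w' - w, it passes decay from a function through an off-diagonal kernel.\<close>

lemma wt_product_le: "wt k x * wt k y \<le> wt k (x + y)"
  unfolding wt_def inverse_mult_distrib[symmetric] power_mult_distrib[symmetric]
  by (intro le_imp_inverse_le power_mono peetre zero_less_power one_plus_norm_pos) auto

lemma wt_continuous [continuous_intros]: "continuous_on S f \<Longrightarrow> continuous_on S (\<lambda>x. wt k (f x))"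
  unfolding wt_def by (intro continuous_intros) (auto simp: add_nonneg_eq_0_iff)

lemma wt_measurable [measurable (raw)]: "f \<in> borel_measurable M \<Longrightarrow> (\<lambda>x. wt k (f x)) \<in> borel_measurable M"
  unfolding wt_def by measurable

text \<open>The exponent 2n comes from comparison with the product of the n factors 1 / (1 + x_b^2):
  no coordinate exceeds the norm, so one factor (1 + |x|)^2 pays for one coordinate, and each
  one-dimensional integral is finite.\<close>

lemma wt_integrable: 
  assumes "2 * DIM('a) \<le> k"
  shows "integrable lborel (wt k :: 'a::euclidean_space \<Rightarrow> real)"
proof -
  have "integrable lborel (\<lambda>x::real. inverse (1 + x\<^sup>2))"
    using integrable_inverse_1_plus_square by (simp add: set_integrable_def)
  then have i: "integrable lborel (\<lambda>x::'a. \<Prod>b\<in>Basis. inverse (1 + (x \<bullet> b)\<^sup>2))"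
    by (intro lborel_integrable_prod)
  have "wt k x \<le> (\<Prod>b\<in>Basis. inverse (1 + (x \<bullet> b)\<^sup>2))" for x :: 'a
  proof -
    have "wt k x \<le> wt (2 * DIM('a)) x" by (rule wt_antimono[OF assms])
    also have "\<dots> = (\<Prod>b\<in>(Basis::'a set). inverse ((1 + norm x)\<^sup>2))"
      by (simp add: wt_def power_mult power_inverse[symmetric])
    also have "\<dots> \<le> (\<Prod>b\<in>Basis. inverse (1 + (x \<bullet> b)\<^sup>2))"
    proof (intro prod_mono conjI le_imp_inverse_le)
      fix b :: 'a assume "b \<in> Basis"
      then have "(x \<bullet> b)\<^sup>2 \<le> (norm x)\<^sup>2" by (simp add: Basis_le_norm abs_le_square_iff[symmetric])
      then show "1 + (x \<bullet> b)\<^sup>2 \<le> (1 + norm x)\<^sup>2" by (simp add: power2_sum add_increasing2)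
    qed (auto intro: add_pos_nonneg)
    finally show ?thesis .
  qed
  then show ?thesis
    by (intro Bochner_Integration.integrable_bound[OF i]) (auto simp: order_trans[OF _ abs_ge_self])
qed

lemma integrable_wt_bound:
  fixes f :: "'a::euclidean_space \<Rightarrow> 'b::{banach, second_countable_topology}"
  assumes "f \<in> borel_measurable borel" "\<And>x. norm (f x) \<le> B * wt (2 * DIM('a)) (x - a)"
  shows "integrable lborel f"
    "norm (\<integral>x. f x \<partial>lborel) \<le> B * (\<integral>x. wt (2 * DIM('a)) (x::'a) \<partial>lborel)"
proof -
  have i: "integrable lborel (\<lambda>x. B * wt (2 * DIM('a)) (x - a))"
    by (intro integrable_mult_right lborel_integrable_shift wt_integrable) simp
  show fi: "integrable lborel f"
    by (rule Bochner_Integration.integrable_bound[OF i])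
       (use assms in \<open>auto intro: order_trans[OF _ abs_ge_self]\<close>)
  have "norm (\<integral>x. f x \<partial>lborel) \<le> (\<integral>x. norm (f x) \<partial>lborel)" by (rule integral_norm_bound)
  also have "\<dots> \<le> (\<integral>x. B * wt (2 * DIM('a)) (x - a) \<partial>lborel)"
    by (rule integral_mono) (use fi i assms in auto)
  also have "\<dots> = B * (\<integral>x. wt (2 * DIM('a)) (x::'a) \<partial>lborel)"
    using lborel_integral_shift[of "wt (2 * DIM('a))" "- a"] by simp
  finally show "norm (\<integral>x. f x \<partial>lborel) \<le> B * (\<integral>x. wt (2 * DIM('a)) (x::'a) \<partial>lborel)" .
qed

section \<open>Decay of Fourier integrals\<close>

text \<open>By translation invariance every difference quotient of \<open>f\<close> in direction
  \<open>b\<close> has integral 0. The quotients converge to the derivative under a common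
  integrable bound, so its integral is 0 as well.\<close>

lemma integral_dird_eq_0:
  fixes f :: "'a::euclidean_space \<Rightarrow> complex"
  assumes f: "smooth f" and b: "b \<in> Basis" and le: "derivs_le 1 (\<lambda>x. B * wt (2 * DIM('a)) (x - a)) f"
  shows "(\<integral>x. dird b f x \<partial>lborel) = 0"
proof -
  let ?w = "wt (2 * DIM('a)) :: 'a \<Rightarrow> real"
  let ?g = "\<lambda>n x. (f (inverse (real (Suc n)) *\<^sub>R b + x) - f x) * of_real (real (Suc n))"
  have fm: "f \<in> borel_measurable borel" using f by (rule smooth_measurable)
  have dm: "dird b f \<in> borel_measurable borel" using f b by (intro smooth_measurable smooth_dird)
  have f1: "norm (f x) \<le> B * ?w (x - a)" and d1: "norm (dird b f x) \<le> B * ?w (x - a)" for x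
    using le b by (auto simp: derivs_le_Suc derivs_le_0)
  have B: "0 \<le> B" using order_trans[OF norm_ge_zero f1[of a]] by (simp add: wt_def)
  have fi: "integrable lborel f" by (rule integrable_wt_bound[OF fm f1])
  have D: "((\<lambda>s. f (s *\<^sub>R b + x)) has_vector_derivative dird b f (s *\<^sub>R b + x)) (at s within S)" for s x S
  proof -
    have "((\<lambda>s. s *\<^sub>R b + x) has_derivative (\<lambda>s. s *\<^sub>R b)) (at s within S)"
      by (auto intro!: derivative_eq_intros)
    from has_derivative_compose[OF this differentiable_has_derivative_dird[OF smooth_differentiable[OF f]]]
    have "((\<lambda>s. f (s *\<^sub>R b + x)) has_derivative (\<lambda>r. dird (r *\<^sub>R b) f (s *\<^sub>R b + x))) (at s within S)" .
    moreover have "dird (r *\<^sub>R b) f (s *\<^sub>R b + x) = r *\<^sub>R dird b f (s *\<^sub>R b + x)" for r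
      by (rule linear_cmul[OF has_derivative_linear[OF differentiable_has_derivative_dird[OF smooth_differentiable[OF f]]]])
    ultimately show ?thesis by (simp add: has_vector_derivative_def)
  qed
  have lim: "(\<lambda>n. ?g n x) \<longlonglongrightarrow> dird b f x" for x
  proof -
    have "((\<lambda>s. f (s *\<^sub>R b + x)) has_vector_derivative dird b f x) (at 0)"
      using D[of x 0 UNIV] by simp
    then have "((\<lambda>h. norm (f (h *\<^sub>R b + x) - f x - h *\<^sub>R dird b f x) / norm h) \<longlongrightarrow> 0) (at 0)"
      by (simp add: has_vector_derivative_def has_derivative_at)
    then have "((\<lambda>h. norm ((f (h *\<^sub>R b + x) - f x) /\<^sub>R h - dird b f x)) \<longlongrightarrow> 0) (at 0)"
    proof (rule Lim_transform_eventually, intro eventually_at_filter[THEN iffD2] always_eventually allI impI)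
      fix h :: real assume h: "h \<noteq> 0"
      have "(f (h *\<^sub>R b + x) - f x) /\<^sub>R h - dird b f x = (f (h *\<^sub>R b + x) - f x - h *\<^sub>R dird b f x) /\<^sub>R h"
        using h by (simp add: scaleR_diff_right)
      then show "norm (f (h *\<^sub>R b + x) - f x - h *\<^sub>R dird b f x) / norm h =
          norm ((f (h *\<^sub>R b + x) - f x) /\<^sub>R h - dird b f x)"
        by (simp only: norm_scaleR) (simp add: divide_inverse mult.commute)
    qed
    then have "((\<lambda>h. (f (h *\<^sub>R b + x) - f x) /\<^sub>R h) \<longlongrightarrow> dird b f x) (at 0)"
      by (simp add: tendsto_norm_zero_iff Lim_null[of _ "dird b f x"])
    then have "(\<lambda>n. (f (inverse (real (Suc n)) *\<^sub>R b + x) - f x) /\<^sub>R inverse (real (Suc n))) \<longlonglongrightarrow> dird b f x"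
      using LIMSEQ_inverse_real_of_nat
      unfolding tendsto_at_iff_sequentially comp_def
      by (elim allE[of _ "\<lambda>n. inverse (real (Suc n))"]) auto
    then show ?thesis by (simp add: scaleR_conv_of_real mult.commute)
  qed
  \<comment> \<open>Mean value inequality along a segment of length at most 1. Moving the centre of
    the weight by such a vector costs the factor 2^(2n) = 4^n.\<close>
  have dom: "norm (?g n x) \<le> (4 ^ DIM('a) * B) * ?w (x - a)" for n x
  proof -
    let ?s = "inverse (real (Suc n))"
    have s: "0 \<le> ?s" "?s \<le> 1" by (auto simp: inverse_le_1_iff)
    have "norm (f (?s *\<^sub>R b + x) - f (0 *\<^sub>R b + x)) \<le> (4 ^ DIM('a) * B * ?w (x - a)) * norm (?s - 0)"
    proof (rule differentiable_bound[where S = "{0..?s}"])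
      fix r assume r: "r \<in> {0..?s}"
      show "((\<lambda>s. f (s *\<^sub>R b + x)) has_derivative (\<lambda>h. h *\<^sub>R dird b f (r *\<^sub>R b + x))) (at r within {0..?s})"
        using D[of x r] by (simp add: has_vector_derivative_def)
      have "B * ?w (r *\<^sub>R b + x - a) \<le> 4 ^ DIM('a) * B * ?w (x - a)"
      proof -
        have "?w (x - a + r *\<^sub>R b) \<le> (1 + norm (r *\<^sub>R b)) ^ (2 * DIM('a)) * ?w (x - a)" by (rule wt_peetre)
        also have "\<dots> \<le> 2 ^ (2 * DIM('a)) * ?w (x - a)"
          using r s b by (intro mult_right_mono power_mono) auto
        also have "\<dots> = 4 ^ DIM('a) * ?w (x - a)" by (simp add: power_mult)
        finally have "?w (r *\<^sub>R b + x - a) \<le> 4 ^ DIM('a) * ?w (x - a)" by (simp add: algebra_simps)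
        from mult_left_mono[OF this B] show ?thesis by (simp only: mult_ac)
      qed
      then have "norm (dird b f (r *\<^sub>R b + x)) \<le> 4 ^ DIM('a) * B * ?w (x - a)"
        using d1[of "r *\<^sub>R b + x"] by simp
      then show "onorm (\<lambda>h. h *\<^sub>R dird b f (r *\<^sub>R b + x)) \<le> 4 ^ DIM('a) * B * ?w (x - a)"
        by (intro onorm_le) (auto intro!: mult_left_mono simp: mult.commute[of _ "\<bar>_\<bar>"])
    qed (use s in auto)
    then have "norm (f (?s *\<^sub>R b + x) - f x) * real (Suc n) \<le> (4 ^ DIM('a) * B * ?w (x - a)) * ?s * real (Suc n)"
      using s by (intro mult_right_mono) auto
    moreover have "X * ?s * real (Suc n) = X" for X by simp
    ultimately show ?thesis
      by (simp only: norm_mult norm_of_real abs_of_nat mult.assoc)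
  qed
  have "(\<lambda>n. \<integral>x. ?g n x \<partial>lborel) \<longlonglongrightarrow> (\<integral>x. dird b f x \<partial>lborel)"
  proof (rule integral_dominated_convergence)
    show "integrable lborel (\<lambda>x. (4 ^ DIM('a) * B) * ?w (x - a))"
      by (intro integrable_mult_right lborel_integrable_shift wt_integrable) simp
    show "?g n \<in> borel_measurable lborel" for n using fm by measurable
  qed (use lim dom dm in auto)
  moreover have "(\<integral>x. ?g n x \<partial>lborel) = 0" for n
    using fi by (simp add: lborel_integrable_shift lborel_integral_shift[OF fm])
  ultimately have "(\<lambda>n. 0) \<longlonglongrightarrow> (\<integral>x. dird b f x \<partial>lborel)" by (simp only:)
  then show ?thesis by (rule LIMSEQ_unique) (rule tendsto_const)
qed

lemma smooth_cis: "smooth (\<lambda>x. cis (d \<bullet> x))"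
  unfolding cis_conv_exp by (intro smooth_exp smooth_mult smooth_const smooth_inner_left)

lemma dird_cis: "dird b (\<lambda>x. cis (d \<bullet> x)) = (\<lambda>x. \<i> * (d \<bullet> b) * cis (d \<bullet> x))"
  by (rule ext, rule dird_eqI[THEN trans])
     (auto intro!: derivative_eq_intros simp: scaleR_conv_of_real mult_ac)

lemma fourier_by_parts:
  fixes f :: "'a::euclidean_space \<Rightarrow> complex"
  assumes f: "smooth f" and b: "b \<in> Basis" and le: "derivs_le 1 (\<lambda>x. B * wt (2 * DIM('a)) (x - a)) f"
  shows "\<i> * (d \<bullet> b) * (\<integral>x. f x * cis (d \<bullet> x) \<partial>lborel) = - (\<integral>x. dird b f x * cis (d \<bullet> x) \<partial>lborel)"
proof -
  let ?w = "wt (2 * DIM('a)) :: 'a \<Rightarrow> real"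
  have dc: "dird b (\<lambda>x. f x * cis (d \<bullet> x)) = (\<lambda>x. dird b f x * cis (d \<bullet> x) + \<i> * (d \<bullet> b) * (f x * cis (d \<bullet> x)))"
    if "b \<in> Basis" for b
    using smooth_differentiable[OF f] smooth_differentiable[OF smooth_cis]
    by (subst dird_mult) (auto simp: dird_cis algebra_simps)
  have f1: "norm (f x) \<le> B * ?w (x - a)" and d1: "b \<in> Basis \<Longrightarrow> norm (dird b f x) \<le> B * ?w (x - a)" for b x
    using le by (auto simp: derivs_le_Suc derivs_le_0)
  have B: "0 \<le> B * ?w x" for x
    using order_trans[OF norm_ge_zero f1[of "x + a"]] by simp
  have "derivs_le 1 (\<lambda>x. ((1 + norm d) * B) * ?w (x - a)) (\<lambda>x. f x * cis (d \<bullet> x))"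
    unfolding derivs_le_Suc One_nat_def derivs_le_0
  proof (intro conjI allI ballI)
    fix x
    have "norm (f x * cis (d \<bullet> x)) \<le> B * ?w (x - a)" using f1 by (simp add: norm_mult)
    also have "\<dots> \<le> B * ?w (x - a) + norm d * (B * ?w (x - a))" using B[of "x - a"] by simp
    finally show "norm (f x * cis (d \<bullet> x)) \<le> ((1 + norm d) * B) * ?w (x - a)" by (simp add: algebra_simps)
  next
    fix c :: 'a and x assume c: "c \<in> Basis"
    have "norm (dird c (\<lambda>x. f x * cis (d \<bullet> x)) x) \<le> norm (dird c f x) + \<bar>d \<bullet> c\<bar> * norm (f x)"
      unfolding dc[OF c] by (rule order_trans[OF norm_triangle_ineq]) (simp add: norm_mult)
    also have "\<dots> \<le> B * ?w (x - a) + norm d * (B * ?w (x - a))"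
      using c B[of "x - a"] by (intro add_mono d1 mult_mono f1 Basis_le_norm) auto
    finally show "norm (dird c (\<lambda>x. f x * cis (d \<bullet> x)) x) \<le> ((1 + norm d) * B) * ?w (x - a)"
      by (simp add: algebra_simps)
  qed
  then have "(\<integral>x. dird b (\<lambda>x. f x * cis (d \<bullet> x)) x \<partial>lborel) = 0"
    by (intro integral_dird_eq_0 smooth_mult f b smooth_cis)
  moreover have "integrable lborel (\<lambda>x. f x * cis (d \<bullet> x))"
    by (rule integrable_wt_bound[of _ B a])
       (use f1 smooth_measurable[OF smooth_mult[OF f smooth_cis]] in \<open>auto simp: norm_mult\<close>)
  moreover have "integrable lborel (\<lambda>x. dird b f x * cis (d \<bullet> x))"
    by (rule integrable_wt_bound[of _ B a])
       (use d1[OF b] smooth_measurable[OF smooth_mult[OF smooth_dird[OF f b] smooth_cis]] in \<open>auto simp: norm_mult\<close>)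
  ultimately show ?thesis unfolding dc[OF b] by (simp add: eq_neg_iff_add_eq_0 add.commute)
qed

lemma fourier_decay_direction:
  fixes f :: "'a::euclidean_space \<Rightarrow> complex"
  assumes b: "b \<in> Basis"
  shows "smooth f \<Longrightarrow> derivs_le N (\<lambda>x. B * wt (2 * DIM('a)) (x - a)) f \<Longrightarrow>
    \<bar>d \<bullet> b\<bar> ^ N * norm (\<integral>x. f x * cis (d \<bullet> x) \<partial>lborel) \<le> B * (\<integral>x. wt (2 * DIM('a)) (x::'a) \<partial>lborel)"
proof (induction N arbitrary: f)
  case 0
  then have "norm (f x * cis (d \<bullet> x)) \<le> B * wt (2 * DIM('a)) (x - a)" for x
    by (simp add: derivs_le_0 norm_mult)
  from integrable_wt_bound(2)[OF smooth_measurable[OF smooth_mult[OF 0(1) smooth_cis]] this]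
  show ?case by simp
next
  case (Suc N)
  have "derivs_le 1 (\<lambda>x. B * wt (2 * DIM('a)) (x - a)) f"
    using Suc.prems(2) by (rule derivs_le_mono) auto
  from fourier_by_parts[OF Suc.prems(1) b this, of d]
  have "norm (\<i> * (d \<bullet> b) * (\<integral>x. f x * cis (d \<bullet> x) \<partial>lborel)) = norm (\<integral>x. dird b f x * cis (d \<bullet> x) \<partial>lborel)"
    by simp
  then have "\<bar>d \<bullet> b\<bar> * norm (\<integral>x. f x * cis (d \<bullet> x) \<partial>lborel) = norm (\<integral>x. dird b f x * cis (d \<bullet> x) \<partial>lborel)"
    by (simp add: norm_mult)
  then have "\<bar>d \<bullet> b\<bar> ^ Suc N * norm (\<integral>x. f x * cis (d \<bullet> x) \<partial>lborel) =
      \<bar>d \<bullet> b\<bar> ^ N * norm (\<integral>x. dird b f x * cis (d \<bullet> x) \<partial>lborel)"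
    by (simp add: mult.assoc mult.left_commute)
  also have "\<dots> \<le> B * (\<integral>x. wt (2 * DIM('a)) (x::'a) \<partial>lborel)"
    using Suc.prems b by (intro Suc.IH smooth_dird) (auto simp: derivs_le_Suc)
  finally show ?case .
qed

text \<open>Integration by parts in one coordinate gives decay in that coordinate of
  \<open>d\<close> only, so the direction is chosen after \<open>d\<close>: the maximum of 1 and of
  the moduli of the coordinates controls 1 + |d| up to the factor n + 1. The constant depends on
  \<open>N\<close> and the dimension alone, not on \<open>f\<close>, the centre \<open>a\<close> or
  the frequency, and this makes the kernel estimates uniform in h.\<close>

lemma fourier_decay:
  obtains C where "C \<ge> 0" "\<And>f B a d. smooth (f :: 'a::euclidean_space \<Rightarrow> complex) \<Longrightarrow>
    derivs_le N (\<lambda>x. B * wt (2 * DIM('a)) (x - a)) f \<Longrightarrow>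
    norm (\<integral>x. f x * cis (d \<bullet> x) \<partial>lborel) \<le> C * B * wt N d"
proof
  let ?n = "real (DIM('a)) + 1"
  let ?I = "\<integral>x. wt (2 * DIM('a)) (x::'a) \<partial>lborel"
  let ?C = "?n ^ N * (?n * ?I)"
  have I: "0 \<le> ?I" by simp
  then show "0 \<le> ?C" by simp
  fix f :: "'a \<Rightarrow> complex" and B a d
  assume f: "smooth f" and le: "derivs_le N (\<lambda>x. B * wt (2 * DIM('a)) (x - a)) f"
  let ?F = "norm (\<integral>x. f x * cis (d \<bullet> x) \<partial>lborel)"
  have le0: "derivs_le 0 (\<lambda>x. B * wt (2 * DIM('a)) (x - a)) f" using le by (rule derivs_le_mono) auto
  have F0: "?F \<le> B * ?I"
    using fourier_decay_direction[OF SOME_Basis f le0, of d] by simp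
  obtain m where m: "1 + norm d \<le> ?n * m" "m ^ N * ?F \<le> B * ?I" "0 \<le> m"
  proof -
    let ?S = "insert 1 ((\<lambda>b. \<bar>d \<bullet> b\<bar>) ` Basis)"
    let ?m = "Max ?S"
    have fin: "finite ?S" by simp
    have "?m \<in> ?S" by (rule Max_in) auto
    then have "?m ^ N * ?F \<le> B * ?I"
      using F0 fourier_decay_direction[OF _ f le, of _ d] by (auto simp del: Max_insert)
    moreover have ge: "x \<le> ?m" if "x \<in> ?S" for x using Max_ge[OF fin that] .
    moreover have "1 + norm d \<le> ?n * ?m"
    proof -
      have "norm d \<le> (\<Sum>b\<in>Basis. \<bar>d \<bullet> b\<bar>)" by (rule norm_le_l1)
      also have "\<dots> \<le> (\<Sum>b\<in>(Basis::'a set). ?m)" by (intro sum_mono ge) auto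
      finally have "norm d \<le> real DIM('a) * ?m" by simp
      moreover have "1 \<le> ?m" by (rule ge) simp
      ultimately show ?thesis by (simp add: algebra_simps)
    qed
    moreover have "0 \<le> ?m" using order_trans[OF zero_le_one ge[of 1]] by blast
    ultimately show ?thesis using that by blast
  qed
  have "(1 + norm d) ^ N * ?F \<le> (?n * m) ^ N * ?F"
    using m by (intro mult_right_mono power_mono) auto
  also have "\<dots> \<le> ?n ^ N * (B * ?I)"
    using m(2) by (simp add: power_mult_distrib mult.assoc mult_left_mono)
  also have "\<dots> \<le> ?n ^ N * (?n * (B * ?I))"
    using mult_right_mono[OF _ order_trans[OF norm_ge_zero F0], of 1 "?n"]
    by (intro mult_left_mono) auto
  finally show "?F \<le> ?C * B * wt N d"
    unfolding wt_def using one_plus_norm_pos[of d] by (simp add: field_simps)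
qed

section \<open>Gaussians and Fourier inversion\<close>

definition gauss :: "'a::euclidean_space \<Rightarrow> real" where
  "gauss x = exp (- (norm x)\<^sup>2 / 2)"

lemma gauss_pos: "0 < gauss x" and gauss_nonneg [simp]: "0 \<le> gauss x" and gauss_le_1: "gauss x \<le> 1"
  and gauss_0 [simp]: "gauss 0 = 1" and gauss_minus [simp]: "gauss (- x) = gauss x"
  by (simp_all add: gauss_def)

lemma gauss_continuous [continuous_intros]: "continuous_on S f \<Longrightarrow> continuous_on S (\<lambda>x. gauss (f x))"
  unfolding gauss_def by (intro continuous_intros) auto

lemma gauss_measurable [measurable]: "gauss \<in> borel_measurable borel"
  by (intro borel_measurable_continuous_onI continuous_intros)

lemma norm_sq_sum: "(norm (x::'a::euclidean_space))\<^sup>2 = (\<Sum>b\<in>Basis. (x \<bullet> b)\<^sup>2)"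
  unfolding power2_norm_eq_inner by (subst euclidean_inner) (simp add: power2_eq_square)

lemma gauss_prod: "gauss (x::'a::euclidean_space) = (\<Prod>b\<in>Basis. exp (- (x \<bullet> b)\<^sup>2 / 2))"
  unfolding gauss_def norm_sq_sum by (subst exp_sum[symmetric]) (simp_all add: sum_negf sum_divide_distrib)

lemma cis_inner_prod: "cis ((d::'a::euclidean_space) \<bullet> x) = (\<Prod>b\<in>Basis. cis ((d \<bullet> b) * (x \<bullet> b)))"
  by (subst euclidean_inner) (simp add: cis_conv_exp sum_distrib_left exp_sum)

text \<open>Up to the factor sqrt (2 pi) this is the characteristic function of the standard normal
  distribution.\<close>

lemma gauss_fourier_real:
  fixes t :: real
  shows "integrable lborel (\<lambda>x. complex_of_real (exp (- x\<^sup>2 / 2)) * cis (t * x))"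
    "(\<integral>x. complex_of_real (exp (- x\<^sup>2 / 2)) * cis (t * x) \<partial>lborel) = of_real (sqrt (2 * pi) * exp (- t\<^sup>2 / 2))"
proof -
  have e: "complex_of_real (exp (- x\<^sup>2 / 2)) * cis (t * x) = of_real (sqrt (2 * pi)) * (std_normal_density x *\<^sub>R iexp (t * x))" for x
    by (simp add: std_normal_density_def scaleR_conv_of_real cis_conv_exp)
  have "integrable lborel (\<lambda>x. std_normal_density x *\<^sub>R iexp (t * x))"
    by (rule Bochner_Integration.integrable_bound[OF integrable_normal_density[of 1 0]])
       (auto simp: normal_density_nonneg)
  then show "integrable lborel (\<lambda>x. complex_of_real (exp (- x\<^sup>2 / 2)) * cis (t * x))"
    unfolding e by (rule integrable_mult_right)
  have "complex_of_real (exp (- t\<^sup>2 / 2)) = (\<integral>x. iexp (t * x) \<partial>std_normal_distribution)"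
    using char_std_normal_distribution by (simp add: char_def fun_eq_iff)
  also have "\<dots> = (\<integral>x. std_normal_density x *\<^sub>R iexp (t * x) \<partial>lborel)"
    by (subst integral_density) (auto simp: normal_density_nonneg)
  finally show "(\<integral>x. complex_of_real (exp (- x\<^sup>2 / 2)) * cis (t * x) \<partial>lborel) =
      of_real (sqrt (2 * pi) * exp (- t\<^sup>2 / 2))"
    unfolding e integral_mult_right_zero by (simp only: of_real_mult)
qed

lemma gauss_fourier:
  fixes d :: "'a::euclidean_space"
  shows integrable_gauss_cis: "integrable lborel (\<lambda>x. complex_of_real (gauss x) * cis (d \<bullet> x))"
    and integral_gauss_cis: "(\<integral>x. complex_of_real (gauss x) * cis (d \<bullet> x) \<partial>lborel) =
      of_real (sqrt (2 * pi) ^ DIM('a) * gauss d)"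
proof -
  have e: "complex_of_real (gauss x) * cis (d \<bullet> x) =
      (\<Prod>b\<in>Basis. complex_of_real (exp (- (x \<bullet> b)\<^sup>2 / 2)) * cis ((d \<bullet> b) * (x \<bullet> b)))" for x
    unfolding gauss_prod cis_inner_prod[of d] prod.distrib by simp
  show "integrable lborel (\<lambda>x. complex_of_real (gauss x) * cis (d \<bullet> x))"
    unfolding e by (rule lborel_integrable_prod[of "\<lambda>b x. complex_of_real (exp (- x\<^sup>2 / 2)) * cis ((d \<bullet> b) * x)"])
      (rule gauss_fourier_real)
  show "(\<integral>x. complex_of_real (gauss x) * cis (d \<bullet> x) \<partial>lborel) = of_real (sqrt (2 * pi) ^ DIM('a) * gauss d)"
    unfolding e
    by (subst lborel_integral_prod[of "\<lambda>b x. complex_of_real (exp (- x\<^sup>2 / 2)) * cis ((d \<bullet> b) * x)"])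
       (simp_all only: gauss_fourier_real gauss_prod[of d] prod.distrib of_real_mult of_real_prod of_real_power prod_constant)
qed

lemma integrable_gauss: "integrable lborel (gauss :: 'a::euclidean_space \<Rightarrow> real)"
  using integrable_gauss_cis[of "0::'a"] by (simp add: complex_of_real_integrable_eq)

text \<open>The factor \<open>gauss (e *\<^sub>R d)\<close> makes the double integral absolutely
  convergent. After Fubini and the substitution y = x - e s the result is a Gaussian average of
  \<open>f\<close> around \<open>x\<close> at scale \<open>e\<close>. As \<open>e\<close> tends to
  0, one side converges because \<open>F\<close> is integrable, the other because \<open>f\<close>
  is continuous and bounded.\<close>

lemma fourier_inversion:
  fixes f :: "'a::euclidean_space \<Rightarrow> complex"
  assumes f: "continuous_on UNIV f" "integrable lborel f" and M: "\<And>x. norm (f x) \<le> M"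
    and F: "\<And>d. F d = (\<integral>y. f y * cis (- (d \<bullet> y)) \<partial>lborel)" "integrable lborel F"
  shows "(\<integral>d. F d * cis (d \<bullet> x) \<partial>lborel) = of_real ((2 * pi) ^ DIM('a)) * f x"
proof -
  let ?n = "DIM('a)"
  let ?g = "\<lambda>d. complex_of_real (gauss d)"
  have fm [measurable]: "f \<in> borel_measurable borel" using f(1) by (rule borel_measurable_continuous_onI)
  have Fm [measurable]: "F \<in> borel_measurable borel" using borel_measurable_integrable[OF F(2)] by simp
  have reg: "(\<integral>d. F d * cis (d \<bullet> x) * ?g (e *\<^sub>R d) \<partial>lborel) =
      (\<integral>s. f (x + (- e) *\<^sub>R s) * (of_real (sqrt (2 * pi) ^ ?n) * ?g s) \<partial>lborel)" if e: "e > 0" for e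
  proof -
    have ige: "integrable lborel (\<lambda>d::'a. gauss (e *\<^sub>R d))"
      using lborel_integrable_affine_iff[of "gauss :: 'a \<Rightarrow> real" e 0] e integrable_gauss by simp
    let ?h = "\<lambda>d y. f y * (cis (d \<bullet> (x - y)) * ?g (e *\<^sub>R d))"
    have "F d * cis (d \<bullet> x) * ?g (e *\<^sub>R d) = (\<integral>y. ?h d y \<partial>lborel)" for d
    proof -
      have c: "cis (d \<bullet> (x - y)) = cis (- (d \<bullet> y)) * cis (d \<bullet> x)" for y
        by (simp add: inner_diff_right cis_mult)
      have "?h d y = f y * cis (- (d \<bullet> y)) * (cis (d \<bullet> x) * ?g (e *\<^sub>R d))" for y
        unfolding c by (simp only: mult.assoc)
      then show ?thesis by (simp only: F integral_mult_left_zero) (simp only: mult.assoc)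
    qed
    then have "(\<integral>d. F d * cis (d \<bullet> x) * ?g (e *\<^sub>R d) \<partial>lborel) = (\<integral>d. (\<integral>y. ?h d y \<partial>lborel) \<partial>lborel)"
      by simp
    also have "\<dots> = (\<integral>y. (\<integral>d. ?h d y \<partial>lborel) \<partial>lborel)"
    proof (rule lborel_swap_dominated)
      show "case_prod ?h \<in> borel_measurable borel"
        unfolding case_prod_beta'
        by (intro borel_measurable_continuous_onI continuous_intros continuous_on_compose2[OF f(1)]) auto
      show "norm (?h d y) \<le> gauss (e *\<^sub>R d) * norm (f y)" for d y by (simp add: norm_mult)
    qed (use ige f in auto)
    also have "\<dots> = (\<integral>y. f y * (of_real ((sqrt (2 * pi) / e) ^ ?n) * ?g ((x - y) /\<^sub>R e)) \<partial>lborel)"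
    proof (rule Bochner_Integration.integral_cong[OF refl])
      fix y
      let ?k = "\<lambda>d. ?g d * cis (((x - y) /\<^sub>R e) \<bullet> d)"
      have "(\<integral>d. cis (d \<bullet> (x - y)) * ?g (e *\<^sub>R d) \<partial>lborel) = (\<integral>d. ?k (0 + e *\<^sub>R d) \<partial>lborel)"
      proof (intro Bochner_Integration.integral_cong refl)
        fix d
        have "((x - y) /\<^sub>R e) \<bullet> (0 + e *\<^sub>R d) = d \<bullet> (x - y)"
          using e by (simp add: inner_commute mult.assoc[symmetric] less_imp_neq[symmetric])
        then show "cis (d \<bullet> (x - y)) * ?g (e *\<^sub>R d) = ?k (0 + e *\<^sub>R d)" by simp
      qed
      also have "\<dots> = (1 / \<bar>e\<bar> ^ ?n) *\<^sub>R (\<integral>d. ?k d \<partial>lborel)"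
        using e by (intro lborel_integral_affine borel_measurable_continuous_onI continuous_intros) auto
      also have "\<dots> = of_real ((sqrt (2 * pi) / e) ^ ?n) * ?g ((x - y) /\<^sub>R e)"
        using e by (simp only: integral_gauss_cis) (simp add: scaleR_conv_of_real power_divide)
      finally show "(\<integral>d. ?h d y \<partial>lborel) = f y * (of_real ((sqrt (2 * pi) / e) ^ ?n) * ?g ((x - y) /\<^sub>R e))"
        by simp
    qed
    also have "\<dots> = (e ^ ?n) *\<^sub>R (\<integral>s. f (x + (- e) *\<^sub>R s) *
        (of_real ((sqrt (2 * pi) / e) ^ ?n) * ?g ((x - (x + (- e) *\<^sub>R s)) /\<^sub>R e)) \<partial>lborel)"
      using e by (subst lborel_integral_affine[of "\<lambda>y. f y * (of_real ((sqrt (2 * pi) / e) ^ ?n) * ?g ((x - y) /\<^sub>R e))"])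
         auto
    also have "\<dots> = (\<integral>s. (e ^ ?n) *\<^sub>R (f (x + (- e) *\<^sub>R s) *
        (of_real ((sqrt (2 * pi) / e) ^ ?n) * ?g ((x - (x + (- e) *\<^sub>R s)) /\<^sub>R e))) \<partial>lborel)"
      by simp
    also have "\<dots> = (\<integral>s. f (x + (- e) *\<^sub>R s) * (of_real (sqrt (2 * pi) ^ ?n) * ?g s) \<partial>lborel)"
      using e by (intro Bochner_Integration.integral_cong refl) (simp add: scaleR_conv_of_real power_divide)
    finally show ?thesis .
  qed
  let ?e = "\<lambda>k. inverse (real (Suc k))"
  have e0: "?e \<longlonglongrightarrow> 0" by (rule LIMSEQ_inverse_real_of_nat)
  have "(\<lambda>k. \<integral>d. F d * cis (d \<bullet> x) * ?g (?e k *\<^sub>R d) \<partial>lborel) \<longlonglongrightarrow> (\<integral>d. F d * cis (d \<bullet> x) \<partial>lborel)"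
  proof (rule integral_dominated_convergence[where w = "\<lambda>d. norm (F d)"])
    show "AE d in lborel. (\<lambda>k. F d * cis (d \<bullet> x) * ?g (?e k *\<^sub>R d)) \<longlonglongrightarrow> F d * cis (d \<bullet> x)"
    proof (rule AE_I2)
      fix d
      have "isCont (\<lambda>e. F d * cis (d \<bullet> x) * ?g (e *\<^sub>R d)) 0"
        by (rule continuous_on_interior[of UNIV]) (auto intro!: continuous_intros)
      from isCont_tendsto_compose[OF this e0]
      show "(\<lambda>k. F d * cis (d \<bullet> x) * ?g (?e k *\<^sub>R d)) \<longlonglongrightarrow> F d * cis (d \<bullet> x)" by simp
    qed
    show "AE d in lborel. norm (F d * cis (d \<bullet> x) * ?g (?e k *\<^sub>R d)) \<le> norm (F d)" for k
      by (auto simp: norm_mult intro!: mult_left_le gauss_le_1)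
    have [measurable]: "(\<lambda>d. cis (d \<bullet> x)) \<in> borel_measurable borel"
        "(\<lambda>d::'a. ?g (?e k *\<^sub>R d)) \<in> borel_measurable borel" for k
      by (auto intro!: borel_measurable_continuous_onI continuous_intros)
    show "(\<lambda>d. F d * cis (d \<bullet> x)) \<in> borel_measurable lborel"
      "(\<lambda>d. F d * cis (d \<bullet> x) * ?g (?e k *\<^sub>R d)) \<in> borel_measurable lborel" for k
      by measurable
  qed (use F(2) in simp)
  moreover have "(\<lambda>k. \<integral>s. f (x + (- ?e k) *\<^sub>R s) * (of_real (sqrt (2 * pi) ^ ?n) * ?g s) \<partial>lborel) \<longlonglongrightarrow>
      (\<integral>s. f x * (of_real (sqrt (2 * pi) ^ ?n) * ?g (s::'a)) \<partial>lborel)"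
  proof (rule integral_dominated_convergence[where w = "\<lambda>s::'a. M * (sqrt (2 * pi) ^ ?n * gauss s)"])
    show "AE s in lborel. (\<lambda>k. f (x + (- ?e k) *\<^sub>R s) * (of_real (sqrt (2 * pi) ^ ?n) * ?g s)) \<longlonglongrightarrow>
        f x * (of_real (sqrt (2 * pi) ^ ?n) * ?g s)"
    proof (rule AE_I2)
      fix s
      have "isCont (\<lambda>e. f (x + (- e) *\<^sub>R s) * (of_real (sqrt (2 * pi) ^ ?n) * ?g s)) 0"
        by (rule continuous_on_interior[of UNIV])
           (auto intro!: continuous_intros continuous_on_compose2[OF f(1)])
      from isCont_tendsto_compose[OF this e0]
      show "(\<lambda>k. f (x + (- ?e k) *\<^sub>R s) * (of_real (sqrt (2 * pi) ^ ?n) * ?g s)) \<longlonglongrightarrow>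
          f x * (of_real (sqrt (2 * pi) ^ ?n) * ?g s)" by simp
    qed
    show "integrable lborel (\<lambda>s::'a. M * (sqrt (2 * pi) ^ ?n * gauss s))"
      by (intro integrable_mult_right integrable_gauss)
    show "AE s in lborel. norm (f (x + (- ?e k) *\<^sub>R s) * (of_real (sqrt (2 * pi) ^ ?n) * ?g s)) \<le>
        M * (sqrt (2 * pi) ^ ?n * gauss s)" for k
      by (auto simp: norm_mult norm_power intro!: mult_right_mono M)
  qed measurable
  ultimately have "(\<integral>d. F d * cis (d \<bullet> x) \<partial>lborel) = (\<integral>s. f x * (of_real (sqrt (2 * pi) ^ ?n) * ?g (s::'a)) \<partial>lborel)"
    using reg by (intro LIMSEQ_unique) (simp_all only: reg inverse_positive_iff_positive of_nat_0_less_iff zero_less_Suc)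
  also have "\<dots> = of_real ((2 * pi) ^ ?n) * f x"
  proof -
    have "(\<integral>s. ?g (s::'a) \<partial>lborel) = of_real (sqrt (2 * pi) ^ ?n)"
      using integral_gauss_cis[of "0::'a"] by simp
    moreover have "sqrt (2 * pi) ^ ?n * sqrt (2 * pi) ^ ?n = (2 * pi) ^ ?n"
      by (subst power_mult_distrib[symmetric]) simp
    ultimately show ?thesis
      unfolding integral_mult_right_zero by (simp only: of_real_mult[symmetric] mult.commute)
  qed
  finally show ?thesis .
qed


section \<open>Functions of slow growth and Schwartz functions\<close>

text \<open>The seminorms with exponents 0 and \<open>N\<close> combine into one weight through (1 +
  r)^N \<le> 2^N (1 + r^N), checked separately for r \<le> 1 and r > 1.\<close>

lemma schwartzD:
  fixes f :: "'a::euclidean_space \<Rightarrow> complex"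
  assumes "f \<in> schwartz"
  shows "smooth f" "\<exists>C\<ge>0. derivs_le k (\<lambda>x. C * wt N x) f"
proof -
  show "smooth f" using assms by (simp add: schwartz_def)
  show "\<exists>C\<ge>0. derivs_le k (\<lambda>x. C * wt N x) f"
  proof (rule derivs_le_finite)
    fix bs :: "'a list" assume bs: "bs \<in> lists Basis"
    obtain C0 CN where C: "\<And>x. norm x ^ 0 * norm (iter_deriv bs f x) \<le> C0"
        "\<And>x. norm x ^ N * norm (iter_deriv bs f x) \<le> CN"
      using assms bs unfolding schwartz_def by blast
    have "norm (iter_deriv bs f x) \<le> (2 ^ N * (C0 + CN)) * wt N x" for x
    proof -
      have "(1 + norm x) ^ N \<le> 2 ^ N * (1 + norm x ^ N)"
      proof (cases "norm x \<le> 1")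
        case True
        then have "(1 + norm x) ^ N \<le> 2 ^ N" by (intro power_mono) auto
        then show ?thesis by (smt (verit, best) mult_le_cancel_left1 norm_ge_zero zero_le_power)
      next
        case False
        then have "(1 + norm x) ^ N \<le> (2 * norm x) ^ N" by (intro power_mono) auto
        then show ?thesis by (simp add: power_mult_distrib distrib_left add_increasing)
      qed
      then have "(1 + norm x) ^ N * norm (iter_deriv bs f x) \<le> 2 ^ N * (1 + norm x ^ N) * norm (iter_deriv bs f x)"
        by (rule mult_right_mono) simp
      also have "\<dots> = 2 ^ N * (norm x ^ 0 * norm (iter_deriv bs f x) + norm x ^ N * norm (iter_deriv bs f x))"
        by (simp add: algebra_simps)
      also have "\<dots> \<le> 2 ^ N * (C0 + CN)" by (intro mult_left_mono add_mono C) auto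
      finally show ?thesis unfolding wt_def using one_plus_norm_pos[of x] by (simp add: field_simps)
    qed
    then show "\<exists>C. \<forall>x. norm (iter_deriv bs f x) \<le> C * wt N x" by blast
  qed simp
qed

lemma schwartzI:
  fixes f :: "'a::euclidean_space \<Rightarrow> complex"
  assumes "smooth f" "\<And>k N. \<exists>C. derivs_le k (\<lambda>x. C * wt N x) f"
  shows "f \<in> schwartz"
  unfolding schwartz_def
proof (intro CollectI conjI ballI allI assms(1))
  fix bs :: "'a list" and N assume bs: "bs \<in> lists Basis"
  obtain C where C: "derivs_le (length bs) (\<lambda>x. C * wt N x) f" using assms(2) by blast
  have "norm x ^ N * norm (iter_deriv bs f x) \<le> C" for x
  proof -
    have "norm x ^ N * norm (iter_deriv bs f x) \<le> (1 + norm x) ^ N * (C * wt N x)"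
      using C bs unfolding derivs_le_def by (intro mult_mono power_mono) auto
    also have "\<dots> = C" unfolding wt_def using one_plus_norm_pos[of x] by (simp add: field_simps)
    finally show ?thesis .
  qed
  then show "\<exists>C. \<forall>x. norm x ^ N * norm (iter_deriv bs f x) \<le> C" by blast
qed

lemma schwartz_bound:
  assumes "f \<in> schwartz"
  obtains C where "C \<ge> 0" "\<And>x. norm (f x) \<le> C * wt N x"
  using schwartzD(2)[OF assms, of 0 N] by (auto simp: derivs_le_0)

lemma schwartz_measurable: "f \<in> schwartz \<Longrightarrow> f \<in> borel_measurable borel"
  and schwartz_continuous: "f \<in> schwartz \<Longrightarrow> continuous_on S f"
  using smooth_measurable smooth_continuous schwartzD(1) by blast+

lemma schwartz_integrable: "f \<in> schwartz \<Longrightarrow> integrable lborel f"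
  by (metis schwartz_bound schwartz_measurable integrable_wt_bound(1)[of f _ 0] diff_zero)

lemma schwartz_dird:
  fixes f :: "'a::euclidean_space \<Rightarrow> complex"
  assumes f: "f \<in> schwartz" and b: "b \<in> Basis"
  shows "dird b f \<in> schwartz"
proof (rule schwartzI)
  fix k N
  obtain C where "derivs_le (Suc k) (\<lambda>x. C * wt N x) f" using schwartzD(2)[OF f] by blast
  then show "\<exists>C. derivs_le k (\<lambda>x. C * wt N x) (dird b f)" using b by (auto simp: derivs_le_Suc)
qed (use f b schwartzD(1) smooth_dird in blast)

lemma schwartz_diff:
  fixes f :: "'a::euclidean_space \<Rightarrow> complex"
  assumes f: "f \<in> schwartz" and g: "g \<in> schwartz"
  shows "(\<lambda>x. f x - g x) \<in> schwartz"
proof (rule schwartzI)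
  fix k N
  obtain C where C: "derivs_le k (\<lambda>x. C * wt N x) f" using schwartzD(2)[OF f] by blast
  obtain D where D: "derivs_le k (\<lambda>x. D * wt N x) g" using schwartzD(2)[OF g] by blast
  have "derivs_le k (\<lambda>x. C * wt N x + norm (-1::complex) * (D * wt N x)) (\<lambda>x. f x + (-1) * g x)"
    using f g by (intro derivs_le_add C derivs_le_cmult D smooth_mult smooth_const) (auto dest: schwartzD(1))
  then show "\<exists>C. derivs_le k (\<lambda>x. C * wt N x) (\<lambda>x. f x - g x)"
    by (intro exI[of _ "C + D"]) (simp add: algebra_simps)
qed (use f g schwartzD(1) smooth_diff in blast)

text \<open>Schwartz's space O_M of multipliers: the growth exponent may depend on the order of
  differentiation. Being closed under products and derivatives, it hosts both the amplitudes and the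
  quadratic exponents of Gaussian functions.\<close>

definition slow :: "('a::euclidean_space \<Rightarrow> complex) \<Rightarrow> bool" where
  "slow f \<longleftrightarrow> smooth f \<and> (\<forall>k. \<exists>C m. derivs_le k (\<lambda>x. C * (1 + norm x) ^ m) f)"

lemma slow_bound:
  assumes "slow f"
  obtains C m where "C \<ge> 0" "derivs_le k (\<lambda>x. C * (1 + norm x) ^ m) f"
proof -
  obtain C m where C: "derivs_le k (\<lambda>x. C * (1 + norm x) ^ m) f" using assms unfolding slow_def by blast
  have "0 \<le> C" using order_trans[OF norm_ge_zero derivs_leD[OF C, of 0]] by simp
  then show ?thesis using C that by blast
qed

lemma slow_const: "slow (\<lambda>x::'a::euclidean_space. c)"
proof -
  have "derivs_le k (\<lambda>x::'a. norm c * (1 + norm x) ^ 0) (\<lambda>x. c)" for k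
    using derivs_le_const[of c "norm c"] by simp
  then show ?thesis unfolding slow_def using smooth_const by blast
qed

lemma slow_dird: "slow f \<Longrightarrow> b \<in> Basis \<Longrightarrow> slow (dird b f)"
  unfolding slow_def by (meson smooth_dird derivs_le_Suc)

lemma slow_mult:
  assumes f: "slow f" and g: "slow g"
  shows "slow (\<lambda>x. f x * g x)"
  unfolding slow_def
proof (intro conjI allI)
  fix k
  obtain C m where C: "derivs_le k (\<lambda>x. C * (1 + norm x) ^ m) f" using slow_bound[OF f] by metis
  obtain D n where D: "derivs_le k (\<lambda>x. D * (1 + norm x) ^ n) g" using slow_bound[OF g] by metis
  have "derivs_le k (\<lambda>x. 2 ^ k * ((C * (1 + norm x) ^ m) * (D * (1 + norm x) ^ n))) (\<lambda>x. f x * g x)"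
    using f g by (intro derivs_le_mult C D) (auto simp: slow_def)
  then show "\<exists>C m. derivs_le k (\<lambda>x. C * (1 + norm x) ^ m) (\<lambda>x. f x * g x)"
    by (intro exI[of _ "2 ^ k * (C * D)"] exI[of _ "m + n"]) (simp add: power_add mult_ac)
qed (use f g in \<open>auto simp: slow_def intro: smooth_mult\<close>)

lemma slow_add:
  assumes f: "slow f" and g: "slow g"
  shows "slow (\<lambda>x. f x + g x)"
  unfolding slow_def
proof (intro conjI allI)
  fix k
  obtain C m where C: "C \<ge> 0" "derivs_le k (\<lambda>x. C * (1 + norm x) ^ m) f" using slow_bound[OF f] by metis
  obtain D n where D: "D \<ge> 0" "derivs_le k (\<lambda>x. D * (1 + norm x) ^ n) g" using slow_bound[OF g] by metis
  have "derivs_le k (\<lambda>x. C * (1 + norm x) ^ m + D * (1 + norm x) ^ n) (\<lambda>x. f x + g x)"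
    using f g by (intro derivs_le_add C D) (auto simp: slow_def)
  then have "derivs_le k (\<lambda>x. (C + D) * (1 + norm x) ^ (m + n)) (\<lambda>x. f x + g x)"
    by (rule derivs_le_mono) (use C D in \<open>auto simp: distrib_right intro!: add_mono mult_left_mono power_increasing\<close>)
  then show "\<exists>C m. derivs_le k (\<lambda>x. C * (1 + norm x) ^ m) (\<lambda>x. f x + g x)" by blast
qed (use f g in \<open>auto simp: slow_def intro: smooth_add\<close>)

lemma slow_bounded_linear:
  assumes T: "bounded_linear (T :: 'a::euclidean_space \<Rightarrow> complex)"
  shows "slow T"
  unfolding slow_def
proof (intro conjI allI)
  show "smooth T" by (rule smooth_bounded_linear[OF T])
  fix k
  have dT: "dird b T = (\<lambda>x. T b)" for b
    by (intro ext dird_eqI bounded_linear_imp_has_derivative T)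
  obtain K where K: "\<And>x. norm (T x) \<le> norm x * K" "0 \<le> K"
    using bounded_linear.nonneg_bounded[OF T] by blast
  have le: "norm (T x) \<le> K * (1 + norm x)" for x using K(1)[of x] K(2) by (simp add: algebra_simps)
  have "derivs_le k (\<lambda>x. K * (1 + norm x) ^ 1) T"
  proof (cases k)
    case (Suc j)
    have "derivs_le j (\<lambda>x::'a. K * (1 + norm x) ^ 1) (\<lambda>x. T b)" if b: "b \<in> Basis" for b
      by (rule derivs_le_mono[OF derivs_le_const[of _ K]])
         (use K(1)[of b] K(2) b in \<open>auto simp: algebra_simps\<close>)
    then show ?thesis using le by (simp add: Suc derivs_le_Suc dT)
  qed (use le in \<open>simp add: derivs_le_0\<close>)
  then show "\<exists>C m. derivs_le k (\<lambda>x. C * (1 + norm x) ^ m) T" by blast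
qed

lemma slow_inner_product:
  assumes "bounded_linear (S :: 'a::euclidean_space \<Rightarrow> 'b::euclidean_space)" "bounded_linear T"
  shows "slow (\<lambda>x. complex_of_real (S x \<bullet> T x))"
proof -
  have "slow (\<lambda>x. complex_of_real (S x \<bullet> b))" if "bounded_linear S" for S :: "'a \<Rightarrow> 'b" and b
    by (rule slow_bounded_linear, rule bounded_linear_compose[OF bounded_linear_of_real],
        rule bounded_linear_compose[OF bounded_linear_inner_left that])
  then have s: "slow (\<lambda>x. complex_of_real (S x \<bullet> b) * complex_of_real (T x \<bullet> b))" for b
    using assms by (intro slow_mult)
  have "slow (\<lambda>x. \<Sum>b\<in>B. complex_of_real (S x \<bullet> b) * complex_of_real (T x \<bullet> b))" if "finite B" for B
    using that by induction (auto intro: slow_const slow_add s)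
  from this[OF finite_Basis] show ?thesis
    by (subst euclidean_inner) simp
qed

text \<open>(1 + r)^m \<le> m! exp (1 + r) by the exponential series, and r - c r^2 \<le> 1 / (4 c)
  by completing the square; hence the bound m! exp (1 + 1 / (4 c)).\<close>

lemma power_exp_neg_sq_bounded:
  assumes c: "c > 0"
  obtains K where "\<And>r::real. 0 \<le> r \<Longrightarrow> (1 + r) ^ m * exp (- c * r\<^sup>2) \<le> K"
proof
  fix r :: real assume r: "0 \<le> r"
  have "(1 + r) ^ m /\<^sub>R fact m \<le> exp (1 + r)"
    using sum_le_suminf[OF summable_exp_generic[of "1 + r"], of "{m}"] r
    by (simp add: exp_def)
  then have "(1 + r) ^ m \<le> fact m * exp (1 + r)" by (simp add: field_simps)
  then have "(1 + r) ^ m * exp (- c * r\<^sup>2) \<le> fact m * (exp (1 + r) * exp (- c * r\<^sup>2))"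
    by (simp add: mult_right_mono mult.assoc[symmetric])
  also have "exp (1 + r) * exp (- c * r\<^sup>2) \<le> exp (1 + 1 / (4 * c))"
  proof -
    have "0 \<le> (2 * c * r - 1)\<^sup>2 / (4 * c)" using c by simp
    also have "\<dots> = c * r\<^sup>2 - r + 1 / (4 * c)" using c by (simp add: power2_eq_square field_simps)
    finally show ?thesis by (simp add: exp_add[symmetric])
  qed
  finally show "(1 + r) ^ m * exp (- c * r\<^sup>2) \<le> fact m * exp (1 + 1 / (4 * c))" by simp
qed

text \<open>A derivative of f exp q is (f' + f q') exp q, whose amplitude is slow again. The class
  is closed under differentiation, so only the decay of the undifferentiated product has to be
  estimated.\<close>

lemma slow_exp_schwartz:
  fixes q :: "'a::euclidean_space \<Rightarrow> complex"
  assumes q: "slow q" and c: "c > 0" and re: "\<And>x. Re (q x) \<le> - c * (norm x)\<^sup>2" and f: "slow f"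
  shows "(\<lambda>x. f x * exp (q x)) \<in> schwartz"
proof (rule schwartzI)
  have sq: "smooth q" using q by (simp add: slow_def)
  show "smooth (\<lambda>x. f x * exp (q x))" using f sq by (auto simp: slow_def intro: smooth_mult smooth_exp)
  fix k N
  have zero: "\<exists>C. \<forall>x. norm (f x * exp (q x)) \<le> C * wt N x" if f: "slow f" for f
  proof -
    obtain C m where C: "C \<ge> 0" "derivs_le 0 (\<lambda>x. C * (1 + norm x) ^ m) f" using slow_bound[OF f] by metis
    obtain K where K: "\<And>r. 0 \<le> r \<Longrightarrow> (1 + r) ^ (m + N) * exp (- c * r\<^sup>2) \<le> K"
      using power_exp_neg_sq_bounded[OF c] by metis
    have "norm (f x * exp (q x)) \<le> (C * K) * wt N x" for x
    proof -
      have "norm (f x * exp (q x)) \<le> (C * (1 + norm x) ^ m) * exp (- c * (norm x)\<^sup>2)"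
        unfolding norm_mult norm_exp_eq_Re using C re[of x] by (intro mult_mono) (auto simp: derivs_le_0)
      also have "\<dots> = C * ((1 + norm x) ^ (m + N) * exp (- c * (norm x)\<^sup>2)) * wt N x"
        unfolding wt_def using one_plus_norm_pos[of x] by (simp add: power_add field_simps)
      also have "\<dots> \<le> C * K * wt N x" by (intro mult_right_mono mult_left_mono K C) auto
      finally show ?thesis .
    qed
    then show ?thesis by blast
  qed
  show "\<exists>C. derivs_le k (\<lambda>x. C * wt N x) (\<lambda>x. f x * exp (q x))"
    using f
  proof (induction k arbitrary: f)
    case 0
    then show ?case using zero by (simp add: derivs_le_0)
  next
    case (Suc k)
    have sf: "smooth f" using Suc.prems by (simp add: slow_def)
    have "\<exists>C. derivs_le k (\<lambda>x. C * wt N x) (dird b (\<lambda>x. f x * exp (q x)))" if b: "b \<in> Basis" for b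
    proof -
      have "dird b (\<lambda>x. f x * exp (q x)) = (\<lambda>x. (dird b f x + f x * dird b q x) * exp (q x))"
        using smooth_differentiable[OF sf] smooth_differentiable[OF smooth_exp[OF sq]] smooth_differentiable[OF sq]
        by (subst dird_mult) (auto simp: dird_exp algebra_simps)
      moreover have "slow (\<lambda>x. dird b f x + f x * dird b q x)"
        using Suc.prems q b by (intro slow_add slow_mult slow_dird)
      ultimately show ?thesis using Suc.IH by simp
    qed
    then obtain D where D: "\<And>b. b \<in> Basis \<Longrightarrow> derivs_le k (\<lambda>x. D b * wt N x) (dird b (\<lambda>x. f x * exp (q x)))"
      by metis
    obtain C where C: "\<And>x. norm (f x * exp (q x)) \<le> C * wt N x" using zero[OF Suc.prems] by blast
    let ?S = "\<bar>C\<bar> + (\<Sum>b\<in>Basis. \<bar>D b\<bar>)"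
    have "C * wt N x \<le> ?S * wt N x" for x :: 'a
      by (rule mult_right_mono) (auto intro: order_trans[OF abs_ge_self] simp: sum_nonneg)
    moreover have "D b * wt N x \<le> ?S * wt N x" if "b \<in> Basis" for b and x :: 'a
      using member_le_sum[OF that, of "\<lambda>b. \<bar>D b\<bar>"] by (intro mult_right_mono) auto
    ultimately have "derivs_le (Suc k) (\<lambda>x. ?S * wt N x) (\<lambda>x. f x * exp (q x))"
      unfolding derivs_le_Suc using C D by (meson order_trans derivs_le_mono order_refl)
    then show ?case by blast
  qed
qed

lemma gauss_schwartz: "(\<lambda>x. complex_of_real (gauss x)) \<in> schwartz"
proof -
  have "slow (\<lambda>x::'a. (-1/2) * complex_of_real (x \<bullet> x))"
    by (intro slow_mult slow_const slow_inner_product bounded_linear_ident)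
  then have "(\<lambda>x::'a. 1 * exp ((-1/2) * complex_of_real (x \<bullet> x))) \<in> schwartz"
    by (rule slow_exp_schwartz[where c = "1/2"]) (auto simp: power2_norm_eq_inner slow_const)
  moreover have "complex_of_real (gauss x) = 1 * exp ((-1/2) * complex_of_real (x \<bullet> x))" for x :: 'a
    by (simp add: gauss_def power2_norm_eq_inner exp_of_real[symmetric])
  ultimately show ?thesis by simp
qed


section \<open>The Gaussian wave packet transform\<close>

text \<open>The bound on the derivative makes \<open>F\<close> Lipschitz in \<open>x\<close> with
  constant \<open>p y\<close>. The normalized remainder of the linear approximation is therefore at
  most \<open>2 * p y\<close>, and dominated convergence applies along sequences.\<close>

lemma has_derivative_integral_dominated:
  fixes F :: "'a::euclidean_space \<Rightarrow> 'b::euclidean_space \<Rightarrow> complex"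
  assumes D: "\<And>x y. ((\<lambda>x. F x y) has_derivative F' x y) (at x)"
    and le: "\<And>x y v. norm (F' x y v) \<le> p y * norm v" and p: "integrable lborel p"
    and F: "\<And>x. integrable lborel (F x)" and m: "\<And>x v. (\<lambda>y. F' x y v) \<in> borel_measurable borel"
  shows "((\<lambda>x. \<integral>y. F x y \<partial>lborel) has_derivative (\<lambda>v. \<integral>y. F' x y v \<partial>lborel)) (at x)"
proof -
  have iF': "integrable lborel (\<lambda>y. F' x y v)" for x v
    by (rule Bochner_Integration.integrable_bound[OF integrable_mult_left[OF p, of "norm v"]])
       (use m in \<open>auto intro!: order_trans[OF le abs_ge_self]\<close>)
  note lin = has_derivative_linear[OF D]
  have bl: "bounded_linear (\<lambda>v. \<integral>y. F' x y v \<partial>lborel)"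
  proof (rule bounded_linear_intro)
    show "(\<integral>y. F' x y (v + w) \<partial>lborel) = (\<integral>y. F' x y v \<partial>lborel) + (\<integral>y. F' x y w \<partial>lborel)" for v w
      using iF' by (simp add: linear_add[OF lin])
    show "(\<integral>y. F' x y (r *\<^sub>R v) \<partial>lborel) = r *\<^sub>R (\<integral>y. F' x y v \<partial>lborel)" for r v
      by (simp add: linear_cmul[OF lin])
    show "norm (\<integral>y. F' x y v \<partial>lborel) \<le> norm v * (\<integral>y. p y \<partial>lborel)" for v
    proof -
      have "norm (\<integral>y. F' x y v \<partial>lborel) \<le> (\<integral>y. norm (F' x y v) \<partial>lborel)" by (rule integral_norm_bound)
      also have "\<dots> \<le> (\<integral>y. p y * norm v \<partial>lborel)"
        by (rule integral_mono) (use iF' p le in auto)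
      finally show ?thesis by (simp add: mult.commute)
    qed
  qed
  have lip: "norm (F (x + h) y - F x y) \<le> p y * norm h" for h y
  proof -
    have "onorm (F' z y) \<le> p y" for z by (rule onorm_le[OF le])
    then show ?thesis
      using differentiable_bound[of UNIV "\<lambda>x. F x y" "\<lambda>x. F' x y" "p y" "x + h" x] D by simp
  qed
  show ?thesis
    unfolding has_derivative_at
  proof (intro conjI bl, unfold tendsto_at_iff_sequentially, intro allI impI)
    fix X :: "nat \<Rightarrow> 'a" assume X0: "\<forall>i. X i \<in> UNIV - {0}" and X: "X \<longlonglongrightarrow> 0"
    let ?G = "\<lambda>n y. (F (x + X n) y - F x y - F' x y (X n)) /\<^sub>R norm (X n)"
    have "(\<lambda>n. \<integral>y. ?G n y \<partial>lborel) \<longlonglongrightarrow> (\<integral>y. 0 \<partial>(lborel::'b measure))"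
    proof (rule integral_dominated_convergence[where w = "\<lambda>y. 2 * p y"])
      show "AE y in lborel. (\<lambda>n. ?G n y) \<longlonglongrightarrow> 0"
      proof (rule AE_I2)
        fix y
        have "((\<lambda>h. norm (F (x + h) y - F x y - F' x y h) / norm h) \<longlongrightarrow> 0) (at 0)"
          using D[of y x] by (simp add: has_derivative_at)
        then have "((\<lambda>h. norm (F (x + h) y - F x y - F' x y h) / norm h) \<circ> X) \<longlonglongrightarrow> 0"
          using X0 X unfolding tendsto_at_iff_sequentially by blast
        then have "(\<lambda>n. norm (?G n y)) \<longlonglongrightarrow> 0" by (simp add: comp_def divide_inverse mult.commute)
        then show "(\<lambda>n. ?G n y) \<longlonglongrightarrow> 0" by (rule tendsto_norm_zero_cancel)
      qed
      show "AE y in lborel. norm (?G n y) \<le> 2 * p y" for n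
      proof (rule AE_I2)
        fix y
        have "norm (F (x + X n) y - F x y - F' x y (X n)) \<le> p y * norm (X n) + p y * norm (X n)"
          by (rule order_trans[OF norm_triangle_ineq4 add_mono[OF lip le]])
        moreover have "0 < norm (X n)" using X0 by auto
        moreover have "norm (?G n y) = norm (F (x + X n) y - F x y - F' x y (X n)) / norm (X n)"
          by (simp add: divide_inverse mult.commute)
        ultimately show "norm (?G n y) \<le> 2 * p y" by (simp add: pos_divide_le_eq)
      qed
      show "?G n \<in> borel_measurable lborel" for n
        using borel_measurable_integrable[OF F] m by measurable
    qed (use p in auto)
    moreover have "(\<integral>y. ?G n y \<partial>lborel) =
        ((\<integral>y. F (x + X n) y \<partial>lborel) - (\<integral>y. F x y \<partial>lborel) - (\<integral>y. F' x y (X n) \<partial>lborel)) /\<^sub>R norm (X n)" for n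
      using F iF' by simp
    ultimately have "(\<lambda>n. ((\<integral>y. F (x + X n) y \<partial>lborel) - (\<integral>y. F x y \<partial>lborel) - (\<integral>y. F' x y (X n) \<partial>lborel)) /\<^sub>R norm (X n)) \<longlonglongrightarrow> 0"
      by (simp only: Bochner_Integration.integral_zero)
    then show "((\<lambda>h. norm ((\<integral>y. F (x + h) y \<partial>lborel) - (\<integral>y. F x y \<partial>lborel) - (\<integral>y. F' x y h \<partial>lborel)) / norm h) \<circ> X) \<longlonglongrightarrow> 0"
      by (drule_tac tendsto_norm_zero) (simp add: comp_def divide_inverse mult.commute)
  qed
qed

lemma cnj_measurable [measurable]: "cnj \<in> borel_measurable borel"
  by (intro borel_measurable_continuous_onI continuous_intros)

definition packet :: "'a::euclidean_space \<times> 'a \<Rightarrow> 'a \<Rightarrow> complex" where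
  "packet w y = cis (snd w \<bullet> (y - fst w)) * complex_of_real (gauss (y - fst w))"

text \<open>The FBI or Bargmann transform, equivalently the short-time Fourier transform with a
  Gaussian window, without its normalizing constant.\<close>

definition fbi :: "('a::euclidean_space \<Rightarrow> complex) \<Rightarrow> 'a \<times> 'a \<Rightarrow> complex" where
  "fbi f w = (\<integral>y. f y * cnj (packet w y) \<partial>lborel)"

lemma norm_packet: "norm (packet w y) = gauss (y - fst w)"
  by (simp add: packet_def norm_mult)

lemma norm_packet_le_1: "norm (packet w y) \<le> 1"
  by (simp add: norm_packet gauss_le_1)

lemma continuous_on_cis_comp [continuous_intros]: "continuous_on S f \<Longrightarrow> continuous_on S (\<lambda>x. cis (f x))"
  by (intro continuous_on_compose2[OF continuous_on_cis]) (auto intro: continuous_intros)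

lemma packet_continuous [continuous_intros]:
  "continuous_on S f \<Longrightarrow> continuous_on S g \<Longrightarrow> continuous_on S (\<lambda>z. packet (f z) (g z))"
  unfolding packet_def by (intro continuous_intros) auto

lemma integrable_packet_norm: "integrable lborel (\<lambda>y. gauss (y - a))" "integrable lborel (\<lambda>y. gauss (a - y))"
  by (intro lborel_integrable_shift integrable_gauss)+

lemma integrable_bounded_packet:
  fixes f :: "'a::euclidean_space \<Rightarrow> complex"
  assumes "f \<in> borel_measurable borel" "\<And>x. norm (f x) \<le> M"
  shows "integrable lborel (\<lambda>y. f y * cnj (packet w y))"
proof (rule Bochner_Integration.integrable_bound[OF integrable_mult_right[OF integrable_packet_norm(1)[of "fst w"], of M]])
  have "packet w \<in> borel_measurable borel"
    by (intro borel_measurable_continuous_onI continuous_intros)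
  then show "(\<lambda>y. f y * cnj (packet w y)) \<in> borel_measurable lborel" using assms(1) by measurable
  show "AE y in lborel. norm (f y * cnj (packet w y)) \<le> norm (M * gauss (y - fst w))"
    by (auto simp: norm_mult norm_packet abs_mult intro!: mult_right_mono order_trans[OF assms(2) abs_ge_self])
qed

lemma fbi_measurable: 
  assumes "f \<in> borel_measurable borel"
  shows "fbi f \<in> borel_measurable borel"
proof -
  have m: "(\<lambda>z::('a \<times> 'a) \<times> 'a. f (snd z) * cnj (packet (fst z) (snd z))) \<in> borel_measurable borel"
    by (intro borel_measurable_times measurable_compose[OF _ assms] borel_measurable_continuous_onI continuous_intros)
  have "sets (borel \<Otimes>\<^sub>M lborel) = sets (borel :: (('a \<times> 'a) \<times> 'a) measure)"
    by (metis borel_prod sets_lborel sets_pair_measure_cong)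
  with m show ?thesis unfolding fbi_def
    by (intro lborel.borel_measurable_lebesgue_integral) (simp add: case_prod_beta' cong: measurable_cong_sets)
qed

text \<open>The constant left in the isometry and in the inversion formula by the missing
  normalization: (2 pi)^n arises from Fourier inversion in the frequency, the squared norm of the
  window from integration over the position. The type argument carries the dimension.\<close>

definition fbi_mass :: "'a::euclidean_space itself \<Rightarrow> real" where
  "fbi_mass _ = (2 * pi) ^ DIM('a) * (\<integral>y. (gauss (y::'a))\<^sup>2 \<partial>lborel)"

lemma integrable_gauss_sq: "integrable lborel (\<lambda>y::'a::euclidean_space. (gauss y)\<^sup>2)"
  by (rule Bochner_Integration.integrable_bound[OF integrable_gauss])
     (auto simp: power2_eq_square intro!: mult_left_le gauss_le_1)

lemma fbi_mass_pos: "0 < fbi_mass TYPE('a::euclidean_space)"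
proof -
  have "0 < (\<integral>y. (gauss (y::'a))\<^sup>2 \<partial>lborel)"
  proof (rule ccontr)
    assume "\<not> ?thesis"
    then have "(\<integral>y. (gauss (y::'a))\<^sup>2 \<partial>lborel) = 0"
      by (intro antisym Bochner_Integration.integral_nonneg) auto
    then have "AE y::'a in lborel. (gauss y)\<^sup>2 = 0"
      using integral_nonneg_eq_0_iff_AE[OF integrable_gauss_sq[where 'a='a]] by simp
    then have "AE y::'a in lborel. False"
      by (rule AE_mp) (auto simp: gauss_pos[THEN less_imp_neq, symmetric])
    then show False by (simp add: AE_iff_null null_sets_def)
  qed
  then show ?thesis by (simp add: fbi_mass_def)
qed

lemma wt_Pair_le: "wt k (x, y) \<le> wt k x" "wt k (x, y) \<le> wt k y"
proof -
  have "norm x \<le> norm (x, y)" "norm y \<le> norm (x, y)" by (auto simp: norm_fst_le norm_snd_le)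
  then show "wt k (x, y) \<le> wt k x" "wt k (x, y) \<le> wt k y"
    unfolding wt_def by (auto intro!: le_imp_inverse_le power_mono zero_less_power one_plus_norm_pos)
qed

text \<open>For a fixed position x0 the transform is, up to a phase, the Fourier transform in the
  frequency of \<open>f\<close> times the window at x0. Inversion leaves \<open>f x\<close> times
  the squared window, which is then integrated over x0. The hypotheses ask for decay of
  \<open>fbi f\<close> and only continuity and boundedness of \<open>f\<close>, because the formula
  is applied to images of operators before these are known to be Schwartz.\<close>

lemma fbi_inversion:
  fixes f :: "'a::euclidean_space \<Rightarrow> complex"
  assumes f: "continuous_on UNIV f" and M: "\<And>x. norm (f x) \<le> M"
    and B: "\<And>w. norm (fbi f w) \<le> B * wt (2 * DIM('a \<times> 'a)) w"
  shows "integrable lborel (fbi f)"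
    "(\<integral>w. fbi f w * packet w x \<partial>lborel) = of_real (fbi_mass TYPE('a)) * f x"
proof -
  have fm [measurable]: "f \<in> borel_measurable borel" using f by (rule borel_measurable_continuous_onI)
  have Fm [measurable]: "fbi f \<in> borel_measurable borel" by (rule fbi_measurable[OF fm])
  show Fi: "integrable lborel (fbi f)"
    by (rule integrable_wt_bound[of _ B 0]) (use Fm B in auto)
  have B0: "0 \<le> B" using order_trans[OF norm_ge_zero B[of 0]] by simp
  have sect: "(\<lambda>\<xi>. fbi f (x0, \<xi>)) \<in> borel_measurable borel" for x0
    using measurable_compose[OF measurable_Pair1' Fm[unfolded borel_prod[symmetric]], of x0] by simp
  have "packet w x = packet w x" for w ..
  have i: "integrable (lborel \<Otimes>\<^sub>M lborel) (\<lambda>w. fbi f w * packet w x)"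
    unfolding lborel_prod
  proof (rule Bochner_Integration.integrable_bound[OF Fi])
    have "(\<lambda>w. packet w x) \<in> borel_measurable borel"
      by (intro borel_measurable_continuous_onI continuous_intros)
    then show "(\<lambda>w. fbi f w * packet w x) \<in> borel_measurable lborel" by measurable
  qed (auto simp: norm_mult intro!: mult_left_le norm_packet_le_1)
  have "(\<integral>w. fbi f w * packet w x \<partial>lborel) = (\<integral>x0. (\<integral>\<xi>. fbi f (x0, \<xi>) * packet (x0, \<xi>) x \<partial>lborel) \<partial>lborel)"
    using lborel_pair.integral_fst'[OF i] by (simp add: lborel_prod)
  also have "\<dots> = (\<integral>x0. of_real ((2 * pi) ^ DIM('a)) * f x * of_real ((gauss (x - x0))\<^sup>2) \<partial>lborel)"
  proof (rule Bochner_Integration.integral_cong[OF refl])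
    fix x0
    let ?g = "\<lambda>y. f y * complex_of_real (gauss (y - x0))"
    let ?F = "\<lambda>\<xi>. fbi f (x0, \<xi>) * cis (- (\<xi> \<bullet> x0))"
    have gi: "integrable lborel ?g"
      by (rule Bochner_Integration.integrable_bound[OF integrable_mult_right[OF integrable_packet_norm(1)[of x0], of M]])
         (auto simp: norm_mult abs_mult intro!: mult_right_mono order_trans[OF M abs_ge_self])
    have F: "?F \<xi> = (\<integral>y. ?g y * cis (- (\<xi> \<bullet> y)) \<partial>lborel)" for \<xi>
    proof -
      have "?g y * cis (- (\<xi> \<bullet> y)) = f y * cnj (packet (x0, \<xi>) y) * cis (- (\<xi> \<bullet> x0))" for y
      proof -
        have "- (\<xi> \<bullet> (y - x0)) + - (\<xi> \<bullet> x0) = - (\<xi> \<bullet> y)" by (simp add: inner_diff_right)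
        then have "cnj (packet (x0, \<xi>) y) * cis (- (\<xi> \<bullet> x0)) = cis (- (\<xi> \<bullet> y)) * of_real (gauss (y - x0))"
          by (simp add: packet_def cis_cnj mult.assoc[symmetric] cis_mult mult.commute[of "complex_of_real _"])
        then show ?thesis by (simp only: mult_ac)
      qed
      then show ?thesis by (simp only: fbi_def integral_mult_left_zero)
    qed
    have Fi: "integrable lborel ?F"
    proof (rule integrable_wt_bound[of _ B 0])
      show "?F \<in> borel_measurable borel"
        by (intro borel_measurable_times sect borel_measurable_continuous_onI continuous_intros)
      fix \<xi>
      have "norm (?F \<xi>) \<le> B * wt (2 * DIM('a \<times> 'a)) (x0, \<xi>)" using B[of "(x0, \<xi>)"] by (simp add: norm_mult)
      also have "\<dots> \<le> B * wt (2 * DIM('a)) \<xi>"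
        by (rule mult_left_mono[OF order_trans[OF wt_Pair_le(2) wt_antimono] B0]) simp
      finally show "norm (?F \<xi>) \<le> B * wt (2 * DIM('a)) (\<xi> - 0)" by simp
    qed
    have "(\<integral>\<xi>. fbi f (x0, \<xi>) * packet (x0, \<xi>) x \<partial>lborel) = (\<integral>\<xi>. (?F \<xi> * cis (\<xi> \<bullet> x)) * of_real (gauss (x - x0)) \<partial>lborel)"
      by (intro Bochner_Integration.integral_cong refl)
         (simp add: packet_def inner_diff_right cis_mult mult_ac)
    also have "\<dots> = (\<integral>\<xi>. ?F \<xi> * cis (\<xi> \<bullet> x) \<partial>lborel) * of_real (gauss (x - x0))" by simp
    also have "(\<integral>\<xi>. ?F \<xi> * cis (\<xi> \<bullet> x) \<partial>lborel) = of_real ((2 * pi) ^ DIM('a)) * ?g x"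
    proof (rule fourier_inversion[OF _ gi _ F Fi])
      show "continuous_on UNIV ?g" by (intro continuous_intros f)
      show "norm (?g y) \<le> M" for y
        using mult_mono[OF M[of y] gauss_le_1[of "y - x0"]] order_trans[OF norm_ge_zero M[of y]] by (simp add: norm_mult)
    qed
    finally show "(\<integral>\<xi>. fbi f (x0, \<xi>) * packet (x0, \<xi>) x \<partial>lborel) =
        of_real ((2 * pi) ^ DIM('a)) * f x * of_real ((gauss (x - x0))\<^sup>2)"
      by (simp add: power2_eq_square)
  qed
  also have "\<dots> = of_real ((2 * pi) ^ DIM('a)) * f x * of_real (\<integral>x0. (gauss (x - x0))\<^sup>2 \<partial>lborel)"
    by (simp only: integral_mult_right_zero integral_complex_of_real)
  also have "(\<integral>x0. (gauss (x - x0))\<^sup>2 \<partial>lborel) = (\<integral>y. (gauss (y::'a))\<^sup>2 \<partial>lborel)"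
    by (rule lborel_integral_reflect) simp
  finally show "(\<integral>w. fbi f w * packet w x \<partial>lborel) = of_real (fbi_mass TYPE('a)) * f x"
    by (simp add: fbi_mass_def)
qed

text \<open>Integrate the inversion formula against the conjugate of \<open>f\<close> and exchange
  the integrals: the inner integral becomes the conjugate of \<open>fbi f w\<close>.\<close>

lemma fbi_isometry:
  fixes f :: "'a::euclidean_space \<Rightarrow> complex"
  assumes f: "continuous_on UNIV f" and M: "\<And>x. norm (f x) \<le> M" and fi: "integrable lborel f"
    and B: "\<And>w. norm (fbi f w) \<le> B * wt (2 * DIM('a \<times> 'a)) w"
  shows "(\<integral>w. (norm (fbi f w))\<^sup>2 \<partial>lborel) = fbi_mass TYPE('a) * (\<integral>x. (norm (f x))\<^sup>2 \<partial>lborel)"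
proof -
  have fm [measurable]: "f \<in> borel_measurable borel" using f by (rule borel_measurable_continuous_onI)
  have Fm [measurable]: "fbi f \<in> borel_measurable borel" by (rule fbi_measurable[OF fm])
  note Fi = fbi_inversion(1)[OF f M B]
  let ?h = "\<lambda>x w. cnj (f x) * (fbi f w * packet w x)"
  have "of_real (fbi_mass TYPE('a) * (\<integral>x. (norm (f x))\<^sup>2 \<partial>lborel)) =
      (\<integral>x. cnj (f x) * (of_real (fbi_mass TYPE('a)) * f x) \<partial>lborel)"
    unfolding of_real_mult integral_complex_of_real[symmetric] integral_mult_right_zero[symmetric]
    by (intro Bochner_Integration.integral_cong refl, subst complex_norm_square) (simp only: mult_ac)
  also have "\<dots> = (\<integral>x. (\<integral>w. ?h x w \<partial>lborel) \<partial>lborel)"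
    by (simp add: fbi_inversion(2)[OF f M B])
  also have "\<dots> = (\<integral>w. (\<integral>x. ?h x w \<partial>lborel) \<partial>lborel)"
  proof (rule lborel_swap_dominated)
    have [measurable]: "(\<lambda>z::'a \<times> 'a \<times> 'a. packet (snd z) (fst z)) \<in> borel_measurable borel"
      by (intro borel_measurable_continuous_onI continuous_intros)
    have [measurable]: "(\<lambda>z::'a \<times> 'a \<times> 'a. fbi f (snd z)) \<in> borel_measurable borel"
       "(\<lambda>z::'a \<times> 'a \<times> 'a. f (fst z)) \<in> borel_measurable borel"
      by (intro measurable_compose[OF borel_measurable_continuous_onI Fm]
            measurable_compose[OF borel_measurable_continuous_onI fm] continuous_intros)+
    show "case_prod ?h \<in> borel_measurable borel" unfolding case_prod_beta' by measurable
    show "norm (?h x w) \<le> norm (f x) * norm (fbi f w)" for x w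
      by (auto simp: norm_mult intro!: mult_left_mono mult_left_le norm_packet_le_1)
  qed (use fi Fi in auto)
  also have "\<dots> = (\<integral>w. of_real ((norm (fbi f w))\<^sup>2) \<partial>lborel)"
  proof (rule Bochner_Integration.integral_cong[OF refl])
    fix w
    have "(\<integral>x. ?h x w \<partial>lborel) = fbi f w * (\<integral>x. cnj (f x * cnj (packet w x)) \<partial>lborel)"
      by (simp only: integral_mult_right_zero[symmetric]) (simp add: mult_ac)
    also have "(\<integral>x. cnj (f x * cnj (packet w x)) \<partial>lborel) = cnj (fbi f w)"
      unfolding fbi_def by (rule Bochner_Integration.integral_cnj)
    finally show "(\<integral>x. ?h x w \<partial>lborel) = of_real ((norm (fbi f w))\<^sup>2)" by (simp only: complex_norm_square)
  qed
  finally show ?thesis by (simp only: integral_complex_of_real of_real_eq_iff)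
qed

text \<open>Decay in frequency comes from \<open>fourier_decay\<close>, decay in position from the
  product of \<open>u\<close> and the Gaussian window. The Gaussian supplies N + 2n powers: N are
  exchanged for decay in the position, and 2n keep the integral convergent.\<close>

lemma fbi_decay:
  fixes u :: "'a::euclidean_space \<Rightarrow> complex"
  assumes u: "u \<in> schwartz"
  obtains C where "C \<ge> 0" "\<And>w. norm (fbi u w) \<le> C * wt N w"
proof -
  let ?g = "\<lambda>y::'a. complex_of_real (gauss y)"
  obtain C1 where C1: "C1 \<ge> 0" "derivs_le N (\<lambda>x. C1 * wt N x) u" using schwartzD(2)[OF u] by blast
  obtain C2 where C2: "C2 \<ge> 0" "derivs_le N (\<lambda>x. C2 * wt (N + 2 * DIM('a)) x) ?g"
    using schwartzD(2)[OF gauss_schwartz] by blast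
  obtain C where C: "C \<ge> 0" "\<And>f B a d. smooth (f :: 'a \<Rightarrow> complex) \<Longrightarrow>
    derivs_le N (\<lambda>x. B * wt (2 * DIM('a)) (x - a)) f \<Longrightarrow>
    norm (\<integral>x. f x * cis (d \<bullet> x) \<partial>lborel) \<le> C * B * wt N d"
    using fourier_decay[where N = N] by blast
  have "norm (fbi u w) \<le> (C * (2 ^ N * (C1 * C2))) * wt N w" for w
  proof -
    obtain x \<xi> where w: "w = (x, \<xi>)" by (cases w)
    let ?f = "\<lambda>y. u (x + y) * ?g y"
    have sm: "smooth (\<lambda>y. u (x + y))" "smooth ?g"
      using smooth_affine[OF basis_affine_translation(1)] schwartzD(1) u gauss_schwartz by blast+
    have "derivs_le N (\<lambda>y. 1 ^ N * (C1 * wt N (x + y))) (\<lambda>y. u (x + y))"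
      by (rule derivs_le_affine[OF basis_affine_translation(1) _ _ C1(2)]) (use u schwartzD(1) in auto)
    then have "derivs_le N (\<lambda>y. 2 ^ N * ((1 ^ N * (C1 * wt N (x + y))) * (C2 * wt (N + 2 * DIM('a)) y))) ?f"
      by (intro derivs_le_mult sm C2)
    then have d: "derivs_le N (\<lambda>y. (2 ^ N * (C1 * C2) * wt N x) * wt (2 * DIM('a)) (y - 0)) ?f"
    proof (rule derivs_le_mono)
      fix y
      have "wt N (x + y) * wt N (- y) \<le> wt N x" using wt_product_le[of N "x + y" "- y"] by simp
      then have "(2 ^ N * (C1 * C2) * wt (2 * DIM('a)) y) * (wt N (x + y) * wt N y) \<le>
          (2 ^ N * (C1 * C2) * wt (2 * DIM('a)) y) * wt N x"
        using C1 C2 by (intro mult_left_mono) (auto simp: wt_minus)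
      then show "2 ^ N * ((1 ^ N * (C1 * wt N (x + y))) * (C2 * wt (N + 2 * DIM('a)) y)) \<le>
          (2 ^ N * (C1 * C2) * wt N x) * wt (2 * DIM('a)) (y - 0)"
        by (simp add: wt_add mult_ac)
    qed simp
    have "fbi u w = (\<integral>y. u (x + y) * cnj (packet w (x + y)) \<partial>lborel)"
      unfolding fbi_def
      by (rule lborel_integral_shift[symmetric])
         (intro borel_measurable_times schwartz_measurable[OF u] borel_measurable_continuous_onI continuous_intros)
    also have "\<dots> = (\<integral>y. ?f y * cis ((- \<xi>) \<bullet> y) \<partial>lborel)"
      by (intro Bochner_Integration.integral_cong refl) (simp add: w packet_def cis_cnj mult_ac)
    finally have "norm (fbi u w) \<le> C * (2 ^ N * (C1 * C2) * wt N x) * wt N (- \<xi>)"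
      using C(2)[OF smooth_mult[OF sm] d, of "- \<xi>"] by simp
    also have "\<dots> = (C * (2 ^ N * (C1 * C2))) * (wt N x * wt N \<xi>)" by (simp add: wt_minus)
    also have "\<dots> \<le> (C * (2 ^ N * (C1 * C2))) * wt N w"
    proof (rule mult_left_mono)
      have "wt N (x, 0::'a) * wt N (0::'a, \<xi>) \<le> wt N ((x, 0) + (0, \<xi>))" by (rule wt_product_le)
      then show "wt N x * wt N \<xi> \<le> wt N w" by (simp add: w wt_def norm_Pair)
    qed (use C C1 C2 in auto)
    finally show ?thesis .
  qed
  then show ?thesis using C C1 C2 by (intro that[of "C * (2 ^ N * (C1 * C2))"]) auto
qed

lemma dird_basis_expand:
  assumes "f differentiable (at x)"
  shows "dird v f x = (\<Sum>b\<in>Basis. of_real (v \<bullet> b) * dird b f x)"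
proof -
  have lin: "linear (\<lambda>b. dird b f x)"
    by (rule has_derivative_linear[OF differentiable_has_derivative_dird[OF assms]])
  have "dird v f x = dird (\<Sum>b\<in>Basis. (v \<bullet> b) *\<^sub>R b) f x" by (simp add: euclidean_representation)
  also have "\<dots> = (\<Sum>b\<in>Basis. (v \<bullet> b) *\<^sub>R dird b f x)"
    by (simp add: linear_sum[OF lin] linear_cmul[OF lin])
  finally show ?thesis by (simp add: scaleR_conv_of_real)
qed

lemma wt_cancel: "(1 + norm x) ^ k * wt (N + k) x = wt N x"
  unfolding wt_def using one_plus_norm_pos[of x] by (simp add: power_add)

section \<open>Superpositions of packets and a criterion for Schwartz functions\<close>

definition rapid :: "('a::euclidean_space \<Rightarrow> complex) \<Rightarrow> bool" where
  "rapid G \<longleftrightarrow> G \<in> borel_measurable borel \<and> (\<forall>N. \<exists>C. \<forall>w. norm (G w) \<le> C * wt N w)"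

lemma rapid_bound:
  assumes "rapid G"
  obtains C where "C \<ge> 0" "\<And>w. norm (G w) \<le> C * wt N w"
proof -
  obtain C where C: "\<And>w. norm (G w) \<le> C * wt N w" using assms unfolding rapid_def by blast
  have "0 \<le> C" using order_trans[OF norm_ge_zero C[of 0]] by simp
  then show ?thesis using C that by blast
qed

lemma rapid_measurable: "rapid G \<Longrightarrow> G \<in> borel_measurable borel"
  by (simp add: rapid_def)

lemma rapid_mult_linear:
  assumes G: "rapid G" and T: "bounded_linear T"
  shows "rapid (\<lambda>w. complex_of_real (T w) * G w)"
  unfolding rapid_def
proof (intro conjI allI)
  have "T \<in> borel_measurable borel"
    by (intro borel_measurable_continuous_onI linear_continuous_on T)
  then show "(\<lambda>w. complex_of_real (T w) * G w) \<in> borel_measurable borel"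
    using rapid_measurable[OF G] by measurable
  fix N
  obtain C where C: "C \<ge> 0" "\<And>w. norm (G w) \<le> C * wt (Suc N) w" using rapid_bound[OF G] by metis
  obtain K where K: "\<And>w. norm (T w) \<le> norm w * K" "0 \<le> K" using bounded_linear.nonneg_bounded[OF T] by blast
  have "norm (complex_of_real (T w) * G w) \<le> (K * C) * wt N w" for w
  proof -
    have "norm (complex_of_real (T w) * G w) \<le> ((1 + norm w) * K) * (C * wt (Suc N) w)"
    proof -
      have "norm (complex_of_real (T w)) \<le> (1 + norm w) * K" using K(1)[of w] K(2) by (simp add: distrib_right)
      then show ?thesis unfolding norm_mult using K C by (intro mult_mono) auto
    qed
    also have "\<dots> = (K * C) * wt N w"
      using wt_cancel[of w 1 N] by (simp add: mult_ac)
    finally show ?thesis .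
  qed
  then show "\<exists>C. \<forall>w. norm (complex_of_real (T w) * G w) \<le> C * wt N w" by blast
qed

lemma rapid_cmult: "rapid G \<Longrightarrow> rapid (\<lambda>w. c * G w)"
  unfolding rapid_def
proof (elim conjE, intro conjI allI)
  fix N assume "\<forall>N. \<exists>C. \<forall>w. norm (G w) \<le> C * wt N w"
  then obtain C where "\<And>w. norm (G w) \<le> C * wt N w" by blast
  then have "norm (c * G w) \<le> (norm c * C) * wt N w" for w
    by (simp add: norm_mult mult.assoc mult_left_mono)
  then show "\<exists>C. \<forall>w. norm (c * G w) \<le> C * wt N w" by blast
qed measurable

lemma rapid_integrable:
  fixes G :: "'a::euclidean_space \<Rightarrow> complex"
  assumes "rapid G"
  shows "integrable lborel G" "integrable lborel (\<lambda>w. norm w ^ k * norm (G w))"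
proof -
  obtain C where C: "\<And>w. norm (G w) \<le> C * wt (2 * DIM('a) + k) w" "C \<ge> 0" using rapid_bound[OF assms] by metis
  have *: "norm w ^ k * norm (G w) \<le> C * wt (2 * DIM('a)) (w - 0)" for w
  proof -
    have "norm w ^ k * norm (G w) \<le> (1 + norm w) ^ k * (C * wt (2 * DIM('a) + k) w)"
      using C by (intro mult_mono power_mono) auto
    also have "\<dots> = C * wt (2 * DIM('a)) (w - 0)"
      unfolding wt_def using one_plus_norm_pos[of w] by (simp add: field_simps power_add)
    finally show ?thesis .
  qed
  show "integrable lborel (\<lambda>w. norm w ^ k * norm (G w))"
    by (rule integrable_wt_bound(1)[of _ C 0]) (use * rapid_measurable[OF assms] in auto)
  obtain D where D: "\<And>w. norm (G w) \<le> D * wt (2 * DIM('a)) w" using rapid_bound[OF assms] by metis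
  show "integrable lborel G"
    by (rule integrable_wt_bound(1)[of _ D 0]) (use D rapid_measurable[OF assms] in auto)
qed

lemma fbi_rapid: "u \<in> schwartz \<Longrightarrow> rapid (fbi u)"
  unfolding rapid_def by (meson fbi_decay fbi_measurable schwartz_measurable)

text \<open>With a general profile \<open>g\<close> in place of the Gaussian the class is closed
  under differentiation: a derivative falls either on the oscillation, multiplying \<open>G\<close>
  by i times a frequency coordinate, or on the profile.\<close>

definition superpose :: "('a::euclidean_space \<times> 'a \<Rightarrow> complex) \<Rightarrow> ('a \<Rightarrow> complex) \<Rightarrow> 'a \<Rightarrow> complex" where
  "superpose G g x = (\<integral>w. G w * (cis (snd w \<bullet> (x - fst w)) * g (x - fst w)) \<partial>lborel)"

lemma schwartz_bounded:
  assumes "g \<in> schwartz"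
  obtains C where "C \<ge> 0" "\<And>x. norm (g x) \<le> C"
  using schwartz_bound[OF assms, where N = 0] by auto

lemma superpose_measurable_integrand:
  fixes G :: "'a::euclidean_space \<times> 'a \<Rightarrow> complex"
  assumes "rapid G" "continuous_on UNIV g"
  shows "(\<lambda>w. G w * (cis (snd w \<bullet> (x - fst w)) * g (x - fst w))) \<in> borel_measurable borel"
  by (intro borel_measurable_times rapid_measurable[OF assms(1)] borel_measurable_continuous_onI
      continuous_intros continuous_on_compose2[OF assms(2)]) auto

lemma superpose_integrable:
  fixes G :: "'a::euclidean_space \<times> 'a \<Rightarrow> complex"
  assumes "rapid G" "g \<in> schwartz"
  shows "integrable lborel (\<lambda>w. G w * (cis (snd w \<bullet> (x - fst w)) * g (x - fst w)))"
proof -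
  obtain C where C: "C \<ge> 0" "\<And>x. norm (g x) \<le> C" using schwartz_bounded[OF assms(2)] by metis
  show ?thesis
    by (rule Bochner_Integration.integrable_bound[OF integrable_mult_right[OF rapid_integrable(1)[OF assms(1)], of "of_real C"]])
       (use superpose_measurable_integrand[OF assms(1) schwartz_continuous[OF assms(2)]] C in
        \<open>auto simp: norm_mult mult.commute[of "norm (G _)"] intro!: mult_right_mono\<close>)
qed

lemma superpose_has_derivative:
  fixes G :: "'a::euclidean_space \<times> 'a \<Rightarrow> complex"
  assumes G: "rapid G" and g: "g \<in> schwartz"
  shows "(superpose G g has_derivative (\<lambda>v. \<Sum>b\<in>Basis. of_real (v \<bullet> b) *
      (superpose (\<lambda>w. of_real (snd w \<bullet> b) * (\<i> * G w)) g x + superpose G (dird b g) x))) (at x)"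
proof -
  let ?F = "\<lambda>x w. G w * (cis (snd w \<bullet> (x - fst w)) * g (x - fst w))"
  let ?A = "\<lambda>b x w. (of_real (snd w \<bullet> b) * (\<i> * G w)) * (cis (snd w \<bullet> (x - fst w)) * g (x - fst w))"
  let ?B = "\<lambda>b x w. G w * (cis (snd w \<bullet> (x - fst w)) * dird b g (x - fst w))"
  let ?F' = "\<lambda>x w v. \<Sum>b\<in>Basis. of_real (v \<bullet> b) * (?A b x w + ?B b x w)"
  have sg: "smooth g" using g by (rule schwartzD(1))
  have rb: "rapid (\<lambda>w. of_real (snd w \<bullet> b) * (\<i> * G w))" for b
    by (intro rapid_mult_linear rapid_cmult G bounded_linear_compose[OF bounded_linear_inner_left bounded_linear_snd])
  obtain C where C: "C \<ge> 0" "\<And>x. norm (g x) \<le> C" using schwartz_bounded[OF g] by metis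
  have "\<exists>C. \<forall>x. norm (dird b g x) \<le> C" if "b \<in> Basis" for b
    using schwartz_bounded[OF schwartz_dird[OF g that]] by metis
  then obtain D where D: "\<And>b x. b \<in> Basis \<Longrightarrow> norm (dird b g x) \<le> D b" by metis
  have D0: "0 \<le> D b" if "b \<in> Basis" for b using order_trans[OF norm_ge_zero D[OF that, of 0]] .
  have "((\<lambda>x. \<integral>w. ?F x w \<partial>lborel) has_derivative (\<lambda>v. \<integral>w. ?F' x w v \<partial>lborel)) (at x)"
  proof (rule has_derivative_integral_dominated[where p = "\<lambda>w. \<Sum>b\<in>Basis. (norm w ^ 1 * norm (G w)) * C + norm (G w) * D b"])
    fix x :: 'a and w :: "'a \<times> 'a"
    have gd: "((\<lambda>x. g (x - fst w)) has_derivative (\<lambda>v. dird v g (x - fst w))) (at x)"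
      using has_derivative_compose[OF has_derivative_diff[OF has_derivative_ident has_derivative_const]
          differentiable_has_derivative_dird[OF smooth_differentiable[OF sg]]] by simp
    have "((\<lambda>x. ?F x w) has_derivative (\<lambda>v. G w * (cis (snd w \<bullet> (x - fst w)) * dird v g (x - fst w) +
        (\<i> * of_real (snd w \<bullet> v) * cis (snd w \<bullet> (x - fst w))) * g (x - fst w)))) (at x)"
      by (rule derivative_eq_intros gd refl | simp)+
         (auto simp: fun_eq_iff scaleR_conv_of_real algebra_simps)
    moreover have "G w * (cis (snd w \<bullet> (x - fst w)) * dird v g (x - fst w) +
        (\<i> * of_real (snd w \<bullet> v) * cis (snd w \<bullet> (x - fst w))) * g (x - fst w)) = ?F' x w v" for v
    proof -
      have "complex_of_real (snd w \<bullet> v) = (\<Sum>b\<in>Basis. of_real (v \<bullet> b) * of_real (snd w \<bullet> b))"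
        by (subst euclidean_inner) (simp add: mult.commute)
      then show ?thesis
        unfolding dird_basis_expand[OF smooth_differentiable[OF sg], of v]
        by (simp add: sum_distrib_left sum_distrib_right sum.distrib[symmetric] algebra_simps)
    qed
    ultimately show "((\<lambda>x. ?F x w) has_derivative ?F' x w) (at x)" by simp
  next
    fix x v :: 'a and w :: "'a \<times> 'a"
    show "norm (?F' x w v) \<le> (\<Sum>b\<in>Basis. (norm w ^ 1 * norm (G w)) * C + norm (G w) * D b) * norm v"
      unfolding sum_distrib_right
    proof (rule order_trans[OF norm_sum sum_mono])
      fix b :: 'a assume b: "b \<in> Basis"
      have sb: "\<bar>snd w \<bullet> b\<bar> \<le> norm w"
        using Basis_le_norm[OF b, of "snd w"] norm_snd_le[of "snd w" "fst w"] by simp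
      have "norm (?A b x w) \<le> (norm w ^ 1 * norm (G w)) * C"
        unfolding norm_mult using sb C by (auto intro!: mult_mono)
      moreover have "norm (?B b x w) \<le> norm (G w) * D b"
        unfolding norm_mult using D[OF b] by (auto intro!: mult_mono)
      ultimately have "norm (?A b x w + ?B b x w) \<le> (norm w ^ 1 * norm (G w)) * C + norm (G w) * D b"
        by (rule norm_triangle_mono)
      then have "norm v * norm (?A b x w + ?B b x w) \<le> norm v * ((norm w ^ 1 * norm (G w)) * C + norm (G w) * D b)"
        by (rule mult_left_mono) simp
      moreover have "\<bar>v \<bullet> b\<bar> * norm (?A b x w + ?B b x w) \<le> norm v * norm (?A b x w + ?B b x w)"
        by (rule mult_right_mono[OF Basis_le_norm[OF b]]) simp
      ultimately show "norm (of_real (v \<bullet> b) * (?A b x w + ?B b x w)) \<le>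
          ((norm w ^ 1 * norm (G w)) * C + norm (G w) * D b) * norm v"
        by (simp add: norm_mult mult.commute)
    qed
  next
    show "integrable lborel (\<lambda>w. \<Sum>b\<in>(Basis::'a set). (norm w ^ 1 * norm (G w)) * C + norm (G w) * D b)"
      by (intro Bochner_Integration.integrable_sum Bochner_Integration.integrable_add integrable_mult_left
          rapid_integrable(2)[OF G] integrable_norm rapid_integrable(1)[OF G])
    show "integrable lborel (?F x)" for x by (rule superpose_integrable[OF G g])
    show "(\<lambda>w. ?F' x w v) \<in> borel_measurable borel" for x v
    proof (rule borel_measurable_sum, rule borel_measurable_times[OF borel_measurable_const borel_measurable_add])
      fix b :: 'a assume b: "b \<in> Basis"
      show "?A b x \<in> borel_measurable borel"
        by (rule superpose_measurable_integrand[OF rb smooth_continuous[OF sg]])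
      show "?B b x \<in> borel_measurable borel"
        by (rule superpose_measurable_integrand[OF G smooth_continuous[OF smooth_dird[OF sg b]]])
    qed
  qed
  moreover have "(\<integral>w. ?F' x w v \<partial>lborel) = (\<Sum>b\<in>Basis. of_real (v \<bullet> b) *
      (superpose (\<lambda>w. of_real (snd w \<bullet> b) * (\<i> * G w)) g x + superpose G (dird b g) x))" for v
  proof -
    have iA: "integrable lborel (?A b x)" for b by (rule superpose_integrable[OF rb g])
    have iB: "integrable lborel (?B b x)" if "b \<in> Basis" for b by (rule superpose_integrable[OF G schwartz_dird[OF g that]])
    have "(\<integral>w. ?F' x w v \<partial>lborel) = (\<Sum>b\<in>Basis. \<integral>w. of_real (v \<bullet> b) * (?A b x w + ?B b x w) \<partial>lborel)"
      by (rule Bochner_Integration.integral_sum) (intro integrable_mult_right Bochner_Integration.integrable_add iA iB)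
    also have "\<dots> = (\<Sum>b\<in>Basis. of_real (v \<bullet> b) * ((\<integral>w. ?A b x w \<partial>lborel) + (\<integral>w. ?B b x w \<partial>lborel)))"
      by (intro sum.cong refl) (simp only: integral_mult_right_zero Bochner_Integration.integral_add[OF iA iB])
    finally show ?thesis by (simp only: superpose_def)
  qed
  ultimately show ?thesis unfolding superpose_def[of G g, abs_def] by simp
qed

lemma superpose_dird:
  fixes G :: "'a::euclidean_space \<times> 'a \<Rightarrow> complex"
  assumes G: "rapid G" and g: "g \<in> schwartz" and b: "b \<in> Basis"
  shows "dird b (superpose G g) = (\<lambda>x. superpose (\<lambda>w. of_real (snd w \<bullet> b) * (\<i> * G w)) g x + superpose G (dird b g) x)"
proof
  fix x
  have "(\<Sum>c\<in>Basis. of_real (b \<bullet> c) * h c) = (h b :: complex)" for h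
  proof -
    have "(\<Sum>c\<in>Basis. of_real (b \<bullet> c) * h c) = (\<Sum>c\<in>Basis. if c = b then h c else 0)"
      using b by (intro sum.cong) (auto simp: inner_Basis)
    then show ?thesis using b by simp
  qed
  then show "dird b (superpose G g) x = superpose (\<lambda>w. of_real (snd w \<bullet> b) * (\<i> * G w)) g x + superpose G (dird b g) x"
    using dird_eqI[OF superpose_has_derivative[OF G g]] by simp
qed

text \<open>Both terms of \<open>superpose_dird\<close> are superpositions of the same kind, so an
  induction with \<open>G\<close> and \<open>g\<close> arbitrary reduces all derivatives to the
  decay of a superposition itself.\<close>

lemma superpose_schwartz:
  fixes G :: "'a::euclidean_space \<times> 'a \<Rightarrow> complex"
  assumes "rapid G" "g \<in> schwartz"
  shows "superpose G g \<in> schwartz"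
proof -
  have rb: "rapid (\<lambda>w. of_real (snd w \<bullet> b) * (\<i> * G w))" if "rapid G" for G :: "'a \<times> 'a \<Rightarrow> complex" and b
    by (intro rapid_mult_linear rapid_cmult that bounded_linear_compose[OF bounded_linear_inner_left bounded_linear_snd])
  have su: "smooth_upto k (superpose G g)" if "rapid G" "g \<in> schwartz" for k and G :: "'a \<times> 'a \<Rightarrow> complex" and g
    using that
  proof (induction k arbitrary: G g)
    case 0
    then show ?case using differentiableI[OF superpose_has_derivative] by auto
  next
    case (Suc k)
    then show ?case
      using differentiableI[OF superpose_has_derivative]
      by (auto simp: superpose_dird intro!: smooth_upto_add rb schwartz_dird)
  qed
  then have sm: "smooth (superpose G g)" if "rapid G" "g \<in> schwartz" for G :: "'a \<times> 'a \<Rightarrow> complex" and g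
    using that smooth_iff_smooth_upto by blast
  have zero: "\<exists>C\<ge>0. \<forall>x. norm (superpose G g x) \<le> C * wt N x"
    if G: "rapid G" and g: "g \<in> schwartz" for N and G :: "'a \<times> 'a \<Rightarrow> complex" and g
  proof -
    let ?k = "2 * DIM('a \<times> 'a)"
    obtain C where C: "C \<ge> 0" "\<And>w. norm (G w) \<le> C * wt (N + ?k) w" using rapid_bound[OF G] by metis
    obtain D where D: "D \<ge> 0" "\<And>x. norm (g x) \<le> D * wt N x" using schwartz_bound[OF g] by metis
    have "norm (superpose G g x) \<le> ((C * D) * wt N x) * (\<integral>w. wt ?k (w::'a \<times> 'a) \<partial>lborel)" for x
      unfolding superpose_def
    proof (rule integrable_wt_bound(2)[OF superpose_measurable_integrand[OF G schwartz_continuous[OF g]]])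
      fix w :: "'a \<times> 'a"
      have "norm (G w * (cis (snd w \<bullet> (x - fst w)) * g (x - fst w))) \<le> (C * wt (N + ?k) w) * (D * wt N (x - fst w))"
        by (simp only: norm_mult norm_cis mult_1, intro mult_mono C D) (use C in auto)
      also have "\<dots> = (C * D * wt ?k w) * (wt N w * wt N (x - fst w))" by (simp add: wt_add mult_ac)
      also have "\<dots> \<le> (C * D * wt ?k w) * wt N x"
      proof (rule mult_left_mono)
        have "wt N w * wt N (x - fst w) \<le> wt N (fst w) * wt N (x - fst w)"
          using wt_Pair_le(1)[of N "fst w" "snd w"] by (intro mult_right_mono) auto
        also have "\<dots> \<le> wt N (fst w + (x - fst w))" by (rule wt_product_le)
        finally show "wt N w * wt N (x - fst w) \<le> wt N x" by simp
      qed (use C D in auto)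
      finally show "norm (G w * (cis (snd w \<bullet> (x - fst w)) * g (x - fst w))) \<le> ((C * D) * wt N x) * wt ?k (w - 0)"
        by (simp add: mult_ac)
    qed
    then have "norm (superpose G g x) \<le> (C * D * (\<integral>w. wt ?k (w::'a \<times> 'a) \<partial>lborel)) * wt N x" for x
      by (simp add: mult_ac)
    moreover have "0 \<le> C * D * (\<integral>w. wt ?k (w::'a \<times> 'a) \<partial>lborel)" using C D by simp
    ultimately show ?thesis by blast
  qed
  have "\<exists>C\<ge>0. derivs_le k (\<lambda>x. C * wt N x) (superpose G g)"
    if "rapid G" "g \<in> schwartz" for k N and G :: "'a \<times> 'a \<Rightarrow> complex" and g
    using that
  proof (induction k arbitrary: G g)
    case 0
    then show ?case using zero by (simp add: derivs_le_0)
  next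
    case (Suc k)
    have "\<exists>C\<ge>0. derivs_le k (\<lambda>x. C * wt N x) (dird b (superpose G g))" if b: "b \<in> Basis" for b
    proof -
      note G' = rb[OF Suc.prems(1), of b] and g' = schwartz_dird[OF Suc.prems(2) b]
      obtain C where C: "C \<ge> 0" "derivs_le k (\<lambda>x. C * wt N x) (superpose (\<lambda>w. of_real (snd w \<bullet> b) * (\<i> * G w)) g)"
        using Suc.IH[OF G' Suc.prems(2)] by blast
      obtain D where D: "D \<ge> 0" "derivs_le k (\<lambda>x. D * wt N x) (superpose G (dird b g))"
        using Suc.IH[OF Suc.prems(1) g'] by blast
      have "derivs_le k (\<lambda>x. C * wt N x + D * wt N x) (dird b (superpose G g))"
        unfolding superpose_dird[OF Suc.prems b]
        by (intro derivs_le_add sm G' g' Suc.prems C D)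
      then show ?thesis using C D by (intro exI[of _ "C + D"]) (simp add: distrib_right)
    qed
    then obtain D where D: "\<And>b. b \<in> Basis \<Longrightarrow> D b \<ge> 0 \<and> derivs_le k (\<lambda>x. D b * wt N x) (dird b (superpose G g))"
      by metis
    obtain C where C: "C \<ge> 0" "\<And>x. norm (superpose G g x) \<le> C * wt N x" using zero[OF Suc.prems] by blast
    let ?S = "C + (\<Sum>b\<in>Basis. D b)"
    have S: "0 \<le> (\<Sum>b\<in>Basis. D b)" using D by (simp add: sum_nonneg)
    have "C * wt N x \<le> ?S * wt N x" for x :: 'a using S by (intro mult_right_mono) auto
    moreover have "D b * wt N x \<le> ?S * wt N x" if "b \<in> Basis" for b and x :: 'a
      using member_le_sum[OF that, of D] D C(1) by (intro mult_right_mono) (auto intro: add_increasing)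
    ultimately have "derivs_le (Suc k) (\<lambda>x. ?S * wt N x) (superpose G g)"
      unfolding derivs_le_Suc using C D by (meson order_trans derivs_le_mono order_refl)
    moreover have "0 \<le> ?S" using C S by simp
    ultimately show ?case by blast
  qed
  then show ?thesis using assms sm by (intro schwartzI) blast+
qed

text \<open>The inversion formula exhibits \<open>f\<close> as a superposition of Gaussian packets
  with rapidly decreasing coefficients. Images of operators are shown to be Schwartz in this way:
  only their transform is estimated, instead of derivatives of an oscillatory integral.\<close>

lemma schwartz_if_fbi_rapid:
  fixes f :: "'a::euclidean_space \<Rightarrow> complex"
  assumes f: "continuous_on UNIV f" and M: "\<And>x. norm (f x) \<le> M" and r: "rapid (fbi f)"
  shows "f \<in> schwartz"
proof -
  let ?c = "complex_of_real (1 / fbi_mass TYPE('a))"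
  obtain B where B: "\<And>w. norm (fbi f w) \<le> B * wt (2 * DIM('a \<times> 'a)) w" using rapid_bound[OF r] by metis
  have "superpose (\<lambda>w. ?c * fbi f w) (\<lambda>y. of_real (gauss y)) x = f x" for x
  proof -
    have "superpose (\<lambda>w. ?c * fbi f w) (\<lambda>y. of_real (gauss y)) x = (\<integral>w. ?c * (fbi f w * packet w x) \<partial>lborel)"
      unfolding superpose_def packet_def by (simp only: mult.assoc)
    also have "\<dots> = ?c * (of_real (fbi_mass TYPE('a)) * f x)"
      by (simp only: integral_mult_right_zero fbi_inversion(2)[OF f M B])
    also have "\<dots> = f x" using fbi_mass_pos[where 'a='a] by simp
    finally show ?thesis .
  qed
  then have "f = superpose (\<lambda>w. ?c * fbi f w) (\<lambda>y. of_real (gauss y))" by auto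
  then show ?thesis using superpose_schwartz[OF rapid_cmult[OF r] gauss_schwartz] by metis
qed

section \<open>Quantization at unit scale and its wave packet kernel\<close>

lemma continuous_on_integral_dominated:
  fixes F :: "'a::euclidean_space \<Rightarrow> 'b::euclidean_space \<Rightarrow> complex"
  assumes F: "\<And>y. continuous_on UNIV (\<lambda>x. F x y)" and le: "\<And>x y. norm (F x y) \<le> p y"
    and p: "integrable lborel p" and m: "\<And>x. F x \<in> borel_measurable borel"
  shows "continuous_on UNIV (\<lambda>x. \<integral>y. F x y \<partial>lborel)"
proof (rule continuous_on_sequentiallyI)
  fix u :: "nat \<Rightarrow> 'a" and a assume u: "u \<longlonglongrightarrow> a"
  show "(\<lambda>n. \<integral>y. F (u n) y \<partial>lborel) \<longlonglongrightarrow> (\<integral>y. F a y \<partial>lborel)"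
  proof (rule integral_dominated_convergence[where w = p])
    show "AE y in lborel. (\<lambda>n. F (u n) y) \<longlonglongrightarrow> F a y"
      using continuous_on_tendsto_compose[OF F u] by simp
  qed (use le p m in auto)
qed

lemma measurable_integral:
  fixes F :: "'a::euclidean_space \<Rightarrow> 'b::euclidean_space \<Rightarrow> complex"
  assumes "(\<lambda>z. F (fst z) (snd z)) \<in> borel_measurable borel"
  shows "(\<lambda>x. \<integral>y. F x y \<partial>lborel) \<in> borel_measurable borel"
proof -
  have "sets (borel \<Otimes>\<^sub>M lborel) = sets (borel :: ('a \<times> 'b) measure)"
    by (metis borel_prod sets_lborel sets_pair_measure_cong)
  with assms show ?thesis
    by (intro lborel.borel_measurable_lebesgue_integral) (simp add: case_prod_beta' cong: measurable_cong_sets)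
qed

lemma gauss_le_wt:
  obtains C where "C \<ge> 0" "\<And>x::'a::euclidean_space. gauss x \<le> C * wt k x"
  using schwartz_bound[OF gauss_schwartz, where N = k] by auto

lemma rapid_weight_integrable:
  fixes G :: "'a::euclidean_space \<Rightarrow> complex"
  assumes "rapid G"
  shows "integrable lborel (\<lambda>w. (1 + norm w) ^ k * norm (G w))"
proof -
  obtain C where C: "C \<ge> 0" "\<And>w. norm (G w) \<le> C * wt (2 * DIM('a) + k) w" using rapid_bound[OF assms] by metis
  have "norm ((1 + norm w) ^ k * norm (G w)) \<le> C * wt (2 * DIM('a)) (w - 0)" for w
  proof -
    have "norm ((1 + norm w) ^ k * norm (G w)) \<le> (1 + norm w) ^ k * (C * wt (2 * DIM('a) + k) w)"
      using C(2)[of w] by (simp add: abs_mult mult_left_mono)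
    also have "\<dots> = C * wt (2 * DIM('a)) (w - 0)" by (simp add: wt_cancel mult.left_commute)
    finally show ?thesis .
  qed
  then show ?thesis
    by (intro integrable_wt_bound(1)[of _ C 0]) (use rapid_measurable[OF assms] in measurable)
qed

section \<open>Symbols with bounded derivatives and their quantization\<close>

text \<open>The Calderon-Vaillancourt class S^0_{0,0}. A rescaled symbol lies in it for each fixed
  h; uniformity in h is carried by explicit constants in \<open>derivs_le\<close>.\<close>

definition unit_symbol :: "('a::euclidean_space \<Rightarrow> complex) \<Rightarrow> bool" where
  "unit_symbol b \<longleftrightarrow> smooth b \<and> (\<forall>k. \<exists>C. derivs_le k (\<lambda>_. C) b)"

lemma unit_symbol_smooth: "unit_symbol b \<Longrightarrow> smooth b"
  by (simp add: unit_symbol_def)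

lemma unit_symbol_bound:
  assumes "unit_symbol b"
  obtains C where "C \<ge> 0" "derivs_le k (\<lambda>_. C) b"
proof -
  obtain C where C: "derivs_le k (\<lambda>_. C) b" using assms unfolding unit_symbol_def by blast
  have "0 \<le> C" using order_trans[OF norm_ge_zero derivs_leD[OF C, of 0]] .
  then show ?thesis using C that by blast
qed

definition amp :: "real \<Rightarrow> ('a::euclidean_space \<times> 'a \<Rightarrow> complex) \<Rightarrow> 'a \<Rightarrow> 'a \<Rightarrow> 'a \<Rightarrow> complex" where
  "amp t b x \<xi> y = b (t *\<^sub>R x + (1 - t) *\<^sub>R y, \<xi>) * cis ((x - y) \<bullet> \<xi>)"

definition Q_inner :: "real \<Rightarrow> ('a::euclidean_space \<times> 'a \<Rightarrow> complex) \<Rightarrow> ('a \<Rightarrow> complex) \<Rightarrow> 'a \<Rightarrow> 'a \<Rightarrow> complex" where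
  "Q_inner t b u x \<xi> = (\<integral>y. amp t b x \<xi> y * u y \<partial>lborel)"

text \<open>Quantization at h = 1 without the factor (2 pi)^(-n), which reappears in
  \<open>Op_schwartz_eq\<close>. The inner integral has a name of its own because the decay in \<xi>
  appears only after integration over y.\<close>

definition Q :: "real \<Rightarrow> ('a::euclidean_space \<times> 'a \<Rightarrow> complex) \<Rightarrow> ('a \<Rightarrow> complex) \<Rightarrow> 'a \<Rightarrow> complex" where
  "Q t b u x = (\<integral>\<xi>. Q_inner t b u x \<xi> \<partial>lborel)"

lemma amp_continuous:
  assumes "smooth b" "continuous_on S f" "continuous_on S g" "continuous_on S h"
  shows "continuous_on S (\<lambda>z. amp t b (f z) (g z) (h z))"
  unfolding amp_def
  by (intro continuous_intros continuous_on_compose2[OF smooth_continuous[OF assms(1), of UNIV]] assms(2-)) auto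

text \<open>For fixed x and \<xi> the integral over y is a Fourier integral, at frequency \<eta> -
  \<xi>, of a slice of the symbol times \<open>g\<close>. The modulation \<eta> is kept explicit so
  that one estimate, with a constant independent of \<eta> and of the centre \<open>a\<close>,
  serves packets as well as Schwartz functions, for which \<eta> = 0.\<close>

lemma Q_inner_bound:
  fixes b :: "'a::euclidean_space \<times> 'a \<Rightarrow> complex"
  assumes b: "unit_symbol b" and t: "t \<in> {0..1}"
  obtains C where "C \<ge> 0" "\<And>g a B \<eta> x \<xi>. smooth g \<Longrightarrow> derivs_le N (\<lambda>y. B * wt (2 * DIM('a)) (y - a)) g \<Longrightarrow>
    norm (Q_inner t b (\<lambda>y. cis (\<eta> \<bullet> y) * g y) x \<xi>) \<le> C * B * wt N (\<xi> - \<eta>)"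
proof -
  obtain Cb where Cb: "Cb \<ge> 0" "derivs_le N (\<lambda>_. Cb) b" using unit_symbol_bound[OF b] by metis
  obtain C where C: "C \<ge> 0" "\<And>f B a d. smooth (f :: 'a \<Rightarrow> complex) \<Longrightarrow>
    derivs_le N (\<lambda>x. B * wt (2 * DIM('a)) (x - a)) f \<Longrightarrow>
    norm (\<integral>x. f x * cis (d \<bullet> x) \<partial>lborel) \<le> C * B * wt N d"
    using fourier_decay[where N = N] by blast
  have "norm (Q_inner t b (\<lambda>y. cis (\<eta> \<bullet> y) * g y) x \<xi>) \<le> (C * (2 ^ N * Cb)) * B * wt N (\<xi> - \<eta>)"
    if g: "smooth g" "derivs_le N (\<lambda>y. B * wt (2 * DIM('a)) (y - a)) g" for g a B \<eta> x \<xi>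
  proof -
    let ?L = "\<lambda>y. (t *\<^sub>R x + (1 - t) *\<^sub>R y, \<xi>)"
    let ?f = "\<lambda>y. b (?L y) * g y"
    have L: "basis_affine 1 ?L" by (rule basis_affine_slice) (use t in auto)
    have sb: "smooth (\<lambda>y. b (?L y))" by (rule smooth_affine[OF L unit_symbol_smooth[OF b]])
    have "derivs_le N (\<lambda>y. 1 ^ N * Cb) (\<lambda>y. b (?L y))"
      by (rule derivs_le_affine[OF L _ unit_symbol_smooth[OF b] Cb(2)]) simp
    then have "derivs_le N (\<lambda>y. 2 ^ N * ((1 ^ N * Cb) * (B * wt (2 * DIM('a)) (y - a)))) ?f"
      by (intro derivs_le_mult sb g)
    then have d: "derivs_le N (\<lambda>y. (2 ^ N * Cb * B) * wt (2 * DIM('a)) (y - a)) ?f"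
      by (simp add: mult_ac)
    have "amp t b x \<xi> y * (cis (\<eta> \<bullet> y) * g y) = cis (x \<bullet> \<xi>) * (?f y * cis ((\<eta> - \<xi>) \<bullet> y))" for y
    proof -
      have "cis ((x - y) \<bullet> \<xi>) * cis (\<eta> \<bullet> y) = cis (x \<bullet> \<xi>) * cis ((\<eta> - \<xi>) \<bullet> y)"
        by (simp add: cis_mult inner_diff_left inner_commute algebra_simps)
      then show ?thesis unfolding amp_def by (simp add: mult_ac)
    qed
    then have "Q_inner t b (\<lambda>y. cis (\<eta> \<bullet> y) * g y) x \<xi> = cis (x \<bullet> \<xi>) * (\<integral>y. ?f y * cis ((\<eta> - \<xi>) \<bullet> y) \<partial>lborel)"
      unfolding Q_inner_def by (simp only: integral_mult_right_zero)
    then have "norm (Q_inner t b (\<lambda>y. cis (\<eta> \<bullet> y) * g y) x \<xi>) = norm (\<integral>y. ?f y * cis ((\<eta> - \<xi>) \<bullet> y) \<partial>lborel)"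
      by (simp add: norm_mult)
    also have "\<dots> \<le> C * (2 ^ N * Cb * B) * wt N (\<eta> - \<xi>)" by (rule C(2)[OF smooth_mult[OF sb g(1)] d])
    finally show ?thesis by (simp add: wt_minus(2)[of N \<eta>] mult_ac)
  qed
  then show ?thesis using that[of "C * (2 ^ N * Cb)"] C Cb by auto
qed

lemma Q_inner_packet_bound:
  fixes b :: "'a::euclidean_space \<times> 'a \<Rightarrow> complex"
  assumes b: "unit_symbol b" and t: "t \<in> {0..1}"
  obtains C where "C \<ge> 0" "\<And>w x \<xi>. norm (Q_inner t b (packet w) x \<xi>) \<le> C * wt N (\<xi> - snd w)"
proof -
  let ?g = "\<lambda>y::'a. complex_of_real (gauss y)"
  obtain C where C: "C \<ge> 0" "\<And>g a B \<eta> x \<xi>. smooth g \<Longrightarrow> derivs_le N (\<lambda>y. B * wt (2 * DIM('a)) (y - a)) g \<Longrightarrow>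
    norm (Q_inner t b (\<lambda>y. cis (\<eta> \<bullet> y) * g y) x \<xi>) \<le> C * B * wt N (\<xi> - \<eta>)"
    using Q_inner_bound[OF b t, where N = N] by blast
  obtain D where D: "D \<ge> 0" "derivs_le N (\<lambda>y. D * wt (2 * DIM('a)) y) ?g"
    using schwartzD(2)[OF gauss_schwartz] by blast
  have sg: "smooth ?g" using schwartzD(1)[OF gauss_schwartz] .
  have "norm (Q_inner t b (packet w) x \<xi>) \<le> (C * D) * wt N (\<xi> - snd w)" for w x \<xi>
  proof -
    let ?c = "cis (- (snd w \<bullet> fst w))"
    let ?h = "\<lambda>y. ?c * ?g (y + (- fst w))"
    have p: "packet w = (\<lambda>y. cis (snd w \<bullet> y) * ?h y)"
    proof
      fix y
      have "cis (snd w \<bullet> (y - fst w)) = cis (snd w \<bullet> y) * ?c" by (simp add: cis_mult inner_diff_right)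
      then show "packet w y = cis (snd w \<bullet> y) * ?h y" by (simp add: packet_def)
    qed
    have s: "smooth (\<lambda>y. ?g (y + (- fst w)))" by (rule smooth_affine[OF basis_affine_translation(2) sg])
    have "derivs_le N (\<lambda>y. 1 ^ N * (D * wt (2 * DIM('a)) (y + (- fst w)))) (\<lambda>y. ?g (y + (- fst w)))"
      by (rule derivs_le_affine[OF basis_affine_translation(2) _ sg D(2)]) simp
    then have "derivs_le N (\<lambda>y. norm ?c * (1 ^ N * (D * wt (2 * DIM('a)) (y + (- fst w))))) ?h"
      by (rule derivs_le_cmult[OF s])
    then have "derivs_le N (\<lambda>y. D * wt (2 * DIM('a)) (y - fst w)) ?h" by simp
    from C(2)[OF smooth_mult[OF smooth_const s] this, of "snd w" x \<xi>]
    show ?thesis unfolding p by simp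
  qed
  then show ?thesis using that[of "C * D"] C D by auto
qed

lemma Q_inner_schwartz_bound:
  fixes b :: "'a::euclidean_space \<times> 'a \<Rightarrow> complex"
  assumes b: "unit_symbol b" and t: "t \<in> {0..1}" and u: "u \<in> schwartz"
  obtains C where "C \<ge> 0" "\<And>x \<xi>. norm (Q_inner t b u x \<xi>) \<le> C * wt N \<xi>"
proof -
  obtain C where C: "C \<ge> 0" "\<And>g a B \<eta> x \<xi>. smooth g \<Longrightarrow> derivs_le N (\<lambda>y. B * wt (2 * DIM('a)) (y - a)) g \<Longrightarrow>
    norm (Q_inner t b (\<lambda>y. cis (\<eta> \<bullet> y) * g y) x \<xi>) \<le> C * B * wt N (\<xi> - \<eta>)"
    using Q_inner_bound[OF b t, where N = N] by blast
  obtain D where D: "D \<ge> 0" "derivs_le N (\<lambda>y. D * wt (2 * DIM('a)) y) u"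
    using schwartzD(2)[OF u] by blast
  have "norm (Q_inner t b u x \<xi>) \<le> (C * D) * wt N \<xi>" for x \<xi>
    using C(2)[OF schwartzD(1)[OF u], of D 0 0 x \<xi>] D by simp
  then show ?thesis using that[of "C * D"] C D by auto
qed

lemma amp_bound:
  assumes "derivs_le 0 (\<lambda>_. C) b"
  shows "norm (amp t b x \<xi> y) \<le> C"
  using assms by (simp add: amp_def norm_mult derivs_le_0)

lemma Q_inner_continuous:
  fixes b :: "'a::euclidean_space \<times> 'a \<Rightarrow> complex"
  assumes b: "unit_symbol b" and u: "continuous_on UNIV u" "integrable lborel u"
  shows "continuous_on UNIV (\<lambda>z. Q_inner t b u (fst z) (snd z))"
proof -
  obtain C where C: "C \<ge> 0" "derivs_le 0 (\<lambda>_. C) b" using unit_symbol_bound[OF b] by metis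
  show ?thesis unfolding Q_inner_def
  proof (rule continuous_on_integral_dominated[where p = "\<lambda>y. C * norm (u y)"])
    show "continuous_on UNIV (\<lambda>z. amp t b (fst z) (snd z) y * u y)" for y
      by (intro continuous_intros amp_continuous unit_symbol_smooth[OF b])
    show "norm (amp t b (fst z) (snd z) y * u y) \<le> C * norm (u y)" for z :: "'a \<times> 'a" and y
      by (simp add: norm_mult mult_right_mono amp_bound[OF C(2)])
    show "(\<lambda>y. amp t b (fst z) (snd z) y * u y) \<in> borel_measurable borel" for z
      by (intro borel_measurable_continuous_onI continuous_intros amp_continuous unit_symbol_smooth[OF b] u)
  qed (use u in auto)
qed

lemma Q_continuous_bounded:
  fixes b :: "'a::euclidean_space \<times> 'a \<Rightarrow> complex"
  assumes b: "unit_symbol b" and t: "t \<in> {0..1}" and u: "u \<in> schwartz"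
  shows "continuous_on UNIV (Q t b u)" "\<exists>M. \<forall>x. norm (Q t b u x) \<le> M"
proof -
  obtain C where C: "C \<ge> 0" "\<And>x \<xi>. norm (Q_inner t b u x \<xi>) \<le> C * wt (2 * DIM('a)) \<xi>"
    using Q_inner_schwartz_bound[OF b t u] by metis
  note c = Q_inner_continuous[OF b schwartz_continuous[OF u] schwartz_integrable[OF u], of t]
  have c1: "continuous_on UNIV (\<lambda>x. Q_inner t b u x \<xi>)" for \<xi>
    using continuous_on_compose2[OF c, of UNIV "\<lambda>x. (x, \<xi>)"] by (simp add: continuous_intros)
  have c2: "continuous_on UNIV (\<lambda>\<xi>. Q_inner t b u x \<xi>)" for x
    using continuous_on_compose2[OF c, of UNIV "\<lambda>\<xi>. (x, \<xi>)"] by (simp add: continuous_intros)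
  show "continuous_on UNIV (Q t b u)"
    unfolding Q_def[abs_def]
    by (rule continuous_on_integral_dominated[where p = "\<lambda>\<xi>. C * wt (2 * DIM('a)) \<xi>"])
       (use c1 C borel_measurable_continuous_onI[OF c2] in \<open>auto intro!: wt_integrable integrable_mult_right\<close>)
  have "norm (Q t b u x) \<le> C * (\<integral>\<xi>. wt (2 * DIM('a)) (\<xi>::'a) \<partial>lborel)" for x
    unfolding Q_def
    by (rule integrable_wt_bound(2)[where a = 0]) (use C borel_measurable_continuous_onI[OF c2] in auto)
  then show "\<exists>M. \<forall>x. norm (Q t b u x) \<le> M" by blast
qed

lemma Q_inner_packet_measurable:
  fixes b :: "'a::euclidean_space \<times> 'a \<Rightarrow> complex"
  assumes b: "unit_symbol b"
  shows "(\<lambda>z. Q_inner t b (packet (fst z)) (fst (snd z)) (snd (snd z))) \<in> borel_measurable borel"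
  unfolding Q_inner_def
  by (rule measurable_integral, rule borel_measurable_continuous_onI)
     (intro continuous_intros amp_continuous unit_symbol_smooth[OF b])

lemma Q_inner_packet_measurable':
  fixes b :: "'a::euclidean_space \<times> 'a \<Rightarrow> complex"
  assumes b: "unit_symbol b" and "continuous_on UNIV f" "continuous_on UNIV g" "continuous_on UNIV h"
  shows "(\<lambda>z. Q_inner t b (packet (f z)) (g z) (h z)) \<in> borel_measurable borel"
proof -
  have "(\<lambda>z. (f z, g z, h z)) \<in> borel_measurable borel"
    by (intro borel_measurable_continuous_onI continuous_intros assms)
  from measurable_compose[OF this Q_inner_packet_measurable[OF b]] show ?thesis by simp
qed

lemma Q_packet_measurable:
  fixes b :: "'a::euclidean_space \<times> 'a \<Rightarrow> complex" and f :: "'c::euclidean_space \<Rightarrow> 'a \<times> 'a"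
  assumes b: "unit_symbol b" and "continuous_on UNIV f" "continuous_on UNIV g"
  shows "(\<lambda>z. Q t b (packet (f z)) (g z)) \<in> borel_measurable borel"
  unfolding Q_def
  by (rule measurable_integral, rule Q_inner_packet_measurable'[OF b])
     (intro continuous_intros continuous_on_compose2[OF assms(2)] continuous_on_compose2[OF assms(3)] subset_UNIV)+

lemma Q_packet_bounded:
  fixes b :: "'a::euclidean_space \<times> 'a \<Rightarrow> complex"
  assumes b: "unit_symbol b" and t: "t \<in> {0..1}"
  obtains C where "C \<ge> 0" "\<And>w x. norm (Q t b (packet w) x) \<le> C"
proof -
  obtain C where C: "C \<ge> 0" "\<And>w x \<xi>. norm (Q_inner t b (packet w) x \<xi>) \<le> C * wt (2 * DIM('a)) (\<xi> - snd w)"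
    using Q_inner_packet_bound[OF b t] by metis
  have "norm (Q t b (packet w) x) \<le> C * (\<integral>\<xi>. wt (2 * DIM('a)) (\<xi>::'a) \<partial>lborel)" for w x
    unfolding Q_def
    by (rule integrable_wt_bound(2)[OF _ C(2)]) (intro Q_inner_packet_measurable'[OF b] continuous_intros)
  then show ?thesis using that C by (meson Bochner_Integration.integral_nonneg mult_nonneg_nonneg wt_nonneg)
qed

section \<open>Operators in the packet representation\<close>

lemma fbi_product_measurable:
  assumes "u \<in> schwartz" "continuous_on UNIV f"
  shows "(\<lambda>z. fbi u (f z)) \<in> borel_measurable borel"
  by (rule measurable_compose[OF borel_measurable_continuous_onI[OF assms(2)] fbi_measurable[OF schwartz_measurable[OF assms(1)]]])

lemma schwartz_fbi_inversion:
  fixes u :: "'a::euclidean_space \<Rightarrow> complex"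
  assumes u: "u \<in> schwartz"
  shows "(\<integral>w. fbi u w * packet w x \<partial>lborel) = of_real (fbi_mass TYPE('a)) * u x"
proof -
  obtain M where M: "\<And>x. norm (u x) \<le> M" using schwartz_bounded[OF u] by metis
  obtain B where B: "\<And>w. norm (fbi u w) \<le> B * wt (2 * DIM('a \<times> 'a)) w" using fbi_decay[OF u] by metis
  show ?thesis by (rule fbi_inversion(2)[OF schwartz_continuous[OF u] M B])
qed

lemma Q_inner_fbi:
  fixes b :: "'a::euclidean_space \<times> 'a \<Rightarrow> complex"
  assumes b: "unit_symbol b" and u: "u \<in> schwartz"
  shows "of_real (fbi_mass TYPE('a)) * Q_inner t b u x \<xi> = (\<integral>w. fbi u w * Q_inner t b (packet w) x \<xi> \<partial>lborel)"
proof -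
  let ?k = "2 * DIM('a)"
  obtain C where C: "C \<ge> 0" "derivs_le 0 (\<lambda>_. C) b" using unit_symbol_bound[OF b] by metis
  obtain D where D: "D \<ge> 0" "\<And>x::'a. gauss x \<le> D * wt ?k x" using gauss_le_wt by metis
  let ?h = "\<lambda>y w. amp t b x \<xi> y * (fbi u w * packet w y)"
  have "of_real (fbi_mass TYPE('a)) * Q_inner t b u x \<xi> = (\<integral>y. amp t b x \<xi> y * (of_real (fbi_mass TYPE('a)) * u y) \<partial>lborel)"
    unfolding Q_inner_def by (simp only: integral_mult_right_zero[symmetric] mult.left_commute)
  also have "\<dots> = (\<integral>y. (\<integral>w. ?h y w \<partial>lborel) \<partial>lborel)"
    by (simp only: schwartz_fbi_inversion[OF u, symmetric] integral_mult_right_zero)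
  also have "\<dots> = (\<integral>w. (\<integral>y. ?h y w \<partial>lborel) \<partial>lborel)"
  \<comment> \<open>Peetre's inequality moves the Gaussian centred at \<open>fst w\<close> to the
    origin; the polynomial loss in \<open>w\<close> is absorbed by the rapid decay of
    \<open>fbi u\<close>.\<close>
  proof (rule lborel_swap_dominated[where p = "\<lambda>y. (C * D) * wt ?k y" and q = "\<lambda>w. (1 + norm w) ^ ?k * norm (fbi u w)"])
    show "case_prod ?h \<in> borel_measurable borel"
      unfolding case_prod_beta'
      by (intro borel_measurable_times fbi_product_measurable u borel_measurable_continuous_onI continuous_intros
          amp_continuous unit_symbol_smooth[OF b])
    fix y :: 'a and w :: "'a \<times> 'a"
    have "gauss (y - fst w) \<le> D * wt ?k (y + (- fst w))" using D(2)[of "y - fst w"] by simp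
    also have "\<dots> \<le> D * ((1 + norm (- fst w)) ^ ?k * wt ?k y)" by (rule mult_left_mono[OF wt_peetre D(1)])
    also have "\<dots> \<le> D * ((1 + norm w) ^ ?k * wt ?k y)"
      using D(1) norm_fst_le[of "fst w" "snd w"] by (intro mult_left_mono mult_right_mono power_mono) auto
    finally have g: "gauss (y - fst w) \<le> D * ((1 + norm w) ^ ?k * wt ?k y)" .
    have "norm (?h y w) \<le> C * (norm (fbi u w) * (D * ((1 + norm w) ^ ?k * wt ?k y)))"
      unfolding norm_mult norm_packet using C g by (intro mult_mono amp_bound[OF C(2)]) auto
    then show "norm (?h y w) \<le> ((C * D) * wt ?k y) * ((1 + norm w) ^ ?k * norm (fbi u w))"
      by (simp only: mult_ac)
  qed (intro integrable_mult_right wt_integrable rapid_weight_integrable fbi_rapid u order_refl)+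
  also have "\<dots> = (\<integral>w. fbi u w * Q_inner t b (packet w) x \<xi> \<partial>lborel)"
    unfolding Q_inner_def by (simp only: integral_mult_right_zero[symmetric] mult.left_commute)
  finally show ?thesis .
qed

lemma Q_fbi:
  fixes b :: "'a::euclidean_space \<times> 'a \<Rightarrow> complex"
  assumes b: "unit_symbol b" and t: "t \<in> {0..1}" and u: "u \<in> schwartz"
  shows "of_real (fbi_mass TYPE('a)) * Q t b u x = (\<integral>w. fbi u w * Q t b (packet w) x \<partial>lborel)"
proof -
  let ?k = "2 * DIM('a)"
  obtain C where C: "C \<ge> 0" "\<And>w x \<xi>. norm (Q_inner t b (packet w) x \<xi>) \<le> C * wt ?k (\<xi> - snd w)"
    using Q_inner_packet_bound[OF b t] by metis
  let ?h = "\<lambda>\<xi> w. fbi u w * Q_inner t b (packet w) x \<xi>"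
  have "of_real (fbi_mass TYPE('a)) * Q t b u x = (\<integral>\<xi>. (\<integral>w. ?h \<xi> w \<partial>lborel) \<partial>lborel)"
    unfolding Q_def by (simp only: integral_mult_right_zero[symmetric] Q_inner_fbi[OF b u])
  also have "\<dots> = (\<integral>w. (\<integral>\<xi>. ?h \<xi> w \<partial>lborel) \<partial>lborel)"
  proof (rule lborel_swap_dominated[where p = "\<lambda>\<xi>. C * wt ?k \<xi>" and q = "\<lambda>w. (1 + norm w) ^ ?k * norm (fbi u w)"])
    show "case_prod ?h \<in> borel_measurable borel"
      unfolding case_prod_beta'
      by (intro borel_measurable_times fbi_product_measurable u Q_inner_packet_measurable'[OF b] continuous_intros)
    fix \<xi> :: 'a and w :: "'a \<times> 'a"
    have "wt ?k (\<xi> + (- snd w)) \<le> (1 + norm (- snd w)) ^ ?k * wt ?k \<xi>" by (rule wt_peetre)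
    also have "\<dots> \<le> (1 + norm w) ^ ?k * wt ?k \<xi>"
      using norm_snd_le[of "snd w" "fst w"] by (intro mult_right_mono power_mono) auto
    finally have g: "wt ?k (\<xi> - snd w) \<le> (1 + norm w) ^ ?k * wt ?k \<xi>" by simp
    have "norm (?h \<xi> w) \<le> norm (fbi u w) * (C * ((1 + norm w) ^ ?k * wt ?k \<xi>))"
      unfolding norm_mult using C(1) g by (intro mult_left_mono order_trans[OF C(2)]) auto
    then show "norm (?h \<xi> w) \<le> (C * wt ?k \<xi>) * ((1 + norm w) ^ ?k * norm (fbi u w))"
      by (simp only: mult_ac)
  qed (intro integrable_mult_right wt_integrable rapid_weight_integrable fbi_rapid u order_refl)+
  finally show ?thesis unfolding Q_def by (simp only: integral_mult_right_zero)
qed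

text \<open>Up to the factor \<open>fbi_mass\<close>, the integral kernel of the operator in the
  packet representation: the first argument is the source, the second the target.\<close>

definition wave_kernel :: "real \<Rightarrow> ('a::euclidean_space \<times> 'a \<Rightarrow> complex) \<Rightarrow> 'a \<times> 'a \<Rightarrow> 'a \<times> 'a \<Rightarrow> complex" where
  "wave_kernel t b w w' = fbi (Q t b (packet w)) w'"

lemma wave_kernel_measurable:
  fixes b :: "'a::euclidean_space \<times> 'a \<Rightarrow> complex" and f :: "'c::euclidean_space \<Rightarrow> 'a \<times> 'a"
  assumes b: "unit_symbol b" and f: "continuous_on UNIV f" and g: "continuous_on UNIV g"
  shows "(\<lambda>z. wave_kernel t b (f z) (g z)) \<in> borel_measurable borel"
  unfolding wave_kernel_def fbi_def
  by (rule measurable_integral, rule borel_measurable_times, rule Q_packet_measurable[OF b])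
     (intro borel_measurable_continuous_onI continuous_intros continuous_on_compose2[OF f] continuous_on_compose2[OF g] subset_UNIV)+

lemma fbi_Q:
  fixes b :: "'a::euclidean_space \<times> 'a \<Rightarrow> complex"
  assumes b: "unit_symbol b" and t: "t \<in> {0..1}" and u: "u \<in> schwartz"
  shows "of_real (fbi_mass TYPE('a)) * fbi (Q t b u) w' = (\<integral>w. fbi u w * wave_kernel t b w w' \<partial>lborel)"
proof -
  obtain C where C: "C \<ge> 0" "\<And>w x. norm (Q t b (packet w) x) \<le> C"
    using Q_packet_bounded[OF b t] by metis
  let ?h = "\<lambda>x w. fbi u w * Q t b (packet w) x * cnj (packet w' x)"
  have "of_real (fbi_mass TYPE('a)) * fbi (Q t b u) w' =
      (\<integral>x. (of_real (fbi_mass TYPE('a)) * Q t b u x) * cnj (packet w' x) \<partial>lborel)"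
    unfolding fbi_def by (simp only: integral_mult_right_zero[symmetric] mult.assoc)
  also have "\<dots> = (\<integral>x. (\<integral>w. ?h x w \<partial>lborel) \<partial>lborel)"
    by (simp only: Q_fbi[OF b t u] integral_mult_left_zero)
  also have "\<dots> = (\<integral>w. (\<integral>x. ?h x w \<partial>lborel) \<partial>lborel)"
  proof (rule lborel_swap_dominated[where p = "\<lambda>x. C * gauss (x - fst w')" and q = "\<lambda>w. norm (fbi u w)"])
    show "case_prod ?h \<in> borel_measurable borel"
      unfolding case_prod_beta'
      by (intro borel_measurable_times fbi_product_measurable u Q_packet_measurable[OF b]
          borel_measurable_continuous_onI continuous_intros)
    fix x :: 'a and w :: "'a \<times> 'a"
    have "norm (?h x w) \<le> norm (fbi u w) * C * gauss (x - fst w')"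
      unfolding norm_mult complex_mod_cnj norm_packet using C by (intro mult_right_mono mult_left_mono) auto
    then show "norm (?h x w) \<le> C * gauss (x - fst w') * norm (fbi u w)" by (simp only: mult_ac)
  qed (intro integrable_mult_right integrable_packet_norm integrable_norm rapid_integrable(1) fbi_rapid u)+
  also have "\<dots> = (\<integral>w. fbi u w * wave_kernel t b w w' \<partial>lborel)"
    unfolding wave_kernel_def fbi_def[of "Q t b (packet _)"] by (simp only: integral_mult_right_zero[symmetric] mult.assoc)
  finally show ?thesis .
qed


section \<open>The packet kernel as a Fourier transform of the localized symbol\<close>

text \<open>The sum t^2 + (1 - t)^2 is the coefficient of |\<nu>|^2 in the exponent of the two
  Gaussians; the second identity makes the completed square in \<open>wigner_gauss_eq\<close>
  collapse.\<close>

lemma interpolation_const: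
  fixes t :: real
  shows "0 < t\<^sup>2 + (1 - t)\<^sup>2" "(1 - 2 * t)\<^sup>2 = 2 * (t\<^sup>2 + (1 - t)\<^sup>2) - 1"
proof -
  show e: "(1 - 2 * t)\<^sup>2 = 2 * (t\<^sup>2 + (1 - t)\<^sup>2) - 1" by (simp add: power2_eq_square algebra_simps)
  show "0 < t\<^sup>2 + (1 - t)\<^sup>2" 
  proof -
    have "0 \<le> 2 * k - 1 \<Longrightarrow> 0 < k" for k :: real by linarith
    then show ?thesis using zero_le_power2[of "1 - 2 * t"] unfolding e .
  qed
qed

text \<open>Both Gaussians are bounded by weights of order 2k; half of the product pays for decay in
  \<zeta>, the other half for decay in \<nu>. This provides product majorants, uniform in t, when
  the Gaussians depend on two integration variables jointly.\<close>

lemma gauss_pair_bound: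
  obtains C where "C \<ge> 0" "\<And>(\<alpha>::'a::euclidean_space) (\<beta>::'a) (\<zeta>::'a) (\<nu>::'a). norm \<zeta> \<le> norm \<alpha> + norm \<beta> \<Longrightarrow> norm \<nu> \<le> norm \<alpha> + norm \<beta> \<Longrightarrow>
    gauss \<alpha> * gauss \<beta> \<le> C * (wt k \<zeta> * wt k \<nu>)"
proof -
  obtain C where C: "C \<ge> 0" "\<And>x::'a. gauss x \<le> C * wt (k + k) x" using gauss_le_wt by metis
  have "gauss \<alpha> * gauss \<beta> \<le> (C * C) * (wt k \<zeta> * wt k \<nu>)"
    if "norm \<zeta> \<le> norm \<alpha> + norm \<beta>" "norm \<nu> \<le> norm \<alpha> + norm \<beta>" for \<alpha> \<beta> \<zeta> \<nu> :: 'a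
  proof -
    have w: "wt k \<alpha> * wt k \<beta> \<le> wt k \<gamma>" if "norm \<gamma> \<le> norm \<alpha> + norm \<beta>" for \<gamma> :: 'a
    proof -
      have "1 + norm \<gamma> \<le> (1 + norm \<alpha>) * (1 + norm \<beta>)"
      proof -
        have "(1 + norm \<alpha>) * (1 + norm \<beta>) = 1 + norm \<alpha> + norm \<beta> + norm \<alpha> * norm \<beta>"
          by (simp add: algebra_simps)
        moreover have "0 \<le> norm \<alpha> * norm \<beta>" by simp
        ultimately show ?thesis using that by linarith
      qed
      then show ?thesis
        unfolding wt_def inverse_mult_distrib[symmetric] power_mult_distrib[symmetric]
        by (intro le_imp_inverse_le power_mono zero_less_power one_plus_norm_pos) auto
    qed
    have "gauss \<alpha> * gauss \<beta> \<le> (C * wt (k + k) \<alpha>) * (C * wt (k + k) \<beta>)"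
      using C by (intro mult_mono) auto
    also have "\<dots> = (C * C) * ((wt k \<alpha> * wt k \<beta>) * (wt k \<alpha> * wt k \<beta>))" by (simp add: wt_add mult_ac)
    also have "\<dots> \<le> (C * C) * (wt k \<zeta> * wt k \<nu>)"
      using C by (intro mult_left_mono mult_mono w that) auto
    finally show ?thesis .
  qed
  then show ?thesis using that[of "C * C"] C by auto
qed

text \<open>The cross Wigner transform of two unit Gaussians in the \<open>t\<close>-quantization.\<close>

definition wigner_gauss :: "real \<Rightarrow> 'a::euclidean_space \<Rightarrow> 'a \<Rightarrow> complex" where
  "wigner_gauss t \<zeta> \<eta> = (\<integral>\<nu>. cis (\<nu> \<bullet> \<eta>) * of_real (gauss (\<zeta> - t *\<^sub>R \<nu>) * gauss (\<zeta> + (1 - t) *\<^sub>R \<nu>)) \<partial>lborel)"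

lemma gauss_mult: "gauss \<alpha> * gauss \<beta> = exp (- ((norm \<alpha>)\<^sup>2 + (norm \<beta>)\<^sup>2) / 2)"
  unfolding gauss_def exp_add[symmetric] by (simp add: add_divide_distrib)

lemma norm_sq_pair:
  "(norm (\<zeta> - t *\<^sub>R \<nu>))\<^sup>2 + (norm (\<zeta> + (1 - t) *\<^sub>R \<nu>))\<^sup>2 =
    2 * (\<zeta> \<bullet> \<zeta>) + 2 * (1 - 2 * t) * (\<zeta> \<bullet> \<nu>) + (t\<^sup>2 + (1 - t)\<^sup>2) * (\<nu> \<bullet> \<nu>)"
proof -
  have "(norm (\<zeta> + r *\<^sub>R \<nu>))\<^sup>2 = \<zeta> \<bullet> \<zeta> + 2 * r * (\<zeta> \<bullet> \<nu>) + r\<^sup>2 * (\<nu> \<bullet> \<nu>)" for r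
    unfolding power2_norm_eq_inner
    by (simp add: inner_add_left inner_add_right inner_commute power2_eq_square algebra_simps)
  from this[of "- t"] this[of "1 - t"] show ?thesis by (simp add: algebra_simps)
qed

text \<open>Complete the square in \<nu>: the substitution \<nu> = e \<zeta> + s \<mu> with e = - (1
  - 2t) / \<kappa> and s = 1 / sqrt \<kappa> turns the exponent into |\<zeta>|^2 / \<kappa> +
  |\<mu>|^2, and a Gaussian Fourier transform in \<mu> remains. For t = 1/2 the cross phase vanishes
  and the familiar exp (- |\<zeta>|^2 - |\<eta>|^2) appears, up to a constant.\<close>

lemma wigner_gauss_eq:
  fixes t :: real
  defines "\<kappa> \<equiv> t\<^sup>2 + (1 - t)\<^sup>2"
  shows "wigner_gauss t \<zeta> (\<eta> :: 'a::euclidean_space) = of_real ((sqrt (2 * pi) / sqrt \<kappa>) ^ DIM('a)) *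
    exp (of_real (- 1 / (2 * \<kappa>)) * of_real (\<zeta> \<bullet> \<zeta> + \<eta> \<bullet> \<eta>) + \<i> * of_real (- (1 - 2 * t) / \<kappa>) * of_real (\<zeta> \<bullet> \<eta>))"
proof -
  have \<kappa>: "\<kappa> > 0" "(1 - 2 * t)\<^sup>2 = 2 * \<kappa> - 1" unfolding \<kappa>_def by (rule interpolation_const)+
  define s where "s = 1 / sqrt \<kappa>"
  have s: "s > 0" "\<kappa> * s\<^sup>2 = 1" "s\<^sup>2 = 1 / \<kappa>" using \<kappa> by (auto simp: s_def power_divide)
  define e where "e = - ((1 - 2 * t) / \<kappa>)"
  have e: "\<kappa> * e = - (1 - 2 * t)" "(1 - 2 * t) * e = - ((1 - 2 * t)\<^sup>2 / \<kappa>)"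
    using \<kappa>(1) by (auto simp: e_def power2_eq_square)
  let ?F = "\<lambda>\<nu>. cis (\<nu> \<bullet> \<eta>) * complex_of_real (gauss (\<zeta> - t *\<^sub>R \<nu>) * gauss (\<zeta> + (1 - t) *\<^sub>R \<nu>))"
  let ?c = "cis (e * (\<zeta> \<bullet> \<eta>)) * complex_of_real (exp (- (\<zeta> \<bullet> \<zeta>) / (2 * \<kappa>)))"
  have F: "?F (e *\<^sub>R \<zeta> + s *\<^sub>R \<mu>) = ?c * (of_real (gauss \<mu>) * cis ((s *\<^sub>R \<eta>) \<bullet> \<mu>))" for \<mu>
  proof -
    let ?\<nu> = "e *\<^sub>R \<zeta> + s *\<^sub>R \<mu>"
    have "(norm (\<zeta> - t *\<^sub>R ?\<nu>))\<^sup>2 + (norm (\<zeta> + (1 - t) *\<^sub>R ?\<nu>))\<^sup>2 =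
        2 * (\<zeta> \<bullet> \<zeta>) + 2 * (1 - 2 * t) * (\<zeta> \<bullet> ?\<nu>) + \<kappa> * (?\<nu> \<bullet> ?\<nu>)"
      unfolding \<kappa>_def by (rule norm_sq_pair)
    also have "\<zeta> \<bullet> ?\<nu> = e * (\<zeta> \<bullet> \<zeta>) + s * (\<zeta> \<bullet> \<mu>)" by (simp add: inner_add_right)
    also have "?\<nu> \<bullet> ?\<nu> = e\<^sup>2 * (\<zeta> \<bullet> \<zeta>) + 2 * (e * s) * (\<zeta> \<bullet> \<mu>) + s\<^sup>2 * (\<mu> \<bullet> \<mu>)"
      unfolding inner_add_right inner_add_left inner_scaleR_left inner_scaleR_right
      by (simp add: inner_commute power2_eq_square algebra_simps)
    also have "2 * (\<zeta> \<bullet> \<zeta>) + 2 * (1 - 2 * t) * (e * (\<zeta> \<bullet> \<zeta>) + s * (\<zeta> \<bullet> \<mu>)) +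
        \<kappa> * (e\<^sup>2 * (\<zeta> \<bullet> \<zeta>) + 2 * (e * s) * (\<zeta> \<bullet> \<mu>) + s\<^sup>2 * (\<mu> \<bullet> \<mu>)) =
        (2 - (1 - 2 * t)\<^sup>2 / \<kappa>) * (\<zeta> \<bullet> \<zeta>) + (\<kappa> * s\<^sup>2) * (\<mu> \<bullet> \<mu>)"
    proof -
      have "2 * Z + 2 * (1 - 2 * t) * (e * Z + s * X) + \<kappa> * (e\<^sup>2 * Z + 2 * (e * s) * X + s\<^sup>2 * M) =
          (2 + 2 * ((1 - 2 * t) * e) + (\<kappa> * e) * e) * Z + 2 * s * ((1 - 2 * t) + \<kappa> * e) * X + (\<kappa> * s\<^sup>2) * M"
        for Z X M by (simp add: algebra_simps power2_eq_square)
      note expand = this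
      have q: "(\<kappa> * e) * e = (1 - 2 * t)\<^sup>2 / \<kappa>"
        by (simp only: e(1) mult_minus_left e(2) minus_minus)
      show ?thesis unfolding expand unfolding q unfolding e by simp
    qed
    also have "\<dots> = (\<zeta> \<bullet> \<zeta>) / \<kappa> + \<mu> \<bullet> \<mu>"
      unfolding \<kappa>(2) s(2) using \<kappa>(1) by (simp add: field_simps)
    finally have AB: "(norm (\<zeta> - t *\<^sub>R ?\<nu>))\<^sup>2 + (norm (\<zeta> + (1 - t) *\<^sub>R ?\<nu>))\<^sup>2 = (\<zeta> \<bullet> \<zeta>) / \<kappa> + \<mu> \<bullet> \<mu>" .
    have "- ((\<zeta> \<bullet> \<zeta>) / \<kappa> + \<mu> \<bullet> \<mu>) / 2 = - (\<zeta> \<bullet> \<zeta>) / (2 * \<kappa>) + - (\<mu> \<bullet> \<mu>) / 2"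
      by (simp add: add_divide_distrib)
    then have gg: "gauss (\<zeta> - t *\<^sub>R ?\<nu>) * gauss (\<zeta> + (1 - t) *\<^sub>R ?\<nu>) = exp (- (\<zeta> \<bullet> \<zeta>) / (2 * \<kappa>)) * gauss \<mu>"
      unfolding gauss_mult AB by (simp only: exp_add gauss_def power2_norm_eq_inner)
    have "cis (?\<nu> \<bullet> \<eta>) = cis (e * (\<zeta> \<bullet> \<eta>)) * cis ((s *\<^sub>R \<eta>) \<bullet> \<mu>)"
      by (simp add: cis_mult inner_add_left inner_add_right inner_commute)
    then show ?thesis unfolding gg by (simp add: mult_ac)
  qed
  have Fm: "?F \<in> borel_measurable borel" by (intro borel_measurable_continuous_onI continuous_intros)
  have "(1 / \<bar>s\<bar> ^ DIM('a)) *\<^sub>R wigner_gauss t \<zeta> \<eta> = (\<integral>\<mu>. ?F (e *\<^sub>R \<zeta> + s *\<^sub>R \<mu>) \<partial>lborel)"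
    unfolding wigner_gauss_def using s(1) by (intro lborel_integral_affine[OF Fm, symmetric]) auto
  also have "\<dots> = ?c * of_real (sqrt (2 * pi) ^ DIM('a) * gauss (s *\<^sub>R \<eta>))"
    unfolding F integral_mult_right_zero integral_gauss_cis ..
  finally have wg: "(1 / \<bar>s\<bar> ^ DIM('a)) *\<^sub>R wigner_gauss t \<zeta> \<eta> = ?c * of_real (sqrt (2 * pi) ^ DIM('a) * gauss (s *\<^sub>R \<eta>))" .
  have "wigner_gauss t \<zeta> \<eta> = (s ^ DIM('a)) *\<^sub>R ((1 / \<bar>s\<bar> ^ DIM('a)) *\<^sub>R wigner_gauss t \<zeta> \<eta>)"
    using s(1) by simp
  also have "\<dots> = (s ^ DIM('a)) *\<^sub>R (?c * of_real (sqrt (2 * pi) ^ DIM('a) * gauss (s *\<^sub>R \<eta>)))"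
    by (simp only: wg)
  also have "gauss (s *\<^sub>R \<eta>) = exp (- (\<eta> \<bullet> \<eta>) / (2 * \<kappa>))"
    by (simp add: gauss_def power_mult_distrib s(3) power2_norm_eq_inner[symmetric])
  also have "(s ^ DIM('a)) *\<^sub>R (?c * of_real (sqrt (2 * pi) ^ DIM('a) * exp (- (\<eta> \<bullet> \<eta>) / (2 * \<kappa>)))) =
      of_real ((sqrt (2 * pi) / sqrt \<kappa>) ^ DIM('a)) *
      (of_real (exp (- (\<zeta> \<bullet> \<zeta>) / (2 * \<kappa>)) * exp (- (\<eta> \<bullet> \<eta>) / (2 * \<kappa>))) * cis (e * (\<zeta> \<bullet> \<eta>)))"
    unfolding s_def power_divide scaleR_conv_of_real by (simp add: power_divide mult_ac)
  also have "exp (- (\<zeta> \<bullet> \<zeta>) / (2 * \<kappa>)) * exp (- (\<eta> \<bullet> \<eta>) / (2 * \<kappa>)) = exp ((- 1 / (2 * \<kappa>)) * (\<zeta> \<bullet> \<zeta> + \<eta> \<bullet> \<eta>))"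
    unfolding exp_add[symmetric] by (simp add: add_divide_distrib)
  finally have wg': "wigner_gauss t \<zeta> \<eta> = of_real ((sqrt (2 * pi) / sqrt \<kappa>) ^ DIM('a)) *
      (of_real (exp ((- 1 / (2 * \<kappa>)) * (\<zeta> \<bullet> \<zeta> + \<eta> \<bullet> \<eta>))) * cis (e * (\<zeta> \<bullet> \<eta>)))" .
  have "- (1 - 2 * t) / \<kappa> = e" unfolding e_def by (rule minus_divide_left[symmetric])
  then show ?thesis unfolding wg'
    by (simp only: cis_conv_exp exp_of_real[symmetric] exp_add[symmetric] of_real_mult mult.assoc)
qed

lemma wigner_gauss_schwartz:
  "(\<lambda>z. wigner_gauss t (fst z) (snd z)) \<in> (schwartz :: ('a::euclidean_space \<times> 'a \<Rightarrow> complex) set)"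
proof -
  define \<kappa> where "\<kappa> = t\<^sup>2 + (1 - t)\<^sup>2"
  have \<kappa>: "\<kappa> > 0" unfolding \<kappa>_def by (rule interpolation_const)
  let ?q = "\<lambda>z::'a \<times> 'a. of_real (- 1 / (2 * \<kappa>)) * (complex_of_real (fst z \<bullet> fst z) + of_real (snd z \<bullet> snd z)) +
      (\<i> * of_real (- (1 - 2 * t) / \<kappa>)) * of_real (fst z \<bullet> snd z)"
  have q: "slow ?q"
    by (intro slow_add slow_mult slow_const slow_inner_product bounded_linear_fst bounded_linear_snd)
  have "(\<lambda>z. of_real ((sqrt (2 * pi) / sqrt \<kappa>) ^ DIM('a)) * exp (?q z)) \<in> schwartz"
  proof (rule slow_exp_schwartz[OF q _ _ slow_const])
    show "0 < 1 / (2 * \<kappa>)" using \<kappa> by simp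
    show "Re (?q z) \<le> - (1 / (2 * \<kappa>)) * (norm z)\<^sup>2" for z
      by (simp add: power2_norm_eq_inner inner_prod_def)
  qed
  moreover have "wigner_gauss t (fst z) (snd z) = of_real ((sqrt (2 * pi) / sqrt \<kappa>) ^ DIM('a)) * exp (?q z)" for z :: "'a \<times> 'a"
    unfolding wigner_gauss_eq \<kappa>_def by (simp only: of_real_add)
  ultimately show ?thesis by simp
qed

text \<open>The recovery of a symbol from its packet kernel divides by this value.\<close>

lemma wigner_gauss_0: "wigner_gauss t 0 (0::'a::euclidean_space) \<noteq> 0"
proof -
  have "t\<^sup>2 + (1 - t)\<^sup>2 \<noteq> 0" by (simp add: sum_power2_eq_zero_iff)
  then show ?thesis by (simp add: wigner_gauss_eq)
qed

text \<open>After the shift v = x2 - x1 + \<nu> both Gaussians depend only on \<nu> and on the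
  deviation of z from the t-dependent intermediate position. The phases that do not involve \<nu>
  come out in front, and the rest leaves the deviation of \<xi> from the intermediate
  frequency.\<close>

lemma wigner_packet:
  fixes x1 :: "'a::euclidean_space"
  shows "(\<integral>v. cis (v \<bullet> \<xi>) * (packet (x1, \<xi>1) (z - t *\<^sub>R v) * cnj (packet (x2, \<xi>2) (z + (1 - t) *\<^sub>R v))) \<partial>lborel) =
    cis ((\<xi>1 - \<xi>2) \<bullet> (z - (t *\<^sub>R x2 + (1 - t) *\<^sub>R x1))) * cis ((x2 - x1) \<bullet> \<xi>) *
    wigner_gauss t (z - (t *\<^sub>R x2 + (1 - t) *\<^sub>R x1)) (\<xi> - (t *\<^sub>R \<xi>1 + (1 - t) *\<^sub>R \<xi>2))"
proof -
  let ?F = "\<lambda>v. cis (v \<bullet> \<xi>) * (packet (x1, \<xi>1) (z - t *\<^sub>R v) * cnj (packet (x2, \<xi>2) (z + (1 - t) *\<^sub>R v)))"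
  let ?\<zeta> = "z - (t *\<^sub>R x2 + (1 - t) *\<^sub>R x1)" and ?\<eta> = "\<xi> - (t *\<^sub>R \<xi>1 + (1 - t) *\<^sub>R \<xi>2)"
  have "?F \<in> borel_measurable borel" by (intro borel_measurable_continuous_onI continuous_intros)
  from lborel_integral_shift[OF this, of "x2 - x1"]
  have "(\<integral>v. ?F v \<partial>lborel) = (\<integral>\<nu>. ?F ((x2 - x1) + \<nu>) \<partial>lborel)" by simp
  also have "\<dots> = (\<integral>\<nu>. (cis ((\<xi>1 - \<xi>2) \<bullet> ?\<zeta>) * cis ((x2 - x1) \<bullet> \<xi>)) *
      (cis (\<nu> \<bullet> ?\<eta>) * of_real (gauss (?\<zeta> - t *\<^sub>R \<nu>) * gauss (?\<zeta> + (1 - t) *\<^sub>R \<nu>))) \<partial>lborel)"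
  proof (intro Bochner_Integration.integral_cong refl)
    fix \<nu>
    have a: "z - t *\<^sub>R (x2 - x1 + \<nu>) - x1 = ?\<zeta> - t *\<^sub>R \<nu>" "z + (1 - t) *\<^sub>R (x2 - x1 + \<nu>) - x2 = ?\<zeta> + (1 - t) *\<^sub>R \<nu>"
      by (simp_all add: algebra_simps)
    have "(x2 - x1 + \<nu>) \<bullet> \<xi> + (\<xi>1 \<bullet> (?\<zeta> - t *\<^sub>R \<nu>) - \<xi>2 \<bullet> (?\<zeta> + (1 - t) *\<^sub>R \<nu>)) =
        (\<xi>1 - \<xi>2) \<bullet> ?\<zeta> + (x2 - x1) \<bullet> \<xi> + \<nu> \<bullet> ?\<eta>"
      by (simp only: inner_diff_left inner_diff_right inner_add_left inner_add_right inner_scaleR_left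
          inner_scaleR_right inner_commute[of _ \<nu>]) (simp add: algebra_simps)
    then have "cis ((x2 - x1 + \<nu>) \<bullet> \<xi>) * (cis (\<xi>1 \<bullet> (?\<zeta> - t *\<^sub>R \<nu>)) * cis (- (\<xi>2 \<bullet> (?\<zeta> + (1 - t) *\<^sub>R \<nu>)))) =
        cis ((\<xi>1 - \<xi>2) \<bullet> ?\<zeta>) * cis ((x2 - x1) \<bullet> \<xi>) * cis (\<nu> \<bullet> ?\<eta>)"
      by (simp only: cis_mult diff_conv_add_uminus)
    moreover have "?F ((x2 - x1) + \<nu>) = (cis ((x2 - x1 + \<nu>) \<bullet> \<xi>) * (cis (\<xi>1 \<bullet> (?\<zeta> - t *\<^sub>R \<nu>)) * cis (- (\<xi>2 \<bullet> (?\<zeta> + (1 - t) *\<^sub>R \<nu>))))) *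
        of_real (gauss (?\<zeta> - t *\<^sub>R \<nu>) * gauss (?\<zeta> + (1 - t) *\<^sub>R \<nu>))"
      unfolding packet_def fst_conv snd_conv a by (simp add: cis_cnj mult_ac)
    ultimately show "?F ((x2 - x1) + \<nu>) = (cis ((\<xi>1 - \<xi>2) \<bullet> ?\<zeta>) * cis ((x2 - x1) \<bullet> \<xi>)) *
      (cis (\<nu> \<bullet> ?\<eta>) * of_real (gauss (?\<zeta> - t *\<^sub>R \<nu>) * gauss (?\<zeta> + (1 - t) *\<^sub>R \<nu>)))"
      by (simp only: mult.assoc)
  qed
  also have "\<dots> = (cis ((\<xi>1 - \<xi>2) \<bullet> ?\<zeta>) * cis ((x2 - x1) \<bullet> \<xi>)) * wigner_gauss t ?\<zeta> ?\<eta>"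
    unfolding wigner_gauss_def by (rule integral_mult_right_zero)
  finally show ?thesis .
qed

text \<open>In the variables z = t x + (1 - t) y, where the symbol is evaluated, and v = x - y, the
  v-integral is a cross Wigner transform of the two packets. What remains is a Fourier integral of
  the symbol localized by a Schwartz window at the intermediate point \<open>(mx, m\<xi>)\<close>;
  its frequency is w' - w turned by the symplectic matrix. Smoothness of the symbol thus becomes
  decay off the diagonal, and its size near the intermediate point the size of the kernel.\<close>

lemma wave_kernel_eq:
  fixes b :: "'a::euclidean_space \<times> 'a \<Rightarrow> complex" and x1 x2 \<xi>1 \<xi>2 :: 'a
  assumes b: "unit_symbol b" and t: "t \<in> {0..1}"
  defines "mx \<equiv> t *\<^sub>R x2 + (1 - t) *\<^sub>R x1" and "m\<xi> \<equiv> t *\<^sub>R \<xi>1 + (1 - t) *\<^sub>R \<xi>2"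
  shows "wave_kernel t b (x1, \<xi>1) (x2, \<xi>2) = cis ((x2 - x1) \<bullet> m\<xi>) *
    (\<integral>z. (b ((mx, m\<xi>) + z) * wigner_gauss t (fst z) (snd z)) * cis ((\<xi>1 - \<xi>2, x2 - x1) \<bullet> z) \<partial>lborel)"
proof -
  let ?k = "2 * DIM('a)"
  let ?p1 = "packet (x1, \<xi>1)" and ?p2 = "packet (x2, \<xi>2)"
  note sb = unit_symbol_smooth[OF b]
  obtain Cb where Cb: "Cb \<ge> 0" "derivs_le 0 (\<lambda>_. Cb) b" using unit_symbol_bound[OF b] by metis
  have nb: "norm (b z) \<le> Cb" for z using derivs_leD[OF Cb(2)] .
  obtain C where C: "C \<ge> 0" "\<And>w x \<xi>. norm (Q_inner t b (packet w) x \<xi>) \<le> C * wt ?k (\<xi> - snd w)"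
    using Q_inner_packet_bound[OF b t] by metis
  obtain G where G: "G \<ge> 0" "\<And>(\<alpha>::'a) (\<beta>::'a) (\<zeta>::'a) (\<nu>::'a). norm \<zeta> \<le> norm \<alpha> + norm \<beta> \<Longrightarrow> norm \<nu> \<le> norm \<alpha> + norm \<beta> \<Longrightarrow>
    gauss \<alpha> * gauss \<beta> \<le> G * (wt ?k \<zeta> * wt ?k \<nu>)"
    using gauss_pair_bound[where k = ?k] by blast
  have wi: "integrable lborel (\<lambda>x. c * wt ?k (x - a))" for c and a :: 'a
    by (intro integrable_mult_right lborel_integrable_shift wt_integrable order_refl)
  let ?W = "\<lambda>z \<xi>. cis ((\<xi>1 - \<xi>2) \<bullet> (z - mx)) * cis ((x2 - x1) \<bullet> \<xi>) * wigner_gauss t (z - mx) (\<xi> - m\<xi>)"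
  have inner: "(\<integral>x. Q_inner t b ?p1 x \<xi> * cnj (?p2 x) \<partial>lborel) = (\<integral>z. b (z, \<xi>) * ?W z \<xi> \<partial>lborel)" for \<xi>
  proof -
    let ?h = "\<lambda>x y. amp t b x \<xi> y * ?p1 y * cnj (?p2 x)"
    let ?H = "\<lambda>x v. ?h x (x - v)"
    let ?J = "\<lambda>z v. b (z, \<xi>) * (cis (v \<bullet> \<xi>) * (?p1 (z - t *\<^sub>R v) * cnj (?p2 (z + (1 - t) *\<^sub>R v))))"
    have "(\<integral>x. Q_inner t b ?p1 x \<xi> * cnj (?p2 x) \<partial>lborel) = (\<integral>x. (\<integral>y. ?h x y \<partial>lborel) \<partial>lborel)"
      unfolding Q_inner_def by (simp only: integral_mult_left_zero)
    also have "\<dots> = (\<integral>x. (\<integral>v. ?H x v \<partial>lborel) \<partial>lborel)"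
      by (intro Bochner_Integration.integral_cong refl lborel_integral_reflect[symmetric]
          borel_measurable_continuous_onI continuous_intros amp_continuous sb)
    also have "\<dots> = (\<integral>v. (\<integral>x. ?H x v \<partial>lborel) \<partial>lborel)"
    proof (rule lborel_swap_dominated[where p = "\<lambda>x. (Cb * G) * wt ?k (x - x2)" and q = "\<lambda>v. 1 * wt ?k (v - (x2 - x1))"])
      show "case_prod ?H \<in> borel_measurable borel"
        unfolding case_prod_beta' by (intro borel_measurable_continuous_onI continuous_intros amp_continuous sb)
      fix x v :: 'a
      have "norm (x - x2) \<le> norm (x - v - x1) + norm (x - x2)" by simp
      moreover have "norm (v - (x2 - x1)) \<le> norm (x - v - x1) + norm (x - x2)"
        using norm_triangle_ineq4[of "x - x2" "x - v - x1"] by (simp add: algebra_simps)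
      ultimately have g: "gauss (x - v - x1) * gauss (x - x2) \<le> G * (wt ?k (x - x2) * wt ?k (v - (x2 - x1)))"
        by (rule G(2))
      have "norm (?H x v) = norm (amp t b x \<xi> (x - v)) * (gauss (x - v - x1) * gauss (x - x2))"
        unfolding norm_mult complex_mod_cnj norm_packet by simp
      also have "\<dots> \<le> Cb * (G * (wt ?k (x - x2) * wt ?k (v - (x2 - x1))))"
        by (rule mult_mono[OF amp_bound[OF Cb(2)] g]) (use Cb in auto)
      finally show "norm (?H x v) \<le> (Cb * G) * wt ?k (x - x2) * (1 * wt ?k (v - (x2 - x1)))" by (simp only: mult_ac)
    qed (rule wi)+
    \<comment> \<open>The shift x = z + (1 - t) v makes t x + (1 - t) y equal to z, so that the
      symbol no longer depends on v.\<close>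
    also have "\<dots> = (\<integral>v. (\<integral>z. ?H ((1 - t) *\<^sub>R v + z) v \<partial>lborel) \<partial>lborel)"
      by (intro Bochner_Integration.integral_cong refl lborel_integral_shift[symmetric]
          borel_measurable_continuous_onI continuous_intros amp_continuous sb)
    also have "\<dots> = (\<integral>v. (\<integral>z. ?J z v \<partial>lborel) \<partial>lborel)"
    proof (intro Bochner_Integration.integral_cong refl)
      fix v z :: 'a
      have h: "(1 - t) *\<^sub>R v + z - v = z - t *\<^sub>R v"
        "t *\<^sub>R ((1 - t) *\<^sub>R v + z) + (1 - t) *\<^sub>R (z - t *\<^sub>R v) = z"
        "(1 - t) *\<^sub>R v + z - (z - t *\<^sub>R v) = v"
        by (simp_all add: algebra_simps)
      have c: "(1 - t) *\<^sub>R v + z = z + (1 - t) *\<^sub>R v" by (rule add.commute)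
      show "?H ((1 - t) *\<^sub>R v + z) v = ?J z v"
        unfolding amp_def h unfolding c by (simp only: mult_ac)
    qed
    also have "\<dots> = (\<integral>z. (\<integral>v. ?J z v \<partial>lborel) \<partial>lborel)"
    proof (rule lborel_swap_dominated[where q = "\<lambda>z. (Cb * G) * wt ?k (z - mx)" and p = "\<lambda>v. 1 * wt ?k (v - (x2 - x1))"])
      show "(\<lambda>(v, z). ?J z v) \<in> borel_measurable borel"
        unfolding case_prod_beta'
        by (intro borel_measurable_continuous_onI continuous_intros
            continuous_on_compose2[OF smooth_continuous[OF sb, of UNIV]]) auto
      fix v z :: 'a
      \<comment> \<open>These are the arguments of the two Gaussians: \<open>z - mx\<close> is a
        convex combination of them and \<open>v - (x2 - x1)\<close> their difference, as
        \<open>gauss_pair_bound\<close> requires.\<close>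
      let ?\<alpha> = "z - t *\<^sub>R v - x1" and ?\<beta> = "z + (1 - t) *\<^sub>R v - x2"
      have "z - mx = (1 - t) *\<^sub>R ?\<alpha> + t *\<^sub>R ?\<beta>" unfolding mx_def by (simp add: algebra_simps)
      also have "norm \<dots> \<le> norm ((1 - t) *\<^sub>R ?\<alpha>) + norm (t *\<^sub>R ?\<beta>)" by (rule norm_triangle_ineq)
      also have "\<dots> \<le> norm ?\<alpha> + norm ?\<beta>" using t by (auto intro!: add_mono mult_left_le_one_le)
      finally have "norm (z - mx) \<le> norm ?\<alpha> + norm ?\<beta>" .
      moreover have "norm (v - (x2 - x1)) \<le> norm ?\<alpha> + norm ?\<beta>"
        using norm_triangle_ineq4[of ?\<beta> ?\<alpha>] by (simp add: algebra_simps)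
      ultimately have g: "gauss ?\<alpha> * gauss ?\<beta> \<le> G * (wt ?k (z - mx) * wt ?k (v - (x2 - x1)))"
        by (rule G(2))
      have "norm (?J z v) = norm (b (z, \<xi>)) * (gauss ?\<alpha> * gauss ?\<beta>)"
        unfolding norm_mult complex_mod_cnj norm_packet by simp
      also have "\<dots> \<le> Cb * (G * (wt ?k (z - mx) * wt ?k (v - (x2 - x1))))"
        by (rule mult_mono[OF nb g]) (use Cb in auto)
      finally show "norm (?J z v) \<le> (1 * wt ?k (v - (x2 - x1))) * ((Cb * G) * wt ?k (z - mx))" by (simp only: mult_ac)
    qed (rule wi)+
    also have "\<dots> = (\<integral>z. b (z, \<xi>) * ?W z \<xi> \<partial>lborel)"
      by (simp only: integral_mult_right_zero wigner_packet mx_def m\<xi>_def)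
    finally show ?thesis .
  qed
  have scg: "continuous_on UNIV (\<lambda>z::'a \<times> 'a. wigner_gauss t (fst z) (snd z))"
    by (rule schwartz_continuous[OF wigner_gauss_schwartz])
  have wc: "continuous_on S (\<lambda>z. wigner_gauss t (f z) (g z))" if "continuous_on S f" "continuous_on S g" for S :: "'c::topological_space set" and f g :: "'c \<Rightarrow> 'a"
    using continuous_on_compose2[OF scg continuous_on_Pair[OF that]] by simp
  have bc: "continuous_on S (\<lambda>z. b (f z))" if "continuous_on S f" for S :: "'c::topological_space set" and f :: "'c \<Rightarrow> 'a \<times> 'a"
    using continuous_on_compose2[OF smooth_continuous[OF sb, of UNIV] that] by simp
  obtain D where D: "D \<ge> 0" "\<And>z::'a \<times> 'a. norm (wigner_gauss t (fst z) (snd z)) \<le> D * wt (?k + ?k) z"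
    using schwartz_bound[OF wigner_gauss_schwartz] by metis
  have "wave_kernel t b (x1, \<xi>1) (x2, \<xi>2) = (\<integral>x. (\<integral>\<xi>. Q_inner t b ?p1 x \<xi> * cnj (?p2 x) \<partial>lborel) \<partial>lborel)"
    unfolding wave_kernel_def fbi_def Q_def by (simp only: integral_mult_left_zero)
  also have "\<dots> = (\<integral>\<xi>. (\<integral>x. Q_inner t b ?p1 x \<xi> * cnj (?p2 x) \<partial>lborel) \<partial>lborel)"
  proof (rule lborel_swap_dominated[where p = "\<lambda>x. gauss (x - x2)" and q = "\<lambda>\<xi>. C * wt ?k (\<xi> - \<xi>1)"])
    show "(\<lambda>(x, \<xi>). Q_inner t b ?p1 x \<xi> * cnj (?p2 x)) \<in> borel_measurable borel"
      unfolding case_prod_beta'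
      by (intro borel_measurable_times Q_inner_packet_measurable'[OF b] borel_measurable_continuous_onI continuous_intros)
    fix x \<xi> :: 'a
    have "norm (Q_inner t b ?p1 x \<xi> * cnj (?p2 x)) \<le> (C * wt ?k (\<xi> - \<xi>1)) * gauss (x - x2)"
      unfolding norm_mult complex_mod_cnj norm_packet using C(1) C(2)[of "(x1, \<xi>1)" x \<xi>] by (intro mult_mono) auto
    then show "norm (Q_inner t b ?p1 x \<xi> * cnj (?p2 x)) \<le> gauss (x - x2) * (C * wt ?k (\<xi> - \<xi>1))"
      by (simp only: mult.commute)
  qed (rule integrable_packet_norm wi)+
  also have "\<dots> = (\<integral>\<xi>. (\<integral>z. b (z, \<xi>) * ?W z \<xi> \<partial>lborel) \<partial>lborel)" by (simp only: inner)
  also have "\<dots> = (\<integral>\<xi>. (\<integral>\<zeta>. b (mx + \<zeta>, \<xi>) * ?W (mx + \<zeta>) \<xi> \<partial>lborel) \<partial>lborel)"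
    by (intro Bochner_Integration.integral_cong refl lborel_integral_shift[symmetric]
        borel_measurable_continuous_onI continuous_intros wc bc)
  also have "\<dots> = (\<integral>\<eta>. (\<integral>\<zeta>. b (mx + \<zeta>, m\<xi> + \<eta>) * ?W (mx + \<zeta>) (m\<xi> + \<eta>) \<partial>lborel) \<partial>lborel)"
    by (intro lborel_integral_shift[symmetric] measurable_integral
        borel_measurable_continuous_onI continuous_intros wc bc)
  also have "\<dots> = (\<integral>\<eta>. (\<integral>\<zeta>. cis ((x2 - x1) \<bullet> m\<xi>) *
      ((b (mx + \<zeta>, m\<xi> + \<eta>) * wigner_gauss t \<zeta> \<eta>) * cis ((\<xi>1 - \<xi>2, x2 - x1) \<bullet> (\<zeta>, \<eta>))) \<partial>lborel) \<partial>lborel)"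
  proof (intro Bochner_Integration.integral_cong refl)
    fix \<eta> \<zeta> :: 'a
    have "cis ((\<xi>1 - \<xi>2) \<bullet> \<zeta>) * cis ((x2 - x1) \<bullet> (m\<xi> + \<eta>)) = cis ((x2 - x1) \<bullet> m\<xi>) * cis ((\<xi>1 - \<xi>2, x2 - x1) \<bullet> (\<zeta>, \<eta>))"
      by (simp add: cis_mult inner_add_right add_ac)
    then show "b (mx + \<zeta>, m\<xi> + \<eta>) * ?W (mx + \<zeta>) (m\<xi> + \<eta>) = cis ((x2 - x1) \<bullet> m\<xi>) *
      ((b (mx + \<zeta>, m\<xi> + \<eta>) * wigner_gauss t \<zeta> \<eta>) * cis ((\<xi>1 - \<xi>2, x2 - x1) \<bullet> (\<zeta>, \<eta>)))"
      by (simp add: mult_ac)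
  qed
  also have "\<dots> = cis ((x2 - x1) \<bullet> m\<xi>) * (\<integral>\<eta>. (\<integral>\<zeta>.
      (b (mx + \<zeta>, m\<xi> + \<eta>) * wigner_gauss t \<zeta> \<eta>) * cis ((\<xi>1 - \<xi>2, x2 - x1) \<bullet> (\<zeta>, \<eta>)) \<partial>lborel) \<partial>lborel)"
    by (simp only: integral_mult_right_zero)
  also have "(\<integral>\<eta>. (\<integral>\<zeta>. (b (mx + \<zeta>, m\<xi> + \<eta>) * wigner_gauss t \<zeta> \<eta>) * cis ((\<xi>1 - \<xi>2, x2 - x1) \<bullet> (\<zeta>, \<eta>)) \<partial>lborel) \<partial>lborel) =
      (\<integral>z. (b ((mx, m\<xi>) + z) * wigner_gauss t (fst z) (snd z)) * cis ((\<xi>1 - \<xi>2, x2 - x1) \<bullet> z) \<partial>lborel)"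
  proof -
    let ?f = "\<lambda>\<zeta> \<eta>. (b (mx + \<zeta>, m\<xi> + \<eta>) * wigner_gauss t \<zeta> \<eta>) * cis ((\<xi>1 - \<xi>2, x2 - x1) \<bullet> (\<zeta>, \<eta>))"
    have m: "case_prod ?f \<in> borel_measurable borel"
      unfolding case_prod_beta' by (intro borel_measurable_continuous_onI continuous_intros wc bc)
    have le: "norm (?f \<zeta> \<eta>) \<le> ((Cb * D) * wt ?k (\<zeta> - 0)) * (1 * wt ?k (\<eta> - 0))" for \<zeta> \<eta>
    proof -
      have "norm (?f \<zeta> \<eta>) \<le> Cb * (D * wt (?k + ?k) (\<zeta>, \<eta>))"
        unfolding norm_mult norm_cis mult_1_right using D(2)[of "(\<zeta>, \<eta>)"] nb Cb by (intro mult_mono) auto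
      also have "\<dots> \<le> Cb * (D * (wt ?k \<zeta> * wt ?k \<eta>))"
        unfolding wt_add using Cb D by (intro mult_left_mono mult_mono wt_Pair_le) auto
      finally show ?thesis by (simp add: mult_ac)
    qed
    show ?thesis
      using lborel_swap_dominated[OF m le wi wi] lborel_iterated_dominated[OF m le wi wi]
      by (simp add: case_prod_beta' plus_prod_def inner_prod_def)
  qed
  finally show ?thesis .
qed

section \<open>Square integrable functions\<close>

lemma L2_measurable: "f \<in> L2 \<Longrightarrow> f \<in> borel_measurable borel"
  by (simp add: L2_def)

lemma L2_integrable: "f \<in> L2 \<Longrightarrow> integrable lborel (\<lambda>x. (norm (f x))\<^sup>2)"
  by (simp add: L2_def)

lemma L2_norm_nonneg [simp]: "0 \<le> L2_norm f"
  by (simp add: L2_norm_def)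

lemma L2_norm_power2: "(L2_norm f)\<^sup>2 = (\<integral>x. (norm (f x))\<^sup>2 \<partial>lborel)"
  by (simp add: L2_norm_def)

lemma L2_nn_integral: "f \<in> L2 \<Longrightarrow> (\<integral>\<^sup>+x. ennreal ((norm (f x))\<^sup>2) \<partial>lborel) = ennreal ((L2_norm f)\<^sup>2)"
  unfolding L2_norm_power2 by (intro nn_integral_eq_integral L2_integrable) auto

lemma L2I_nn:
  assumes f: "f \<in> borel_measurable borel" and le: "(\<integral>\<^sup>+x. ennreal ((norm (f x))\<^sup>2) \<partial>lborel) \<le> ennreal (c\<^sup>2)" and c: "0 \<le> c"
  shows "f \<in> L2" "L2_norm f \<le> c"
proof -
  have "integrable lborel (\<lambda>x. (norm (f x))\<^sup>2)"
    unfolding integrable_iff_bounded using f le by (auto simp: order_le_less_trans[OF le])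
  then show L: "f \<in> L2" using f by (simp add: L2_def)
  show "L2_norm f \<le> c"
  proof (rule power2_le_imp_le[OF _ c])
    show "(L2_norm f)\<^sup>2 \<le> c\<^sup>2" using le unfolding L2_nn_integral[OF L] by (subst (asm) ennreal_le_iff) auto
  qed
qed

lemma ennreal_power2_le_imp_le:
  assumes "x\<^sup>2 \<le> (ennreal c)\<^sup>2" "0 \<le> c"
  shows "x \<le> ennreal c"
proof (cases x)
  case (real r)
  then have "ennreal (r\<^sup>2) \<le> ennreal (c\<^sup>2)" using assms by (simp add: ennreal_power)
  then have "r\<^sup>2 \<le> c\<^sup>2" by (subst (asm) ennreal_le_iff) auto
  then have "r \<le> c" using assms(2) by (rule power2_le_imp_le)
  then show ?thesis by (simp add: real ennreal_leI)
next
  case top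
  then show ?thesis using assms
    by (simp add: ennreal_power power2_eq_square ennreal_mult_top top_unique ennreal_mult[symmetric])
qed

lemma L2_cauchy_schwarz:
  assumes f: "f \<in> L2" and g: "g \<in> L2"
  shows "integrable lborel (\<lambda>x. norm (f x) * norm (g x))"
    "(\<integral>x. norm (f x) * norm (g x) \<partial>lborel) \<le> L2_norm f * L2_norm g"
proof -
  have m [measurable]: "f \<in> borel_measurable borel" "g \<in> borel_measurable borel" using f g by (auto dest: L2_measurable)
  have "(\<integral>\<^sup>+x. ennreal (norm (f x)) * ennreal (norm (g x)) \<partial>lborel)\<^sup>2 \<le>
      (\<integral>\<^sup>+x. (ennreal (norm (f x)))\<^sup>2 \<partial>lborel) * (\<integral>\<^sup>+x. (ennreal (norm (g x)))\<^sup>2 \<partial>lborel)"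
    by (rule Cauchy_Schwarz_nn_integral) auto
  also have "\<dots> = (ennreal (L2_norm f * L2_norm g))\<^sup>2"
    using L2_nn_integral[OF f] L2_nn_integral[OF g] by (simp add: ennreal_power power_mult_distrib ennreal_mult)
  finally have "(\<integral>\<^sup>+x. ennreal (norm (f x) * norm (g x)) \<partial>lborel)\<^sup>2 \<le> (ennreal (L2_norm f * L2_norm g))\<^sup>2"
    by (simp only: ennreal_mult norm_ge_zero)
  then have le: "(\<integral>\<^sup>+x. ennreal (norm (f x) * norm (g x)) \<partial>lborel) \<le> ennreal (L2_norm f * L2_norm g)"
    by (rule ennreal_power2_le_imp_le) simp
  then show i: "integrable lborel (\<lambda>x. norm (f x) * norm (g x))"
    unfolding integrable_iff_bounded by (auto simp: abs_mult order_le_less_trans[OF le])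
  show "(\<integral>x. norm (f x) * norm (g x) \<partial>lborel) \<le> L2_norm f * L2_norm g"
    using le nn_integral_eq_integral[OF i] by simp
qed

lemma L2_mono:
  assumes f: "f \<in> L2" and g: "g \<in> borel_measurable borel" and le: "\<And>x. norm (g x) \<le> norm (f x)"
  shows "g \<in> L2" "L2_norm g \<le> L2_norm f"
proof -
  have "(\<integral>\<^sup>+x. ennreal ((norm (g x))\<^sup>2) \<partial>lborel) \<le> (\<integral>\<^sup>+x. ennreal ((norm (f x))\<^sup>2) \<partial>lborel)"
    by (intro nn_integral_mono ennreal_leI power_mono le) auto
  then have "(\<integral>\<^sup>+x. ennreal ((norm (g x))\<^sup>2) \<partial>lborel) \<le> ennreal ((L2_norm f)\<^sup>2)"
    by (simp only: L2_nn_integral[OF f])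
  then show "g \<in> L2" "L2_norm g \<le> L2_norm f" using L2I_nn[OF g] by auto
qed

lemma L2_cmult: "f \<in> L2 \<Longrightarrow> (\<lambda>x. c * f x) \<in> L2"
  by (auto simp: L2_def norm_mult power_mult_distrib)

lemma L2_norm_cmult: "L2_norm (\<lambda>x. c * f x) = norm c * L2_norm f"
  by (simp add: L2_norm_def norm_mult power_mult_distrib real_sqrt_mult)

lemma L2_add:
  assumes f: "f \<in> L2" and g: "g \<in> L2"
  shows "(\<lambda>x. f x + g x) \<in> L2" "L2_norm (\<lambda>x. f x + g x) \<le> L2_norm f + L2_norm g"
proof -
  have m [measurable]: "f \<in> borel_measurable borel" "g \<in> borel_measurable borel" using f g by (auto dest: L2_measurable)
  let ?h = "\<lambda>x. (norm (f x))\<^sup>2 + 2 * (norm (f x) * norm (g x)) + (norm (g x))\<^sup>2"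
  have i: "integrable lborel ?h"
    using f g by (intro Bochner_Integration.integrable_add integrable_mult_right L2_integrable L2_cauchy_schwarz)
  have le: "(norm (f x + g x))\<^sup>2 \<le> ?h x" for x
    using power_mono[OF norm_triangle_ineq[of "f x" "g x"], of 2] by (simp add: power2_sum)
  have i2: "integrable lborel (\<lambda>x. (norm (f x + g x))\<^sup>2)"
    by (rule Bochner_Integration.integrable_bound[OF i]) (use le in \<open>auto intro!: AE_I2 order_trans[OF le abs_ge_self]\<close>)
  then show "(\<lambda>x. f x + g x) \<in> L2" by (simp add: L2_def)
  have "(L2_norm (\<lambda>x. f x + g x))\<^sup>2 \<le> (\<integral>x. ?h x \<partial>lborel)"
    unfolding L2_norm_power2 by (rule integral_mono[OF i2 i le])
  also have "\<dots> = (L2_norm f)\<^sup>2 + 2 * (\<integral>x. norm (f x) * norm (g x) \<partial>lborel) + (L2_norm g)\<^sup>2"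
    using f g by (simp add: L2_norm_power2 L2_integrable L2_cauchy_schwarz)
  also have "\<dots> \<le> (L2_norm f + L2_norm g)\<^sup>2"
    using L2_cauchy_schwarz(2)[OF f g] by (simp add: power2_sum)
  finally show "L2_norm (\<lambda>x. f x + g x) \<le> L2_norm f + L2_norm g"
    by (rule power2_le_imp_le) simp
qed

lemma L2_diff:
  assumes f: "f \<in> L2" and g: "g \<in> L2"
  shows "(\<lambda>x. f x - g x) \<in> L2" "L2_norm (\<lambda>x. f x - g x) \<le> L2_norm f + L2_norm g"
  using L2_add[OF f L2_cmult[OF g, of "-1"]] L2_norm_cmult[of "-1" g] by simp_all

lemma L2_indicator:
  assumes f: "f \<in> L2" and E: "E \<in> sets borel"
  shows "(\<lambda>x. indicator E x * f x) \<in> L2" "L2_norm (\<lambda>x. indicator E x * f x) \<le> L2_norm f"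
proof -
  have m [measurable]: "f \<in> borel_measurable borel" "E \<in> sets borel" using f E by (auto dest: L2_measurable)
  have "(\<lambda>x. indicator E x * f x) \<in> borel_measurable borel" by measurable
  then show "(\<lambda>x. indicator E x * f x) \<in> L2" "L2_norm (\<lambda>x. indicator E x * f x) \<le> L2_norm f"
    using L2_mono[OF f, of "\<lambda>x. indicator E x * f x"] by (auto simp: norm_mult indicator_def)
qed

lemma rapid_L2:
  fixes f :: "'a::euclidean_space \<Rightarrow> complex"
  assumes m: "f \<in> borel_measurable borel" and le: "\<And>x. norm (f x) \<le> B * wt (2 * DIM('a)) (x - a)"
  shows "f \<in> L2"
proof -
  have B: "0 \<le> B" using order_trans[OF norm_ge_zero le[of a]] by simp
  have "norm ((norm (f x))\<^sup>2) \<le> B\<^sup>2 * wt (2 * DIM('a)) (x - a)" for x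
  proof -
    have "(norm (f x))\<^sup>2 \<le> (B * wt (2 * DIM('a)) (x - a))\<^sup>2" by (intro power_mono le) simp
    also have "\<dots> = B\<^sup>2 * (wt (2 * DIM('a)) (x - a) * wt (2 * DIM('a)) (x - a))" by (simp add: power2_eq_square)
    also have "\<dots> \<le> B\<^sup>2 * (wt (2 * DIM('a)) (x - a) * 1)"
      by (intro mult_left_mono wt_le_1) auto
    finally show ?thesis by simp
  qed
  then have "integrable lborel (\<lambda>x. (norm (f x))\<^sup>2)"
    by (intro integrable_wt_bound(1)) (use m in measurable)
  then show ?thesis using m by (simp add: L2_def)
qed

lemma schwartz_L2: "f \<in> schwartz \<Longrightarrow> f \<in> L2"
  by (metis schwartz_bound schwartz_measurable rapid_L2[of f _ 0] diff_zero)

section \<open>Schur's test for rapidly decaying kernels\<close>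

lemma nn_integral_wt_shift:
  fixes a :: "'a::euclidean_space"
  shows "(\<integral>\<^sup>+x. ennreal (wt (2 * DIM('a)) (x - a)) \<partial>lborel) = ennreal (\<integral>x. wt (2 * DIM('a)) (x::'a) \<partial>lborel)"
    "(\<integral>\<^sup>+x. ennreal (wt (2 * DIM('a)) (a - x)) \<partial>lborel) = ennreal (\<integral>x. wt (2 * DIM('a)) (x::'a) \<partial>lborel)"
proof -
  have i: "integrable lborel (\<lambda>x. wt (2 * DIM('a)) (x - a))"
    by (intro lborel_integrable_shift wt_integrable) simp
  have "(\<integral>x. wt (2 * DIM('a)) (x - a) \<partial>lborel) = (\<integral>x. wt (2 * DIM('a)) (x::'a) \<partial>lborel)"
    using lborel_integral_shift[of "wt (2 * DIM('a))" "- a"] by simp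
  then show 1: "(\<integral>\<^sup>+x. ennreal (wt (2 * DIM('a)) (x - a)) \<partial>lborel) = ennreal (\<integral>x. wt (2 * DIM('a)) (x::'a) \<partial>lborel)"
    using nn_integral_eq_integral[OF i] by simp
  then show "(\<integral>\<^sup>+x. ennreal (wt (2 * DIM('a)) (a - x)) \<partial>lborel) = ennreal (\<integral>x. wt (2 * DIM('a)) (x::'a) \<partial>lborel)"
    by (simp only: wt_minus(2)[of _ a])
qed

text \<open>Split the weight into two square roots, apply Cauchy-Schwarz in x and exchange the order
  of integration; the two integrations of the weight cost the same constant. \<open>G\<close> need
  only be dominated by the convolution, so it may carry cut-offs or be a remainder.\<close>

lemma schur_test:
  fixes F G :: "'a::euclidean_space \<Rightarrow> complex"
  assumes F: "F \<in> L2" and G: "G \<in> borel_measurable borel" and A: "0 \<le> A"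
    and le: "\<And>y. norm (G y) \<le> A * (\<integral>x. wt (2 * DIM('a)) (y - x) * norm (F x) \<partial>lborel)"
  shows "G \<in> L2" "L2_norm G \<le> A * (\<integral>x. wt (2 * DIM('a)) (x::'a) \<partial>lborel) * L2_norm F"
proof -
  let ?w = "wt (2 * DIM('a)) :: 'a \<Rightarrow> real"
  define I where "I = (\<integral>x. ?w x \<partial>lborel)"
  have I: "0 \<le> I" by (simp add: I_def)
  note Fm [measurable] = L2_measurable[OF F]
  have wm [measurable]: "?w \<in> borel_measurable borel" by measurable
  have pt: "ennreal ((norm (G y))\<^sup>2) \<le> ennreal (A\<^sup>2 * I) * (\<integral>\<^sup>+x. ennreal (?w (y - x)) * ennreal ((norm (F x))\<^sup>2) \<partial>lborel)" for y
  proof -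
    \<comment> \<open>If the integrand is not integrable, its Bochner integral is 0 and the
      inequality is trivial.\<close>
    have "ennreal (\<integral>x. ?w (y - x) * norm (F x) \<partial>lborel) \<le> (\<integral>\<^sup>+x. ennreal (?w (y - x) * norm (F x)) \<partial>lborel)"
    proof (cases "integrable lborel (\<lambda>x. ?w (y - x) * norm (F x))")
      case True
      then show ?thesis using nn_integral_eq_integral[OF True] by simp
    qed (simp add: not_integrable_integral_eq)
    also have "\<dots> = (\<integral>\<^sup>+x. ennreal (sqrt (?w (y - x))) * ennreal (sqrt (?w (y - x)) * norm (F x)) \<partial>lborel)"
      by (intro nn_integral_cong) (simp add: ennreal_mult[symmetric] mult.assoc[symmetric])
    finally have "(ennreal (\<integral>x. ?w (y - x) * norm (F x) \<partial>lborel))\<^sup>2 \<le>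
        (\<integral>\<^sup>+x. ennreal (sqrt (?w (y - x))) * ennreal (sqrt (?w (y - x)) * norm (F x)) \<partial>lborel)\<^sup>2"
      by (rule power_mono) simp
    also have "\<dots> \<le> (\<integral>\<^sup>+x. (ennreal (sqrt (?w (y - x))))\<^sup>2 \<partial>lborel) * (\<integral>\<^sup>+x. (ennreal (sqrt (?w (y - x)) * norm (F x)))\<^sup>2 \<partial>lborel)"
      by (rule Cauchy_Schwarz_nn_integral) measurable
    also have "\<dots> = ennreal I * (\<integral>\<^sup>+x. ennreal (?w (y - x)) * ennreal ((norm (F x))\<^sup>2) \<partial>lborel)"
      by (simp add: ennreal_power power_mult_distrib ennreal_mult nn_integral_wt_shift I_def)
    finally have sq: "(ennreal (\<integral>x. ?w (y - x) * norm (F x) \<partial>lborel))\<^sup>2 \<le>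
        ennreal I * (\<integral>\<^sup>+x. ennreal (?w (y - x)) * ennreal ((norm (F x))\<^sup>2) \<partial>lborel)" .
    have "ennreal ((norm (G y))\<^sup>2) \<le> ennreal ((A * (\<integral>x. ?w (y - x) * norm (F x) \<partial>lborel))\<^sup>2)"
      by (intro ennreal_leI power_mono le) simp
    also have "\<dots> = ennreal (A\<^sup>2) * (ennreal (\<integral>x. ?w (y - x) * norm (F x) \<partial>lborel))\<^sup>2"
      by (simp add: power_mult_distrib ennreal_mult ennreal_power)
    also have "\<dots> \<le> ennreal (A\<^sup>2) * (ennreal I * (\<integral>\<^sup>+x. ennreal (?w (y - x)) * ennreal ((norm (F x))\<^sup>2) \<partial>lborel))"
      by (rule mult_left_mono[OF sq]) simp
    finally show ?thesis using I by (simp add: ennreal_mult mult.assoc)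
  qed
  have m2: "(\<lambda>(y, x). ennreal (?w (y - x)) * ennreal ((norm (F x))\<^sup>2)) \<in> borel_measurable (lborel \<Otimes>\<^sub>M lborel)"
    by measurable
  have "(\<integral>\<^sup>+y. ennreal ((norm (G y))\<^sup>2) \<partial>lborel) \<le>
      (\<integral>\<^sup>+y. ennreal (A\<^sup>2 * I) * (\<integral>\<^sup>+x. ennreal (?w (y - x)) * ennreal ((norm (F x))\<^sup>2) \<partial>lborel) \<partial>lborel)"
    by (intro nn_integral_mono pt)
  also have "\<dots> = ennreal (A\<^sup>2 * I) * (\<integral>\<^sup>+y. (\<integral>\<^sup>+x. ennreal (?w (y - x)) * ennreal ((norm (F x))\<^sup>2) \<partial>lborel) \<partial>lborel)"
    by (rule nn_integral_cmult) (use lborel.borel_measurable_nn_integral[OF m2] in simp)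
  also have "(\<integral>\<^sup>+y. (\<integral>\<^sup>+x. ennreal (?w (y - x)) * ennreal ((norm (F x))\<^sup>2) \<partial>lborel) \<partial>lborel) =
      (\<integral>\<^sup>+x. (\<integral>\<^sup>+y. ennreal (?w (y - x)) * ennreal ((norm (F x))\<^sup>2) \<partial>lborel) \<partial>lborel)"
    by (rule lborel_pair.Fubini'[OF m2, symmetric])
  also have "\<dots> = (\<integral>\<^sup>+x. ennreal I * ennreal ((norm (F x))\<^sup>2) \<partial>lborel)"
    by (intro nn_integral_cong) (simp add: nn_integral_multc nn_integral_wt_shift I_def)
  also have "\<dots> = ennreal I * ennreal ((L2_norm F)\<^sup>2)"
    by (simp add: nn_integral_cmult L2_nn_integral[OF F])
  finally have le2: "(\<integral>\<^sup>+y. ennreal ((norm (G y))\<^sup>2) \<partial>lborel) \<le> ennreal (A\<^sup>2 * I) * (ennreal I * ennreal ((L2_norm F)\<^sup>2))" .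
  have "(\<integral>\<^sup>+y. ennreal ((norm (G y))\<^sup>2) \<partial>lborel) \<le> ennreal ((A * I * L2_norm F)\<^sup>2)"
  proof -
    have "ennreal (A\<^sup>2 * I) * (ennreal I * ennreal ((L2_norm F)\<^sup>2)) = ennreal ((A\<^sup>2 * I) * (I * (L2_norm F)\<^sup>2))"
      using I by (simp only: ennreal_mult mult_nonneg_nonneg zero_le_power2)
    also have "(A\<^sup>2 * I) * (I * (L2_norm F)\<^sup>2) = (A * I * L2_norm F)\<^sup>2" by (simp add: power2_eq_square)
    finally show ?thesis using le2 by (simp only:)
  qed
  then show "G \<in> L2" "L2_norm G \<le> A * (\<integral>x. ?w x \<partial>lborel) * L2_norm F"
    unfolding I_def[symmetric] using L2I_nn[OF G, of "A * I * L2_norm F"] A I by auto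
qed

section \<open>Kernel estimates\<close>

lemma norm_scaled_Pair_le:
  assumes "\<bar>r\<bar> \<le> 1" "\<bar>q\<bar> \<le> 1"
  shows "norm (r *\<^sub>R x, q *\<^sub>R y) \<le> norm (x, y)"
proof -
  have "norm (r *\<^sub>R x) \<le> norm x" "norm (q *\<^sub>R y) \<le> norm y"
    using assms by (auto intro: mult_left_le_one_le)
  then show ?thesis unfolding norm_Pair by (intro real_sqrt_le_mono add_mono power_mono) auto
qed

text \<open>The symbol may grow like (1 + |z - p|)^P away from \<open>p\<close>. The intermediate
  point lies within |w' - w| of both packets, so the growth costs P powers of 1 + |w' - w|, repaid
  by P additional derivatives, and P powers of the decay of the window. A small \<open>B\<close>
  says that the symbol is small near \<open>p\<close>; since \<open>p\<close> may be either packet,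
  this smallness can be read off at either end of the kernel.\<close>

lemma wave_kernel_bound:
  fixes t :: real
  assumes t: "t \<in> {0..1}"
  obtains C where "C \<ge> 0" "\<And>b B p w w'. unit_symbol (b :: 'a::euclidean_space \<times> 'a \<Rightarrow> complex) \<Longrightarrow>
    derivs_le (N + P) (\<lambda>z. B * (1 + norm (z - p)) ^ P) b \<Longrightarrow> p = w \<or> p = w' \<Longrightarrow>
    norm (wave_kernel t b w w') \<le> C * B * wt N (w' - w)"
proof -
  let ?k = "2 * DIM('a \<times> 'a)" and ?M = "N + P"
  let ?g = "\<lambda>z::'a \<times> 'a. wigner_gauss t (fst z) (snd z)"
  obtain D where D: "D \<ge> 0" "derivs_le ?M (\<lambda>z. D * wt (?k + P) z) ?g"
    using schwartzD(2)[OF wigner_gauss_schwartz] by blast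
  obtain C where C: "C \<ge> 0" "\<And>f B a d. smooth (f :: 'a \<times> 'a \<Rightarrow> complex) \<Longrightarrow>
    derivs_le ?M (\<lambda>x. B * wt (2 * DIM('a \<times> 'a)) (x - a)) f \<Longrightarrow>
    norm (\<integral>x. f x * cis (d \<bullet> x) \<partial>lborel) \<le> C * B * wt ?M d"
    using fourier_decay[where N = ?M and 'a = "'a \<times> 'a"] by blast
  have "norm (wave_kernel t b w w') \<le> (C * (2 ^ ?M * D)) * B * wt N (w' - w)"
    if b: "unit_symbol b" and le: "derivs_le ?M (\<lambda>z. B * (1 + norm (z - p)) ^ P) b" and p: "p = w \<or> p = w'"
    for b :: "'a \<times> 'a \<Rightarrow> complex" and B p w w'
  proof -
    obtain x1 \<xi>1 x2 \<xi>2 where w: "w = (x1, \<xi>1)" "w' = (x2, \<xi>2)" by (cases w, cases w') auto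
    define m where "m = (t *\<^sub>R x2 + (1 - t) *\<^sub>R x1, t *\<^sub>R \<xi>1 + (1 - t) *\<^sub>R \<xi>2)"
    define d where "d = (\<xi>1 - \<xi>2, x2 - x1)"
    have nd: "norm d = norm (w' - w)"
      by (simp add: d_def w norm_Pair norm_minus_commute add.commute)
    have mp: "norm (m - p) \<le> norm (w' - w)"
      using p
    proof
      assume "p = w"
      then have "m - p = (t *\<^sub>R (x2 - x1), (1 - t) *\<^sub>R (\<xi>2 - \<xi>1))" by (simp add: m_def w algebra_simps)
      then show ?thesis using norm_scaled_Pair_le[of t "1 - t" "x2 - x1" "\<xi>2 - \<xi>1"] t by (simp add: w)
    next
      assume "p = w'"
      then have "m - p = ((- (1 - t)) *\<^sub>R (x2 - x1), (- t) *\<^sub>R (\<xi>2 - \<xi>1))" by (simp add: m_def w algebra_simps)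
      then show ?thesis using norm_scaled_Pair_le[of "- (1 - t)" "- t" "x2 - x1" "\<xi>2 - \<xi>1"] t by (simp add: w)
    qed
    have B: "0 \<le> B" using order_trans[OF norm_ge_zero derivs_leD[OF le, of p]] by simp
    have sb: "smooth (\<lambda>z. b (m + z))" by (rule smooth_affine[OF basis_affine_translation(1) unit_symbol_smooth[OF b]])
    have sg: "smooth ?g" by (rule schwartzD(1)[OF wigner_gauss_schwartz])
    have "derivs_le ?M (\<lambda>z. 1 ^ ?M * (B * (1 + norm (m + z - p)) ^ P)) (\<lambda>z. b (m + z))"
      by (rule derivs_le_affine[OF basis_affine_translation(1) _ unit_symbol_smooth[OF b] le]) simp
    then have "derivs_le ?M (\<lambda>z. (B * (1 + norm (w' - w)) ^ P) * (1 + norm z) ^ P) (\<lambda>z. b (m + z))"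
    proof (rule derivs_le_mono)
      fix z
      have "1 + norm (m + z - p) \<le> (1 + norm (m - p)) * (1 + norm z)"
        using peetre[of "m - p" z] by (simp add: algebra_simps)
      also have "\<dots> \<le> (1 + norm (w' - w)) * (1 + norm z)" using mp by (intro mult_right_mono) auto
      finally have "(1 + norm (m + z - p)) ^ P \<le> ((1 + norm (w' - w)) * (1 + norm z)) ^ P"
        by (rule power_mono) simp
      then show "1 ^ ?M * (B * (1 + norm (m + z - p)) ^ P) \<le> (B * (1 + norm (w' - w)) ^ P) * (1 + norm z) ^ P"
        using mult_left_mono[OF _ B] by (simp add: power_mult_distrib mult.assoc)
    qed simp
    then have "derivs_le ?M (\<lambda>z. 2 ^ ?M * (((B * (1 + norm (w' - w)) ^ P) * (1 + norm z) ^ P) * (D * wt (?k + P) z)))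
        (\<lambda>z. b (m + z) * ?g z)"
      by (intro derivs_le_mult sb sg D)
    moreover have "2 ^ ?M * (((B * (1 + norm (w' - w)) ^ P) * (1 + norm z) ^ P) * (D * wt (?k + P) z)) =
        (2 ^ ?M * D * B * (1 + norm (w' - w)) ^ P) * wt ?k (z - 0)" for z :: "'a \<times> 'a"
    proof -
      have "2 ^ ?M * (((B * (1 + norm (w' - w)) ^ P) * (1 + norm z) ^ P) * (D * wt (?k + P) z)) =
        (2 ^ ?M * D * B * (1 + norm (w' - w)) ^ P) * ((1 + norm z) ^ P * wt (?k + P) z)" by (simp only: mult_ac)
      then show ?thesis by (simp only: wt_cancel diff_zero)
    qed
    ultimately have "derivs_le ?M (\<lambda>z. (2 ^ ?M * D * B * (1 + norm (w' - w)) ^ P) * wt ?k (z - 0)) (\<lambda>z. b (m + z) * ?g z)"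
      by (simp only:)
    from C(2)[OF smooth_mult[OF sb sg] this, of d]
    have "norm (wave_kernel t b w w') \<le> C * (2 ^ ?M * D * B * (1 + norm (w' - w)) ^ P) * wt ?M d"
      unfolding w wave_kernel_eq[OF b t] m_def[symmetric] d_def[symmetric] by (simp add: norm_mult)
    also have "\<dots> = C * (2 ^ ?M * D) * B * ((1 + norm (w' - w)) ^ P * wt (N + P) (w' - w))"
      unfolding wt_def nd by (simp only: mult_ac)
    finally show ?thesis by (simp only: wt_cancel)
  qed
  then show ?thesis using that[of "C * (2 ^ ?M * D)"] C D by auto
qed


section \<open>Operators on Schwartz functions and their compositions\<close>

lemma schwartz_fbi_L2:
  fixes u :: "'a::euclidean_space \<Rightarrow> complex"
  assumes u: "u \<in> schwartz"
  shows "fbi u \<in> L2" "L2_norm (fbi u) = sqrt (fbi_mass TYPE('a)) * L2_norm u"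
proof -
  obtain B where B: "\<And>w. norm (fbi u w) \<le> B * wt (2 * DIM('a \<times> 'a)) w" using fbi_decay[OF u] by metis
  then show "fbi u \<in> L2"
    by (intro rapid_L2[of _ B 0]) (use fbi_measurable[OF schwartz_measurable[OF u]] in auto)
  obtain M where M: "\<And>x. norm (u x) \<le> M" using schwartz_bounded[OF u] by metis
  show "L2_norm (fbi u) = sqrt (fbi_mass TYPE('a)) * L2_norm u"
    unfolding L2_norm_def fbi_isometry[OF schwartz_continuous[OF u] M schwartz_integrable[OF u] B]
    by (rule real_sqrt_mult)
qed

text \<open>The coefficient \<open>D w\<close> may depend on the source point: in a composition the
  outer kernel is bounded differently on two parts of phase space. \<open>F\<close> is a bounded
  measurable majorant, which makes the integral on the right meaningful.\<close>

lemma norm_fbi_Q_le: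
  fixes b :: "'a::euclidean_space \<times> 'a \<Rightarrow> complex"
  assumes b: "unit_symbol b" and t: "t \<in> {0..1}" and u: "u \<in> schwartz"
    and K: "\<And>w. norm (wave_kernel t b w w') \<le> D w * wt (2 * DIM('a \<times> 'a)) (w' - w)"
    and F: "\<And>w. D w * norm (fbi u w) \<le> F w" and Fi: "F \<in> borel_measurable borel" "\<And>w. F w \<le> M"
  shows "norm (fbi (Q t b u) w') \<le>
    1 / fbi_mass TYPE('a) * (\<integral>w. wt (2 * DIM('a \<times> 'a)) (w' - w) * F w \<partial>lborel)"
proof -
  let ?k = "2 * DIM('a \<times> 'a)"
  have F0: "0 \<le> F w" for w
  proof -
    have "0 \<le> D w * wt ?k (w' - w)" by (rule order_trans[OF norm_ge_zero K])
    then have "0 \<le> D w" using wt_pos[of ?k "w' - w"] by (simp add: zero_le_mult_iff)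
    then show ?thesis using order_trans[OF mult_nonneg_nonneg F] by simp
  qed
  have "fbi_mass TYPE('a) * norm (fbi (Q t b u) w') = norm (\<integral>w. fbi u w * wave_kernel t b w w' \<partial>lborel)"
    unfolding fbi_Q[OF b t u, symmetric] using fbi_mass_pos[where 'a='a] by (simp add: norm_mult)
  also have "\<dots> \<le> (\<integral>w. norm (fbi u w * wave_kernel t b w w') \<partial>lborel)" by (rule integral_norm_bound)
  also have "\<dots> \<le> (\<integral>w. wt ?k (w' - w) * F w \<partial>lborel)"
  proof (rule integral_mono)
    have le: "norm (fbi u w * wave_kernel t b w w') \<le> wt ?k (w' - w) * F w" for w
    proof -
      have "norm (fbi u w * wave_kernel t b w w') \<le> norm (fbi u w) * (D w * wt ?k (w' - w))"
        unfolding norm_mult by (intro mult_left_mono K) simp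
      also have "\<dots> = wt ?k (w' - w) * (D w * norm (fbi u w))" by (simp only: mult_ac)
      also have "\<dots> \<le> wt ?k (w' - w) * F w" by (intro mult_left_mono F) simp
      finally show ?thesis .
    qed
    show i: "integrable lborel (\<lambda>w. wt ?k (w' - w) * F w)"
    proof (rule integrable_wt_bound(1)[of _ M w'])
      show "(\<lambda>w. wt ?k (w' - w) * F w) \<in> borel_measurable borel" using Fi(1) by measurable
      show "norm (wt ?k (w' - w) * F w) \<le> M * wt ?k (w - w')" for w
        using mult_right_mono[OF Fi(2)[of w], of "wt ?k (w' - w)"] F0[of w]
        by (simp add: wt_minus(2)[of _ w w'] abs_mult mult.commute)
    qed
    have "(\<lambda>w. fbi u w * wave_kernel t b w w') \<in> borel_measurable borel"
      by (intro borel_measurable_times fbi_measurable schwartz_measurable u wave_kernel_measurable[OF b] continuous_intros)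
    then show "integrable lborel (\<lambda>w. norm (fbi u w * wave_kernel t b w w'))"
      by (intro Bochner_Integration.integrable_bound[OF i])
         (simp, rule AE_I2, use order_trans[OF le abs_ge_self] in \<open>simp only: real_norm_def abs_norm_cancel\<close>)
    show "norm (fbi u w * wave_kernel t b w w') \<le> wt ?k (w' - w) * F w" for w by (rule le)
  qed
  finally show ?thesis using fbi_mass_pos[where 'a='a] by (simp add: field_simps)
qed

text \<open>Rapid decay of \<open>fbi u\<close> passes through the kernel, which decays rapidly off
  the diagonal, by submultiplicativity of the weights; \<open>schwartz_if_fbi_rapid\<close> does the
  rest.\<close>

lemma Q_schwartz:
  fixes b :: "'a::euclidean_space \<times> 'a \<Rightarrow> complex"
  assumes b: "unit_symbol b" and t: "t \<in> {0..1}" and u: "u \<in> schwartz"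
  shows "Q t b u \<in> schwartz"
proof -
  let ?k = "2 * DIM('a \<times> 'a)"
  note Qc = Q_continuous_bounded[OF b t u]
  obtain M where M: "\<And>x. norm (Q t b u x) \<le> M" using Qc(2) by blast
  have "rapid (fbi (Q t b u))"
    unfolding rapid_def
  proof (intro conjI allI)
    show "fbi (Q t b u) \<in> borel_measurable borel"
      by (intro fbi_measurable borel_measurable_continuous_onI Qc(1))
    fix N
    obtain Cu where Cu: "Cu \<ge> 0" "\<And>w. norm (fbi u w) \<le> Cu * wt (N + ?k) w" using fbi_decay[OF u] by metis
    obtain B where B: "B \<ge> 0" "derivs_le N (\<lambda>_. B) b" using unit_symbol_bound[OF b] by metis
    obtain CK where CK: "CK \<ge> 0" "\<And>b B p w w'. unit_symbol (b :: 'a \<times> 'a \<Rightarrow> complex) \<Longrightarrow>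
      derivs_le (N + 0) (\<lambda>z. B * (1 + norm (z - p)) ^ 0) b \<Longrightarrow> p = w \<or> p = w' \<Longrightarrow>
      norm (wave_kernel t b w w') \<le> CK * B * wt N (w' - w)"
      using wave_kernel_bound[OF t, where N = N and P = 0 and 'a = 'a] by blast
    have K: "norm (wave_kernel t b w w') \<le> CK * B * wt N (w' - w)" for w w'
      by (rule CK(2)[OF b, of B w]) (use B in simp_all)
    let ?C = "Cu * (CK * B)"
    have "norm (fbi (Q t b u) w') \<le> (?C * (\<integral>w. wt ?k (w::'a \<times> 'a) \<partial>lborel) / fbi_mass TYPE('a)) * wt N w'" for w'
    proof -
      have le: "norm (fbi u w * wave_kernel t b w w') \<le> (?C * wt N w') * wt ?k (w - 0)" for w
      proof -
        have "norm (fbi u w * wave_kernel t b w w') \<le> (Cu * wt (N + ?k) w) * (CK * B * wt N (w' - w))"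
          unfolding norm_mult using Cu by (intro mult_mono Cu K) auto
        also have "\<dots> = (?C * wt ?k w) * (wt N w * wt N (w' - w))" by (simp add: wt_add mult_ac)
        also have "\<dots> \<le> (?C * wt ?k w) * wt N w'"
          using Cu CK B wt_product_le[of N w "w' - w"] by (intro mult_left_mono) auto
        finally show ?thesis by (simp add: mult_ac)
      qed
      have "fbi_mass TYPE('a) * norm (fbi (Q t b u) w') = norm (\<integral>w. fbi u w * wave_kernel t b w w' \<partial>lborel)"
        unfolding fbi_Q[OF b t u, symmetric] using fbi_mass_pos[where 'a='a] by (simp add: norm_mult)
      also have "\<dots> \<le> (?C * wt N w') * (\<integral>w. wt ?k (w::'a \<times> 'a) \<partial>lborel)"
        by (rule integrable_wt_bound(2)[OF _ le])
           (intro borel_measurable_times fbi_measurable schwartz_measurable u wave_kernel_measurable[OF b] continuous_intros)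
      finally show ?thesis using fbi_mass_pos[where 'a='a] by (simp add: field_simps)
    qed
    then show "\<exists>C. \<forall>w. norm (fbi (Q t b u) w) \<le> C * wt N w" by blast
  qed
  then show ?thesis by (rule schwartz_if_fbi_rapid[OF Qc(1) M])
qed

lemma fbi_bounded_schwartz:
  assumes u: "u \<in> schwartz"
  obtains M where "M \<ge> 0" "\<And>w. norm (fbi u w) \<le> M"
  using fbi_decay[OF u, where N = 0] by auto

text \<open>The intermediate phase space is split into \<open>E\<close> and its complement. At
  points of \<open>E\<close> the symbol \<open>b\<close> is small as seen from the target of its
  kernel while \<open>c\<close> is merely bounded; off \<open>E\<close> the roles are exchanged,
  with \<open>c\<close> read at its source. Every intermediate point carries one small and one
  bounded factor, whence \<open>Bc * \<epsilon>b + \<epsilon>c * Bb\<close>.\<close>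

lemma Q_comp_bound:
  fixes s t :: real
  assumes s: "s \<in> {0..1}" and t: "t \<in> {0..1}"
  obtains C where "C \<ge> 0"
    "\<And>b c E Bb Bc \<epsilon>b \<epsilon>c u. unit_symbol (b :: 'a::euclidean_space \<times> 'a \<Rightarrow> complex) \<Longrightarrow> unit_symbol c \<Longrightarrow> E \<in> sets borel \<Longrightarrow>
      derivs_le (2 * DIM('a \<times> 'a) + P) (\<lambda>_. Bb) b \<Longrightarrow> derivs_le (2 * DIM('a \<times> 'a) + P) (\<lambda>_. Bc) c \<Longrightarrow>
      \<epsilon>b \<ge> 0 \<Longrightarrow> \<epsilon>c \<ge> 0 \<Longrightarrow>
      (\<And>w. w \<in> E \<Longrightarrow> derivs_le (2 * DIM('a \<times> 'a) + P) (\<lambda>z. \<epsilon>b * (1 + norm (z - w)) ^ P) b) \<Longrightarrow>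
      (\<And>w. w \<notin> E \<Longrightarrow> derivs_le (2 * DIM('a \<times> 'a) + P) (\<lambda>z. \<epsilon>c * (1 + norm (z - w)) ^ P) c) \<Longrightarrow>
      u \<in> schwartz \<Longrightarrow> L2_norm (Q s c (Q t b u)) \<le> C * (Bc * \<epsilon>b + \<epsilon>c * Bb) * L2_norm u"
proof -
  let ?k = "2 * DIM('a \<times> 'a)"
  let ?M = "?k + P"
  define \<mu> where "\<mu> = fbi_mass TYPE('a)"
  have \<mu>: "0 < \<mu>" unfolding \<mu>_def by (rule fbi_mass_pos)
  define I where "I = (\<integral>w. wt ?k (w::'a \<times> 'a) \<partial>lborel)"
  have I: "0 \<le> I" by (simp add: I_def)
  obtain Cs where Cs: "Cs \<ge> 0" "\<And>b B p w w'. unit_symbol (b :: 'a \<times> 'a \<Rightarrow> complex) \<Longrightarrow>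
      derivs_le ?M (\<lambda>z. B * (1 + norm (z - p)) ^ P) b \<Longrightarrow> p = w \<or> p = w' \<Longrightarrow>
      norm (wave_kernel s b w w') \<le> Cs * B * wt ?k (w' - w)"
    using wave_kernel_bound[OF s, where N = ?k and P = P and 'a = 'a] by blast
  obtain Ct where Ct: "Ct \<ge> 0" "\<And>b B p w w'. unit_symbol (b :: 'a \<times> 'a \<Rightarrow> complex) \<Longrightarrow>
      derivs_le ?M (\<lambda>z. B * (1 + norm (z - p)) ^ P) b \<Longrightarrow> p = w \<or> p = w' \<Longrightarrow>
      norm (wave_kernel t b w w') \<le> Ct * B * wt ?k (w' - w)"
    using wave_kernel_bound[OF t, where N = ?k and P = P and 'a = 'a] by blast
  have weak: "derivs_le ?M (\<lambda>z. B * (1 + norm (z - p)) ^ P) b" if "derivs_le ?M (\<lambda>_. B) b" for b and B and p :: "'a \<times> 'a"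
  proof (rule derivs_le_mono[OF that order_refl])
    have "0 \<le> B" using order_trans[OF norm_ge_zero derivs_leD[OF that, of 0]] .
    then show "B \<le> B * (1 + norm (z - p)) ^ P" for z
      by (simp add: mult_le_cancel_left1 one_le_power)
  qed
  have main: "L2_norm (Q s c (Q t b u)) \<le> (Cs / \<mu> * I * (Ct / \<mu> * I)) * (Bc * \<epsilon>b + \<epsilon>c * Bb) * L2_norm u"
    if b: "unit_symbol b" and c: "unit_symbol c" and E: "E \<in> sets borel" and Bb: "derivs_le ?M (\<lambda>_. Bb) b" and Bc: "derivs_le ?M (\<lambda>_. Bc) c"
      and e0: "\<epsilon>b \<ge> 0" "\<epsilon>c \<ge> 0"
      and Eb: "\<And>w. w \<in> E \<Longrightarrow> derivs_le ?M (\<lambda>z. \<epsilon>b * (1 + norm (z - w)) ^ P) b"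
      and Ec: "\<And>w. w \<notin> E \<Longrightarrow> derivs_le ?M (\<lambda>z. \<epsilon>c * (1 + norm (z - w)) ^ P) c"
      and u: "u \<in> schwartz"
    for b c :: "'a \<times> 'a \<Rightarrow> complex" and E Bb Bc \<epsilon>b \<epsilon>c u
  proof -
    have B0: "0 \<le> Bb" "0 \<le> Bc"
      using order_trans[OF norm_ge_zero derivs_leD[OF Bb, of 0]] order_trans[OF norm_ge_zero derivs_leD[OF Bc, of 0]] .
    let ?v = "Q t b u"
    have v: "?v \<in> schwartz" by (rule Q_schwartz[OF b t u])
    have Qv: "Q s c ?v \<in> schwartz" by (rule Q_schwartz[OF c s v])
    \<comment> \<open>The weight is the size of the kernel of \<open>c\<close> at the source
      \<open>w\<close>, up to a constant. Once it is part of \<open>F\<close>, Schur's test can be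
      applied to each of the two operators in turn.\<close>
    define F where "F = (\<lambda>w. complex_of_real (Bc * indicator E w + \<epsilon>c * indicator (- E) w) * fbi ?v w)"
    have nF: "norm (F w) = (Bc * indicator E w + \<epsilon>c * indicator (- E) w) * norm (fbi ?v w)" for w
      unfolding F_def norm_mult norm_of_real using B0 e0 by simp
    have Fm: "F \<in> borel_measurable borel"
      unfolding F_def using E fbi_measurable[OF schwartz_measurable[OF v]] by measurable
    obtain M where M: "M \<ge> 0" "\<And>w. norm (fbi u w) \<le> M" using fbi_bounded_schwartz[OF u] by metis
    obtain M' where M': "M' \<ge> 0" "\<And>w. norm (fbi ?v w) \<le> M'" using fbi_bounded_schwartz[OF v] by metis
    define A where "A = Bc * \<epsilon>b + \<epsilon>c * Bb"
    have A0: "0 \<le> A" using B0 e0 by (simp add: A_def)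
    have Fu: "norm (F w') \<le> (A * (Ct / \<mu>)) * (\<integral>w. wt ?k (w' - w) * norm (fbi u w) \<partial>lborel)" for w'
    proof -
      have kk: "norm (fbi ?v w') \<le> (Ct / \<mu>) * B * (\<integral>w. wt ?k (w' - w) * norm (fbi u w) \<partial>lborel)"
        if "derivs_le ?M (\<lambda>z. B * (1 + norm (z - w')) ^ P) b" for B
      proof -
        have "norm (fbi ?v w') \<le> 1 / \<mu> * (\<integral>w. wt ?k (w' - w) * (Ct * B * norm (fbi u w)) \<partial>lborel)"
          unfolding \<mu>_def
        proof (rule norm_fbi_Q_le[OF b t u])
          show "norm (wave_kernel t b w w') \<le> (Ct * B) * wt ?k (w' - w)" for w by (rule Ct(2)[OF b that]) simp
          have "0 \<le> B" using order_trans[OF norm_ge_zero derivs_leD[OF that, of w']] by simp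
          then show "Ct * B * norm (fbi u w) \<le> Ct * B * M" for w using Ct M by (intro mult_left_mono) auto
          show "(\<lambda>w. Ct * B * norm (fbi u w)) \<in> borel_measurable borel"
            using fbi_measurable[OF schwartz_measurable[OF u]] by measurable
        qed simp
        also have "\<dots> = (Ct / \<mu>) * B * (\<integral>w. wt ?k (w' - w) * norm (fbi u w) \<partial>lborel)"
          by (simp only: mult.left_commute[of "wt _ _"] integral_mult_right_zero) simp
        finally show ?thesis .
      qed
      let ?J = "\<integral>w. wt ?k (w' - w) * norm (fbi u w) \<partial>lborel"
      have J: "0 \<le> (Ct / \<mu>) * ?J" using Ct \<mu> by (intro mult_nonneg_nonneg Bochner_Integration.integral_nonneg) auto
      show ?thesis
      proof (cases "w' \<in> E")
        case True
        have "norm (F w') = Bc * norm (fbi ?v w')" unfolding nF using True by simp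
        also have "\<dots> \<le> Bc * ((Ct / \<mu>) * \<epsilon>b * ?J)" by (intro mult_left_mono kk Eb True B0)
        also have "\<dots> = (Bc * \<epsilon>b) * ((Ct / \<mu>) * ?J)" by (simp only: mult_ac)
        also have "\<dots> \<le> A * ((Ct / \<mu>) * ?J)" unfolding A_def using B0 e0 by (intro mult_right_mono J) simp
        finally show ?thesis by (simp only: mult.assoc)
      next
        case False
        have "norm (F w') = \<epsilon>c * norm (fbi ?v w')" unfolding nF using False by simp
        also have "\<dots> \<le> \<epsilon>c * ((Ct / \<mu>) * Bb * ?J)" by (intro mult_left_mono kk weak Bb e0)
        also have "\<dots> = (\<epsilon>c * Bb) * ((Ct / \<mu>) * ?J)" by (simp only: mult_ac)
        also have "\<dots> \<le> A * ((Ct / \<mu>) * ?J)" unfolding A_def using B0 e0 by (intro mult_right_mono J) simp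
        finally show ?thesis by (simp only: mult.assoc)
      qed
    qed
    have F2: "F \<in> L2" "L2_norm F \<le> (A * (Ct / \<mu>)) * I * L2_norm (fbi u)"
      using schur_test[OF schwartz_fbi_L2(1)[OF u] Fm _ Fu] A0 Ct \<mu> unfolding I_def by auto
    have "norm (fbi (Q s c ?v) w') \<le> (Cs / \<mu>) * (\<integral>w. wt ?k (w' - w) * norm (F w) \<partial>lborel)" for w'
    proof -
      have "norm (fbi (Q s c ?v) w') \<le> 1 / \<mu> * (\<integral>w. wt ?k (w' - w) * (Cs * norm (F w)) \<partial>lborel)"
        unfolding \<mu>_def
      proof (rule norm_fbi_Q_le[OF c s v])
        let ?D = "\<lambda>w. Cs * (Bc * indicator E w + \<epsilon>c * indicator (- E) w)"
        show "norm (wave_kernel s c w w') \<le> ?D w * wt ?k (w' - w)" for w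
        proof (cases "w \<in> E")
          case True
          then show ?thesis using Cs(2)[OF c weak[OF Bc, of w]] by simp
        next
          case False
          then show ?thesis using Cs(2)[OF c Ec[OF False]] by simp
        qed
        show "?D w * norm (fbi ?v w) \<le> Cs * norm (F w)" for w by (simp add: nF)
        show "(\<lambda>w. Cs * norm (F w)) \<in> borel_measurable borel" using Fm by measurable
        show "Cs * norm (F w) \<le> Cs * ((Bc + \<epsilon>c) * M')" for w
          unfolding nF using Cs B0 e0 M' by (intro mult_left_mono mult_mono) (auto simp: indicator_def)
      qed
      then show ?thesis by (simp only: mult.left_commute[of "wt _ _"] integral_mult_right_zero) simp
    qed
    from schur_test(2)[OF F2(1) fbi_measurable[OF schwartz_measurable[OF Qv]] _ this]
    have "L2_norm (fbi (Q s c ?v)) \<le> (Cs / \<mu>) * I * L2_norm F"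
      using Cs \<mu> unfolding I_def by auto
    also have "\<dots> \<le> (Cs / \<mu>) * I * ((A * (Ct / \<mu>)) * I * L2_norm (fbi u))"
      using Cs \<mu> I by (intro mult_left_mono F2) auto
    finally have "sqrt \<mu> * L2_norm (Q s c ?v) \<le> (Cs / \<mu>) * I * ((A * (Ct / \<mu>)) * I * (sqrt \<mu> * L2_norm u))"
      unfolding schwartz_fbi_L2(2)[OF u] schwartz_fbi_L2(2)[OF Qv] \<mu>_def .
    also have "\<dots> = sqrt \<mu> * ((Cs / \<mu> * I * (Ct / \<mu> * I)) * A * L2_norm u)" by (simp only: mult_ac)
    finally have le: "sqrt \<mu> * L2_norm (Q s c ?v) \<le> sqrt \<mu> * ((Cs / \<mu> * I * (Ct / \<mu> * I)) * A * L2_norm u)" .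
    have "0 < sqrt \<mu>" using \<mu> by simp
    from mult_left_le_imp_le[OF le this] show ?thesis unfolding A_def .
  qed
  have "0 \<le> Cs / \<mu> * I * (Ct / \<mu> * I)" using Cs Ct \<mu> I by simp
  then show ?thesis using that main by blast
qed


text \<open>The Calderon-Vaillancourt theorem at unit scale: the kernel bound with P = 0, Schur's
  test and the isometry. The constant depends on the symbol, which suffices for extending a fixed
  operator from Schwartz functions to L2.\<close>

lemma Q_L2_bound:
  fixes b :: "'a::euclidean_space \<times> 'a \<Rightarrow> complex"
  assumes b: "unit_symbol b" and t: "t \<in> {0..1}"
  obtains C where "C \<ge> 0" "\<And>u. u \<in> schwartz \<Longrightarrow> L2_norm (Q t b u) \<le> C * L2_norm u"
proof -
  let ?k = "2 * DIM('a \<times> 'a)"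
  define \<mu> where "\<mu> = fbi_mass TYPE('a)"
  have \<mu>: "0 < \<mu>" unfolding \<mu>_def by (rule fbi_mass_pos)
  define I where "I = (\<integral>w. wt ?k (w::'a \<times> 'a) \<partial>lborel)"
  have I: "0 \<le> I" by (simp add: I_def)
  obtain B where B: "B \<ge> 0" "derivs_le ?k (\<lambda>_. B) b" using unit_symbol_bound[OF b] by metis
  obtain Ct where Ct: "Ct \<ge> 0" "\<And>b B p w w'. unit_symbol (b :: 'a \<times> 'a \<Rightarrow> complex) \<Longrightarrow>
      derivs_le (?k + 0) (\<lambda>z. B * (1 + norm (z - p)) ^ 0) b \<Longrightarrow> p = w \<or> p = w' \<Longrightarrow>
      norm (wave_kernel t b w w') \<le> Ct * B * wt ?k (w' - w)"
    using wave_kernel_bound[OF t, where N = ?k and P = 0 and 'a = 'a] by blast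
  have "L2_norm (Q t b u) \<le> (Ct * B / \<mu> * I) * L2_norm u" if u: "u \<in> schwartz" for u
  proof -
    have Qu: "Q t b u \<in> schwartz" by (rule Q_schwartz[OF b t u])
    obtain M where M: "M \<ge> 0" "\<And>w. norm (fbi u w) \<le> M" using fbi_bounded_schwartz[OF u] by metis
    have le: "norm (fbi (Q t b u) w') \<le> (Ct * B / \<mu>) * (\<integral>w. wt ?k (w' - w) * norm (fbi u w) \<partial>lborel)" for w'
    proof -
      have "norm (fbi (Q t b u) w') \<le> 1 / \<mu> * (\<integral>w. wt ?k (w' - w) * (Ct * B * norm (fbi u w)) \<partial>lborel)"
        unfolding \<mu>_def
      proof (rule norm_fbi_Q_le[OF b t u])
        show "norm (wave_kernel t b w w') \<le> (Ct * B) * wt ?k (w' - w)" for w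
          by (rule Ct(2)[OF b, of B w]) (use B in simp_all)
        show "Ct * B * norm (fbi u w) \<le> Ct * B * M" for w using Ct B M by (intro mult_left_mono) auto
        show "(\<lambda>w. Ct * B * norm (fbi u w)) \<in> borel_measurable borel"
          using fbi_measurable[OF schwartz_measurable[OF u]] by measurable
      qed simp
      then show ?thesis by (simp only: mult.left_commute[of "wt _ _"] integral_mult_right_zero) simp
    qed
    have "sqrt \<mu> * L2_norm (Q t b u) \<le> (Ct * B / \<mu>) * I * (sqrt \<mu> * L2_norm u)"
      using schur_test(2)[OF schwartz_fbi_L2(1)[OF u] fbi_measurable[OF schwartz_measurable[OF Qu]] _ le] Ct B \<mu>
      unfolding I_def \<mu>_def schwartz_fbi_L2(2)[OF u] schwartz_fbi_L2(2)[OF Qu] by auto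
    also have "\<dots> = sqrt \<mu> * ((Ct * B / \<mu>) * I * L2_norm u)" by (simp only: mult_ac)
    finally have le: "sqrt \<mu> * L2_norm (Q t b u) \<le> sqrt \<mu> * ((Ct * B / \<mu>) * I * L2_norm u)" .
    have "0 < sqrt \<mu>" using \<mu> by simp
    from mult_left_le_imp_le[OF le this] show ?thesis .
  qed
  then show ?thesis using that[of "Ct * B / \<mu> * I"] Ct B \<mu> I by auto
qed

lemma amp_integrable:
  fixes b :: "'a::euclidean_space \<times> 'a \<Rightarrow> complex"
  assumes b: "unit_symbol b" and u: "u \<in> schwartz"
  shows "integrable lborel (\<lambda>y. amp t b x \<xi> y * u y)"
proof -
  obtain C where C: "C \<ge> 0" "derivs_le 0 (\<lambda>_. C) b" using unit_symbol_bound[OF b] by metis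
  show ?thesis
  proof (rule Bochner_Integration.integrable_bound[OF integrable_mult_right[OF integrable_norm[OF schwartz_integrable[OF u]], of C]])
    show "(\<lambda>y. amp t b x \<xi> y * u y) \<in> borel_measurable lborel"
      using borel_measurable_continuous_onI[OF continuous_on_mult[OF amp_continuous[OF unit_symbol_smooth[OF b]] schwartz_continuous[OF u]]]
      by (simp add: continuous_intros)
    show "AE y in lborel. norm (amp t b x \<xi> y * u y) \<le> norm (C * norm (u y))"
      using C by (auto simp: norm_mult abs_mult intro!: AE_I2 mult_right_mono amp_bound)
  qed
qed

lemma Q_inner_integrable:
  fixes b :: "'a::euclidean_space \<times> 'a \<Rightarrow> complex"
  assumes b: "unit_symbol b" and t: "t \<in> {0..1}" and u: "u \<in> schwartz"
  shows "integrable lborel (\<lambda>\<xi>. Q_inner t b u x \<xi>)"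
proof -
  obtain C where C: "C \<ge> 0" "\<And>x \<xi>. norm (Q_inner t b u x \<xi>) \<le> C * wt (2 * DIM('a)) \<xi>"
    using Q_inner_schwartz_bound[OF b t u] by metis
  note c = Q_inner_continuous[OF b schwartz_continuous[OF u] schwartz_integrable[OF u], of t]
  have "continuous_on UNIV (\<lambda>\<xi>. Q_inner t b u x \<xi>)"
    using continuous_on_compose2[OF c, of UNIV "\<lambda>\<xi>. (x, \<xi>)"] by (simp add: continuous_intros)
  then show ?thesis
    by (intro integrable_wt_bound(1)[of _ C 0] borel_measurable_continuous_onI) (use C in auto)
qed

lemma Q_diff:
  fixes b :: "'a::euclidean_space \<times> 'a \<Rightarrow> complex"
  assumes b: "unit_symbol b" and t: "t \<in> {0..1}" and u: "u \<in> schwartz" and v: "v \<in> schwartz"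
  shows "Q t b (\<lambda>y. u y - v y) x = Q t b u x - Q t b v x"
proof -
  have e: "Q_inner t b (\<lambda>y. u y - v y) x = (\<lambda>\<xi>. Q_inner t b u x \<xi> - Q_inner t b v x \<xi>)"
    unfolding Q_inner_def
    by (rule ext) (simp add: right_diff_distrib Bochner_Integration.integral_diff[OF amp_integrable[OF b u] amp_integrable[OF b v]])
  show ?thesis
    unfolding Q_def e
    by (rule Bochner_Integration.integral_diff[OF Q_inner_integrable[OF b t u] Q_inner_integrable[OF b t v]])
qed

section \<open>Freezing the symbol: a lower bound for elliptic operators\<close>

lemma unit_symbol_const: "unit_symbol (\<lambda>_. c)"
  unfolding unit_symbol_def using derivs_le_const[of c "norm c"] by auto

lemma unit_symbol_diff_const:
  assumes b: "unit_symbol b"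
  shows "unit_symbol (\<lambda>z. b z - c)"
  unfolding unit_symbol_def
proof (intro conjI allI)
  show "smooth (\<lambda>z. b z - c)" by (intro smooth_diff unit_symbol_smooth[OF b] smooth_const)
  fix k
  obtain C where C: "derivs_le k (\<lambda>_. C) b" using unit_symbol_bound[OF b] by metis
  have "derivs_le k (\<lambda>_. C + norm (- c)) (\<lambda>z. b z + (- c))"
    by (intro derivs_le_add C derivs_le_const unit_symbol_smooth[OF b] smooth_const order_refl)
  then show "\<exists>C. derivs_le k (\<lambda>_. C) (\<lambda>z. b z - c)" by auto
qed

text \<open>This is Fourier inversion; it fixes the factor (2 pi)^n by which \<open>Q\<close>
  exceeds the normalized quantization.\<close>

lemma Q_one:
  fixes v :: "'a::euclidean_space \<Rightarrow> complex"
  assumes t: "t \<in> {0..1}" and v: "v \<in> schwartz"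
  shows "Q t (\<lambda>_. 1) v x = of_real ((2 * pi) ^ DIM('a)) * v x"
proof -
  let ?F = "\<lambda>\<xi>. \<integral>y. v y * cis (- (\<xi> \<bullet> y)) \<partial>lborel"
  have Qi: "Q_inner t (\<lambda>_. 1) v x \<xi> = ?F \<xi> * cis (\<xi> \<bullet> x)" for x \<xi>
  proof -
    have "amp t (\<lambda>_. 1) x \<xi> y * v y = (v y * cis (- (\<xi> \<bullet> y))) * cis (\<xi> \<bullet> x)" for y
      by (simp add: amp_def inner_diff_left inner_commute[of \<xi>] mult.assoc cis_mult mult.commute)
    then show ?thesis unfolding Q_inner_def by (simp only: integral_mult_left_zero)
  qed
  have Fi: "integrable lborel ?F"
    using Q_inner_integrable[OF unit_symbol_const[of 1] t v, of 0] unfolding Qi by simp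
  obtain M where M: "\<And>x. norm (v x) \<le> M" using schwartz_bounded[OF v] by metis
  show ?thesis unfolding Q_def Qi
    by (rule fourier_inversion[OF schwartz_continuous[OF v] schwartz_integrable[OF v] M refl Fi])
qed

lemma Q_diff_const:
  fixes b :: "'a::euclidean_space \<times> 'a \<Rightarrow> complex"
  assumes b: "unit_symbol b" and t: "t \<in> {0..1}" and v: "v \<in> schwartz"
  shows "Q t (\<lambda>z. b z - c) v x = Q t b v x - c * (of_real ((2 * pi) ^ DIM('a)) * v x)"
proof -
  have i: "integrable lborel (\<lambda>y. c * (amp t (\<lambda>_. 1) x \<xi> y * v y))" for \<xi>
    by (intro integrable_mult_right amp_integrable unit_symbol_const v)
  have "Q_inner t (\<lambda>z. b z - c) v x \<xi> = Q_inner t b v x \<xi> - c * Q_inner t (\<lambda>_. 1) v x \<xi>" for \<xi>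
  proof -
    have "amp t (\<lambda>z. b z - c) x \<xi> y * v y = amp t b x \<xi> y * v y - c * (amp t (\<lambda>_. 1) x \<xi> y * v y)" for y
      by (simp add: amp_def algebra_simps)
    then show ?thesis
      unfolding Q_inner_def
      by (simp only: Bochner_Integration.integral_diff[OF amp_integrable[OF b v] i] integral_mult_right_zero)
  qed
  then have e: "Q_inner t (\<lambda>z. b z - c) v x = (\<lambda>\<xi>. Q_inner t b v x \<xi> - c * Q_inner t (\<lambda>_. 1) v x \<xi>)" ..
  have i1: "integrable lborel (\<lambda>\<xi>. c * Q_inner t (\<lambda>_. 1) v x \<xi>)"
    by (intro integrable_mult_right Q_inner_integrable unit_symbol_const t v)
  show ?thesis
    unfolding Q_one[OF t v, symmetric] unfolding Q_def e integral_mult_right_zero[symmetric]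
    by (rule Bochner_Integration.integral_diff[OF Q_inner_integrable[OF b t v] i1])
qed

text \<open>Freeze the symbol at the point w where the transform is evaluated: the main term is (2
  pi)^n c(w) times \<open>fbi v w\<close>, and the error is the transform at w of the operator with
  symbol c - c(w). That symbol grows linearly with slope \<sigma> away from w, so the kernel bound
  with P = 1 and Schur's test make the error O(\<sigma>) in norm. The factor (2 pi)^n \<ge> 1 is
  dropped.\<close>

lemma Q_elliptic_lower_bound:
  fixes t :: real
  assumes t: "t \<in> {0..1}"
  obtains C where "C \<ge> 0"
    "\<And>c E \<sigma> \<epsilon> v. unit_symbol (c :: 'a::euclidean_space \<times> 'a \<Rightarrow> complex) \<Longrightarrow> E \<in> sets borel \<Longrightarrow>
      (\<And>w. derivs_le (2 * DIM('a \<times> 'a) + 1) (\<lambda>z. \<sigma> * (1 + norm (z - w))) (\<lambda>z. c z - c w)) \<Longrightarrow>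
      (\<And>w. w \<in> E \<Longrightarrow> \<epsilon> \<le> norm (c w)) \<Longrightarrow> 0 \<le> \<epsilon> \<Longrightarrow> v \<in> schwartz \<Longrightarrow>
      \<epsilon> * L2_norm (\<lambda>w. indicator E w * fbi v w) \<le> C * (L2_norm (Q t c v) + \<sigma> * L2_norm v)"
proof -
  let ?k = "2 * DIM('a \<times> 'a)"
  define \<mu> where "\<mu> = fbi_mass TYPE('a)"
  have \<mu>: "0 < \<mu>" unfolding \<mu>_def by (rule fbi_mass_pos)
  define I where "I = (\<integral>w. wt ?k (w::'a \<times> 'a) \<partial>lborel)"
  have I: "0 \<le> I" by (simp add: I_def)
  define p where "p = (2 * pi) ^ DIM('a)"
  have p: "1 \<le> p" unfolding p_def using pi_gt3 by (intro one_le_power) simp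
  obtain Ct where Ct: "Ct \<ge> 0" "\<And>b B q w w'. unit_symbol (b :: 'a \<times> 'a \<Rightarrow> complex) \<Longrightarrow>
      derivs_le (?k + 1) (\<lambda>z. B * (1 + norm (z - q)) ^ 1) b \<Longrightarrow> q = w \<or> q = w' \<Longrightarrow>
      norm (wave_kernel t b w w') \<le> Ct * B * wt ?k (w' - w)"
    using wave_kernel_bound[OF t, where N = ?k and P = 1 and 'a = 'a] by blast
  define C where "C = sqrt \<mu> * (1 + Ct / \<mu> * I)"
  have C: "C \<ge> 0" using \<mu> Ct I by (simp add: C_def)
  have "\<epsilon> * L2_norm (\<lambda>w. indicator E w * fbi v w) \<le> C * (L2_norm (Q t c v) + \<sigma> * L2_norm v)"
    if c: "unit_symbol c" and E: "E \<in> sets borel"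
      and cw: "\<And>w. derivs_le (?k + 1) (\<lambda>z. \<sigma> * (1 + norm (z - w))) (\<lambda>z. c z - c w)"
      and ell: "\<And>w. w \<in> E \<Longrightarrow> \<epsilon> \<le> norm (c w)" and eps: "0 \<le> \<epsilon>" and v: "v \<in> schwartz"
    for c :: "'a \<times> 'a \<Rightarrow> complex" and E \<sigma> \<epsilon> v
  proof -
    have \<sigma>: "0 \<le> \<sigma>" using order_trans[OF norm_ge_zero derivs_leD[OF cw, of 0 0]] by simp
    have Qv: "Q t c v \<in> schwartz" by (rule Q_schwartz[OF c t v])
    note Vm = fbi_measurable[OF schwartz_measurable[OF v]] and QVm = fbi_measurable[OF schwartz_measurable[OF Qv]]
    define R where "R w = fbi (Q t c v) w - c w * of_real p * fbi v w" for w
    obtain M where M: "M \<ge> 0" "\<And>w. norm (fbi v w) \<le> M" using fbi_bounded_schwartz[OF v] by metis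
    have R: "R w' = fbi (Q t (\<lambda>z. c z - c w') v) w'" for w'
    proof -
      obtain M1 where M1: "\<And>x. norm (v x) \<le> M1" using schwartz_bounded[OF v] by metis
      obtain M2 where M2: "\<And>x. norm (Q t c v x) \<le> M2" using schwartz_bounded[OF Qv] by metis
      have "fbi (Q t (\<lambda>z. c z - c w') v) w' =
          (\<integral>y. Q t c v y * cnj (packet w' y) - (c w' * of_real p) * (v y * cnj (packet w' y)) \<partial>lborel)"
        unfolding fbi_def Q_diff_const[OF c t v] p_def
        by (intro Bochner_Integration.integral_cong refl) (simp add: left_diff_distrib mult.assoc)
      also have "\<dots> = R w'"
        unfolding R_def fbi_def
        by (subst Bochner_Integration.integral_diff)
           (auto intro!: integrable_mult_right integrable_bounded_packet[OF schwartz_measurable[OF v] M1]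
             integrable_bounded_packet[OF schwartz_measurable[OF Qv] M2])
      finally show ?thesis by simp
    qed
    have Rm: "R \<in> borel_measurable borel"
      unfolding R_def[abs_def] using QVm Vm smooth_measurable[OF unit_symbol_smooth[OF c]] by measurable
    have "norm (R w') \<le> (Ct * \<sigma> / \<mu>) * (\<integral>w. wt ?k (w' - w) * norm (fbi v w) \<partial>lborel)" for w'
    proof -
      note c' = unit_symbol_diff_const[OF c, of "c w'"]
      have "norm (R w') \<le> 1 / \<mu> * (\<integral>w. wt ?k (w' - w) * (Ct * \<sigma> * norm (fbi v w)) \<partial>lborel)"
        unfolding \<mu>_def R
      proof (rule norm_fbi_Q_le[OF c' t v])
        show "norm (wave_kernel t (\<lambda>z. c z - c w') w w') \<le> (Ct * \<sigma>) * wt ?k (w' - w)" for w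
          by (rule Ct(2)[OF c', of \<sigma> w']) (use cw in simp_all)
        show "Ct * \<sigma> * norm (fbi v w) \<le> Ct * \<sigma> * M" for w using Ct \<sigma> M by (intro mult_left_mono) auto
        show "(\<lambda>w. Ct * \<sigma> * norm (fbi v w)) \<in> borel_measurable borel" using Vm by measurable
      qed simp
      then show ?thesis by (simp only: mult.left_commute[of "wt _ _"] integral_mult_right_zero) simp
    qed
    from schur_test[OF schwartz_fbi_L2(1)[OF v] Rm _ this]
    have RL: "R \<in> L2" "L2_norm R \<le> (Ct * \<sigma> / \<mu>) * I * L2_norm (fbi v)"
      using Ct \<sigma> \<mu> unfolding I_def by auto
    have le: "norm (of_real \<epsilon> * (indicator E w * fbi v w)) \<le> norm (fbi (Q t c v) w - R w)" for w
    proof (cases "w \<in> E")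
      case True
      have "\<epsilon> * norm (fbi v w) \<le> (norm (c w) * p) * norm (fbi v w)"
        using ell[OF True] p mult_mono[of \<epsilon> "norm (c w)" 1 p] by (intro mult_right_mono) auto
      also have "\<dots> = norm (fbi (Q t c v) w - R w)" using p by (simp add: R_def norm_mult)
      finally show ?thesis using True eps by (simp add: norm_mult)
    qed simp
    have m: "(\<lambda>w. of_real \<epsilon> * (indicator E w * fbi v w)) \<in> borel_measurable borel"
      using L2_measurable[OF L2_cmult[OF L2_indicator(1)[OF schwartz_fbi_L2(1)[OF v] E]]] .
    have "\<epsilon> * L2_norm (\<lambda>w. indicator E w * fbi v w) = L2_norm (\<lambda>w. of_real \<epsilon> * (indicator E w * fbi v w))"
      using eps L2_norm_cmult[of "of_real \<epsilon>" "\<lambda>w. indicator E w * fbi v w"] by simp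
    also have "\<dots> \<le> L2_norm (\<lambda>w. fbi (Q t c v) w - R w)"
      by (rule L2_mono(2)[OF L2_diff(1)[OF schwartz_fbi_L2(1)[OF Qv] RL(1)] m le])
    also have "\<dots> \<le> L2_norm (fbi (Q t c v)) + L2_norm R" by (rule L2_diff(2)[OF schwartz_fbi_L2(1)[OF Qv] RL(1)])
    also have "\<dots> \<le> sqrt \<mu> * L2_norm (Q t c v) + (Ct * \<sigma> / \<mu>) * I * (sqrt \<mu> * L2_norm v)"
      using RL(2) unfolding schwartz_fbi_L2(2)[OF v] schwartz_fbi_L2(2)[OF Qv] \<mu>_def[symmetric] by simp
    also have "\<dots> = sqrt \<mu> * (1 * L2_norm (Q t c v)) + sqrt \<mu> * ((Ct / \<mu> * I) * (\<sigma> * L2_norm v))"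
      by (simp add: mult_ac)
    also have "\<dots> \<le> sqrt \<mu> * ((1 + Ct / \<mu> * I) * L2_norm (Q t c v)) + sqrt \<mu> * ((1 + Ct / \<mu> * I) * (\<sigma> * L2_norm v))"
      using \<mu> Ct I \<sigma> by (intro add_mono mult_left_mono mult_right_mono) auto
    finally show ?thesis by (simp add: C_def algebra_simps)
  qed
  then show ?thesis using that C by blast
qed

section \<open>Action on wave packets\<close>

lemma schwartz_translate:
  fixes f :: "'a::euclidean_space \<Rightarrow> complex"
  assumes f: "f \<in> schwartz"
  shows "(\<lambda>x. f (x + a)) \<in> schwartz"
proof (rule schwartzI)
  show "smooth (\<lambda>x. f (x + a))" by (rule smooth_affine[OF basis_affine_translation(2) schwartzD(1)[OF f]])
  fix k N
  obtain C where C: "C \<ge> 0" "derivs_le k (\<lambda>x. C * wt N x) f" using schwartzD(2)[OF f] by blast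
  have "derivs_le k (\<lambda>x. 1 ^ k * (C * wt N (x + a))) (\<lambda>x. f (x + a))"
    by (rule derivs_le_affine[OF basis_affine_translation(2) _ schwartzD(1)[OF f] C(2)]) simp
  then have "derivs_le k (\<lambda>x. (C * (1 + norm a) ^ N) * wt N x) (\<lambda>x. f (x + a))"
    by (rule derivs_le_mono) (use mult_left_mono[OF wt_peetre C(1)] in \<open>simp_all add: mult.assoc\<close>)
  then show "\<exists>C. derivs_le k (\<lambda>x. C * wt N x) (\<lambda>x. f (x + a))" by blast
qed

lemma packet_schwartz: "packet w \<in> schwartz"
proof -
  let ?q = "\<lambda>y::'a. (-1/2) * complex_of_real (y \<bullet> y) + \<i> * complex_of_real (snd w \<bullet> y)"
  have "slow (\<lambda>y::'a. complex_of_real (snd w \<bullet> y))"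
    by (rule slow_bounded_linear, rule bounded_linear_compose[OF bounded_linear_of_real bounded_linear_inner_right])
  then have "slow ?q"
    by (rule slow_add[OF slow_mult[OF slow_const slow_inner_product[OF bounded_linear_ident bounded_linear_ident]]
          slow_mult[OF slow_const]])
  then have "(\<lambda>y. 1 * exp (?q y)) \<in> schwartz"
    by (rule slow_exp_schwartz[where c = "1/2"]) (auto simp: power2_norm_eq_inner slow_const)
  from schwartz_translate[OF this, of "- fst w"]
  have "(\<lambda>y. exp (?q (y - fst w))) \<in> schwartz" by simp
  moreover have "packet w = (\<lambda>y. exp (?q (y - fst w)))"
    by (rule ext) (simp add: packet_def gauss_def cis_conv_exp exp_of_real[symmetric] power2_norm_eq_inner exp_add[symmetric] add.commute)
  ultimately show ?thesis by (simp only:)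
qed

lemma L2_norm_packet:
  fixes w :: "'a::euclidean_space \<times> 'a"
  shows "L2_norm (packet w) = L2_norm (\<lambda>y::'a. complex_of_real (gauss y))"
proof -
  have "(\<integral>y. (gauss (y - fst w))\<^sup>2 \<partial>lborel) = (\<integral>y. (gauss (y::'a))\<^sup>2 \<partial>lborel)"
    using lborel_integral_shift[of "\<lambda>y::'a. (gauss y)\<^sup>2" "- fst w"] by simp
  then show ?thesis by (simp add: L2_norm_def norm_packet)
qed

lemma norm_fbi_le: 
  assumes "f \<in> L2"
  shows "norm (fbi f w) \<le> L2_norm f * L2_norm (packet w)"
proof -
  have "norm (fbi f w) \<le> (\<integral>y. norm (f y * cnj (packet w y)) \<partial>lborel)"
    unfolding fbi_def by (rule integral_norm_bound)
  also have "\<dots> = (\<integral>y. norm (f y) * norm (packet w y) \<partial>lborel)" by (simp add: norm_mult)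
  also have "\<dots> \<le> L2_norm f * L2_norm (packet w)"
    by (rule L2_cauchy_schwarz(2)[OF assms schwartz_L2[OF packet_schwartz]])
  finally show ?thesis .
qed

text \<open>The transform of the image of a packet is the packet kernel. Of its decay, P powers give
  the factor (1 + R)^(-P) outside \<open>E\<close>, and the others keep it square
  integrable.\<close>

lemma Q_packet_tail:
  fixes t :: real
  assumes t: "t \<in> {0..1}"
  obtains C where "C \<ge> 0"
    "\<And>b B E R w. unit_symbol (b :: 'a::euclidean_space \<times> 'a \<Rightarrow> complex) \<Longrightarrow> derivs_le (2 * DIM('a \<times> 'a) + P) (\<lambda>_. B) b \<Longrightarrow>
      E \<in> sets borel \<Longrightarrow> R \<ge> 0 \<Longrightarrow> (\<And>w'. w' \<notin> E \<Longrightarrow> R \<le> norm (w' - w)) \<Longrightarrow>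
      L2_norm (\<lambda>w'. indicator (- E) w' * fbi (Q t b (packet w)) w') \<le> C * B * inverse ((1 + R) ^ P)"
proof -
  let ?k = "2 * DIM('a \<times> 'a)"
  define I where "I = (\<integral>w. wt ?k (w::'a \<times> 'a) \<partial>lborel)"
  have I: "0 \<le> I" by (simp add: I_def)
  obtain Ct where Ct: "Ct \<ge> 0" "\<And>b B p w w'. unit_symbol (b :: 'a \<times> 'a \<Rightarrow> complex) \<Longrightarrow>
      derivs_le (?k + P + 0) (\<lambda>z. B * (1 + norm (z - p)) ^ 0) b \<Longrightarrow> p = w \<or> p = w' \<Longrightarrow>
      norm (wave_kernel t b w w') \<le> Ct * B * wt (?k + P) (w' - w)"
    using wave_kernel_bound[OF t, where N = "?k + P" and P = 0 and 'a = 'a] by blast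
  have "L2_norm (\<lambda>w'. indicator (- E) w' * fbi (Q t b (packet w)) w') \<le> (Ct * sqrt I) * B * inverse ((1 + R) ^ P)"
    if b: "unit_symbol b" and B: "derivs_le (?k + P) (\<lambda>_. B) b" and E: "E \<in> sets borel" and R: "R \<ge> 0"
      and far: "\<And>w'. w' \<notin> E \<Longrightarrow> R \<le> norm (w' - w)"
    for b :: "'a \<times> 'a \<Rightarrow> complex" and B E R w
  proof -
    have B0: "0 \<le> B" using order_trans[OF norm_ge_zero derivs_leD[OF B, of 0]] .
    let ?f = "\<lambda>w'. indicator (- E) w' * fbi (Q t b (packet w)) w'"
    let ?r = "inverse ((1 + R) ^ P)"
    define h where "h w' = complex_of_real (Ct * B * ?r * wt ?k (w' - w))" for w'
    have le: "norm (?f w') \<le> norm (h w')" for w'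
    proof (cases "w' \<in> E")
      case False
      have "norm (?f w') = norm (wave_kernel t b w w')" using False by (simp add: wave_kernel_def)
      also have "\<dots> \<le> Ct * B * wt (?k + P) (w' - w)" by (rule Ct(2)[OF b, of B w]) (use B in simp_all)
      also have "\<dots> \<le> Ct * B * (wt ?k (w' - w) * ?r)"
      proof -
        have "wt P (w' - w) \<le> ?r"
          unfolding wt_def using far[OF False] R by (intro le_imp_inverse_le power_mono) auto
        then show ?thesis unfolding wt_add using Ct B0 by (intro mult_left_mono) auto
      qed
      also have "\<dots> \<le> norm (h w')"
        unfolding h_def norm_of_real by (rule order_trans[OF _ abs_ge_self]) (simp add: mult_ac)
      finally show ?thesis .
    qed simp
    have hm: "h \<in> borel_measurable borel" unfolding h_def by measurable
    have hL: "h \<in> L2"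
    proof (rule rapid_L2[OF hm])
      have "0 \<le> Ct * B * ?r * wt ?k (x - w)" for x using Ct(1) B0 R by (intro mult_nonneg_nonneg) auto
      then show "norm (h x) \<le> (Ct * B * ?r) * wt ?k (x - w)" for x
        unfolding h_def norm_of_real by (simp only: abs_of_nonneg)
    qed
    have i1: "integrable lborel (\<lambda>w'. wt ?k (w' - w))"
      by (intro lborel_integrable_shift wt_integrable) simp
    have "(L2_norm h)\<^sup>2 \<le> (\<integral>w'. (Ct * B * ?r)\<^sup>2 * wt ?k (w' - w) \<partial>lborel)"
      unfolding L2_norm_power2
    proof (rule integral_mono[OF L2_integrable[OF hL] integrable_mult_right[OF i1]])
      fix w'
      have "(norm (h w'))\<^sup>2 = (Ct * B * ?r)\<^sup>2 * (wt ?k (w' - w) * wt ?k (w' - w))"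
        unfolding h_def norm_of_real by (simp add: power2_eq_square)
      also have "\<dots> \<le> (Ct * B * ?r)\<^sup>2 * (wt ?k (w' - w) * 1)" by (intro mult_left_mono wt_le_1) auto
      finally show "(norm (h w'))\<^sup>2 \<le> (Ct * B * ?r)\<^sup>2 * wt ?k (w' - w)" by simp
    qed
    also have "\<dots> = (Ct * B * ?r)\<^sup>2 * I"
      using lborel_integral_shift[of "wt ?k :: 'a \<times> 'a \<Rightarrow> real" "- w"] by (simp add: I_def)
    also have "\<dots> = ((Ct * sqrt I) * B * ?r)\<^sup>2" using I by (simp add: power_mult_distrib)
    finally have "L2_norm h \<le> (Ct * sqrt I) * B * ?r"
      by (rule power2_le_imp_le) (use Ct B0 R I in auto)
    moreover have "?f \<in> borel_measurable borel"
      by (intro borel_measurable_times borel_measurable_indicator fbi_measurable schwartz_measurable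
          Q_schwartz[OF b t packet_schwartz]) (use E in auto)
    ultimately show ?thesis using L2_mono(2)[OF hL _ le] by fastforce
  qed
  then show ?thesis using that[of "Ct * sqrt I"] Ct I by auto
qed

text \<open>\<open>wave_kernel_eq\<close> read backwards: over all pairs of packets with
  intermediate point \<open>m\<close>, the kernel is up to a phase the Fourier transform of the
  symbol centred at \<open>m\<close> times \<open>wigner_gauss\<close>. Inversion at the origin
  returns \<open>b m\<close>, because the window does not vanish there. Frequencies up to
  \<open>R\<close> are controlled by the hypothesis and larger ones by kernel decay.\<close>

lemma unit_symbol_recovery:
  fixes t :: real
  assumes t: "t \<in> {0..1}"
  obtains C where "C \<ge> 0"
    "\<And>b B R \<epsilon> m. unit_symbol (b :: 'a::euclidean_space \<times> 'a \<Rightarrow> complex) \<Longrightarrow> derivs_le (2 * DIM('a \<times> 'a) + P) (\<lambda>_. B) b \<Longrightarrow>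
      R \<ge> 0 \<Longrightarrow> (\<And>w. norm (w - m) \<le> R \<Longrightarrow> L2_norm (Q t b (packet w)) \<le> \<epsilon>) \<Longrightarrow>
      norm (b m) \<le> C * (\<epsilon> * (1 + R) ^ (2 * DIM('a \<times> 'a)) + B * inverse ((1 + R) ^ P))"
proof -
  let ?k = "2 * DIM('a \<times> 'a)"
  let ?g = "\<lambda>z::'a \<times> 'a. wigner_gauss t (fst z) (snd z)"
  define I where "I = (\<integral>w. wt ?k (w::'a \<times> 'a) \<partial>lborel)"
  have I: "0 \<le> I" by (simp add: I_def)
  define G where "G = L2_norm (\<lambda>y::'a. complex_of_real (gauss y))"
  have G: "0 \<le> G" by (simp add: G_def)
  define p where "p = (2 * pi) ^ DIM('a \<times> 'a) * norm (wigner_gauss t 0 (0::'a))"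
  have p: "0 < p" unfolding p_def using wigner_gauss_0[where 'a = 'a, of t] by simp
  obtain Ct where Ct: "Ct \<ge> 0" "\<And>b B p w w'. unit_symbol (b :: 'a \<times> 'a \<Rightarrow> complex) \<Longrightarrow>
      derivs_le (?k + P + 0) (\<lambda>z. B * (1 + norm (z - p)) ^ 0) b \<Longrightarrow> p = w \<or> p = w' \<Longrightarrow>
      norm (wave_kernel t b w w') \<le> Ct * B * wt (?k + P) (w' - w)"
    using wave_kernel_bound[OF t, where N = "?k + P" and P = 0 and 'a = 'a] by blast
  have "norm (b m) \<le> ((G + Ct) * I / p) * (\<epsilon> * (1 + R) ^ ?k + B * inverse ((1 + R) ^ P))"
    if b: "unit_symbol b" and B: "derivs_le (?k + P) (\<lambda>_. B) b" and R: "R \<ge> 0"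
      and small: "\<And>w. norm (w - m) \<le> R \<Longrightarrow> L2_norm (Q t b (packet w)) \<le> \<epsilon>"
    for b :: "'a \<times> 'a \<Rightarrow> complex" and B R \<epsilon> m
  proof -
    have B0: "0 \<le> B" using order_trans[OF norm_ge_zero derivs_leD[OF B, of 0]] .
    have e0: "0 \<le> \<epsilon>" using order_trans[OF L2_norm_nonneg small[of m]] R by simp
    let ?f = "\<lambda>z. b (m + z) * ?g z"
    let ?F = "\<lambda>d. \<integral>z. ?f z * cis (- (d \<bullet> z)) \<partial>lborel"
    let ?r = "inverse ((1 + R) ^ P)"
    have sb: "smooth (\<lambda>z. b (m + z))" by (rule smooth_affine[OF basis_affine_translation(1) unit_symbol_smooth[OF b]])
    have sf: "smooth ?f" by (intro smooth_mult sb schwartzD(1)[OF wigner_gauss_schwartz])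
    note fc = smooth_continuous[OF sf, of UNIV]
    have nb: "norm (b z) \<le> B" for z by (rule derivs_leD[OF B])
    obtain D where D: "D \<ge> 0" "\<And>z. norm (?g z) \<le> D * wt ?k z" using schwartz_bound[OF wigner_gauss_schwartz] by metis
    have fb: "norm (?f z) \<le> (B * D) * wt ?k (z - 0)" for z
      using mult_mono[OF nb D(2) B0 norm_ge_zero, of "m + z" z] by (simp add: norm_mult mult.assoc)
    have fi: "integrable lborel ?f"
      by (rule integrable_wt_bound(1)[OF smooth_measurable[OF sf] fb])
    have fM: "norm (?f z) \<le> B * D" for z
      using fb[of z] mult_left_mono[OF wt_le_1[of ?k z], of "B * D"] B0 D by simp
    have nF: "norm (?F d) \<le> ((G + Ct) * (\<epsilon> * (1 + R) ^ ?k + B * ?r)) * wt ?k (d - 0)" for d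
    proof -
      obtain d1 d2 where d: "d = (d1, d2)" by (cases d)
      obtain m1 m2 where m: "m = (m1, m2)" by (cases m)
      \<comment> \<open>The pair of packets with intermediate point \<open>m\<close> and kernel
        frequency \<open>- d\<close>. The source \<open>?w\<close> stays within |d| of
        \<open>m\<close>, so the hypothesis covers it when |d| \<le> R.\<close>
      let ?w = "(m1 + t *\<^sub>R d2, m2 - (1 - t) *\<^sub>R d1)" and ?w' = "(m1 - (1 - t) *\<^sub>R d2, m2 + t *\<^sub>R d1)"
      have e1: "t *\<^sub>R (m1 - (1 - t) *\<^sub>R d2) + (1 - t) *\<^sub>R (m1 + t *\<^sub>R d2) = m1"
        "t *\<^sub>R (m2 - (1 - t) *\<^sub>R d1) + (1 - t) *\<^sub>R (m2 + t *\<^sub>R d1) = m2"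
        "m2 - (1 - t) *\<^sub>R d1 - (m2 + t *\<^sub>R d1) = - d1"
        "m1 - (1 - t) *\<^sub>R d2 - (m1 + t *\<^sub>R d2) = - d2"
        by (simp_all add: algebra_simps)
      have "norm (wave_kernel t b ?w ?w') = norm (\<integral>z. ?f z * cis ((- d1, - d2) \<bullet> z) \<partial>lborel)"
        unfolding wave_kernel_eq[OF b t] e1 m by (simp add: norm_mult)
      also have "(\<integral>z. ?f z * cis ((- d1, - d2) \<bullet> z) \<partial>lborel) = ?F d"
        by (simp add: d inner_prod_def)
      finally have FK: "norm (?F d) = norm (wave_kernel t b ?w ?w')" by simp
      have ww: "?w' - ?w = (- d2, d1)" by (simp add: algebra_simps)
      have nd: "norm (?w' - ?w) = norm d" unfolding ww d norm_Pair by (simp add: add.commute)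
      have "?w - m = (t *\<^sub>R d2, (- (1 - t)) *\<^sub>R d1)" unfolding m diff_Pair scaleR_minus_left by simp
      then have wm: "norm (?w - m) \<le> norm d"
        using norm_scaled_Pair_le[of t "- (1 - t)" d2 d1] t by (simp add: d norm_Pair add.commute)
      have Q: "Q t b (packet ?w) \<in> schwartz" by (rule Q_schwartz[OF b t packet_schwartz])
      show ?thesis
      proof (cases "norm d \<le> R")
        case True
        have "norm (?F d) \<le> L2_norm (Q t b (packet ?w)) * G"
          unfolding FK wave_kernel_def G_def
          using norm_fbi_le[OF schwartz_L2[OF Q], of ?w'] by (simp only: L2_norm_packet)
        also have "\<dots> \<le> \<epsilon> * G" using True wm G by (intro mult_right_mono small) auto
        \<comment> \<open>For |d| \<le> R the inserted factor is at least 1; it makes the bound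
          integrable in \<open>d\<close>, in the same form as in the other case.\<close>
        also have "\<dots> \<le> \<epsilon> * G * ((1 + R) ^ ?k * wt ?k d)"
        proof -
          have "(1 + norm d) ^ ?k * wt ?k d \<le> (1 + R) ^ ?k * wt ?k d"
            using True by (intro mult_right_mono power_mono) auto
          then have "1 \<le> (1 + R) ^ ?k * wt ?k d" using wt_cancel[of d ?k 0] by simp
          then show ?thesis using e0 G mult_left_mono[of 1 "(1 + R) ^ ?k * wt ?k d" "\<epsilon> * G"] by simp
        qed
        also have "\<dots> = (G * (\<epsilon> * (1 + R) ^ ?k)) * wt ?k d" by (simp only: mult_ac)
        also have "\<dots> \<le> ((G + Ct) * (\<epsilon> * (1 + R) ^ ?k + B * ?r)) * wt ?k d"
          using G Ct e0 B0 R by (intro mult_right_mono mult_mono) auto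
        finally show ?thesis by simp
      next
        case False
        have "norm (?F d) \<le> Ct * B * wt (?k + P) (?w' - ?w)"
          unfolding FK by (rule Ct(2)[OF b, of B ?w]) (use B in simp_all)
        also have "\<dots> = Ct * B * (wt ?k d * wt P d)" unfolding wt_add[symmetric] unfolding wt_def nd ..
        also have "\<dots> \<le> Ct * B * (wt ?k d * ?r)"
        proof -
          have "wt P d \<le> ?r" unfolding wt_def using False R by (intro le_imp_inverse_le power_mono) auto
          then show ?thesis using Ct B0 by (intro mult_left_mono) auto
        qed
        also have "\<dots> = (Ct * (B * ?r)) * wt ?k d" by (simp only: mult_ac)
        also have "\<dots> \<le> ((G + Ct) * (\<epsilon> * (1 + R) ^ ?k + B * ?r)) * wt ?k d"
          using G Ct e0 B0 R by (intro mult_right_mono mult_mono) auto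
        finally show ?thesis by simp
      qed
    qed
    have Fm: "?F \<in> borel_measurable borel"
      by (rule measurable_integral, rule borel_measurable_continuous_onI)
         (intro continuous_intros continuous_on_compose2[OF fc] subset_UNIV)
    have "(\<integral>d. ?F d * cis (d \<bullet> 0) \<partial>lborel) = of_real ((2 * pi) ^ DIM('a \<times> 'a)) * ?f 0"
      by (rule fourier_inversion[OF fc fi fM refl integrable_wt_bound(1)[OF Fm nF]])
    then have "p * norm (b m) = norm (\<integral>d. ?F d \<partial>lborel)"
      by (simp add: p_def norm_mult norm_power)
    also have "norm (\<integral>d. ?F d \<partial>lborel) \<le> ((G + Ct) * (\<epsilon> * (1 + R) ^ ?k + B * ?r)) * I"
      unfolding I_def by (rule integrable_wt_bound(2)[OF Fm nF])
    finally show ?thesis using p by (simp add: field_simps)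
  qed
  then show ?thesis using that[of "(G + Ct) * I / p"] G Ct I p by auto
qed

section \<open>Completeness and density\<close>

text \<open>Riesz-Fischer for functions. Along a subsequence with consecutive distances at most
  2^(-k), Cauchy-Schwarz against the Gaussian makes the weighted sum of the differences integrable;
  since the Gaussian is positive, the subsequence converges almost everywhere. Fatou's lemma then
  gives convergence in L2.\<close>

lemma L2_complete:
  fixes f :: "nat \<Rightarrow> 'a::euclidean_space \<Rightarrow> complex"
  assumes f: "\<And>k. f k \<in> L2"
    and cauchy: "\<And>e. e > 0 \<Longrightarrow> \<exists>N. \<forall>m\<ge>N. \<forall>n\<ge>N. L2_norm (\<lambda>x. f m x - f n x) \<le> e"
  obtains v where "L2_tendsto f v"
proof -
  note fm [measurable] = L2_measurable[OF f]
  have "\<exists>N. \<forall>m\<ge>N. \<forall>n\<ge>N. L2_norm (\<lambda>x. f m x - f n x) \<le> (1/2) ^ k" for k :: nat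
    by (rule cauchy) simp
  then obtain N where N: "\<And>k m n. m \<ge> N k \<Longrightarrow> n \<ge> N k \<Longrightarrow> L2_norm (\<lambda>x. f m x - f n x) \<le> (1/2) ^ k"
    by metis
  \<comment> \<open>Summing the \<open>N j\<close> makes both \<open>r k\<close> and
    \<open>r (Suc k)\<close> at least \<open>N k\<close>; the summand \<open>k\<close> lets the
    subsequence run to infinity.\<close>
  define r where "r k = (\<Sum>j\<le>k. N j) + k" for k
  have rN: "N k \<le> r k" "N k \<le> r (Suc k)" "k \<le> r k" for k
    using member_le_sum[of k "{..k}" N] by (auto simp: r_def)
  define d where "d k x = f (r (Suc k)) x - f (r k) x" for k x
  have dL: "d k \<in> L2" "L2_norm (d k) \<le> (1/2) ^ k" for k
    using L2_diff(1)[OF f f, of "r (Suc k)" "r k"] N[OF rN(2) rN(1)] by (simp_all add: d_def[abs_def])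
  let ?g = "\<lambda>x::'a. complex_of_real (gauss x)"
  have gL: "?g \<in> L2" by (rule schwartz_L2[OF gauss_schwartz])
  note dm [measurable] = L2_measurable[OF dL(1)]
  have "(\<integral>\<^sup>+x. (\<Sum>k. ennreal (norm (d k x) * gauss x)) \<partial>lborel) = (\<Sum>k. \<integral>\<^sup>+x. ennreal (norm (d k x) * gauss x) \<partial>lborel)"
    by (rule nn_integral_suminf) measurable
  also have "\<dots> \<le> (\<Sum>k. ennreal ((1/2) ^ k * L2_norm ?g))"
  proof (rule suminf_le)
    fix k
    have "(\<integral>\<^sup>+x. ennreal (norm (d k x) * norm (?g x)) \<partial>lborel) = ennreal (\<integral>x. norm (d k x) * norm (?g x) \<partial>lborel)"
      by (rule nn_integral_eq_integral[OF L2_cauchy_schwarz(1)[OF dL(1) gL]]) auto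
    also have "\<dots> \<le> ennreal ((1/2) ^ k * L2_norm ?g)"
      by (intro ennreal_leI order_trans[OF L2_cauchy_schwarz(2)[OF dL(1) gL]] mult_right_mono dL) auto
    finally show "(\<integral>\<^sup>+x. ennreal (norm (d k x) * gauss x) \<partial>lborel) \<le> ennreal ((1/2) ^ k * L2_norm ?g)"
      by simp
  qed auto
  also have "\<dots> = ennreal (\<Sum>k. (1/2) ^ k * L2_norm ?g)"
    by (intro suminf_ennreal2 summable_mult2 summable_geometric) auto
  also have "\<dots> < \<infinity>" by simp
  finally have fin: "(\<integral>\<^sup>+x. (\<Sum>k. ennreal (norm (d k x) * gauss x)) \<partial>lborel) \<noteq> \<infinity>" by simp
  have "AE x in lborel. (\<Sum>k. ennreal (norm (d k x) * gauss x)) \<noteq> \<infinity>"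
    by (rule nn_integral_PInf_AE[OF _ fin]) measurable
  then have conv: "AE x in lborel. convergent (\<lambda>k. f (r k) x)"
  proof (rule AE_mp, intro AE_I2 impI)
    fix x assume "(\<Sum>k. ennreal (norm (d k x) * gauss x)) \<noteq> \<infinity>"
    then have "summable (\<lambda>k. norm (d k x) * gauss x)" by (intro summable_suminf_not_top) auto
    then have "summable (\<lambda>k. norm (d k x) * gauss x * (1 / gauss x))" by (rule summable_mult2)
    moreover have "norm (d k x) * gauss x * (1 / gauss x) = norm (d k x)" for k using gauss_pos[of x] by simp
    ultimately have "summable (\<lambda>k. norm (d k x))" by (simp only:)
    then have "summable (\<lambda>k. d k x)" by (rule summable_norm_cancel)
    then have "convergent (\<lambda>n. f (r 0) x + (\<Sum>k<n. d k x))"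
      by (intro convergent_add convergent_const) (simp add: summable_iff_convergent)
    moreover have "f (r 0) x + (\<Sum>k<n. d k x) = f (r n) x" for n
      unfolding d_def using sum_lessThan_telescope[of "\<lambda>k. f (r k) x" n] by simp
    ultimately show "convergent (\<lambda>k. f (r k) x)" by (simp only:)
  qed
  define v where "v x = lim (\<lambda>k. f (r k) x)" for x
  have vm [measurable]: "v \<in> borel_measurable borel"
    unfolding v_def[abs_def] by (rule borel_measurable_lim_metric) (rule fm)
  have lim: "AE x in lborel. (\<lambda>k. f (r k) x) \<longlonglongrightarrow> v x"
    using conv by eventually_elim (simp add: v_def convergent_LIMSEQ_iff)
  have close: "(\<lambda>x. f m x - v x) \<in> L2" "L2_norm (\<lambda>x. f m x - v x) \<le> e"
    if e: "0 \<le> e" and M: "\<And>n. n \<ge> M \<Longrightarrow> L2_norm (\<lambda>x. f m x - f n x) \<le> e" for m M e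
  proof -
    let ?u = "\<lambda>k x. ennreal ((norm (f m x - f (r k) x))\<^sup>2)"
    have "(\<integral>\<^sup>+x. ennreal ((norm (f m x - v x))\<^sup>2) \<partial>lborel) = (\<integral>\<^sup>+x. liminf (\<lambda>k. ?u k x) \<partial>lborel)"
    proof (rule nn_integral_cong_AE)
      show "AE x in lborel. ennreal ((norm (f m x - v x))\<^sup>2) = liminf (\<lambda>k. ?u k x)"
        using lim
      proof eventually_elim
        case (elim x)
        have "(\<lambda>k. ?u k x) \<longlonglongrightarrow> ennreal ((norm (f m x - v x))\<^sup>2)"
          by (intro tendsto_ennrealI tendsto_power tendsto_norm tendsto_diff tendsto_const elim)
        then show ?case by (rule lim_imp_Liminf[OF sequentially_bot, symmetric])
      qed
    qed
    also have "\<dots> \<le> liminf (\<lambda>k. \<integral>\<^sup>+x. ?u k x \<partial>lborel)"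
      by (rule nn_integral_liminf) measurable
    also have "\<dots> \<le> limsup (\<lambda>k. \<integral>\<^sup>+x. ?u k x \<partial>lborel)"
      by (rule Liminf_le_Limsup) simp
    also have "\<dots> \<le> ennreal (e\<^sup>2)"
    proof (rule Limsup_bounded, rule eventually_sequentiallyI)
      fix k assume "M \<le> k"
      then have "L2_norm (\<lambda>x. f m x - f (r k) x) \<le> e" using rN(3)[of k] by (intro M) simp
      then show "(\<integral>\<^sup>+x. ?u k x \<partial>lborel) \<le> ennreal (e\<^sup>2)"
        unfolding L2_nn_integral[OF L2_diff(1)[OF f f]] by (intro ennreal_leI power_mono) auto
    qed
    finally have le: "(\<integral>\<^sup>+x. ennreal ((norm (f m x - v x))\<^sup>2) \<partial>lborel) \<le> ennreal (e\<^sup>2)" .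
    have "(\<lambda>x. f m x - v x) \<in> borel_measurable borel" by measurable
    from L2I_nn[OF this le e] show "(\<lambda>x. f m x - v x) \<in> L2" "L2_norm (\<lambda>x. f m x - v x) \<le> e" .
  qed
  obtain M where M: "\<And>m n. m \<ge> M \<Longrightarrow> n \<ge> M \<Longrightarrow> L2_norm (\<lambda>x. f m x - f n x) \<le> 1" using cauchy[of 1] by auto
  have "(\<lambda>x. f M x - (f M x - v x)) \<in> L2"
    by (rule L2_diff(1)[OF f close(1)[of 1 M]]) (use M in auto)
  then have vL: "v \<in> L2" by simp
  have "(\<lambda>k. L2_norm (\<lambda>x. f k x - v x)) \<longlonglongrightarrow> 0"
  proof (rule LIMSEQ_I)
    fix e :: real assume e: "0 < e"
    obtain M where M: "\<And>m n. m \<ge> M \<Longrightarrow> n \<ge> M \<Longrightarrow> L2_norm (\<lambda>x. f m x - f n x) \<le> e / 2"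
      using cauchy[of "e / 2"] e by auto
    have "norm (L2_norm (\<lambda>x. f m x - v x) - 0) < e" if "m \<ge> M" for m
      using close(2)[of "e / 2" M m] M[OF that] e by simp
    then show "\<exists>no. \<forall>n\<ge>no. norm (L2_norm (\<lambda>x. f n x - v x) - 0) < e" by blast
  qed
  then show ?thesis using that f vL by (auto simp: L2_tendsto_def)
qed

definition schwartz_approx :: "('a::euclidean_space \<Rightarrow> complex) \<Rightarrow> bool" where
  "schwartz_approx f \<longleftrightarrow> f \<in> L2 \<and> (\<forall>e>0. \<exists>\<phi>\<in>schwartz. L2_norm (\<lambda>x. f x - \<phi> x) < e)"

lemma schwartz_approx_limit:
  assumes f: "f \<in> L2" and g: "\<And>k. schwartz_approx (g k)"
    and lim: "(\<lambda>k. L2_norm (\<lambda>x. g k x - f x)) \<longlonglongrightarrow> 0"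
  shows "schwartz_approx f"
  unfolding schwartz_approx_def
proof (intro conjI f allI impI)
  fix e :: real assume e: "0 < e"
  have gL: "g k \<in> L2" for k using g by (auto simp: schwartz_approx_def)
  obtain k where k: "L2_norm (\<lambda>x. g k x - f x) < e / 2"
    using order_tendstoD(2)[OF lim, of "e / 2"] e by (auto simp: eventually_sequentially)
  obtain \<phi> where \<phi>: "\<phi> \<in> schwartz" "L2_norm (\<lambda>x. g k x - \<phi> x) < e / 2"
    using g[of k, unfolded schwartz_approx_def] half_gt_zero[OF e] by blast
  have "L2_norm (\<lambda>x. (g k x - \<phi> x) - (g k x - f x)) \<le> L2_norm (\<lambda>x. g k x - \<phi> x) + L2_norm (\<lambda>x. g k x - f x)"
    by (intro L2_diff gL f schwartz_L2 \<phi>)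
  then have "L2_norm (\<lambda>x. f x - \<phi> x) < e" using k \<phi> by simp
  then show "\<exists>\<phi>\<in>schwartz. L2_norm (\<lambda>x. f x - \<phi> x) < e" using \<phi> by blast
qed

lemma L2_dominated_convergence:
  fixes f :: "'a::euclidean_space \<Rightarrow> complex"
  assumes m: "f \<in> borel_measurable borel" "\<And>k. g k \<in> borel_measurable borel"
    and w: "integrable lborel w" "\<And>k x. (norm (g k x - f x))\<^sup>2 \<le> w x"
    and lim: "AE x in lborel. (\<lambda>k. g k x) \<longlonglongrightarrow> f x"
  shows "(\<lambda>k. L2_norm (\<lambda>x. g k x - f x)) \<longlonglongrightarrow> 0"
proof -
  have "(\<lambda>k. \<integral>x. (norm (g k x - f x))\<^sup>2 \<partial>lborel) \<longlonglongrightarrow> (\<integral>x. 0 \<partial>(lborel :: 'a measure))"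
  proof (rule integral_dominated_convergence[OF _ _ w(1)])
    show "AE x in lborel. (\<lambda>k. (norm (g k x - f x))\<^sup>2) \<longlonglongrightarrow> 0"
      using lim
    proof eventually_elim
      case (elim x)
      have "(\<lambda>k. (norm (g k x - f x))\<^sup>2) \<longlonglongrightarrow> (norm (f x - f x))\<^sup>2"
        by (intro tendsto_power tendsto_norm tendsto_diff tendsto_const elim)
      then show ?case by simp
    qed
    show "(\<lambda>x. (norm (g k x - f x))\<^sup>2) \<in> borel_measurable lborel" for k using m by measurable
  qed (use w(2) in auto)
  then have "(\<lambda>k. sqrt (\<integral>x. (norm (g k x - f x))\<^sup>2 \<partial>lborel)) \<longlonglongrightarrow> sqrt 0"
    by (intro tendsto_real_sqrt) simp
  then show ?thesis by (simp add: L2_norm_def)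
qed

lemma smooth_real_polynomial_function:
  "real_polynomial_function p \<Longrightarrow> smooth (\<lambda>x. complex_of_real (p x))"
  for p :: "'a::euclidean_space \<Rightarrow> real"
proof (induction p rule: real_polynomial_function.induct)
  case (linear f)
  then show ?case
    by (intro smooth_bounded_linear bounded_linear_compose[OF bounded_linear_of_real])
next
  case (add f g)
  then show ?case using smooth_add[of "\<lambda>x. complex_of_real (f x)"] by simp
next
  case (mult f g)
  then show ?case using smooth_mult[of "\<lambda>x. complex_of_real (f x)"] by simp
qed simp

lemma smooth_polynomial_function:
  fixes p :: "'a::euclidean_space \<Rightarrow> complex"
  assumes "polynomial_function p"
  shows "smooth p"
proof -
  have "real_polynomial_function (Re \<circ> p)" "real_polynomial_function (Im \<circ> p)"
    using assms bounded_linear_Re bounded_linear_Im unfolding polynomial_function_def by blast+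
  then have "smooth (\<lambda>x. complex_of_real (Re (p x)) + \<i> * complex_of_real (Im (p x)))"
    by (intro smooth_add smooth_mult smooth_const)
       (use smooth_real_polynomial_function[of "Re \<circ> p"] smooth_real_polynomial_function[of "Im \<circ> p"] in auto)
  then show ?thesis by (simp add: complex_eq[symmetric])
qed

lemma compact_support_schwartz:
  fixes f :: "'a::euclidean_space \<Rightarrow> complex"
  assumes f: "smooth f" and supp: "\<And>x. r < norm x \<Longrightarrow> f x = 0"
  shows "f \<in> schwartz"
  unfolding schwartz_def
proof (intro CollectI conjI ballI allI f)
  fix bs :: "'a list" and k assume bs: "bs \<in> lists Basis"
  obtain C where C: "\<And>x. norm (iter_deriv bs f x) \<le> C" "\<And>x. r < norm x \<Longrightarrow> iter_deriv bs f x = 0"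
    using bounded_support_derivs[OF f supp bs] by blast
  have C0: "0 \<le> C" using order_trans[OF norm_ge_zero C(1)[of 0]] .
  have "norm x ^ k * norm (iter_deriv bs f x) \<le> \<bar>r\<bar> ^ k * C" for x
  proof (cases "r < norm x")
    case False
    then show ?thesis by (intro mult_mono power_mono C) auto
  qed (use C C0 in auto)
  then show "\<exists>C. \<forall>x. norm x ^ k * norm (iter_deriv bs f x) \<le> C" by blast
qed

lemma bump_le_1: "bump r x \<le> 1" and bump_nonneg: "0 \<le> bump r x"
  by (auto simp: bump_def flat_def)

text \<open>Write h as a bump times a quotient q that is continuous on a larger ball. A polynomial
  uniformly close to q there, multiplied by the bump, is smooth with compact support. The
  denominator is the bump cut off below at its minimum over the ball containing the support of h, so
  that q stays continuous where the bump tends to 0.\<close>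

lemma schwartz_approx_continuous:
  fixes h :: "'a::euclidean_space \<Rightarrow> complex"
  assumes h: "continuous_on UNIV h" and supp: "\<And>x. R < norm x \<Longrightarrow> h x = 0" and R: "0 \<le> R"
  shows "schwartz_approx h"
proof -
  let ?b = "\<lambda>x::'a. bump (R + 1) x"
  let ?S = "cball 0 (R + 1) :: 'a set"
  have bc: "continuous_on S ?b" for S
  proof -
    have "continuous_on S (\<lambda>x. Re (complex_of_real (?b x)))" by (intro continuous_intros smooth_continuous smooth_bump)
    then show ?thesis by simp
  qed
  have "\<exists>x\<in>cball 0 R. \<forall>y\<in>cball 0 R. ?b x \<le> ?b y"
    using R by (intro continuous_attains_inf bc) auto
  then obtain x0 where x0: "norm x0 \<le> R" "\<And>y. norm y \<le> R \<Longrightarrow> ?b x0 \<le> ?b y" by auto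
  have c: "0 < ?b x0" using x0 by (intro bump_pos) simp
  let ?q = "\<lambda>x. h x / complex_of_real (max (?b x) (?b x0))"
  have qc: "continuous_on ?S ?q"
    using c by (intro continuous_intros continuous_on_subset[OF h] bc) (auto simp: max_def)
  have hq: "h x = complex_of_real (?b x) * ?q x" for x
  proof (cases "R < norm x")
    case False
    then have "max (?b x) (?b x0) = ?b x" "?b x \<noteq> 0" using x0(2)[of x] c by auto
    then show ?thesis by simp
  qed (simp add: supp)
  let ?V = "measure lborel ?S"
  have int: "integrable lborel (\<lambda>x. e\<^sup>2 * indicator ?S x)" for e :: real
    using emeasure_lborel_cball_finite[of "0::'a" "R + 1"] by (intro integrable_mult_right integrable_real_indicator) auto
  have hL: "h \<in> L2"
  proof -
    have "compact (h ` ?S)" by (intro compact_continuous_image continuous_on_subset[OF h]) auto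
    then obtain B where B: "\<And>x. x \<in> ?S \<Longrightarrow> norm (h x) \<le> B" using bounded_iff compact_imp_bounded by (metis imageI)
    have "(norm (h x))\<^sup>2 \<le> B\<^sup>2 * indicator ?S x" for x
    proof (cases "x \<in> ?S")
      case True
      then show ?thesis using B[OF True] by (simp add: power_mono)
    next
      case False
      then show ?thesis using supp[of x] by simp
    qed
    then have "integrable lborel (\<lambda>x. (norm (h x))\<^sup>2)"
      by (intro Bochner_Integration.integrable_bound[OF int[of B]])
         (use borel_measurable_continuous_onI[OF h] in auto)
    then show ?thesis using borel_measurable_continuous_onI[OF h] by (simp add: L2_def)
  qed
  show ?thesis unfolding schwartz_approx_def
  proof (intro conjI hL allI impI)
    fix e :: real assume e: "0 < e"
    define \<delta> where "\<delta> = e / (2 * sqrt (?V + 1))"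
    have \<delta>: "0 < \<delta>" using e by (simp add: \<delta>_def add_nonneg_pos)
    obtain p where p: "polynomial_function p" "\<And>x. x \<in> ?S \<Longrightarrow> norm (?q x - p x) < \<delta>"
      using Stone_Weierstrass_polynomial_function[OF compact_cball qc \<delta>] by blast
    let ?\<phi> = "\<lambda>x. complex_of_real (?b x) * p x"
    have \<phi>: "?\<phi> \<in> schwartz"
      using R by (intro compact_support_schwartz[where r = "R + 1"] smooth_mult smooth_bump smooth_polynomial_function p)
        (auto simp: bump_eq_0)
    have le: "(norm (h x - ?\<phi> x))\<^sup>2 \<le> \<delta>\<^sup>2 * indicator ?S x" for x
    proof (cases "x \<in> ?S")
      case True
      have "h x - ?\<phi> x = complex_of_real (?b x) * (?q x - p x)"
        unfolding right_diff_distrib hq[of x, symmetric] ..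
      then have "norm (h x - ?\<phi> x) = ?b x * norm (?q x - p x)"
        using bump_nonneg[of "R + 1" x] by (simp only: norm_mult norm_of_real abs_of_nonneg)
      also have "\<dots> \<le> 1 * \<delta>" using p(2)[OF True] by (intro mult_mono bump_le_1) auto
      finally show ?thesis using True by (simp add: power_mono)
    next
      case False
      then have "?b x = 0" using R by (intro bump_eq_0) auto
      moreover from this have "h x = 0" by (subst hq) simp
      ultimately show ?thesis using False by simp
    qed
    have "(L2_norm (\<lambda>x. h x - ?\<phi> x))\<^sup>2 \<le> (\<integral>x. \<delta>\<^sup>2 * indicator ?S x \<partial>lborel)"
      unfolding L2_norm_power2
      by (rule integral_mono[OF L2_integrable[OF L2_diff(1)[OF hL schwartz_L2[OF \<phi>]]] int le])
    also have "\<dots> = \<delta>\<^sup>2 * ?V" by simp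
    also have "\<dots> \<le> \<delta>\<^sup>2 * (?V + 1)" by (intro mult_left_mono) auto
    also have "\<dots> = (e / 2)\<^sup>2"
    proof -
      have "(e / (2 * sqrt W))\<^sup>2 * W = (e / 2)\<^sup>2" if "0 < W" for W
        using that by (simp add: power_divide power_mult_distrib)
      then show ?thesis unfolding \<delta>_def by (simp add: add_nonneg_pos)
    qed
    finally have "L2_norm (\<lambda>x. h x - ?\<phi> x) \<le> e / 2" by (rule power2_le_imp_le) (use e in simp)
    also have "e / 2 < e" using e by simp
    finally show "\<exists>\<phi>\<in>schwartz. L2_norm (\<lambda>x. h x - \<phi> x) < e" by (intro bexI[OF _ \<phi>])
  qed
qed

text \<open>A measurable function is almost everywhere a limit of continuous ones. Projecting their
  values onto the disc of radius \<open>B\<close> and multiplying by a continuous cut-off gives a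
  common bound and a common compact support, so the convergence also holds in L2.\<close>

lemma schwartz_approx_bounded:
  fixes f :: "'a::euclidean_space \<Rightarrow> complex"
  assumes f: "f \<in> borel_measurable borel" and B: "\<And>x. norm (f x) \<le> B" and supp: "\<And>x. R < norm x \<Longrightarrow> f x = 0"
    and R: "0 \<le> R"
  shows "schwartz_approx f"
proof -
  have B0: "0 \<le> B" using order_trans[OF norm_ge_zero B[of 0]] .
  have "f \<in> borel_measurable lebesgue" using f by (simp add: measurable_completion)
  then have "f measurable_on UNIV" by (rule lebesgue_measurable_imp_measurable_on) simp
  then obtain N g where N: "negligible N" and g: "\<And>n. continuous_on UNIV (g n)"
    and lim: "\<And>x. x \<notin> N \<Longrightarrow> (\<lambda>n. g n x) \<longlonglongrightarrow> f x"
    unfolding measurable_on_def by auto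
  let ?P = "closest_point (cball 0 B) :: complex \<Rightarrow> complex"
  let ?\<chi> = "\<lambda>x::'a. complex_of_real (max 0 (min 1 (R + 1 - norm x)))"
  let ?h = "\<lambda>n x. ?\<chi> x * ?P (g n x)"
  have Pc: "continuous_on UNIV ?P"
    using B0 by (intro continuous_on_closest_point) auto
  have Pn: "norm (?P z) \<le> B" for z
    using closest_point_in_set[of "cball 0 B" z] B0 by auto
  have Pid: "?P z = z" if "norm z \<le> B" for z
    using that by (intro closest_point_self) auto
  have \<chi>1: "norm (?\<chi> x) \<le> 1" for x by simp
  have hc: "continuous_on UNIV (?h n)" for n
    by (intro continuous_intros continuous_on_compose2[OF Pc g]) auto
  have ha: "schwartz_approx (?h n)" for n
    by (rule schwartz_approx_continuous[OF hc, of "R + 1"]) (use R in auto)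
  have hB: "norm (?h n x) \<le> B" for n x
    using mult_mono[OF \<chi>1[of x] Pn[of "g n x"]] by (simp only: norm_mult mult_1) simp
  have le: "(norm (?h n x - f x))\<^sup>2 \<le> (2 * B)\<^sup>2 * indicator (cball 0 (R + 1)) x" for n x
  proof (cases "x \<in> cball 0 (R + 1)")
    case True
    have "norm (?h n x - f x) \<le> B + B" by (rule order_trans[OF norm_triangle_ineq4 add_mono[OF hB B]])
    then have "(norm (?h n x - f x))\<^sup>2 \<le> (B + B)\<^sup>2" by (rule power_mono) simp
    then show ?thesis using True by simp
  next
    case False
    then show ?thesis using supp[of x] by simp
  qed
  have int: "integrable lborel (\<lambda>x::'a. (2 * B)\<^sup>2 * indicator (cball 0 (R + 1)) x)"
    using emeasure_lborel_cball_finite[of "0::'a" "R + 1"] by (intro integrable_mult_right integrable_real_indicator) auto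
  have lim': "(\<lambda>n. ?h n x) \<longlonglongrightarrow> f x" if "x \<notin> N" for x
  proof -
    have "(\<lambda>n. ?P (g n x)) \<longlonglongrightarrow> ?P (f x)"
      using continuous_on_tendsto_compose[OF Pc lim[OF that]] by simp
    then have "(\<lambda>n. ?h n x) \<longlonglongrightarrow> ?\<chi> x * f x" unfolding Pid[OF B] by (rule tendsto_mult_left)
    moreover have "?\<chi> x * f x = f x" using supp[of x] by (cases "R < norm x") auto
    ultimately show ?thesis by simp
  qed
  have AE: "AE x in lborel. (\<lambda>n. ?h n x) \<longlonglongrightarrow> f x"
  proof -
    have "AE x in lebesgue. x \<notin> N" using N by (simp add: AE_not_in negligible_iff_null_sets)
    then have "AE x in lborel. x \<notin> N" by (simp add: AE_completion_iff)
    then show ?thesis by eventually_elim (rule lim')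
  qed
  have fL: "f \<in> L2"
  proof -
    have "(norm (f x))\<^sup>2 \<le> (2 * B)\<^sup>2 * indicator (cball 0 (R + 1)) x" for x
    proof (cases "x \<in> cball 0 (R + 1)")
      case True
      have "norm (f x) \<le> 2 * B" using B[of x] B0 by simp
      then have "(norm (f x))\<^sup>2 \<le> (2 * B)\<^sup>2" by (rule power_mono) simp
      then show ?thesis using True by simp
    next
      case False
      then show ?thesis using supp[of x] by simp
    qed
    then have "integrable lborel (\<lambda>x. (norm (f x))\<^sup>2)"
      by (intro Bochner_Integration.integrable_bound[OF int]) (use f in auto)
    then show ?thesis using f by (simp add: L2_def)
  qed
  show ?thesis
    by (rule schwartz_approx_limit[OF fL ha L2_dominated_convergence[OF f borel_measurable_continuous_onI[OF hc] int le AE]])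
qed

lemma schwartz_dense:
  assumes u: "u \<in> L2"
  shows "schwartz_approx u"
proof -
  note um [measurable] = L2_measurable[OF u]
  let ?g = "\<lambda>(k::nat) x. if norm (u x) \<le> real k \<and> norm x \<le> real k then u x else 0"
  have gm: "?g k \<in> borel_measurable borel" for k by measurable
  have ga: "schwartz_approx (?g k)" for k
    by (rule schwartz_approx_bounded[OF gm, of k "real k" "real k"]) auto
  have lim: "(\<lambda>k. ?g k x) \<longlonglongrightarrow> u x" for x
  proof (rule tendsto_eventually, rule eventually_sequentiallyI)
    fix k assume "nat \<lceil>max (norm (u x)) (norm x)\<rceil> \<le> k"
    then have "max (norm (u x)) (norm x) \<le> real k" by linarith
    then show "?g k x = u x" by auto
  qed
  show ?thesis
  proof (rule schwartz_approx_limit[OF u ga])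
    show "(\<lambda>k. L2_norm (\<lambda>x. ?g k x - u x)) \<longlonglongrightarrow> 0"
      by (rule L2_dominated_convergence[OF um gm L2_integrable[OF u]]) (use lim in auto)
  qed
qed

lemma schwartz_sequence:
  assumes u: "u \<in> L2"
  obtains \<phi> where "\<And>k. \<phi> k \<in> schwartz" "L2_tendsto \<phi> u"
proof -
  have "\<exists>\<phi>\<in>schwartz. L2_norm (\<lambda>x. u x - \<phi> x) < inverse (real (Suc k))" for k
    using schwartz_dense[OF u] by (auto simp: schwartz_approx_def)
  then obtain \<phi> where \<phi>: "\<And>k. \<phi> k \<in> schwartz" "\<And>k. L2_norm (\<lambda>x. u x - \<phi> k x) < inverse (real (Suc k))" by metis
  have "L2_norm (\<lambda>x. \<phi> k x - u x) = L2_norm (\<lambda>x. u x - \<phi> k x)" for k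
    by (simp add: L2_norm_def norm_minus_commute)
  then have "(\<lambda>k. L2_norm (\<lambda>x. \<phi> k x - u x)) \<longlonglongrightarrow> 0"
    using \<phi>(2) by (intro tendsto_sandwich[OF _ _ tendsto_const LIMSEQ_inverse_real_of_nat]) (auto intro: always_eventually less_imp_le)
  then show ?thesis using that \<phi> u by (auto simp: L2_tendsto_def intro: schwartz_L2)
qed

lemma L2_tendsto_norm:
  assumes "L2_tendsto f v"
  shows "(\<lambda>k. L2_norm (f k)) \<longlonglongrightarrow> L2_norm v"
proof -
  have L: "f k \<in> L2" "v \<in> L2" for k using assms by (auto simp: L2_tendsto_def)
  have 1: "L2_norm (\<lambda>x. (f k x - v x) + v x) \<le> L2_norm (\<lambda>x. f k x - v x) + L2_norm v" for k
    by (intro L2_add L2_diff L)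
  have 2: "L2_norm (\<lambda>x. f k x - (f k x - v x)) \<le> L2_norm (f k) + L2_norm (\<lambda>x. f k x - v x)" for k
    by (intro L2_diff L)
  have le: "\<bar>L2_norm (f k) - L2_norm v\<bar> \<le> L2_norm (\<lambda>x. f k x - v x)" for k
    using 1[of k, unfolded diff_add_cancel] 2[of k] by (simp add: abs_le_iff)
  have lim: "(\<lambda>k. L2_norm (\<lambda>x. f k x - v x)) \<longlonglongrightarrow> 0" using assms unfolding L2_tendsto_def by blast
  have "(\<lambda>k. L2_norm (f k) - L2_norm v) \<longlonglongrightarrow> 0"
    by (rule Lim_null_comparison[OF _ lim], rule always_eventually) (use le in simp)
  then show ?thesis by (rule LIM_zero_cancel)
qed

section \<open>Dilations and the operators at a fixed parameter\<close>

lemma basis_affine_mono: "basis_affine R L \<Longrightarrow> R \<le> R' \<Longrightarrow> basis_affine R' L"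
  unfolding basis_affine_def by (meson order_trans)

lemma derivs_le_dilate:
  assumes l: "l > 0" and f: "smooth f" "derivs_le k p f"
  shows "derivs_le k (\<lambda>x. max 1 l ^ k * p (l *\<^sub>R x)) (\<lambda>x. f (l *\<^sub>R x))"
  using l by (intro derivs_le_affine basis_affine_mono[OF basis_affine_scale] f) auto

lemma smooth_dilate: "smooth f \<Longrightarrow> smooth (\<lambda>x. f (l *\<^sub>R x))"
  by (rule smooth_affine[OF basis_affine_scale])

lemma schwartz_dilate:
  fixes u :: "'a::euclidean_space \<Rightarrow> complex"
  assumes l: "l > 0" and u: "u \<in> schwartz"
  shows "(\<lambda>x. u (l *\<^sub>R x)) \<in> schwartz"
proof (rule schwartzI)
  show "smooth (\<lambda>x. u (l *\<^sub>R x))" by (rule smooth_dilate[OF schwartzD(1)[OF u]])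
  fix k N
  obtain C where C: "C \<ge> 0" "derivs_le k (\<lambda>x. C * wt N x) u" using schwartzD(2)[OF u] by blast
  let ?m = "max 1 (1 / l)"
  have le: "wt N (l *\<^sub>R x) \<le> ?m ^ N * wt N x" for x :: 'a
  proof -
    have "1 + norm x \<le> ?m * (1 + norm (l *\<^sub>R x))"
    proof -
      have "1 * 1 \<le> ?m * 1" by simp
      moreover have "(1 / l) * (l * norm x) \<le> ?m * (l * norm x)" using l by (intro mult_right_mono) auto
      ultimately show ?thesis using l by (simp add: distrib_left)
    qed
    then have "(1 + norm x) ^ N \<le> (?m * (1 + norm (l *\<^sub>R x))) ^ N" by (intro power_mono) auto
    moreover have "0 < (1 + norm x) ^ N" "0 < (1 + norm (l *\<^sub>R x)) ^ N" by (intro zero_less_power one_plus_norm_pos)+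
    ultimately show ?thesis unfolding wt_def power_mult_distrib by (simp add: field_simps)
  qed
  have "derivs_le k (\<lambda>x. (max 1 l ^ k * C * ?m ^ N) * wt N x) (\<lambda>x. u (l *\<^sub>R x))"
  proof (rule derivs_le_mono[OF derivs_le_dilate[OF l schwartzD(1)[OF u] C(2)] order_refl])
    show "max 1 l ^ k * (C * wt N (l *\<^sub>R x)) \<le> (max 1 l ^ k * C * ?m ^ N) * wt N x" for x :: 'a
      using mult_left_mono[OF le[of x], of "max 1 l ^ k * C"] C(1) by (simp add: mult.assoc)
  qed
  then show "\<exists>C. derivs_le k (\<lambda>x. C * wt N x) (\<lambda>x. u (l *\<^sub>R x))" by blast
qed

lemma unit_symbol_dilate:
  assumes l: "l > 0" and b: "unit_symbol b"
  shows "unit_symbol (\<lambda>z. b (l *\<^sub>R z))"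
  unfolding unit_symbol_def
proof (intro conjI allI)
  show "smooth (\<lambda>z. b (l *\<^sub>R z))" by (rule smooth_dilate[OF unit_symbol_smooth[OF b]])
  fix k
  obtain C where "derivs_le k (\<lambda>_. C) b" using unit_symbol_bound[OF b] by metis
  from derivs_le_dilate[OF l unit_symbol_smooth[OF b] this]
  show "\<exists>C. derivs_le k (\<lambda>_. C) (\<lambda>z. b (l *\<^sub>R z))" by blast
qed

lemma L2_norm_dilate:
  fixes u :: "'a::euclidean_space \<Rightarrow> complex"
  assumes l: "l > 0" and u: "u \<in> borel_measurable borel"
  shows "L2_norm (\<lambda>x. u (l *\<^sub>R x)) = sqrt (1 / l ^ DIM('a)) * L2_norm u"
  using lborel_integral_affine[of "\<lambda>x. (norm (u x))\<^sup>2" l 0] l u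
  unfolding L2_norm_def by (simp add: real_sqrt_divide)

lemma schwartz_cmult:
  assumes "f \<in> schwartz"
  shows "(\<lambda>x. c * f x) \<in> schwartz"
proof (rule schwartzI)
  show "smooth (\<lambda>x. c * f x)" by (intro smooth_mult smooth_const schwartzD(1) assms)
  fix k N
  obtain C where "derivs_le k (\<lambda>x. C * wt N x) f" using schwartzD(2)[OF assms] by blast
  from derivs_le_cmult[OF schwartzD(1)[OF assms] this, of c]
  show "\<exists>C. derivs_le k (\<lambda>x. C * wt N x) (\<lambda>x. c * f x)" unfolding mult.assoc[symmetric] by blast
qed

lemma Q_cmult: "Q t b (\<lambda>y. k * u y) x = k * Q t b u x"
  by (simp add: Q_def Q_inner_def mult.left_commute[of _ k])

text \<open>Substituting sqrt h times the variable for both y and \<xi> removes h from the phase;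
  the two Jacobians h^(n/2) cancel the h^(-n) of the normalization.\<close>

lemma Op_schwartz_eq:
  fixes a :: "'n::finite phase \<Rightarrow> complex"
  assumes h: "h > 0" and a: "smooth a" and u: "continuous_on UNIV u"
  shows "Op_schwartz t h a u = (\<lambda>x. complex_of_real (1 / (2 * pi) ^ CARD('n)) *
    Q t (\<lambda>z. a (sqrt h *\<^sub>R z)) (\<lambda>y. u (sqrt h *\<^sub>R y)) (inverse (sqrt h) *\<^sub>R x))"
proof
  fix x :: "real ^ 'n"
  let ?r = "sqrt h"
  have r: "?r > 0" "?r * ?r = h" using h by auto
  let ?F = "\<lambda>\<xi> y. a (t *\<^sub>R x + (1 - t) *\<^sub>R y, \<xi>) * exp (\<i> * complex_of_real (((x - y) \<bullet> \<xi>) / h)) * u y"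
  let ?X = "inverse ?r *\<^sub>R x"
  have ac: "continuous_on UNIV a" by (rule smooth_continuous[OF a])
  have Fc: "continuous_on S (\<lambda>z. ?F (f z) (g z))" if "continuous_on S f" "continuous_on S g" for f g and S :: "'z::topological_space set"
    by (intro continuous_intros continuous_on_compose2[OF ac] continuous_on_compose2[OF u] that subset_UNIV)
      (use h in auto)
  have m1: "(\<lambda>y. ?F \<xi> y) \<in> borel_measurable borel" for \<xi>
    by (intro borel_measurable_continuous_onI Fc continuous_on_const continuous_on_id)
  have m2: "(\<lambda>\<xi>. \<integral>y. ?F \<xi> y \<partial>lborel) \<in> borel_measurable borel"
    by (rule measurable_integral, rule borel_measurable_continuous_onI, rule Fc)
       (intro continuous_intros)+
  have eq: "?F (?r *\<^sub>R \<xi>) (?r *\<^sub>R y) = amp t (\<lambda>z. a (?r *\<^sub>R z)) ?X \<xi> y * u (?r *\<^sub>R y)" for \<xi> y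
  proof -
    have "x = ?r *\<^sub>R ?X" using r by simp
    then have 1: "t *\<^sub>R x + (1 - t) *\<^sub>R (?r *\<^sub>R y) = ?r *\<^sub>R (t *\<^sub>R ?X + (1 - t) *\<^sub>R y)"
      and 2: "x - ?r *\<^sub>R y = ?r *\<^sub>R (?X - y)"
      by (metis scaleR_left_commute scaleR_right_distrib, metis scaleR_right_diff_distrib)
    have "((x - ?r *\<^sub>R y) \<bullet> (?r *\<^sub>R \<xi>)) / h = (?X - y) \<bullet> \<xi>"
      unfolding 2 using r h by (simp add: mult.assoc[symmetric])
    then show ?thesis unfolding amp_def 1 by (simp add: cis_conv_exp)
  qed
  have inner: "(\<integral>y. ?F (?r *\<^sub>R \<xi>) y \<partial>lborel) = complex_of_real (?r ^ CARD('n)) * Q_inner t (\<lambda>z. a (?r *\<^sub>R z)) (\<lambda>y. u (?r *\<^sub>R y)) ?X \<xi>" for \<xi>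
    using lborel_integral_affine[OF m1[of "?r *\<^sub>R \<xi>"], where c = ?r and t = 0] r unfolding add_0 eq Q_inner_def by (simp add: scaleR_conv_of_real)
  have "(\<integral>\<xi>. \<integral>y. ?F \<xi> y \<partial>lborel \<partial>lborel) = complex_of_real (?r ^ CARD('n)) * (\<integral>\<xi>. \<integral>y. ?F (?r *\<^sub>R \<xi>) y \<partial>lborel \<partial>lborel)"
    using lborel_integral_affine[OF m2, where c = ?r and t = 0] r by (simp add: scaleR_conv_of_real)
  also have "\<dots> = complex_of_real (?r ^ CARD('n)) * (complex_of_real (?r ^ CARD('n)) * Q t (\<lambda>z. a (?r *\<^sub>R z)) (\<lambda>y. u (?r *\<^sub>R y)) ?X)"
    unfolding inner Q_def by simp
  finally have I: "(\<integral>\<xi>. \<integral>y. ?F \<xi> y \<partial>lborel \<partial>lborel) = \<dots>" .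
  have "1 / (2 * pi * h) ^ CARD('n) * (?r ^ CARD('n) * ?r ^ CARD('n)) = 1 / (2 * pi) ^ CARD('n)"
    unfolding power_mult_distrib[symmetric] r using h by (simp add: power_mult_distrib)
  then show "Op_schwartz t h a u x = complex_of_real (1 / (2 * pi) ^ CARD('n)) *
    Q t (\<lambda>z. a (?r *\<^sub>R z)) (\<lambda>y. u (?r *\<^sub>R y)) ?X"
    unfolding Op_schwartz_def I mult.assoc[symmetric] of_real_mult[symmetric] by (simp only: mult.assoc)
qed

lemma Op_schwartz_dilate:
  fixes a :: "'n::finite phase \<Rightarrow> complex"
  assumes "h > 0" "smooth a" "u \<in> schwartz"
  shows "Op_schwartz t h a u (sqrt h *\<^sub>R x) = complex_of_real (1 / (2 * pi) ^ CARD('n)) *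
    Q t (\<lambda>z. a (sqrt h *\<^sub>R z)) (\<lambda>y. u (sqrt h *\<^sub>R y)) x"
  using assms by (simp add: Op_schwartz_eq schwartz_continuous)

lemma Op_schwartz_schwartz:
  fixes a :: "'n::finite phase \<Rightarrow> complex"
  assumes h: "h > 0" and a: "unit_symbol a" and t: "t \<in> {0..1}" and u: "u \<in> schwartz"
  shows "Op_schwartz t h a u \<in> schwartz"
proof -
  have r: "sqrt h > 0" "inverse (sqrt h) > 0" using h by auto
  show ?thesis
    unfolding Op_schwartz_eq[OF h unit_symbol_smooth[OF a] schwartz_continuous[OF u]]
    by (intro schwartz_cmult schwartz_dilate[OF r(2), of "\<lambda>x. Q t _ _ x"] Q_schwartz unit_symbol_dilate schwartz_dilate r a t u)
qed

lemma Op_schwartz_diff: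
  fixes a :: "'n::finite phase \<Rightarrow> complex"
  assumes h: "h > 0" and a: "unit_symbol a" and t: "t \<in> {0..1}" and u: "u \<in> schwartz" and v: "v \<in> schwartz"
  shows "Op_schwartz t h a (\<lambda>x. u x - v x) x = Op_schwartz t h a u x - Op_schwartz t h a v x"
proof -
  have r: "sqrt h > 0" using h by auto
  note e = Op_schwartz_eq[OF h unit_symbol_smooth[OF a] schwartz_continuous]
  show ?thesis
    unfolding e[OF u] e[OF v] e[OF schwartz_diff[OF u v]]
      Q_diff[OF unit_symbol_dilate[OF r a] t schwartz_dilate[OF r u] schwartz_dilate[OF r v]]
    by (simp only: right_diff_distrib)
qed

text \<open>Dilation by \<open>sqrt h\<close> multiplies every \<open>L\<^sup>2\<close> norm by the same factor, which therefore
  disappears from operator bounds.\<close>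

definition dil :: "real \<Rightarrow> ('n::finite) itself \<Rightarrow> real" where
  "dil h _ = sqrt (1 / sqrt h ^ CARD('n))"

lemma dil_pos: "h > 0 \<Longrightarrow> 0 < dil h TYPE('n::finite)"
  by (simp add: dil_def)

lemma L2_norm_sqrt_dilate:
  fixes u :: "real ^ 'n::finite \<Rightarrow> complex"
  assumes "h > 0" "u \<in> borel_measurable borel"
  shows "L2_norm (\<lambda>x. u (sqrt h *\<^sub>R x)) = dil h TYPE('n) * L2_norm u"
  using L2_norm_dilate[of "sqrt h" u] assms by (simp add: dil_def)

lemma L2_norm_Op_schwartz:
  fixes a :: "'n::finite phase \<Rightarrow> complex"
  assumes h: "h > 0" and a: "unit_symbol a" and t: "t \<in> {0..1}" and u: "u \<in> schwartz"
  shows "dil h TYPE('n) * L2_norm (Op_schwartz t h a u) =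
    1 / (2 * pi) ^ CARD('n) * L2_norm (Q t (\<lambda>z. a (sqrt h *\<^sub>R z)) (\<lambda>y. u (sqrt h *\<^sub>R y)))"
proof -
  have "dil h TYPE('n) * L2_norm (Op_schwartz t h a u) = L2_norm (\<lambda>x. Op_schwartz t h a u (sqrt h *\<^sub>R x))"
    by (rule L2_norm_sqrt_dilate[symmetric, OF h schwartz_measurable[OF Op_schwartz_schwartz[OF assms]]])
  then show ?thesis unfolding Op_schwartz_dilate[OF h unit_symbol_smooth[OF a] u] L2_norm_cmult norm_of_real by simp
qed

lemma L2_norm_Op_schwartz_comp:
  fixes a c :: "'n::finite phase \<Rightarrow> complex"
  assumes h: "h > 0" and a: "unit_symbol a" and t: "t \<in> {0..1}" and c: "unit_symbol c" and s: "s \<in> {0..1}" and u: "u \<in> schwartz"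
  shows "dil h TYPE('n) * L2_norm (Op_schwartz s h c (Op_schwartz t h a u)) =
    (1 / (2 * pi) ^ CARD('n))\<^sup>2 * L2_norm (Q s (\<lambda>z. c (sqrt h *\<^sub>R z)) (Q t (\<lambda>z. a (sqrt h *\<^sub>R z)) (\<lambda>y. u (sqrt h *\<^sub>R y))))"
proof -
  have "Q s (\<lambda>z. c (sqrt h *\<^sub>R z)) (\<lambda>y. Op_schwartz t h a u (sqrt h *\<^sub>R y)) =
    (\<lambda>x. complex_of_real (1 / (2 * pi) ^ CARD('n)) * Q s (\<lambda>z. c (sqrt h *\<^sub>R z)) (Q t (\<lambda>z. a (sqrt h *\<^sub>R z)) (\<lambda>y. u (sqrt h *\<^sub>R y))) x)"
    unfolding Op_schwartz_dilate[OF h unit_symbol_smooth[OF a] u] Q_cmult by (rule refl)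
  then show ?thesis
    unfolding L2_norm_Op_schwartz[OF h c s Op_schwartz_schwartz[OF h a t u]]
    by (simp only: L2_norm_cmult norm_of_real) (simp add: power2_eq_square)
qed

lemma Op_schwartz_L2_bound:
  fixes a :: "'n::finite phase \<Rightarrow> complex"
  assumes h: "h > 0" and a: "unit_symbol a" and t: "t \<in> {0..1}"
  obtains C where "C \<ge> 0" "\<And>u. u \<in> schwartz \<Longrightarrow> L2_norm (Op_schwartz t h a u) \<le> C * L2_norm u"
proof -
  have r: "sqrt h > 0" using h by auto
  obtain C where C: "C \<ge> 0" "\<And>u. u \<in> schwartz \<Longrightarrow> L2_norm (Q t (\<lambda>z. a (sqrt h *\<^sub>R z)) u) \<le> C * L2_norm u"
    using Q_L2_bound[OF unit_symbol_dilate[OF r a] t] by blast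
  show ?thesis
  proof (rule that)
    show "0 \<le> 1 / (2 * pi) ^ CARD('n) * C" using C by simp
    fix u :: "'n wave" assume u: "u \<in> schwartz"
    have "dil h TYPE('n) * L2_norm (Op_schwartz t h a u) \<le> 1 / (2 * pi) ^ CARD('n) * (C * (dil h TYPE('n) * L2_norm u))"
      unfolding L2_norm_Op_schwartz[OF h a t u] L2_norm_sqrt_dilate[OF h schwartz_measurable[OF u], symmetric]
      by (intro mult_left_mono C schwartz_dilate r u) auto
    also have "\<dots> = dil h TYPE('n) * (1 / (2 * pi) ^ CARD('n) * C * L2_norm u)" by simp
    finally show "L2_norm (Op_schwartz t h a u) \<le> 1 / (2 * pi) ^ CARD('n) * C * L2_norm u"
      by (rule mult_left_le_imp_le) (rule dil_pos[OF h])
  qed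
qed

text \<open>This discharges the choice in the definition of \<open>Op\<close>. The images of one
  approximating sequence are Cauchy by the L2 bound and converge by completeness; any other sequence
  has images that differ from these by a null sequence.\<close>

lemma Op_spec:
  fixes a :: "'n::finite phase \<Rightarrow> complex"
  assumes h: "h > 0" and a: "unit_symbol a" and t: "t \<in> {0..1}" and u: "u \<in> L2"
  shows "Op t h a u \<in> L2"
    "\<And>\<phi>. (\<And>k. \<phi> k \<in> schwartz) \<Longrightarrow> L2_tendsto \<phi> u \<Longrightarrow> L2_tendsto (\<lambda>k. Op_schwartz t h a (\<phi> k)) (Op t h a u)"
proof -
  obtain C where C: "C \<ge> 0" "\<And>u. u \<in> schwartz \<Longrightarrow> L2_norm (Op_schwartz t h a u) \<le> C * L2_norm u"
    using Op_schwartz_L2_bound[OF h a t] by blast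
  have Ld: "L2_norm (\<lambda>x. Op_schwartz t h a f x - Op_schwartz t h a g x) \<le> C * L2_norm (\<lambda>x. f x - g x)"
    if "f \<in> schwartz" "g \<in> schwartz" for f g
  proof -
    have "Op_schwartz t h a (\<lambda>x. f x - g x) = (\<lambda>x. Op_schwartz t h a f x - Op_schwartz t h a g x)"
      by (rule ext, rule Op_schwartz_diff[OF h a t that])
    then show ?thesis using C(2)[OF schwartz_diff[OF that]] by simp
  qed
  have L: "Op_schwartz t h a f \<in> L2" if "f \<in> schwartz" for f
    by (intro schwartz_L2 Op_schwartz_schwartz h a t that)
  obtain \<phi>0 where \<phi>0: "\<And>k. \<phi>0 k \<in> schwartz" "L2_tendsto \<phi>0 u" using schwartz_sequence[OF u] by blast
  have tri: "L2_norm (\<lambda>x. f x - g x) \<le> L2_norm (\<lambda>x. f x - u x) + L2_norm (\<lambda>x. g x - u x)" if "f \<in> L2" "g \<in> L2" for f g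
    using L2_diff(2)[OF L2_diff(1)[OF that(1) u] L2_diff(1)[OF that(2) u]] by simp
  have cauchy: "\<exists>N. \<forall>m\<ge>N. \<forall>n\<ge>N. L2_norm (\<lambda>x. Op_schwartz t h a (\<phi>0 m) x - Op_schwartz t h a (\<phi>0 n) x) \<le> e" if e: "e > 0" for e
  proof -
    \<comment> \<open>\<open>C + 1\<close> in place of \<open>C\<close>, which may be 0.\<close>
    have "0 < e / (2 * (C + 1))" using e C(1) by simp
    then obtain N where N: "\<And>k. k \<ge> N \<Longrightarrow> L2_norm (\<lambda>x. \<phi>0 k x - u x) < e / (2 * (C + 1))"
      using \<phi>0(2) unfolding L2_tendsto_def LIMSEQ_iff by (metis L2_norm_nonneg abs_of_nonneg diff_zero real_norm_def)
    have "L2_norm (\<lambda>x. Op_schwartz t h a (\<phi>0 m) x - Op_schwartz t h a (\<phi>0 n) x) \<le> e" if "m \<ge> N" "n \<ge> N" for m n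
    proof -
      have "L2_norm (\<lambda>x. Op_schwartz t h a (\<phi>0 m) x - Op_schwartz t h a (\<phi>0 n) x) \<le> C * L2_norm (\<lambda>x. \<phi>0 m x - \<phi>0 n x)"
        by (rule Ld) (rule \<phi>0)+
      also have "\<dots> \<le> (C + 1) * (e / (2 * (C + 1)) + e / (2 * (C + 1)))"
        using C(1) order_trans[OF tri[OF schwartz_L2[OF \<phi>0(1)[of m]] schwartz_L2[OF \<phi>0(1)[of n]]]
            add_mono[OF less_imp_le[OF N[OF that(1)]] less_imp_le[OF N[OF that(2)]]]]
        by (intro mult_mono) auto
      also have "\<dots> = e"
      proof -
        have "D * (e / (2 * D) + e / (2 * D)) = e" if "D > 0" for D using that by simp
        then show ?thesis using C(1) by (simp only: add_nonneg_pos zero_less_one)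
      qed
      finally show ?thesis .
    qed
    then show ?thesis by blast
  qed
  obtain v where v: "L2_tendsto (\<lambda>k. Op_schwartz t h a (\<phi>0 k)) v"
    using L2_complete[of "\<lambda>k. Op_schwartz t h a (\<phi>0 k)", OF L[OF \<phi>0(1)] cauchy] by blast
  have vL: "v \<in> L2" using v by (simp add: L2_tendsto_def)
  have lim: "L2_tendsto (\<lambda>k. Op_schwartz t h a (\<phi> k)) v" if \<phi>: "\<And>k. \<phi> k \<in> schwartz" "L2_tendsto \<phi> u" for \<phi>
    unfolding L2_tendsto_def
  proof (intro conjI allI vL L \<phi>)
    let ?g = "\<lambda>k. C * (L2_norm (\<lambda>x. \<phi> k x - u x) + L2_norm (\<lambda>x. \<phi>0 k x - u x)) + L2_norm (\<lambda>x. Op_schwartz t h a (\<phi>0 k) x - v x)"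
    have "?g \<longlonglongrightarrow> C * (0 + 0) + 0"
      using \<phi>(2) \<phi>0(2) v unfolding L2_tendsto_def by (intro tendsto_add tendsto_mult tendsto_const) auto
    then have g: "?g \<longlonglongrightarrow> 0" by simp
    have "L2_norm (\<lambda>x. Op_schwartz t h a (\<phi> k) x - v x) \<le> ?g k" for k
    proof -
      have "L2_norm (\<lambda>x. (Op_schwartz t h a (\<phi> k) x - Op_schwartz t h a (\<phi>0 k) x) + (Op_schwartz t h a (\<phi>0 k) x - v x)) \<le>
        L2_norm (\<lambda>x. Op_schwartz t h a (\<phi> k) x - Op_schwartz t h a (\<phi>0 k) x) + L2_norm (\<lambda>x. Op_schwartz t h a (\<phi>0 k) x - v x)"
        by (intro L2_add L2_diff L \<phi> \<phi>0 vL)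
      moreover have "L2_norm (\<lambda>x. Op_schwartz t h a (\<phi> k) x - Op_schwartz t h a (\<phi>0 k) x) \<le> C * L2_norm (\<lambda>x. \<phi> k x - \<phi>0 k x)"
        by (intro Ld \<phi> \<phi>0)
      moreover have "C * L2_norm (\<lambda>x. \<phi> k x - \<phi>0 k x) \<le> C * (L2_norm (\<lambda>x. \<phi> k x - u x) + L2_norm (\<lambda>x. \<phi>0 k x - u x))"
        by (intro mult_left_mono tri schwartz_L2 \<phi> \<phi>0 C(1))
      ultimately show ?thesis by simp
    qed
    then show "(\<lambda>k. L2_norm (\<lambda>x. Op_schwartz t h a (\<phi> k) x - v x)) \<longlonglongrightarrow> 0"
      by (intro Lim_null_comparison[OF _ g] always_eventually) simp
  qed
  let ?P = "\<lambda>v. v \<in> L2 \<and> (\<forall>\<phi>. (\<forall>k. \<phi> k \<in> schwartz) \<and> L2_tendsto \<phi> u \<longrightarrow> L2_tendsto (\<lambda>k. Op_schwartz t h a (\<phi> k)) v)"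
  have "?P (Op t h a u)"
    unfolding Op_def if_P[OF u] by (rule someI[of ?P v]) (use vL lim in blast)
  then show "Op t h a u \<in> L2"
    "\<And>\<phi>. (\<And>k. \<phi> k \<in> schwartz) \<Longrightarrow> L2_tendsto \<phi> u \<Longrightarrow> L2_tendsto (\<lambda>k. Op_schwartz t h a (\<phi> k)) (Op t h a u)"
    by blast+
qed

text \<open>The images under the inner operator are again Schwartz functions converging in L2, hence
  an admissible sequence for the outer one. Bounds for compositions can thus be proved on Schwartz
  functions, where the unit-scale estimates live.\<close>

lemma Op_comp_tendsto:
  fixes a c :: "'n::finite phase \<Rightarrow> complex"
  assumes h: "h > 0" and a: "unit_symbol a" and t: "t \<in> {0..1}" and c: "unit_symbol c" and s: "s \<in> {0..1}"
    and \<phi>: "\<And>k. \<phi> k \<in> schwartz" "L2_tendsto \<phi> u"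
  shows "(\<lambda>k. L2_norm (Op_schwartz s h c (Op_schwartz t h a (\<phi> k)))) \<longlonglongrightarrow> L2_norm (Op s h c (Op t h a u))"
proof -
  have u: "u \<in> L2" using \<phi>(2) by (simp add: L2_tendsto_def)
  show ?thesis
    by (intro L2_tendsto_norm Op_spec(2)[OF h c s Op_spec(1)[OF h a t u]] Op_schwartz_schwartz[OF h a t]
        Op_spec(2)[OF h a t u] \<phi>)
qed

lemma Op_comp_bound:
  fixes a c :: "'n::finite phase \<Rightarrow> complex"
  assumes h: "h > 0" and a: "unit_symbol a" and t: "t \<in> {0..1}" and c: "unit_symbol c" and s: "s \<in> {0..1}" and u: "u \<in> L2"
    and K: "\<And>\<phi>. \<phi> \<in> schwartz \<Longrightarrow> L2_norm (Op_schwartz s h c (Op_schwartz t h a \<phi>)) \<le> K * L2_norm \<phi>"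
  shows "L2_norm (Op s h c (Op t h a u)) \<le> K * L2_norm u"
proof -
  obtain \<phi> where \<phi>: "\<And>k. \<phi> k \<in> schwartz" "L2_tendsto \<phi> u" using schwartz_sequence[OF u] by blast
  show ?thesis
    by (rule LIMSEQ_le[OF Op_comp_tendsto[OF h a t c s \<phi>] tendsto_mult_left[OF L2_tendsto_norm[OF \<phi>(2)], of K]])
       (use K \<phi>(1) in blast)
qed

lemma Op_comp_schwartz:
  fixes a c :: "'n::finite phase \<Rightarrow> complex"
  assumes h: "h > 0" and a: "unit_symbol a" and t: "t \<in> {0..1}" and c: "unit_symbol c" and s: "s \<in> {0..1}" and u: "u \<in> schwartz"
  shows "L2_norm (Op s h c (Op t h a u)) = L2_norm (Op_schwartz s h c (Op_schwartz t h a u))"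
proof -
  have "L2_tendsto (\<lambda>_. u) u" using schwartz_L2[OF u] by (simp add: L2_tendsto_def L2_norm_def)
  from Op_comp_tendsto[OF h a t c s u this] show ?thesis by (metis LIMSEQ_const_iff)
qed

section \<open>Derivatives under rescaling\<close>

lemma iter_deriv_translate:
  assumes f: "smooth f" and bs: "bs \<in> lists Basis"
  shows "iter_deriv bs (\<lambda>z. f (z - c)) = (\<lambda>z. iter_deriv bs f (z - c))"
  using bs
proof (induction bs)
  case (Cons b bs)
  have "dird b (\<lambda>z. iter_deriv bs f (z - c)) = (\<lambda>z. complex_of_real 1 * dird b (iter_deriv bs f) (z - c))"
    by (rule dird_affine[where c = "- c" and T = "\<lambda>x. x"])
       (use Cons in \<open>auto intro: smooth_differentiable smooth_iter_deriv f bounded_linear_ident\<close>)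
  then show ?case using Cons unfolding iter_deriv_Cons_dird by simp
qed simp

lemma iter_deriv_dilate:
  assumes f: "smooth f" and bs: "bs \<in> lists Basis"
  shows "iter_deriv bs (\<lambda>z. f (l *\<^sub>R z)) = (\<lambda>z. complex_of_real (l ^ length bs) * iter_deriv bs f (l *\<^sub>R z))"
  using bs
proof (induction bs)
  case (Cons b bs)
  have sm: "smooth (iter_deriv bs f)" using Cons by (intro smooth_iter_deriv f) auto
  have "dird b (\<lambda>z. iter_deriv bs f (l *\<^sub>R z)) = (\<lambda>z. complex_of_real l * dird b (iter_deriv bs f) (l *\<^sub>R z))"
    by (rule dird_affine[where c = 0 and T = "\<lambda>x. l *\<^sub>R x"])
       (auto intro: smooth_differentiable sm bounded_linear_scaleR_right)
  moreover have "dird b (\<lambda>z. complex_of_real (l ^ length bs) * iter_deriv bs f (l *\<^sub>R z)) =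
      (\<lambda>z. 0 * iter_deriv bs f (l *\<^sub>R z) + complex_of_real (l ^ length bs) * dird b (\<lambda>z. iter_deriv bs f (l *\<^sub>R z)) z)"
    by (subst dird_mult) (auto intro: smooth_differentiable smooth_dilate[OF sm])
  ultimately show ?case using Cons unfolding iter_deriv_Cons_dird by (auto simp: algebra_simps)
qed simp

text \<open>Mean value inequality for \<open>f\<close> minus a linear function of slope
  \<open>d\<close> along a segment in direction \<open>b\<close>. The interpolation argument uses it
  with d = 0 and with d the derivative at the base point.\<close>

lemma norm_diff_dird_le:
  fixes f :: "'a::euclidean_space \<Rightarrow> complex"
  assumes f: "\<And>x. f differentiable (at x)" and s: "0 \<le> s"
    and M: "\<And>r. 0 \<le> r \<Longrightarrow> r \<le> s \<Longrightarrow> norm (dird b f (x + r *\<^sub>R b) - d) \<le> M"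
  shows "norm (f (x + s *\<^sub>R b) - f x - s *\<^sub>R d) \<le> M * s"
proof -
  have "norm ((f (x + s *\<^sub>R b) - s *\<^sub>R d) - (f (x + 0 *\<^sub>R b) - 0 *\<^sub>R d)) \<le> M * norm (s - 0)"
  proof (rule differentiable_bound[where S = "{0..s}"])
    fix r assume r: "r \<in> {0..s}"
    have L: "((\<lambda>r. x + r *\<^sub>R b) has_derivative (\<lambda>h. h *\<^sub>R b)) (at r within {0..s})"
      by (auto intro!: derivative_eq_intros)
    have D: "(f has_derivative (\<lambda>v. dird v f (x + r *\<^sub>R b))) (at (x + r *\<^sub>R b))"
      by (rule differentiable_has_derivative_dird[OF f])
    have "((\<lambda>r. f (x + r *\<^sub>R b)) has_derivative (\<lambda>h. dird (h *\<^sub>R b) f (x + r *\<^sub>R b))) (at r within {0..s})"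
      using has_derivative_compose[OF L D] by simp
    then have "((\<lambda>r. f (x + r *\<^sub>R b)) has_derivative (\<lambda>h. h *\<^sub>R dird b f (x + r *\<^sub>R b))) (at r within {0..s})"
      by (simp add: linear_cmul[OF has_derivative_linear[OF D]])
    then show "((\<lambda>r. f (x + r *\<^sub>R b) - r *\<^sub>R d) has_derivative (\<lambda>h. h *\<^sub>R (dird b f (x + r *\<^sub>R b) - d))) (at r within {0..s})"
      by (auto intro!: derivative_eq_intros simp: scaleR_right_diff_distrib)
    show "onorm (\<lambda>h. h *\<^sub>R (dird b f (x + r *\<^sub>R b) - d)) \<le> M"
      using M[of r] r by (intro onorm_le) (auto simp: mult.commute[of M] intro!: mult_left_mono)
  qed (use s in auto)
  then show ?thesis using s by (simp add: algebra_simps)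
qed

lemma norm_diff_le_dird:
  fixes f :: "'a::euclidean_space \<Rightarrow> complex"
  assumes f: "\<And>x. f differentiable (at x)" and M: "\<And>b x. b \<in> Basis \<Longrightarrow> norm (dird b f x) \<le> M"
  shows "norm (f z - f w) \<le> (real DIM('a) * M) * norm (z - w)"
proof (rule differentiable_bound[where S = UNIV and f' = "\<lambda>x b. dird b f x"])
  fix x
  note D = differentiable_has_derivative_dird[OF f, of x]
  show "(f has_derivative (\<lambda>b. dird b f x)) (at x within UNIV)" using D by simp
  show "onorm (\<lambda>b. dird b f x) \<le> real DIM('a) * M"
  proof (rule onorm_le)
    fix v :: 'a
    note l = has_derivative_linear[OF D]
    have "dird v f x = dird (\<Sum>b\<in>Basis. (v \<bullet> b) *\<^sub>R b) f x" by (simp add: euclidean_representation)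
    also have "\<dots> = (\<Sum>b\<in>Basis. (v \<bullet> b) *\<^sub>R dird b f x)" by (simp add: linear_sum[OF l] linear_cmul[OF l])
    also have "norm \<dots> \<le> (\<Sum>b\<in>(Basis::'a set). norm v * M)"
      by (rule sum_norm_le) (auto intro!: mult_mono M Basis_le_norm)
    finally show "norm (dird v f x) \<le> real DIM('a) * M * norm v" by (simp add: mult_ac)
  qed
qed auto

text \<open>Subtracting a constant changes only order zero, where the mean value inequality yields
  linear growth. With \<sigma> of order sqrt h this is the input of the elliptic lower
  bound.\<close>

lemma derivs_le_diff_const:
  fixes f :: "'a::euclidean_space \<Rightarrow> complex"
  assumes f: "smooth f" and d: "\<And>b. b \<in> Basis \<Longrightarrow> derivs_le M (\<lambda>_. \<sigma>) (dird b f)" and \<sigma>: "0 \<le> \<sigma>"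
  shows "derivs_le (Suc M) (\<lambda>z. real DIM('a) * \<sigma> * (1 + norm (z - w))) (\<lambda>z. f z - f w)"
  unfolding derivs_le_Suc
proof (intro conjI allI ballI)
  fix z
  have "norm (f z - f w) \<le> (real DIM('a) * \<sigma>) * norm (z - w)"
    by (rule norm_diff_le_dird[OF smooth_differentiable[OF f] derivs_leD[OF d]])
  also have "\<dots> \<le> real DIM('a) * \<sigma> * (1 + norm (z - w))"
    using \<sigma> by (intro mult_left_mono) auto
  finally show "norm (f z - f w) \<le> real DIM('a) * \<sigma> * (1 + norm (z - w))" .
next
  fix b :: 'a assume b: "b \<in> Basis"
  have "dird b (\<lambda>z. f z + - f w) = dird b f"
    by (subst dird_add) (auto intro: smooth_differentiable f)
  then have e: "dird b (\<lambda>z. f z - f w) = dird b f" by simp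
  have "\<sigma> \<le> real DIM('a) * \<sigma> * (1 + norm (z - w))" for z
  proof -
    have "1 * 1 \<le> real DIM('a) * (1 + norm (z - w))" by (intro mult_mono) (auto simp: Suc_le_eq)
    from mult_left_mono[OF this \<sigma>] show ?thesis by (simp add: mult_ac)
  qed
  then show "derivs_le M (\<lambda>z. real DIM('a) * \<sigma> * (1 + norm (z - w))) (dird b (\<lambda>z. f z - f w))"
    unfolding e by (rule derivs_le_mono[OF d[OF b] order_refl])
qed

lemma derivs_le_uniform:
  fixes f :: "'i \<Rightarrow> 'a::euclidean_space \<Rightarrow> complex"
  assumes "\<And>bs. bs \<in> lists Basis \<Longrightarrow> \<exists>C. \<forall>h\<in>H. \<forall>x. norm (iter_deriv bs (f h) x) \<le> C * g h"
    and g: "\<And>h. h \<in> H \<Longrightarrow> 0 \<le> g h"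
  obtains B where "B \<ge> 0" "\<And>h. h \<in> H \<Longrightarrow> derivs_le M (\<lambda>_. B * g h) (f h)"
proof -
  let ?L = "{bs :: 'a list. set bs \<subseteq> Basis \<and> length bs \<le> M}"
  have fin: "finite ?L" by (rule finite_lists_length_le) simp
  obtain C where C: "\<And>bs h x. bs \<in> ?L \<Longrightarrow> h \<in> H \<Longrightarrow> norm (iter_deriv bs (f h) x) \<le> C bs * g h"
    using assms(1) by (metis (mono_tags, lifting) mem_Collect_eq lists_eq_set)
  have "norm (iter_deriv bs (f h) x) \<le> (\<Sum>bs\<in>?L. \<bar>C bs\<bar>) * g h" if "bs \<in> ?L" "h \<in> H" for bs h x
  proof -
    have "C bs * g h \<le> (\<Sum>bs\<in>?L. \<bar>C bs\<bar>) * g h"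
      using member_le_sum[OF that(1) _ fin, of "\<lambda>b. \<bar>C b\<bar>"] g[OF that(2)] by (intro mult_right_mono) auto
    then show ?thesis using C[OF that, of x] by simp
  qed
  then show ?thesis
    by (intro that[of "\<Sum>bs\<in>?L. \<bar>C bs\<bar>"]) (auto simp: derivs_le_def lists_eq_set sum_nonneg)
qed

section \<open>Rescaled symbols\<close>

lemma symbol_smooth: "a \<in> symbol_class h0 \<delta> \<Longrightarrow> h \<in> {0<..<h0} \<Longrightarrow> smooth (a h)"
  by (simp add: symbol_class_def)

lemma symbol_unit:
  assumes a: "a \<in> symbol_class h0 \<delta>" and h: "h \<in> {0<..<h0}"
  shows "unit_symbol (a h)"
  unfolding unit_symbol_def
proof (intro conjI allI symbol_smooth[OF a h])
  fix k
  have "\<exists>C\<ge>0. derivs_le k (\<lambda>_. C * 1) (a h)"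
  proof (rule derivs_le_finite)
    show "\<exists>C. \<forall>x. norm (iter_deriv bs (a h) x) \<le> C * 1" if "bs \<in> lists Basis" for bs
      using a h that unfolding symbol_class_def by fastforce
  qed simp
  then show "\<exists>C. derivs_le k (\<lambda>_. C) (a h)" by auto
qed

abbreviation rescale :: "real \<Rightarrow> ('a::real_vector \<Rightarrow> complex) \<Rightarrow> 'a \<Rightarrow> complex" where
  "rescale h f \<equiv> (\<lambda>z. f (sqrt h *\<^sub>R z))"

lemma rescale_symbol_unit:
  assumes "a \<in> symbol_class h0 \<delta>" "h \<in> {0<..<h0}"
  shows "unit_symbol (rescale h (a h))"
  using assms by (intro unit_symbol_dilate symbol_unit[OF assms]) auto

lemma powr_le_max:
  fixes h :: real
  assumes "0 < h" "h < h0" "0 \<le> p"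
  shows "h powr p \<le> max 1 h0 powr p"
  using assms by (intro powr_mono2) auto

text \<open>Rescaling multiplies a derivative of order k by h^(k/2) while the symbol class loses
  h^(-\<delta> k). Of the gain h^((1/2 - \<delta>) k) any smaller power \<open>q\<close> may be
  kept, the excess being bounded through h < h0. The choice q = 0 gives uniform bounds; q = 1/2 with
  \<delta> = 0 and k \<ge> 1 gives the factor sqrt h for test symbols.\<close>

lemma rescale_iter_deriv_bound:
  assumes a: "a \<in> symbol_class h0 \<delta>" and \<delta>: "\<delta> \<le> 1/2" and bs: "bs \<in> lists Basis"
    and q: "0 \<le> q" "q \<le> (1/2 - \<delta>) * real (length bs)"
  shows "\<exists>C. \<forall>h\<in>{0<..<h0}. \<forall>z. norm (iter_deriv bs (rescale h (a h)) z) \<le> C * h powr q"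
proof -
  obtain C where C: "\<And>h \<rho>. h \<in> {0<..<h0} \<Longrightarrow> norm (iter_deriv bs (a h) \<rho>) \<le> C * h powr (- \<delta> * real (length bs))"
    using a bs unfolding symbol_class_def by blast
  let ?e = "(1/2 - \<delta>) * real (length bs)"
  have "norm (iter_deriv bs (rescale h (a h)) z) \<le> (\<bar>C\<bar> * max 1 h0 powr (?e - q)) * h powr q" if h: "h \<in> {0<..<h0}" for h z
  proof -
    have "sqrt h ^ length bs = h powr (real (length bs) / 2)"
      using h by (simp add: powr_half_sqrt[symmetric] powr_realpow[symmetric] powr_powr)
    then have "norm (iter_deriv bs (rescale h (a h)) z) = h powr (real (length bs) / 2) * norm (iter_deriv bs (a h) (sqrt h *\<^sub>R z))"
      using h by (simp add: iter_deriv_dilate[OF symbol_smooth[OF a h] bs] norm_mult norm_power)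
    also have "\<dots> \<le> h powr (real (length bs) / 2) * (\<bar>C\<bar> * h powr (- \<delta> * real (length bs)))"
      using C[OF h, of "sqrt h *\<^sub>R z"] mult_right_mono[OF abs_ge_self[of C], of "h powr (- \<delta> * real (length bs))"]
      by (intro mult_left_mono) (auto intro: order_trans)
    also have "\<dots> = \<bar>C\<bar> * h powr ?e"
      by (simp add: powr_add[symmetric] algebra_simps)
    also have "\<dots> = \<bar>C\<bar> * (h powr (?e - q) * h powr q)"
      by (simp add: powr_add[symmetric])
    also have "\<dots> \<le> \<bar>C\<bar> * (max 1 h0 powr (?e - q) * h powr q)"
      using h q by (intro mult_left_mono mult_right_mono powr_le_max) auto
    finally show ?thesis by simp
  qed
  then show ?thesis by blast
qed

lemma rescale_symbol_bound:
  assumes a: "a \<in> symbol_class h0 \<delta>" and \<delta>: "\<delta> \<le> 1/2"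
  obtains B where "B \<ge> 0" "\<And>h. h \<in> {0<..<h0} \<Longrightarrow> derivs_le M (\<lambda>_. B) (rescale h (a h))"
proof -
  have "\<exists>C. \<forall>h\<in>{0<..<h0}. \<forall>z. norm (iter_deriv bs (rescale h (a h)) z) \<le> C * 1" if bs: "bs \<in> lists Basis" for bs
    using rescale_iter_deriv_bound[OF a \<delta> bs, of 0] \<delta> by (auto simp: zero_le_mult_iff)
  from derivs_le_uniform[OF this] show ?thesis using that by (metis mult.right_neutral zero_le_one)
qed

text \<open>For \<delta> = 0 every derivative of positive order gains sqrt h, so a rescaled test
  symbol is almost constant at unit scale. This is what permits freezing it.\<close>

lemma rescale_symbol_diff_bound:
  fixes c :: "real \<Rightarrow> 'n::finite phase \<Rightarrow> complex"
  assumes c: "c \<in> symbol_class h0 0"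
  obtains K where "K \<ge> 0" "\<And>h w. h \<in> {0<..<h0} \<Longrightarrow>
    derivs_le (Suc M) (\<lambda>z. (K * sqrt h) * (1 + norm (z - w))) (\<lambda>z. rescale h (c h) z - rescale h (c h) w)"
proof -
  have "\<exists>B. B \<ge> 0 \<and> (\<forall>h\<in>{0<..<h0}. derivs_le M (\<lambda>_. B * sqrt h) (dird b (rescale h (c h))))" if b: "b \<in> Basis" for b
  proof -
    have "\<exists>C. \<forall>h\<in>{0<..<h0}. \<forall>z. norm (iter_deriv bs (dird b (rescale h (c h))) z) \<le> C * sqrt h" if bs: "bs \<in> lists Basis" for bs
    proof -
      have "\<exists>C. \<forall>h\<in>{0<..<h0}. \<forall>z. norm (iter_deriv (bs @ [b]) (rescale h (c h)) z) \<le> C * h powr (1/2)"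
        by (rule rescale_iter_deriv_bound[OF c]) (use bs b in auto)
      then show ?thesis unfolding iter_deriv_snoc by (auto simp: powr_half_sqrt)
    qed
    from derivs_le_uniform[OF this] show ?thesis by (metis greaterThanLessThan_iff less_imp_le real_sqrt_ge_zero)
  qed
  then obtain B where B: "\<And>b. b \<in> Basis \<Longrightarrow> B b \<ge> 0"
    "\<And>b h. b \<in> Basis \<Longrightarrow> h \<in> {0<..<h0} \<Longrightarrow> derivs_le M (\<lambda>_. B b * sqrt h) (dird b (rescale h (c h)))"
    by metis
  define S where "S = sum B (Basis :: 'n phase set)"
  have S: "0 \<le> S" "\<And>b. b \<in> Basis \<Longrightarrow> B b \<le> S" using B(1) member_le_sum[of _ Basis B] by (auto simp: S_def intro: sum_nonneg)
  show ?thesis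
  proof (rule that)
    show "0 \<le> real DIM('n phase) * S" using S by simp
    fix h w assume h: "h \<in> {0<..<h0}"
    have "derivs_le M (\<lambda>_. S * sqrt h) (dird b (rescale h (c h)))" if b: "b \<in> Basis" for b
      using h S(2)[OF b] by (intro derivs_le_mono[OF B(2)[OF b h]] mult_right_mono) auto
    from derivs_le_diff_const[OF unit_symbol_smooth[OF rescale_symbol_unit[OF c h]] this]
    show "derivs_le (Suc M) (\<lambda>z. (real DIM('n phase) * S * sqrt h) * (1 + norm (z - w))) (\<lambda>z. rescale h (c h) z - rescale h (c h) w)"
      using S(1) h by (simp add: mult.assoc)
  qed
qed

section \<open>Wavefront sets lie in the essential support\<close>

lemma eventually_at_right_0: "0 < (e::real) \<Longrightarrow> \<forall>\<^sub>F h in at_right 0. h \<in> {0<..<e}"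
  using eventually_at_right_real by simp

text \<open>Where l |z - w| \<ge> r, the quantity (l / r) (1 + |z - w|) is at least 1, so the global
  bound \<open>B\<close> may be multiplied by its P-th power. A symbol small only near
  \<open>w\<close> thus gets a bound with polynomial growth and coefficient e + B (l / r)^P; for l =
  sqrt h and P = 2N the second term is O(h^N).\<close>

lemma derivs_le_near:
  fixes f :: "'a::euclidean_space \<Rightarrow> complex"
  assumes B: "derivs_le M (\<lambda>_. B) f" and l: "0 < l" and r: "0 < r" and e: "0 \<le> e"
    and near: "\<And>bs z. bs \<in> lists Basis \<Longrightarrow> length bs \<le> M \<Longrightarrow> l * norm (z - w) < r \<Longrightarrow> norm (iter_deriv bs f z) \<le> e"
  shows "derivs_le M (\<lambda>z. (e + B * (l / r) ^ P) * (1 + norm (z - w)) ^ P) f"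
  unfolding derivs_le_def
proof (intro ballI impI allI)
  fix bs :: "'a list" and z assume bs: "bs \<in> lists Basis" "length bs \<le> M"
  have B0: "0 \<le> B" using order_trans[OF norm_ge_zero derivs_leD[OF B, of z]] .
  have q: "1 \<le> (1 + norm (z - w)) ^ P" by simp
  show "norm (iter_deriv bs f z) \<le> (e + B * (l / r) ^ P) * (1 + norm (z - w)) ^ P"
  proof (cases "l * norm (z - w) < r")
    case True
    have "e * 1 \<le> e * (1 + norm (z - w)) ^ P" by (rule mult_left_mono[OF q e])
    moreover have "0 \<le> B * (l / r) ^ P * (1 + norm (z - w)) ^ P" using B0 l r by simp
    ultimately show ?thesis using near[OF bs True] by (simp add: distrib_right)
  next
    case False
    then have "r \<le> l * (1 + norm (z - w))" using l by (simp add: distrib_left)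
    then have "1 \<le> (l / r) * (1 + norm (z - w))" using r by (simp add: field_simps)
    then have "1 \<le> ((l / r) * (1 + norm (z - w))) ^ P" by (rule one_le_power)
    from mult_left_mono[OF this B0] have "B \<le> B * (l / r) ^ P * (1 + norm (z - w)) ^ P"
      by (simp only: power_mult_distrib mult_1_right mult.assoc)
    moreover have "norm (iter_deriv bs f z) \<le> B" using B bs by (simp add: derivs_le_def)
    moreover have "0 \<le> e * (1 + norm (z - w)) ^ P" using e by simp
    ultimately show ?thesis by (simp add: distrib_right)
  qed
qed

lemma sqrt_power_double: "0 \<le> h \<Longrightarrow> sqrt h ^ (2 * N) = h ^ N"
  by (simp add: power_mult)

text \<open>In \<open>ess_supp\<close> the constant and the range of h depend on the derivative. The
  finitely many derivatives up to order M can share both, which turns the definition into the input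
  of \<open>derivs_le_near\<close>.\<close>

lemma ess_supp_uniform:
  assumes "\<rho> \<notin> ess_supp a"
  obtains U where "open U" "\<rho> \<in> U" "\<And>M N. \<exists>D\<ge>0. \<forall>\<^sub>F h in at_right 0.
    \<forall>bs\<in>lists Basis. length bs \<le> M \<longrightarrow> (\<forall>\<sigma>\<in>U. norm (iter_deriv bs (a h) \<sigma>) \<le> D * h ^ N)"
proof -
  obtain U where U: "open U" "\<rho> \<in> U" and small: "\<And>bs N. bs \<in> lists Basis \<Longrightarrow> \<exists>C. \<forall>\<^sub>F h in at_right 0. \<forall>\<sigma>\<in>U.
             norm (iter_deriv bs (a h) \<sigma>) \<le> C * h ^ N"
    using assms unfolding ess_supp_def by blast
  have "\<exists>D\<ge>0. \<forall>\<^sub>F h in at_right 0. \<forall>bs\<in>lists Basis. length bs \<le> M \<longrightarrow> (\<forall>\<sigma>\<in>U. norm (iter_deriv bs (a h) \<sigma>) \<le> D * h ^ N)" for M N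
  proof -
    let ?L = "{bs :: ('a phase) list. set bs \<subseteq> Basis \<and> length bs \<le> M}"
    have fin: "finite ?L" by (rule finite_lists_length_le) simp
    have "\<forall>bs\<in>?L. \<exists>C. \<forall>\<^sub>F h in at_right 0. \<forall>\<sigma>\<in>U. norm (iter_deriv bs (a h) \<sigma>) \<le> C * h ^ N"
      using small by (simp add: lists_eq_set)
    from bchoice[OF this] obtain C where C: "\<And>bs. bs \<in> ?L \<Longrightarrow> \<forall>\<^sub>F h in at_right 0. \<forall>\<sigma>\<in>U. norm (iter_deriv bs (a h) \<sigma>) \<le> C bs * h ^ N"
      by blast
    let ?D = "\<Sum>bs\<in>?L. \<bar>C bs\<bar>"
    have "\<forall>\<^sub>F h in at_right 0. \<forall>bs\<in>?L. \<forall>\<sigma>\<in>U. norm (iter_deriv bs (a h) \<sigma>) \<le> C bs * h ^ N"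
      by (rule eventually_ball_finite[OF fin]) (use C in blast)
    moreover have "\<forall>\<^sub>F h::real in at_right 0. h \<in> {0<..<1}" by (rule eventually_at_right_0) simp
    ultimately have "\<forall>\<^sub>F h in at_right 0. \<forall>bs\<in>?L. \<forall>\<sigma>\<in>U. norm (iter_deriv bs (a h) \<sigma>) \<le> ?D * h ^ N"
    proof eventually_elim
      case (elim h)
      have "C bs * h ^ N \<le> ?D * h ^ N" if "bs \<in> ?L" for bs
        using member_le_sum[OF that _ fin, of "\<lambda>b. \<bar>C b\<bar>"] elim by (intro mult_right_mono) auto
      then show ?case using elim(1) by (meson order_trans)
    qed
    moreover have "0 \<le> ?D" by (simp add: sum_nonneg)
    ultimately show ?thesis by (intro exI[of _ ?D]) (simp add: lists_eq_set imp_conjL)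
  qed
  then show ?thesis using that U by blast
qed

lemma Op_comp_bound_rescale:
  fixes a c :: "'n::finite phase \<Rightarrow> complex"
  assumes h: "h > 0" and a: "unit_symbol a" and t: "t \<in> {0..1}" and c: "unit_symbol c" and s: "s \<in> {0..1}" and u: "u \<in> L2"
    and K: "\<And>v. v \<in> schwartz \<Longrightarrow> L2_norm (Q s (rescale h c) (Q t (rescale h a) v)) \<le> K * L2_norm v"
  shows "L2_norm (Op s h c (Op t h a u)) \<le> (1 / (2 * pi) ^ CARD('n))\<^sup>2 * K * L2_norm u"
proof (rule Op_comp_bound[OF h a t c s u])
  fix \<phi> :: "'n wave" assume \<phi>: "\<phi> \<in> schwartz"
  have r: "0 < sqrt h" using h by simp
  have "dil h TYPE('n) * L2_norm (Op_schwartz s h c (Op_schwartz t h a \<phi>)) \<le>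
      (1 / (2 * pi) ^ CARD('n))\<^sup>2 * (K * L2_norm (rescale h \<phi>))"
    unfolding L2_norm_Op_schwartz_comp[OF h a t c s \<phi>] by (intro mult_left_mono K schwartz_dilate r \<phi>) simp
  also have "\<dots> = dil h TYPE('n) * ((1 / (2 * pi) ^ CARD('n))\<^sup>2 * K * L2_norm \<phi>)"
    unfolding L2_norm_sqrt_dilate[OF h schwartz_measurable[OF \<phi>]] by simp
  finally show "L2_norm (Op_schwartz s h c (Op_schwartz t h a \<phi>)) \<le> (1 / (2 * pi) ^ CARD('n))\<^sup>2 * K * L2_norm \<phi>"
    by (rule mult_left_le_imp_le) (rule dil_pos[OF h])
qed

lemma bump_symbol:
  fixes \<rho> :: "'n::finite phase"
  assumes r: "0 < r"
  shows "(\<lambda>h z. complex_of_real (bump r (z - \<rho>))) \<in> symbol_class h0 0"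
    and "bs \<in> lists Basis \<Longrightarrow> r < norm (\<sigma> - \<rho>) \<Longrightarrow> iter_deriv bs (\<lambda>z. complex_of_real (bump r (z - \<rho>))) \<sigma> = 0"
proof -
  let ?f = "\<lambda>z::'n phase. complex_of_real (bump r z)"
  have z: "r < norm x \<Longrightarrow> ?f x = 0" for x using r by (simp add: bump_eq_0)
  have D: "\<exists>C. \<forall>x. norm (iter_deriv bs ?f x) \<le> C \<and> (r < norm x \<longrightarrow> iter_deriv bs ?f x = 0)"
    if "bs \<in> lists Basis" for bs
    by (rule bounded_support_derivs[OF smooth_bump z that])
  have e: "iter_deriv bs (\<lambda>z. complex_of_real (bump r (z - \<rho>))) = (\<lambda>z. iter_deriv bs ?f (z - \<rho>))"
    if "bs \<in> lists Basis" for bs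
    by (rule iter_deriv_translate[OF smooth_bump that])
  have "smooth (\<lambda>z. complex_of_real (bump r (z - \<rho>)))"
    using smooth_affine[OF basis_affine_translation(2)[of "- \<rho>"] smooth_bump[of r]] by simp
  moreover have "\<exists>C. \<forall>h\<in>{0<..<h0}. \<forall>\<sigma>. norm (iter_deriv bs (\<lambda>z. complex_of_real (bump r (z - \<rho>))) \<sigma>) \<le> C * h powr (- 0 * real (length bs))"
    if bs: "bs \<in> lists Basis" for bs
  proof -
    obtain C where "\<And>x. norm (iter_deriv bs ?f x) \<le> C" using D[OF bs] by blast
    then show ?thesis unfolding e[OF bs] by (intro exI[of _ C]) auto
  qed
  ultimately show "(\<lambda>h z. complex_of_real (bump r (z - \<rho>))) \<in> symbol_class h0 0"
    unfolding symbol_class_def mem_Collect_eq by blast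
  show "bs \<in> lists Basis \<Longrightarrow> r < norm (\<sigma> - \<rho>) \<Longrightarrow> iter_deriv bs (\<lambda>z. complex_of_real (bump r (z - \<rho>))) \<sigma> = 0"
    using D[of bs] e[of bs] by metis
qed

lemma WF_subset_ess_supp:
  fixes a :: "real \<Rightarrow> 'n::finite phase \<Rightarrow> complex"
  assumes h0: "0 < h0" and \<delta>: "\<delta> < 1/2" and t: "t \<in> {0..1}" and s: "s \<in> {0..1}"
    and a: "a \<in> symbol_class h0 \<delta>" and A: "quantizes h0 t a A" and u: "L2_bounded_family h0 u"
  shows "WF h0 s (\<lambda>h. A h (u h)) \<subseteq> ess_supp a"
proof (rule ccontr)
  assume "\<not> ?thesis"
  then obtain \<rho> where \<rho>: "\<rho> \<in> WF h0 s (\<lambda>h. A h (u h))" "\<rho> \<notin> ess_supp a" by blast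
  obtain U where U: "open U" "\<rho> \<in> U" and small: "\<And>M N. \<exists>D\<ge>0. \<forall>\<^sub>F h in at_right 0.
    \<forall>bs\<in>lists Basis. length bs \<le> M \<longrightarrow> (\<forall>\<sigma>\<in>U. norm (iter_deriv bs (a h) \<sigma>) \<le> D * h ^ N)"
    using ess_supp_uniform[OF \<rho>(2)] by blast
  obtain d where d: "0 < d" "ball \<rho> d \<subseteq> U" using U open_contains_ball by blast
  \<comment> \<open>The cut-off lives in the ball of radius r, \<open>?E\<close> corresponds to
    radius 2 r, and U contains radius 4 r. A point within 2 r of \<open>?E\<close> then stays in U,
    and a point within r of its complement stays outside the cut-off.\<close>
  define r where "r = d / 4"
  have r: "0 < r" "\<And>\<sigma>. norm (\<sigma> - \<rho>) < 4 * r \<Longrightarrow> \<sigma> \<in> U"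
    using d by (auto simp: r_def dist_norm norm_minus_commute subset_iff)
  define f where "f z = complex_of_real (bump r (z - \<rho>))" for z
  have c: "(\<lambda>h. f) \<in> symbol_class h0 0" unfolding f_def[abs_def] by (rule bump_symbol[OF r(1)])
  have f0: "iter_deriv bs f \<sigma> = 0" if "bs \<in> lists Basis" "r < norm (\<sigma> - \<rho>)" for bs \<sigma>
    unfolding f_def[abs_def] by (rule bump_symbol(2)[OF r(1) that])
  have ell: "0 < (INF h\<in>{0<..<h0}. norm (f \<rho>))"
    using h0 r bump_pos[of "0 :: 'n phase" r] by (simp add: f_def)
  obtain Cu where Cu: "\<And>h. h \<in> {0<..<h0} \<Longrightarrow> L2_norm (u h) \<le> Cu" and uL: "\<And>h. h \<in> {0<..<h0} \<Longrightarrow> u h \<in> L2"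
    using u unfolding L2_bounded_family_def by blast
  have "(\<lambda>h. L2_norm (Op s h f (A h (u h)))) \<in> O[at_right 0](\<lambda>h. h ^ N)" for N
  proof -
    \<comment> \<open>The exponent is 2N because each power of the separation is worth only sqrt
      h.\<close>
    let ?P = "2 * N" and ?M = "2 * DIM('n phase) + 2 * N"
    obtain C where C: "C \<ge> 0"
      "\<And>b c E Bb Bc \<epsilon>b \<epsilon>c v. unit_symbol (b :: 'n phase \<Rightarrow> complex) \<Longrightarrow> unit_symbol c \<Longrightarrow> E \<in> sets borel \<Longrightarrow>
      derivs_le ?M (\<lambda>_. Bb) b \<Longrightarrow> derivs_le ?M (\<lambda>_. Bc) c \<Longrightarrow>
      \<epsilon>b \<ge> 0 \<Longrightarrow> \<epsilon>c \<ge> 0 \<Longrightarrow>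
      (\<And>w. w \<in> E \<Longrightarrow> derivs_le ?M (\<lambda>z. \<epsilon>b * (1 + norm (z - w)) ^ ?P) b) \<Longrightarrow>
      (\<And>w. w \<notin> E \<Longrightarrow> derivs_le ?M (\<lambda>z. \<epsilon>c * (1 + norm (z - w)) ^ ?P) c) \<Longrightarrow>
      v \<in> schwartz \<Longrightarrow> L2_norm (Q s c (Q t b v)) \<le> C * (Bc * \<epsilon>b + \<epsilon>c * Bb) * L2_norm v"
      using Q_comp_bound[OF s t, where P = ?P] by blast
    have "\<delta> \<le> 1/2" using \<delta> by simp
    from rescale_symbol_bound[OF a this] obtain B where B: "B \<ge> 0" "\<And>h. h \<in> {0<..<h0} \<Longrightarrow> derivs_le ?M (\<lambda>_. B) (rescale h (a h))"
      by blast
    obtain Bc where Bc: "Bc \<ge> 0" "\<And>h. h \<in> {0<..<h0} \<Longrightarrow> derivs_le ?M (\<lambda>_. Bc) (rescale h f)"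
      using rescale_symbol_bound[OF c] by (metis half_gt_zero less_imp_le zero_less_one)
    obtain D where D: "D \<ge> 0" "\<forall>\<^sub>F h in at_right 0. \<forall>bs\<in>lists Basis. length bs \<le> ?M \<longrightarrow>
        (\<forall>\<sigma>\<in>U. norm (iter_deriv bs (a h) \<sigma>) \<le> D * h ^ N)"
      using small by blast
    define \<epsilon>b where "\<epsilon>b = D + B / (2 * r) ^ ?P"
    define \<epsilon>c where "\<epsilon>c = Bc / r ^ ?P"
    have \<epsilon>: "0 \<le> \<epsilon>b" "0 \<le> \<epsilon>c" using B Bc D r by (auto simp: \<epsilon>b_def \<epsilon>c_def)
    let ?K = "(1 / (2 * pi) ^ CARD('n))\<^sup>2 * (C * (Bc * \<epsilon>b + \<epsilon>c * B)) * Cu"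
    have "\<forall>\<^sub>F h in at_right 0. h \<in> {0<..<min h0 1}" using h0 by (intro eventually_at_right_0) simp
    then have "\<forall>\<^sub>F h in at_right 0. L2_norm (Op s h f (A h (u h))) \<le> ?K * h ^ N"
      using D(2)
    proof eventually_elim
      case (elim h)
      then have h: "h \<in> {0<..<h0}" "0 < h" "h < 1" by auto
      let ?l = "sqrt h"
      have l: "0 < ?l" "?l \<le> 1" "?l ^ ?P = h ^ N" using h by (auto simp: power_mult)
      let ?E = "{w :: 'n phase. norm (?l *\<^sub>R w - \<rho>) < 2 * r}"
      have E: "?E \<in> sets borel" by measurable
      have l_norm: "norm (?l *\<^sub>R z - ?l *\<^sub>R w) = ?l * norm (z - w)" for z w :: "'n phase"
        unfolding scaleR_right_diff_distrib[symmetric] using l by simp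
      have bE: "derivs_le ?M (\<lambda>z. (\<epsilon>b * h ^ N) * (1 + norm (z - w)) ^ ?P) (rescale h (a h))" if w: "w \<in> ?E" for w
      proof -
        have "derivs_le ?M (\<lambda>z. (D * h ^ N + B * (?l / (2 * r)) ^ ?P) * (1 + norm (z - w)) ^ ?P) (rescale h (a h))"
        proof (rule derivs_le_near[OF B(2)[OF h(1)] l(1)])
          fix bs :: "'n phase list" and z assume bs: "bs \<in> lists Basis" "length bs \<le> ?M" and z: "?l * norm (z - w) < 2 * r"
          have "norm (?l *\<^sub>R z - \<rho>) \<le> norm (?l *\<^sub>R z - ?l *\<^sub>R w) + norm (?l *\<^sub>R w - \<rho>)"
            using norm_triangle_ineq[of "?l *\<^sub>R z - ?l *\<^sub>R w" "?l *\<^sub>R w - \<rho>"] by simp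
          then have "?l *\<^sub>R z \<in> U" using w z by (intro r(2)) (simp add: l_norm)
          then have 1: "norm (iter_deriv bs (a h) (?l *\<^sub>R z)) \<le> D * h ^ N" using elim bs by blast
          have "norm (iter_deriv bs (rescale h (a h)) z) = ?l ^ length bs * norm (iter_deriv bs (a h) (?l *\<^sub>R z))"
            using l by (simp add: iter_deriv_dilate[OF symbol_smooth[OF a h(1)] bs(1)] norm_mult norm_power)
          also have "\<dots> \<le> 1 * (D * h ^ N)" using l by (intro mult_mono 1 power_le_one) auto
          finally show "norm (iter_deriv bs (rescale h (a h)) z) \<le> D * h ^ N" by simp
        qed (use r D h in auto)
        moreover have "D * h ^ N + B * (?l / (2 * r)) ^ ?P = \<epsilon>b * h ^ N"
          by (simp only: power_divide l(3) \<epsilon>b_def) (simp add: field_simps)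
        ultimately show ?thesis by simp
      qed
      have cE: "derivs_le ?M (\<lambda>z. (\<epsilon>c * h ^ N) * (1 + norm (z - w)) ^ ?P) (rescale h f)" if w: "w \<notin> ?E" for w
      proof -
        have "derivs_le ?M (\<lambda>z. (0 + Bc * (?l / r) ^ ?P) * (1 + norm (z - w)) ^ ?P) (rescale h f)"
        proof (rule derivs_le_near[OF Bc(2)[OF h(1)] l(1) r(1)])
          fix bs :: "'n phase list" and z assume bs: "bs \<in> lists Basis" "length bs \<le> ?M" and z: "?l * norm (z - w) < r"
          have "norm (?l *\<^sub>R w - \<rho>) \<le> norm (?l *\<^sub>R z - ?l *\<^sub>R w) + norm (?l *\<^sub>R z - \<rho>)"
            using norm_triangle_ineq4[of "?l *\<^sub>R z - \<rho>" "?l *\<^sub>R z - ?l *\<^sub>R w"] by simp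
          then have "r < norm (?l *\<^sub>R z - \<rho>)" using w z by (simp add: l_norm)
          then show "norm (iter_deriv bs (rescale h f) z) \<le> 0"
            by (simp add: iter_deriv_dilate[OF symbol_smooth[OF c h(1)] bs(1)] f0[OF bs(1)])
        qed simp
        then show ?thesis by (simp only: power_divide l(3) \<epsilon>c_def) simp
      qed
      have "L2_norm (Q s (rescale h f) (Q t (rescale h (a h)) v)) \<le> C * (Bc * (\<epsilon>b * h ^ N) + (\<epsilon>c * h ^ N) * B) * L2_norm v"
        if v: "v \<in> schwartz" for v
        by (rule C(2)[OF rescale_symbol_unit[OF a h(1)] rescale_symbol_unit[OF c h(1)] E B(2)[OF h(1)] Bc(2)[OF h(1)] _ _ bE cE v])
           (use \<epsilon> h in auto)
      then have "L2_norm (Op s h f (Op t h (a h) (u h))) \<le>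
        (1 / (2 * pi) ^ CARD('n))\<^sup>2 * (C * (Bc * (\<epsilon>b * h ^ N) + (\<epsilon>c * h ^ N) * B)) * L2_norm (u h)"
        by (rule Op_comp_bound_rescale[OF h(2) symbol_unit[OF a h(1)] t symbol_unit[OF c h(1)] s uL[OF h(1)]])
      also have "\<dots> \<le> (1 / (2 * pi) ^ CARD('n))\<^sup>2 * (C * (Bc * (\<epsilon>b * h ^ N) + (\<epsilon>c * h ^ N) * B)) * Cu"
        using \<epsilon> B(1) Bc(1) C(1) h by (intro mult_left_mono Cu) auto
      also have "\<dots> = ?K * h ^ N" by (simp add: algebra_simps)
      finally show ?case using A h by (simp add: quantizes_def)
    qed
    moreover have "\<forall>\<^sub>F h::real in at_right 0. h \<in> {0<..<1}" by (rule eventually_at_right_0) simp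
    ultimately show ?thesis
      by (intro bigoI[where c = ?K], eventually_elim) simp
  qed
  then have "\<exists>c\<in>symbol_class h0 0. 0 < (INF h\<in>{0<..<h0}. norm (c h \<rho>)) \<and>
      (\<forall>N. (\<lambda>h. L2_norm (Op s h (c h) (A h (u h)))) \<in> O[at_right 0](\<lambda>h. h ^ N))"
    using ell by (intro bexI[OF _ c]) simp
  moreover from \<rho>(1) have "\<not> (\<exists>c\<in>symbol_class h0 0. 0 < (INF h\<in>{0<..<h0}. norm (c h \<rho>)) \<and>
      (\<forall>N. (\<lambda>h. L2_norm (Op s h (c h) (A h (u h)))) \<in> O[at_right 0](\<lambda>h. h ^ N)))"
    unfolding WF_def mem_Collect_eq .
  ultimately show False by contradiction
qed

section \<open>Coherent states\<close>

text \<open>For w = (x0, \<xi>0) this is h^(-n/4) exp (i \<xi>0 . (x - x0) / h) exp (- |x - x0|^2 /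
  (2 h)): a packet centred at w in the original scale. The factor \<open>dil\<close> makes its L2
  norm independent of h and w.\<close>

definition coherent :: "real \<Rightarrow> 'n::finite phase \<Rightarrow> 'n wave" where
  "coherent h w x = complex_of_real (dil h TYPE('n)) * packet (inverse (sqrt h) *\<^sub>R w) (inverse (sqrt h) *\<^sub>R x)"

lemma coherent_schwartz: "h > 0 \<Longrightarrow> coherent h w \<in> schwartz"
  unfolding coherent_def[abs_def] by (intro schwartz_cmult schwartz_dilate packet_schwartz) simp

lemma rescale_coherent:
  fixes w :: "'n::finite phase"
  shows "h > 0 \<Longrightarrow> rescale h (coherent h w) = (\<lambda>y. complex_of_real (dil h TYPE('n)) * packet (inverse (sqrt h) *\<^sub>R w) y)"
  by (simp add: coherent_def)

lemma L2_norm_coherent: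
  fixes w :: "'n::finite phase"
  assumes h: "h > 0"
  shows "L2_norm (coherent h w) = L2_norm (\<lambda>y::real^'n. complex_of_real (gauss y))"
proof -
  have "dil h TYPE('n) * L2_norm (coherent h w) = L2_norm (rescale h (coherent h w))"
    by (rule L2_norm_sqrt_dilate[OF h schwartz_measurable[OF coherent_schwartz[OF h]], symmetric])
  also have "\<dots> = dil h TYPE('n) * L2_norm (\<lambda>y::real^'n. complex_of_real (gauss y))"
    using dil_pos[OF h, where 'n = 'n] unfolding rescale_coherent[OF h] L2_norm_cmult L2_norm_packet by simp
  finally show ?thesis using dil_pos[OF h, where 'n = 'n] by simp
qed

lemma L2_norm_Op_coherent:
  fixes a :: "'n::finite phase \<Rightarrow> complex"
  assumes h: "h > 0" and a: "unit_symbol a" and t: "t \<in> {0..1}"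
  shows "L2_norm (Op_schwartz t h a (coherent h w)) =
    1 / (2 * pi) ^ CARD('n) * L2_norm (Q t (rescale h a) (packet (inverse (sqrt h) *\<^sub>R w)))"
proof -
  have "dil h TYPE('n) * L2_norm (Op_schwartz t h a (coherent h w)) =
      1 / (2 * pi) ^ CARD('n) * (dil h TYPE('n) * L2_norm (Q t (rescale h a) (packet (inverse (sqrt h) *\<^sub>R w))))"
    using dil_pos[OF h, where 'n = 'n]
    unfolding L2_norm_Op_schwartz[OF h a t coherent_schwartz[OF h]] rescale_coherent[OF h] Q_cmult L2_norm_cmult by simp
  also have "\<dots> = dil h TYPE('n) * (1 / (2 * pi) ^ CARD('n) * L2_norm (Q t (rescale h a) (packet (inverse (sqrt h) *\<^sub>R w))))"
    by (simp only: mult.left_commute)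
  finally show ?thesis using dil_pos[OF h, where 'n = 'n] by (metis less_irrefl mult_cancel_left)
qed

lemma L2_norm_Op_comp_coherent:
  fixes a c :: "'n::finite phase \<Rightarrow> complex"
  assumes h: "h > 0" and a: "unit_symbol a" and t: "t \<in> {0..1}" and c: "unit_symbol c" and s: "s \<in> {0..1}"
  shows "L2_norm (Op_schwartz s h c (Op_schwartz t h a (coherent h w))) =
    (1 / (2 * pi) ^ CARD('n))\<^sup>2 * L2_norm (Q s (rescale h c) (Q t (rescale h a) (packet (inverse (sqrt h) *\<^sub>R w))))"
proof -
  have "Q t (rescale h a) (rescale h (coherent h w)) =
      (\<lambda>x. complex_of_real (dil h TYPE('n)) * Q t (rescale h a) (packet (inverse (sqrt h) *\<^sub>R w)) x)"
    unfolding rescale_coherent[OF h] Q_cmult by (rule refl)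
  then have "dil h TYPE('n) * L2_norm (Op_schwartz s h c (Op_schwartz t h a (coherent h w))) =
      (1 / (2 * pi) ^ CARD('n))\<^sup>2 * (dil h TYPE('n) * L2_norm (Q s (rescale h c) (Q t (rescale h a) (packet (inverse (sqrt h) *\<^sub>R w)))))"
    using dil_pos[OF h, where 'n = 'n]
    by (simp only: L2_norm_Op_schwartz_comp[OF h a t c s coherent_schwartz[OF h]] Q_cmult[abs_def] L2_norm_cmult norm_of_real abs_of_pos)
  then show ?thesis using dil_pos[OF h, where 'n = 'n] by simp
qed

lemma inverse_power_sqrt_le:
  assumes h: "0 < h" and x: "0 < x"
  shows "inverse ((1 + x / sqrt h) ^ (2 * N)) \<le> (1 / x) ^ (2 * N) * h ^ N"
proof -
  have r: "0 < sqrt h" using h by simp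
  have "inverse ((1 + x / sqrt h) ^ (2 * N)) \<le> inverse ((x / sqrt h) ^ (2 * N))"
    using x r by (intro le_imp_inverse_le power_mono zero_less_power) auto
  also have "\<dots> = (1 / x) ^ (2 * N) * sqrt h ^ (2 * N)"
    by (simp add: power_divide divide_simps)
  finally show ?thesis using h by (simp add: sqrt_power_double)
qed

lemma sqrt_small: "0 < (e::real) \<Longrightarrow> \<forall>\<^sub>F h in at_right 0. sqrt h < e"
  using eventually_at_right_0[of "e\<^sup>2"]
  by (auto elim!: eventually_mono intro: real_less_lsqrt)

section \<open>Elliptic test operators detect coherent states\<close>

text \<open>Ellipticity at \<rho> spreads to radius 2 R, uniformly in h, because the derivatives of
  \<open>c\<close> are bounded. A packet centred within R of \<rho> has an image concentrated in
  that larger ball up to O(h^N), and there the elliptic lower bound applies; its error, O(sqrt h)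
  times the norm of the image, is absorbed on the left. \<open>R\<close> is independent of
  \<open>N\<close>, while \<open>K\<close> is not.\<close>

lemma elliptic_coherent_bound:
  fixes a c :: "real \<Rightarrow> 'n::finite phase \<Rightarrow> complex"
  assumes h0: "0 < h0" and \<delta>: "\<delta> \<le> 1/2" and t: "t \<in> {0..1}" and s: "s \<in> {0..1}"
    and a: "a \<in> symbol_class h0 \<delta>" and c: "c \<in> symbol_class h0 0"
    and \<epsilon>: "0 < \<epsilon>" "\<And>h. h \<in> {0<..<h0} \<Longrightarrow> \<epsilon> \<le> norm (c h \<rho>)"
  obtains R where "R > 0" "\<And>N. \<exists>K\<ge>0. \<forall>\<^sub>F h in at_right 0. \<forall>w\<in>ball \<rho> R.
    L2_norm (Op_schwartz t h (a h) (coherent h w)) \<le>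
      K * (L2_norm (Op_schwartz s h (c h) (Op_schwartz t h (a h) (coherent h w))) + h ^ N)"
proof -
  let ?k = "2 * DIM('n phase)"
  define \<mu> where "\<mu> = fbi_mass TYPE(real^'n)"
  have \<mu>: "0 < \<mu>" unfolding \<mu>_def by (rule fbi_mass_pos)
  define \<kappa> :: real where "\<kappa> = 1 / (2 * pi) ^ CARD('n)"
  have \<kappa>: "0 < \<kappa>" by (simp add: \<kappa>_def)
  obtain L where L: "L \<ge> 0" "\<And>h w. h \<in> {0<..<h0} \<Longrightarrow>
      derivs_le (Suc ?k) (\<lambda>z. (L * sqrt h) * (1 + norm (z - w))) (\<lambda>z. rescale h (c h) z - rescale h (c h) w)"
    using rescale_symbol_diff_bound[OF c, where M = ?k] by blast
  obtain Ce where Ce: "Ce \<ge> 0" "\<And>c E \<sigma> \<epsilon> v. unit_symbol (c :: 'n phase \<Rightarrow> complex) \<Longrightarrow> E \<in> sets borel \<Longrightarrow>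
      (\<And>w. derivs_le (?k + 1) (\<lambda>z. \<sigma> * (1 + norm (z - w))) (\<lambda>z. c z - c w)) \<Longrightarrow>
      (\<And>w. w \<in> E \<Longrightarrow> \<epsilon> \<le> norm (c w)) \<Longrightarrow> 0 \<le> \<epsilon> \<Longrightarrow> v \<in> schwartz \<Longrightarrow>
      \<epsilon> * L2_norm (\<lambda>w. indicator E w * fbi v w) \<le> Ce * (L2_norm (Q s c v) + \<sigma> * L2_norm v)"
    using Q_elliptic_lower_bound[OF s] by blast
  \<comment> \<open>Over the distance 2 R the symbol moves by at most \<epsilon> / 4. Another
    \<epsilon> / 4 is reserved for the term L sqrt h coming from the 1 in 1 + |z - w|, so that |c|
    \<ge> \<epsilon> / 2 remains.\<close>
  define R where "R = \<epsilon> / (8 * (L + 1))"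
  have R: "0 < R" "L * (2 * R) \<le> \<epsilon> / 4"
    using \<epsilon>(1) L(1) by (auto simp: R_def field_simps)
  have "\<exists>K\<ge>0. \<forall>\<^sub>F h in at_right 0. \<forall>w\<in>ball \<rho> R.
    L2_norm (Op_schwartz t h (a h) (coherent h w)) \<le>
      K * (L2_norm (Op_schwartz s h (c h) (Op_schwartz t h (a h) (coherent h w))) + h ^ N)" for N
  proof -
    obtain Ct where Ct: "Ct \<ge> 0" "\<And>b B E R w. unit_symbol (b :: 'n phase \<Rightarrow> complex) \<Longrightarrow> derivs_le (?k + 2 * N) (\<lambda>_. B) b \<Longrightarrow>
      E \<in> sets borel \<Longrightarrow> R \<ge> 0 \<Longrightarrow> (\<And>w'. w' \<notin> E \<Longrightarrow> R \<le> norm (w' - w)) \<Longrightarrow>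
      L2_norm (\<lambda>w'. indicator (- E) w' * fbi (Q t b (packet w)) w') \<le> Ct * B * inverse ((1 + R) ^ (2 * N))"
      using Q_packet_tail[OF t, where P = "2 * N"] by blast
    obtain B where B: "B \<ge> 0" "\<And>h. h \<in> {0<..<h0} \<Longrightarrow> derivs_le (?k + 2 * N) (\<lambda>_. B) (rescale h (a h))"
      using rescale_symbol_bound[OF a \<delta>] by blast
    define T where "T = Ct * B * (1 / R) ^ (2 * N)"
    have T: "0 \<le> T" using Ct B R by (simp add: T_def)
    define K1 where "K1 = (Ce + \<epsilon> / 2 * T) * (4 / (\<epsilon> * sqrt \<mu>))"
    have K1: "0 \<le> K1" using Ce(1) \<epsilon> T \<mu> by (simp add: K1_def)
    define K where "K = \<kappa> * K1 * (1 / \<kappa>\<^sup>2 + 1)"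
    have K: "0 \<le> K" using K1 \<kappa> by (simp add: K_def)
    \<comment> \<open>Two thresholds for sqrt h: the first makes L sqrt h \<le> \<epsilon> / 4, the
      second makes the error term at most half of the left-hand side, so that it can be
      absorbed.\<close>
    have e1: "0 < \<epsilon> / (4 * (L + 1))" using \<epsilon> L(1) by simp
    have e2: "0 < \<epsilon> * sqrt \<mu> / (4 * (Ce * L + 1))" using \<epsilon> L(1) Ce(1) \<mu> by (simp add: add_nonneg_pos)
    have "\<forall>\<^sub>F h in at_right 0. \<forall>w\<in>ball \<rho> R. L2_norm (Op_schwartz t h (a h) (coherent h w)) \<le>
      K * (L2_norm (Op_schwartz s h (c h) (Op_schwartz t h (a h) (coherent h w))) + h ^ N)"
      using eventually_at_right_0[OF h0] sqrt_small[OF e1] sqrt_small[OF e2]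
    proof eventually_elim
      case (elim h)
      then have h: "h \<in> {0<..<h0}" "0 < h" by auto
      let ?l = "sqrt h"
      have l: "0 < ?l" using h by simp
      have Ll: "L * ?l \<le> \<epsilon> / 4" "Ce * L * ?l \<le> \<epsilon> * sqrt \<mu> / 4"
      proof -
        have "(L + 1) * ?l \<le> \<epsilon> / 4" using elim(2) L(1) by (simp add: field_simps)
        moreover have "L * ?l \<le> (L + 1) * ?l" using l by (intro mult_right_mono) auto
        ultimately show "L * ?l \<le> \<epsilon> / 4" by linarith
        have "(Ce * L + 1) * ?l \<le> \<epsilon> * sqrt \<mu> / 4"
          using elim(3) L(1) Ce(1) by (simp add: pos_less_divide_eq add_nonneg_pos mult_ac)
        moreover have "Ce * L * ?l \<le> (Ce * L + 1) * ?l" using l by (intro mult_right_mono) auto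
        ultimately show "Ce * L * ?l \<le> \<epsilon> * sqrt \<mu> / 4" by linarith
      qed
      note b = rescale_symbol_unit[OF a h(1)] and c' = rescale_symbol_unit[OF c h(1)]
      let ?E = "{z :: 'n phase. norm (?l *\<^sub>R z - \<rho>) < 2 * R}"
      have E: "?E \<in> sets borel" by measurable
      have ell: "\<epsilon> / 2 \<le> norm (rescale h (c h) z)" if "z \<in> ?E" for z
      proof -
        let ?z0 = "inverse ?l *\<^sub>R \<rho>"
        have "norm (rescale h (c h) z - c h \<rho>) \<le> L * ?l * (1 + norm (z - ?z0))"
          using derivs_leD[OF L(2)[OF h(1), of ?z0]] l by simp
        also have "\<dots> = L * ?l + L * norm (?l *\<^sub>R z - \<rho>)"
        proof -
          have "?l *\<^sub>R z - \<rho> = ?l *\<^sub>R (z - ?z0)" using l by (simp add: scaleR_right_diff_distrib)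
          then have "norm (?l *\<^sub>R z - \<rho>) = ?l * norm (z - ?z0)" using l by (simp only: norm_scaleR abs_of_pos)
          then show ?thesis by (simp only: distrib_left mult_1_right mult.assoc)
        qed
        also have "\<dots> \<le> \<epsilon> / 4 + L * (2 * R)"
          using that Ll(1) L(1) by (intro add_mono mult_left_mono) auto
        also have "\<dots> \<le> \<epsilon> / 2" using R(2) by simp
        finally show ?thesis
          using \<epsilon>(2)[OF h(1)] norm_triangle_ineq2[of "c h \<rho>" "rescale h (c h) z"] by (simp add: norm_minus_commute)
      qed
      show ?case
      proof
        fix w assume w: "w \<in> ball \<rho> R"
        define W where "W = inverse ?l *\<^sub>R w"
        define v where "v = Q t (rescale h (a h)) (packet W)"
        have v: "v \<in> schwartz" unfolding v_def by (intro Q_schwartz b t packet_schwartz)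
        define X where "X = L2_norm v"
        define Y where "Y = L2_norm (Q s (rescale h (c h)) v)"
        have XY: "0 \<le> X" "0 \<le> Y" by (auto simp: X_def Y_def)
        have far: "R / ?l \<le> norm (z - W)" if "z \<notin> ?E" for z
        proof -
          have "norm (?l *\<^sub>R z - \<rho>) \<le> norm (?l *\<^sub>R z - w) + norm (w - \<rho>)"
            using norm_triangle_ineq[of "?l *\<^sub>R z - w" "w - \<rho>"] by simp
          moreover have "?l *\<^sub>R z - w = ?l *\<^sub>R (z - W)" using l by (simp add: W_def scaleR_right_diff_distrib)
          ultimately have "R \<le> ?l * norm (z - W)" using w that l by (simp add: dist_norm norm_minus_commute)
          then show ?thesis using l by (simp add: field_simps)
        qed
        have "L2_norm (\<lambda>z. indicator (- ?E) z * fbi v z) \<le> Ct * B * inverse ((1 + R / ?l) ^ (2 * N))"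
          unfolding v_def using R l by (intro Ct(2)[OF b B(2)[OF h(1)] E] far) auto
        also have "\<dots> \<le> Ct * B * ((1 / R) ^ (2 * N) * h ^ N)"
          using Ct B by (intro mult_left_mono inverse_power_sqrt_le h R) auto
        finally have tail: "L2_norm (\<lambda>z. indicator (- ?E) z * fbi v z) \<le> T * h ^ N"
          by (simp add: T_def mult.assoc)
        have main: "\<epsilon> / 2 * L2_norm (\<lambda>z. indicator ?E z * fbi v z) \<le> Ce * (Y + L * ?l * X)"
          unfolding X_def Y_def using L(2)[OF h(1)] \<epsilon>(1) by (intro Ce(2) c' E v ell) auto
        have fL: "fbi v \<in> L2" by (rule schwartz_fbi_L2(1)[OF v])
        have "sqrt \<mu> * X = L2_norm (fbi v)" unfolding X_def \<mu>_def schwartz_fbi_L2(2)[OF v] ..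
        also have "fbi v = (\<lambda>z. indicator ?E z * fbi v z + indicator (- ?E) z * fbi v z)"
          by (auto simp: indicator_def)
        also have "L2_norm \<dots> \<le> L2_norm (\<lambda>z. indicator ?E z * fbi v z) + L2_norm (\<lambda>z. indicator (- ?E) z * fbi v z)"
          using E by (intro L2_add L2_indicator fL) auto
        finally have "\<epsilon> / 2 * (sqrt \<mu> * X) \<le> \<epsilon> / 2 * (L2_norm (\<lambda>z. indicator ?E z * fbi v z) + L2_norm (\<lambda>z. indicator (- ?E) z * fbi v z))"
          using \<epsilon>(1) by (intro mult_left_mono) auto
        also have "\<dots> \<le> Ce * (Y + L * ?l * X) + \<epsilon> / 2 * (T * h ^ N)"
          unfolding distrib_left[of "\<epsilon> / 2"] using \<epsilon>(1) by (intro add_mono main mult_left_mono tail) auto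
        also have "\<dots> \<le> Ce * Y + \<epsilon> * sqrt \<mu> / 4 * X + \<epsilon> / 2 * (T * h ^ N)"
          using mult_right_mono[OF Ll(2) XY(1)] by (simp add: algebra_simps)
        finally have "\<epsilon> * sqrt \<mu> / 4 * X \<le> Ce * Y + \<epsilon> / 2 * T * h ^ N" by (simp add: algebra_simps)
        also have "\<dots> \<le> (Ce + \<epsilon> / 2 * T) * (Y + h ^ N)"
        proof -
          have "p * Y + q * H \<le> (p + q) * (Y + H)" if "0 \<le> p * H" "0 \<le> q * Y" for p q H :: real
            using that by (simp add: algebra_simps)
          then show ?thesis by this (use Ce(1) h \<epsilon>(1) T XY in auto)
        qed
        finally have "X \<le> K1 * (Y + h ^ N)"
          using \<epsilon>(1) \<mu> unfolding K1_def by (simp add: field_simps)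
        then have "\<kappa> * X \<le> \<kappa> * (K1 * (Y + h ^ N))" using \<kappa> by simp
        also have "\<dots> \<le> K * (\<kappa>\<^sup>2 * Y + h ^ N)"
        proof -
          have "Y + h ^ N \<le> (1 / \<kappa>\<^sup>2 + 1) * (\<kappa>\<^sup>2 * Y + h ^ N)"
            using \<kappa> XY h by (simp add: algebra_simps)
          from mult_left_mono[OF this, of "\<kappa> * K1"] show ?thesis using \<kappa> K1 by (simp add: K_def mult.assoc)
        qed
        finally show "L2_norm (Op_schwartz t h (a h) (coherent h w)) \<le>
            K * (L2_norm (Op_schwartz s h (c h) (Op_schwartz t h (a h) (coherent h w))) + h ^ N)"
          unfolding L2_norm_Op_coherent[OF h(2) symbol_unit[OF a h(1)] t]
            L2_norm_Op_comp_coherent[OF h(2) symbol_unit[OF a h(1)] t symbol_unit[OF c h(1)] s]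
          by (simp only: X_def Y_def v_def W_def \<kappa>_def)
      qed
    qed
    then show ?thesis using K by blast
  qed
  then show ?thesis using that R(1) by blast
qed

section \<open>Recovering the symbol from coherent states\<close>

text \<open>\<open>unit_symbol_recovery\<close> at the rescaled radius (r / 2) / sqrt h, which is r
  / 2 in the original scale; hence the conclusion on half the ball. The factor (1 + R)^k is at most
  a constant times h^(-k), so smallness of the packet images is invoked with exponent N + k.\<close>

lemma coherent_small_imp_symbol_small:
  fixes a :: "real \<Rightarrow> 'n::finite phase \<Rightarrow> complex"
  assumes h0: "0 < h0" and \<delta>: "\<delta> \<le> 1/2" and t: "t \<in> {0..1}" and a: "a \<in> symbol_class h0 \<delta>" and r: "0 < r"
    and small: "\<And>N. \<exists>C. \<forall>\<^sub>F h in at_right 0. \<forall>w\<in>ball \<rho> r. L2_norm (Op_schwartz t h (a h) (coherent h w)) \<le> C * h ^ N"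
  shows "\<exists>C. \<forall>\<^sub>F h in at_right 0. \<forall>\<sigma>\<in>ball \<rho> (r / 2). norm (a h \<sigma>) \<le> C * h ^ N"
proof -
  let ?k = "2 * DIM('n phase)"
  define \<kappa> :: real where "\<kappa> = 1 / (2 * pi) ^ CARD('n)"
  have \<kappa>: "0 < \<kappa>" by (simp add: \<kappa>_def)
  obtain C where C: "C \<ge> 0" "\<And>b B R \<epsilon> m. unit_symbol (b :: 'n phase \<Rightarrow> complex) \<Longrightarrow> derivs_le (?k + 2 * N) (\<lambda>_. B) b \<Longrightarrow>
      R \<ge> 0 \<Longrightarrow> (\<And>w. norm (w - m) \<le> R \<Longrightarrow> L2_norm (Q t b (packet w)) \<le> \<epsilon>) \<Longrightarrow>
      norm (b m) \<le> C * (\<epsilon> * (1 + R) ^ ?k + B * inverse ((1 + R) ^ (2 * N)))"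
    using unit_symbol_recovery[OF t, where P = "2 * N"] by blast
  obtain B where B: "B \<ge> 0" "\<And>h. h \<in> {0<..<h0} \<Longrightarrow> derivs_le (?k + 2 * N) (\<lambda>_. B) (rescale h (a h))"
    using rescale_symbol_bound[OF a \<delta>] by blast
  obtain D where D: "\<forall>\<^sub>F h in at_right 0. \<forall>w\<in>ball \<rho> r. L2_norm (Op_schwartz t h (a h) (coherent h w)) \<le> D * h ^ (N + ?k)"
    using small by blast
  let ?K = "C * (\<bar>D\<bar> / \<kappa> * (1 + r) ^ ?k + B * (1 / (r / 2)) ^ (2 * N))"
  have "\<forall>\<^sub>F h in at_right 0. h \<in> {0<..<min h0 1}" using h0 by (intro eventually_at_right_0) simp
  then have "\<forall>\<^sub>F h in at_right 0. \<forall>\<sigma>\<in>ball \<rho> (r / 2). norm (a h \<sigma>) \<le> ?K * h ^ N"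
    using D
  proof eventually_elim
    case (elim h)
    then have h: "h \<in> {0<..<h0}" "0 < h" "h < 1" by auto
    let ?l = "sqrt h"
    have l: "0 < ?l" "?l \<le> 1" using h by auto
    note b = rescale_symbol_unit[OF a h(1)]
    show ?case
    proof
      fix \<sigma> assume \<sigma>: "\<sigma> \<in> ball \<rho> (r / 2)"
      let ?m = "inverse ?l *\<^sub>R \<sigma>" and ?R = "(r / 2) / ?l" and ?e = "\<bar>D\<bar> / \<kappa> * h ^ (N + ?k)"
      have sm: "L2_norm (Q t (rescale h (a h)) (packet W)) \<le> ?e" if W: "norm (W - ?m) \<le> ?R" for W
      proof -
        have "?l *\<^sub>R W - \<sigma> = ?l *\<^sub>R (W - ?m)" using l by (simp add: scaleR_right_diff_distrib)
        then have "norm (?l *\<^sub>R W - \<sigma>) = ?l * norm (W - ?m)" using l by (simp only: norm_scaleR abs_of_pos)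
        also have "\<dots> \<le> ?l * ?R" using W l by (intro mult_left_mono) auto
        also have "\<dots> = r / 2" using l by simp
        finally have "norm (?l *\<^sub>R W - \<sigma>) \<le> r / 2" .
        then have "?l *\<^sub>R W \<in> ball \<rho> r"
          using \<sigma> norm_triangle_ineq[of "\<rho> - \<sigma>" "\<sigma> - ?l *\<^sub>R W"] by (simp add: dist_norm norm_minus_commute)
        then have "L2_norm (Op_schwartz t h (a h) (coherent h (?l *\<^sub>R W))) \<le> D * h ^ (N + ?k)" using elim by blast
        also have "\<dots> \<le> \<bar>D\<bar> * h ^ (N + ?k)" using h by (intro mult_right_mono) auto
        finally have "\<kappa> * L2_norm (Q t (rescale h (a h)) (packet W)) \<le> \<bar>D\<bar> * h ^ (N + ?k)"
          unfolding L2_norm_Op_coherent[OF h(2) symbol_unit[OF a h(1)] t] \<kappa>_def using l by simp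
        then show ?thesis using \<kappa> by (simp add: field_simps)
      qed
      have "norm (rescale h (a h) ?m) \<le> C * (?e * (1 + ?R) ^ ?k + B * inverse ((1 + ?R) ^ (2 * N)))"
        by (rule C(2)[OF b B(2)[OF h(1)] _ sm]) (use l r in simp)
      then have "norm (a h \<sigma>) \<le> C * (?e * (1 + ?R) ^ ?k + B * inverse ((1 + ?R) ^ (2 * N)))"
        using l r by simp
      also have "\<dots> \<le> C * (\<bar>D\<bar> / \<kappa> * ((1 + r) ^ ?k * h ^ N) + B * ((1 / (r / 2)) ^ (2 * N) * h ^ N))"
      proof (intro mult_left_mono add_mono C B)
        have "h * (1 + ?R) = h + ?l * (r / 2)" using l h real_sqrt_mult_self[of h] by (simp add: field_simps)
        also have "\<dots> \<le> 1 + 1 * r" using l h r by (intro add_mono mult_mono) auto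
        finally have "(h * (1 + ?R)) ^ ?k \<le> (1 + r) ^ ?k" using h r l by (intro power_mono) auto
        then have "h ^ N * (h * (1 + ?R)) ^ ?k \<le> h ^ N * (1 + r) ^ ?k" using h by (intro mult_left_mono) auto
        then have "h ^ (N + ?k) * (1 + ?R) ^ ?k \<le> (1 + r) ^ ?k * h ^ N"
          unfolding power_mult_distrib power_add by (simp only: mult_ac)
        from mult_left_mono[OF this, of "\<bar>D\<bar> / \<kappa>"] show "?e * (1 + ?R) ^ ?k \<le> \<bar>D\<bar> / \<kappa> * ((1 + r) ^ ?k * h ^ N)"
          using \<kappa> by (simp only: mult.assoc) simp
        show "inverse ((1 + ?R) ^ (2 * N)) \<le> (1 / (r / 2)) ^ (2 * N) * h ^ N"
          by (rule inverse_power_sqrt_le[OF h(2)]) (use r in simp)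
      qed
      also have "\<dots> = ?K * h ^ N" by (simp only: distrib_left distrib_right mult.assoc)
      finally show "norm (a h \<sigma>) \<le> ?K * h ^ N" .
    qed
  qed
  then show ?thesis by blast
qed

text \<open>A Landau type interpolation inequality: a function of size \<open>h\<^sup>M\<close> whose second derivative is of
  size \<open>h\<^sup>-\<^sup>q\<close> has a small first derivative, by a difference quotient with step \<open>h\<^sup>N\<^sup>+\<^sup>q\<^sup>+\<^sup>1\<close>.\<close>

lemma dird_small:
  fixes f :: "real \<Rightarrow> 'a::euclidean_space \<Rightarrow> complex"
  assumes f: "\<forall>\<^sub>F h in at_right 0. smooth (f h)" and b: "b \<in> Basis" and r: "r' < r"
    and q: "\<forall>\<^sub>F h in at_right 0. \<forall>x. norm (dird b (dird b (f h)) x) \<le> C * inverse (h ^ q)"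
    and small: "\<And>N. \<exists>C. \<forall>\<^sub>F h in at_right 0. \<forall>\<sigma>\<in>ball \<rho> r. norm (f h \<sigma>) \<le> C * h ^ N"
  shows "\<exists>C. \<forall>\<^sub>F h in at_right 0. \<forall>\<sigma>\<in>ball \<rho> r'. norm (dird b (f h) \<sigma>) \<le> C * h ^ N"
proof -
  let ?m = "N + q + 1"
  \<comment> \<open>Division by the step h^(N + q + 1) must still leave h^N, hence the sum of the
    two exponents.\<close>
  obtain D where D: "\<forall>\<^sub>F h in at_right 0. \<forall>\<sigma>\<in>ball \<rho> r. norm (f h \<sigma>) \<le> D * h ^ (N + ?m)"
    using small by blast
  have "\<forall>\<^sub>F h in at_right 0. h \<in> {0<..<min 1 (r - r')}" using r by (intro eventually_at_right_0) simp
  then have "\<forall>\<^sub>F h in at_right 0. \<forall>\<sigma>\<in>ball \<rho> r'. norm (dird b (f h) \<sigma>) \<le> (C + 2 * D) * h ^ N"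
    using f q D
  proof eventually_elim
    case (elim h)
    then have h: "0 < h" "h < 1" "h < r - r'" by auto
    define s where "s = h ^ ?m"
    have s: "0 < s" "s \<le> h" using h power_le_one[of h "N + q"] by (auto simp: s_def mult_left_le)
    show ?case
    proof
      fix \<sigma> assume \<sigma>: "\<sigma> \<in> ball \<rho> r'"
      let ?d = "dird b (f h) \<sigma>"
      have C0: "0 \<le> C * inverse (h ^ q)" using order_trans[OF norm_ge_zero elim(3)[rule_format, of \<sigma>]] .
      have C: "0 \<le> C" using C0 h zero_less_power[OF h(1), of q] by (auto simp: zero_le_mult_iff)
      have "norm (dird b (f h) (\<sigma> + x *\<^sub>R b) - ?d) \<le> C * inverse (h ^ q) * s" if x: "0 \<le> x" "x \<le> s" for x
      proof -
        have "norm (dird b (f h) (\<sigma> + x *\<^sub>R b) - ?d - x *\<^sub>R 0) \<le> (C * inverse (h ^ q)) * x"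
          using elim(3) x smooth_differentiable[OF smooth_dird[OF elim(2) b]] by (intro norm_diff_dird_le) auto
        also have "\<dots> \<le> (C * inverse (h ^ q)) * s" by (rule mult_left_mono[OF x(2) C0])
        finally show ?thesis by simp
      qed
      then have 1: "norm (f h (\<sigma> + s *\<^sub>R b) - f h \<sigma> - s *\<^sub>R ?d) \<le> (C * inverse (h ^ q) * s) * s"
        using s smooth_differentiable[OF elim(2)] by (intro norm_diff_dird_le) auto
      have "\<sigma> + s *\<^sub>R b \<in> ball \<rho> r"
        using \<sigma> s h b norm_triangle_ineq4[of "\<rho> - \<sigma>" "s *\<^sub>R b"] by (simp add: dist_norm diff_diff_eq)
      then have 2: "norm (f h (\<sigma> + s *\<^sub>R b)) \<le> D * h ^ (N + ?m)" using elim(4) by blast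
      have "\<sigma> \<in> ball \<rho> r" using \<sigma> r by simp
      then have 3: "norm (f h \<sigma>) \<le> D * h ^ (N + ?m)" using elim(4) by blast
      have "norm (s *\<^sub>R ?d) \<le> norm (f h (\<sigma> + s *\<^sub>R b) - f h \<sigma>) + norm (f h (\<sigma> + s *\<^sub>R b) - f h \<sigma> - s *\<^sub>R ?d)"
        using norm_triangle_ineq4[of "f h (\<sigma> + s *\<^sub>R b) - f h \<sigma>" "f h (\<sigma> + s *\<^sub>R b) - f h \<sigma> - s *\<^sub>R ?d"] by simp
      also have "\<dots> \<le> (D * h ^ (N + ?m) + D * h ^ (N + ?m)) + (C * inverse (h ^ q) * s) * s"
        by (intro add_mono order_trans[OF norm_triangle_ineq4] 1 2 3)
      also have "\<dots> = s * (2 * D * h ^ N + C * (inverse (h ^ q) * s))"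
        by (simp add: s_def power_add algebra_simps)
      finally have "s * norm ?d \<le> s * (2 * D * h ^ N + C * (inverse (h ^ q) * s))" using s by simp
      then have "norm ?d \<le> 2 * D * h ^ N + C * (inverse (h ^ q) * s)" using s by simp
      also have "inverse (h ^ q) * s = h ^ N * h" using h by (simp add: s_def power_add field_simps)
      also have "C * (h ^ N * h) \<le> C * (h ^ N * 1)" using C h by (intro mult_left_mono) auto
      finally show "norm ?d \<le> (C + 2 * D) * h ^ N" by (simp add: algebra_simps)
    qed
  qed
  then show ?thesis by blast
qed

text \<open>\<open>dird_small\<close> passes from one derivative to the next. It needs smallness of
  the lower one on a slightly larger ball, here of radius (r + r') / 2, and a bound on the second
  derivative, which the symbol class provides everywhere with a negative power of h.\<close>

lemma symbol_small_imp_not_ess_supp: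
  fixes a :: "real \<Rightarrow> 'n::finite phase \<Rightarrow> complex"
  assumes h0: "0 < h0" and \<delta>: "\<delta> \<le> 1" and a: "a \<in> symbol_class h0 \<delta>" and r: "0 < r"
    and small: "\<And>N. \<exists>C. \<forall>\<^sub>F h in at_right 0. \<forall>\<sigma>\<in>ball \<rho> r. norm (a h \<sigma>) \<le> C * h ^ N"
  shows "\<rho> \<notin> ess_supp a"
proof -
  have "\<exists>C. \<forall>\<^sub>F h in at_right 0. \<forall>\<sigma>\<in>ball \<rho> r'. norm (iter_deriv bs (a h) \<sigma>) \<le> C * h ^ N"
    if "bs \<in> lists Basis" "r' < r" for bs r' N
    using that
  proof (induction bs arbitrary: r' N)
    case Nil
    obtain C where "\<forall>\<^sub>F h in at_right 0. \<forall>\<sigma>\<in>ball \<rho> r. norm (a h \<sigma>) \<le> C * h ^ N" using small by blast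
    then show ?case by (intro exI[of _ C], rule eventually_mono) (use Nil in auto)
  next
    case (Cons b bs)
    then have b: "b \<in> Basis" and bs: "bs \<in> lists Basis" by auto
    let ?q = "length bs + 2"
    obtain C where C: "\<And>h x. h \<in> {0<..<h0} \<Longrightarrow> norm (iter_deriv (b # b # bs) (a h) x) \<le> C * h powr (- \<delta> * real (length (b # b # bs)))"
    proof -
      have "b # b # bs \<in> lists Basis" using b bs by simp
      then show thesis using a that unfolding symbol_class_def by blast
    qed
    have "\<forall>\<^sub>F h in at_right 0. h \<in> {0<..<min h0 1}" using h0 by (intro eventually_at_right_0) simp
    then have ev: "\<forall>\<^sub>F h in at_right 0. smooth (iter_deriv bs (a h)) \<and>
        (\<forall>x. norm (dird b (dird b (iter_deriv bs (a h))) x) \<le> \<bar>C\<bar> * inverse (h ^ ?q))"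
    proof eventually_elim
      case (elim h)
      then have h: "h \<in> {0<..<h0}" "0 < h" "h < 1" by auto
      have "\<delta> * real ?q \<le> 1 * real ?q" using \<delta> by (intro mult_right_mono) auto
      then have "- real ?q \<le> - \<delta> * real ?q" by (simp only: minus_mult_left[symmetric] mult_1_left neg_le_iff_le)
      then have "h powr (- \<delta> * real ?q) \<le> h powr (- real ?q)" using h by (intro powr_mono') auto
      also have "\<dots> = inverse (h ^ ?q)" using h by (simp only: powr_minus powr_realpow)
      finally have p: "h powr (- \<delta> * real ?q) \<le> inverse (h ^ ?q)" .
      have "norm (dird b (dird b (iter_deriv bs (a h))) x) \<le> \<bar>C\<bar> * inverse (h ^ ?q)" for x
      proof -
        have "norm (dird b (dird b (iter_deriv bs (a h))) x) \<le> C * h powr (- \<delta> * real ?q)"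
          using C[OF h(1), of x] unfolding iter_deriv_Cons_dird by (simp add: algebra_simps)
        also have "\<dots> \<le> \<bar>C\<bar> * inverse (h ^ ?q)" by (intro mult_mono p) auto
        finally show ?thesis .
      qed
      then show ?case using smooth_iter_deriv[OF symbol_smooth[OF a h(1)] bs] by blast
    qed
    let ?r = "(r + r') / 2"
    have "\<exists>C. \<forall>\<^sub>F h in at_right 0. \<forall>\<sigma>\<in>ball \<rho> r'. norm (dird b (iter_deriv bs (a h)) \<sigma>) \<le> C * h ^ N"
    proof (rule dird_small[OF _ b])
      show "r' < ?r" using Cons.prems by simp
      show "\<forall>\<^sub>F h in at_right 0. smooth (iter_deriv bs (a h))" using ev by (rule eventually_mono) simp
      show "\<forall>\<^sub>F h in at_right 0. \<forall>x. norm (dird b (dird b (iter_deriv bs (a h))) x) \<le> \<bar>C\<bar> * inverse (h ^ ?q)"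
        using ev by (rule eventually_mono) simp
      show "\<exists>C. \<forall>\<^sub>F h in at_right 0. \<forall>\<sigma>\<in>ball \<rho> ?r. norm (iter_deriv bs (a h) \<sigma>) \<le> C * h ^ N" for N
        using Cons.prems by (intro Cons.IH bs) simp
    qed
    then show ?case unfolding iter_deriv_Cons_dird .
  qed
  then have "\<forall>bs\<in>lists Basis. \<forall>N::nat. \<exists>C. \<forall>\<^sub>F h in at_right 0. \<forall>\<sigma>\<in>ball \<rho> (r / 2). norm (iter_deriv bs (a h) \<sigma>) \<le> C * h ^ N"
    using r by simp
  moreover have "open (ball \<rho> (r / 2))" "\<rho> \<in> ball \<rho> (r / 2)" using r by auto
  ultimately show ?thesis unfolding ess_supp_def mem_Collect_eq by blast
qed

section \<open>A gliding hump\<close>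

text \<open>Decoding n as a pair makes every \<open>j\<close> come up infinitely often. The
  parameters chosen at successive n are strictly decreasing, hence distinct, so each carries just
  one packet and \<open>W\<close> is well defined; the bound by 1 / n sends them to 0.\<close>

lemma diagonal_selection:
  fixes S :: "nat \<Rightarrow> real \<Rightarrow> 'b \<Rightarrow> bool"
  assumes S: "\<And>j e. e > 0 \<Longrightarrow> \<exists>h w. 0 < h \<and> h < e \<and> S j h w"
  obtains W :: "real \<Rightarrow> 'b option" where "\<And>j e. e > 0 \<Longrightarrow> \<exists>h w. 0 < h \<and> h < e \<and> S j h w \<and> W h = Some w"
proof -
  let ?j = "\<lambda>n. fst (prod_decode n)"
  have "\<exists>f. \<forall>n. (0 < fst (f n) \<and> S (?j n) (fst (f n)) (snd (f n))) \<and>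
      (fst (f (Suc n)) < fst (f n) \<and> fst (f (Suc n)) < 1 / real (Suc n))"
  proof (rule dependent_nat_choice)
    show "\<exists>x. 0 < fst x \<and> S (?j 0) (fst x) (snd x)" using S[of 1 "?j 0"] by auto
    fix x :: "real \<times> 'b" and n assume "0 < fst x \<and> S (?j n) (fst x) (snd x)"
    then have "0 < min (fst x) (1 / real (Suc n))" by simp
    from S[OF this, of "?j (Suc n)"]
    show "\<exists>y. (0 < fst y \<and> S (?j (Suc n)) (fst y) (snd y)) \<and> fst y < fst x \<and> fst y < 1 / real (Suc n)" by auto
  qed
  then obtain f where f: "\<And>n. 0 < fst (f n)" "\<And>n. S (?j n) (fst (f n)) (snd (f n))"
    "\<And>n. fst (f (Suc n)) < fst (f n)" "\<And>n. fst (f (Suc n)) < 1 / real (Suc n)"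
    by blast
  have "strict_mono (\<lambda>n. - fst (f n))" unfolding strict_mono_Suc_iff using f(3) by simp
  then have inj: "fst (f m) = fst (f n) \<Longrightarrow> m = n" for m n
    using strict_mono_eq by fastforce
  define W where "W h = (if \<exists>n. fst (f n) = h then Some (snd (f (SOME n. fst (f n) = h))) else None)" for h
  have W: "W (fst (f n)) = Some (snd (f n))" for n
  proof -
    have "(SOME m. fst (f m) = fst (f n)) = n" by (rule some_equality) (auto dest: inj)
    then show ?thesis unfolding W_def by auto
  qed
  show ?thesis
  proof (rule that)
    fix j and e :: real assume e: "0 < e"
    obtain m where m: "1 / real (Suc m) < e" using e by (metis nat_approx_posE)
    \<comment> \<open>The second component only pushes the index up: an index of at least m + 1
      forces a parameter below 1 / (m + 1).\<close>
    let ?n = "prod_encode (j, Suc m)"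
    have "Suc m \<le> ?n" by (rule le_prod_encode_2)
    then obtain k where k: "?n = Suc k" "m \<le> k" by (metis Suc_le_D Suc_le_mono)
    have "fst (f ?n) < 1 / real (Suc k)" unfolding k(1) by (rule f(4))
    also have "\<dots> \<le> 1 / real (Suc m)" using k(2) by (intro divide_left_mono) auto
    also note m
    finally have "fst (f ?n) < e" .
    moreover have "S j (fst (f ?n)) (snd (f ?n))" using f(2)[of ?n] by simp
    ultimately show "\<exists>h w. 0 < h \<and> h < e \<and> S j h w \<and> W h = Some w" using f(1) W by blast
  qed
qed

lemma ess_supp_subset_WF:
  fixes a :: "real \<Rightarrow> 'n::finite phase \<Rightarrow> complex"
  assumes h0: "0 < h0" and \<delta>: "\<delta> < 1/2" and t: "t \<in> {0..1}" and s: "s \<in> {0..1}"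
    and a: "a \<in> symbol_class h0 \<delta>" and A: "quantizes h0 t a A" and \<rho>: "\<rho> \<in> ess_supp a"
  obtains u where "L2_bounded_family h0 u" "\<rho> \<in> WF h0 s (\<lambda>h. A h (u h))"
proof -
  have \<delta>': "\<delta> \<le> 1/2" "\<delta> \<le> 1" using \<delta> by auto
  let ?P = "\<lambda>h w. L2_norm (Op_schwartz t h (a h) (coherent h w))"
  let ?r = "\<lambda>j. 1 / real (Suc j)"
  \<comment> \<open>If all powers of h were bounds on such a ball, the symbol would be negligible
    near \<rho>. The exponent so obtained depends on \<open>j\<close> alone, while the constant
    stays arbitrary.\<close>
  have "\<exists>N. \<forall>C. \<not> (\<forall>\<^sub>F h in at_right 0. \<forall>w\<in>ball \<rho> (?r j). ?P h w \<le> C * h ^ N)" for j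
  proof (rule ccontr)
    assume "\<nexists>N. \<forall>C. \<not> (\<forall>\<^sub>F h in at_right 0. \<forall>w\<in>ball \<rho> (?r j). ?P h w \<le> C * h ^ N)"
    then have "\<exists>C. \<forall>\<^sub>F h in at_right 0. \<forall>w\<in>ball \<rho> (?r j). ?P h w \<le> C * h ^ N" for N by blast
    from coherent_small_imp_symbol_small[OF h0 \<delta>'(1) t a _ this]
    have "\<exists>C. \<forall>\<^sub>F h in at_right 0. \<forall>\<sigma>\<in>ball \<rho> (?r j / 2). norm (a h \<sigma>) \<le> C * h ^ N" for N by simp
    from symbol_small_imp_not_ess_supp[OF h0 \<delta>'(2) a _ this] \<rho> show False by simp
  qed
  then have "\<exists>M. \<forall>j C. \<not> (\<forall>\<^sub>F h in at_right 0. \<forall>w\<in>ball \<rho> (?r j). ?P h w \<le> C * h ^ M j)"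
    by (intro choice allI)
  then obtain M where M: "\<And>j C. \<not> (\<forall>\<^sub>F h in at_right 0. \<forall>w\<in>ball \<rho> (?r j). ?P h w \<le> C * h ^ M j)"
    by blast
  have "\<exists>h w. 0 < h \<and> h < e \<and> (w \<in> ball \<rho> (?r j) \<and> h ^ M j < ?P h w)" if e: "e > 0" for j e
  proof (rule ccontr)
    assume no: "\<nexists>h w. 0 < h \<and> h < e \<and> (w \<in> ball \<rho> (?r j) \<and> h ^ M j < ?P h w)"
    have "\<forall>w\<in>ball \<rho> (?r j). ?P h w \<le> 1 * h ^ M j" if "h \<in> {0<..<e}" for h
    proof
      fix w assume "w \<in> ball \<rho> (?r j)"
      then have "\<not> h ^ M j < ?P h w" using no that unfolding greaterThanLessThan_iff by blast
      then show "?P h w \<le> 1 * h ^ M j" by simp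
    qed
    then have "\<forall>\<^sub>F h in at_right 0. \<forall>w\<in>ball \<rho> (?r j). ?P h w \<le> 1 * h ^ M j"
      using eventually_at_right_0[OF e] by (rule eventually_mono[rotated])
    then show False using M by blast
  qed
  from diagonal_selection[of "\<lambda>j h w. w \<in> ball \<rho> (?r j) \<and> h ^ M j < ?P h w", OF this]
  obtain W where W: "\<And>j e. e > 0 \<Longrightarrow> \<exists>h w. 0 < h \<and> h < e \<and> (w \<in> ball \<rho> (?r j) \<and> h ^ M j < ?P h w) \<and> W h = Some w"
    by blast
  \<comment> \<open>At parameters that were not selected the family is 0; the selected ones
    accumulate at 0, which is enough to refute O(h^N).\<close>
  define u where "u h = (case W h of None \<Rightarrow> \<lambda>_. 0 | Some w \<Rightarrow> coherent h w)" for h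
  have bounded: "L2_bounded_family h0 u"
    unfolding L2_bounded_family_def
  proof (intro conjI ballI exI)
    fix h assume h: "h \<in> {0<..<h0}"
    show "u h \<in> L2"
    proof (cases "W h")
      case None
      then show ?thesis by (simp add: u_def L2_def)
    next
      case (Some w)
      then show ?thesis using schwartz_L2[OF coherent_schwartz[of h w]] h by (simp add: u_def)
    qed
    show "L2_norm (u h) \<le> L2_norm (\<lambda>y::real^'n. complex_of_real (gauss y))"
    proof (cases "W h")
      case None
      then have "L2_norm (u h) = 0" by (simp add: u_def L2_norm_def)
      then show ?thesis by simp
    next
      case (Some w)
      then show ?thesis using L2_norm_coherent[of h w] h by (simp add: u_def)
    qed
  qed
  have "\<rho> \<in> WF h0 s (\<lambda>h. A h (u h))"
  proof (rule ccontr)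
    assume "\<rho> \<notin> WF h0 s (\<lambda>h. A h (u h))"
    then obtain c where c: "c \<in> symbol_class h0 0" and inf: "0 < (INF h\<in>{0<..<h0}. norm (c h \<rho>))"
      and O: "\<And>N. (\<lambda>h. L2_norm (Op s h (c h) (A h (u h)))) \<in> O[at_right 0](\<lambda>h. h ^ N)"
      unfolding WF_def mem_Collect_eq by blast
    have "(INF h\<in>{0<..<h0}. norm (c h \<rho>)) \<le> norm (c h \<rho>)" if "h \<in> {0<..<h0}" for h
      by (rule cINF_lower[OF _ that]) (auto intro: bdd_belowI[of _ 0])
    from elliptic_coherent_bound[OF h0 \<delta>'(1) t s a c inf this]
    obtain R where R: "R > 0" and ell: "\<And>N. \<exists>K\<ge>0. \<forall>\<^sub>F h in at_right 0. \<forall>w\<in>ball \<rho> R.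
      ?P h w \<le> K * (L2_norm (Op_schwartz s h (c h) (Op_schwartz t h (a h) (coherent h w))) + h ^ N)"
      by blast
    obtain j where j: "?r j < R" using R by (metis nat_approx_posE)
    \<comment> \<open>One power more than in the lower bound: the spare factor h beats
      \<open>K\<close> and \<open>D\<close>, which become known only with the test symbol.\<close>
    let ?N = "Suc (M j)"
    obtain K where K: "K \<ge> 0" "\<forall>\<^sub>F h in at_right 0. \<forall>w\<in>ball \<rho> R.
      ?P h w \<le> K * (L2_norm (Op_schwartz s h (c h) (Op_schwartz t h (a h) (coherent h w))) + h ^ ?N)"
      using ell by blast
    obtain D where D: "D > 0" "\<forall>\<^sub>F h in at_right 0. norm (L2_norm (Op s h (c h) (A h (u h)))) \<le> D * norm (h ^ ?N)"
      using landau_o.bigE[OF O[of ?N]] by blast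
    have "0 < min h0 (1 / (K * (D + 1) + 1))" using h0 K D by (simp add: add_nonneg_pos)
    note ev = eventually_conj[OF eventually_at_right_0[OF this] eventually_conj[OF K(2) D(2)]]
    then obtain e where e: "e > 0" "\<And>h. 0 < h \<Longrightarrow> h < e \<Longrightarrow> h \<in> {0<..<min h0 (1 / (K * (D + 1) + 1))} \<and>
        (\<forall>w\<in>ball \<rho> R. ?P h w \<le> K * (L2_norm (Op_schwartz s h (c h) (Op_schwartz t h (a h) (coherent h w))) + h ^ ?N)) \<and>
        norm (L2_norm (Op s h (c h) (A h (u h)))) \<le> D * norm (h ^ ?N)"
      unfolding eventually_at_right_field by blast
    obtain h w where h: "0 < h" "h < e" and w: "w \<in> ball \<rho> (?r j)" "h ^ M j < ?P h w" "W h = Some w"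
      using W[OF e(1), of j] by blast
    note eh = e(2)[OF h]
    then have h': "h \<in> {0<..<h0}" and hK: "h < 1 / (K * (D + 1) + 1)" by auto
    have wR: "w \<in> ball \<rho> R" using w(1) j by simp
    have "L2_norm (Op s h (c h) (A h (u h))) =
        L2_norm (Op_schwartz s h (c h) (Op_schwartz t h (a h) (coherent h w)))"
      using A h' w(3) Op_comp_schwartz[OF h(1) symbol_unit[OF a h'] t symbol_unit[OF c h'] s coherent_schwartz[OF h(1)]]
      by (simp add: quantizes_def u_def)
    then have "L2_norm (Op_schwartz s h (c h) (Op_schwartz t h (a h) (coherent h w))) \<le> D * h ^ ?N"
      using eh h by simp
    then have "K * (L2_norm (Op_schwartz s h (c h) (Op_schwartz t h (a h) (coherent h w))) + h ^ ?N) \<le> K * (D * h ^ ?N + h ^ ?N)"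
      using K(1) by (intro mult_left_mono) auto
    with eh wR have "?P h w \<le> K * (D * h ^ ?N + h ^ ?N)" by (meson order_trans)
    also have "\<dots> = (K * (D + 1) * h) * h ^ M j" by (simp add: algebra_simps)
    also have "\<dots> \<le> 1 * h ^ M j"
    proof (rule mult_right_mono)
      have "(K * (D + 1) + 1) * h < 1"
        using hK K D by (simp add: pos_less_divide_eq add_nonneg_pos mult.commute)
      then show "K * (D + 1) * h \<le> 1" using h by (simp add: distrib_right)
    qed (use h in simp)
    finally show False using w(2) by simp
  qed
  then show ?thesis using that bounded by blast
qed

lemma ess_supp_eq_Union_WF:
  fixes a :: "real \<Rightarrow> 'n::finite phase \<Rightarrow> complex"
  assumes "0 < h0" "\<delta> < 1/2" "t \<in> {0..1}" "s \<in> {0..1}" "a \<in> symbol_class h0 \<delta>" "quantizes h0 t a A"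
  shows "ess_supp a = (\<Union>u\<in>{u. L2_bounded_family h0 u}. WF h0 s (\<lambda>h. A h (u h)))"
proof
  show "ess_supp a \<subseteq> (\<Union>u\<in>{u. L2_bounded_family h0 u}. WF h0 s (\<lambda>h. A h (u h)))"
    using ess_supp_subset_WF[OF assms] by blast
  show "(\<Union>u\<in>{u. L2_bounded_family h0 u}. WF h0 s (\<lambda>h. A h (u h))) \<subseteq> ess_supp a"
    using WF_subset_ess_supp[OF assms] by blast
qed

text \<open>The right-hand side does not involve the symbol, so the essential support is the same for all
  representations of \<open>A\<close>; this makes the definite description in \<open>WF_op\<close> well defined.\<close>

theorem corollary1:
  fixes h0 \<delta> t s :: real
    and a :: "real \<Rightarrow> (real ^ 'n::finite) \<times> (real ^ 'n) \<Rightarrow> complex"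
    and A :: "real \<Rightarrow> (real ^ 'n \<Rightarrow> complex) \<Rightarrow> (real ^ 'n \<Rightarrow> complex)"
  assumes "0 < h0"
    and "0 \<le> \<delta>" and "\<delta> < 1/2"
    and "t \<in> {0..1}"
    and "s \<in> {0..1}"
    and "a \<in> symbol_class h0 \<delta>"
    and "quantizes h0 t a A"
  shows "WF_op h0 A = (\<Union>u\<in>{u. L2_bounded_family h0 u}. WF h0 s (\<lambda>h. A h (u h)))"
proof -
  note eq = ess_supp_eq_Union_WF[OF \<open>0 < h0\<close> _ _ \<open>s \<in> {0..1}\<close>]
  show ?thesis
    unfolding WF_op_def
  proof (rule the_equality)
    show "\<exists>t\<in>{0..1}. \<exists>\<delta>. 0 \<le> \<delta> \<and> \<delta> < 1/2 \<and> (\<exists>a\<in>symbol_class h0 \<delta>. quantizes h0 t a A \<and>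
        (\<Union>u\<in>{u. L2_bounded_family h0 u}. WF h0 s (\<lambda>h. A h (u h))) = ess_supp a)"
      using eq[of \<delta> t a A] assms by blast
  qed (use eq in blast)
qed

end
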